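(* Let $R$ be a Dedekind domain with quotient field $K$ and let $M$ be an $R$-module. (i) If $R$ is a discrete valuation ring with maximal ideal $\mathfrak{m}$, then $M$ is dual strongly self-CS-Baer if and only if $M\cong R$ or $M\cong K$ or $M\cong K/R$ or $M\cong R/\mathfrak{m}^n$ or $M\cong K\oplus R/\mathfrak{m}^n$ for some non-negative integer $n$. (ii) If $R$ is not local, then $M$ is dual strongly self-CS-Baer if and only if one of the following conditions holds: (a) $M=\left(\bigoplus_{\mathfrak{p}\in\mathbf{P}}T_{\mathfrak{p}}(M)\right)\oplus L$ with $L\cong K$, and for every non-zero prime ideal $\mathfrak{p}$ of $R$ there exists a non-negative integer $n_{\mathfrak{p}}$ depending on $\mathfrak{p}$ such that $T_{\mathfrak{p}}(M)\cong R/\mathfrak{p}^{n_{\mathfrak{p}}}$. (b) $M=\bigoplus_{\mathfrak{p}\in\mathbf{P}}T_{\mathfrak{p}}(M)$ such that for every non-zero prime ideal $\mathfrak{p}$ of $R$, $T_{\mathfrak{p}}(M)\cong R(\mathfrak{p}^{\infty})$ or $T_{\mathfrak{p}}(M)\cong R/\mathfrak{p}^{n_{\mathfrak{p}}}$ for some non-negative integer $n_{\mathfrak{p}}$ depending on $\mathfrak{p}$.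
   Context: A module $M$ is dual strongly self-CS-Baer if for every family $(f_i)_{i\in I}$ of endomorphisms of $M$, the submodule $\sum_{i\in I}\mathrm{Im}(f_i)$ lies above a fully invariant direct summand of $M$, i.e. contains a direct summand $D$ of $M$ with $h(D)\subseteq D$ for all endomorphisms $h$ of $M$ such that $\left(\sum_{i\in I}\mathrm{Im}(f_i)\right)/D$ is superfluous in $M/D$ (a submodule $A$ of $B$ is superfluous if $A+X=B$ implies $X=B$ for every submodule $X$ of $B$). $\mathbf{P}$ is the set of non-zero prime ideals of $R$. For $\mathfrak{p}\in\mathbf{P}$, $T_{\mathfrak{p}}(M)=\{x\in M\mid \mathfrak{p}^n x=0\text{ for some integer }n\geq 0\}$, and $R(\mathfrak{p}^{\infty})=T_{\mathfrak{p}}(K/R)$ is the $\mathfrak{p}$-primary component of $K/R$. By convention $\mathfrak{m}^0=R$ and $\mathfrak{p}^0=R$. *)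

theory Defs
  imports
    "HOL-Algebra.Module"
    "HOL-Algebra.AbelCoset"
    "HOL-Algebra.Ideal_Product"
    "HOL-Algebra.Ring_Divisibility"
begin

section \<open>Rings\<close>

text \<open>The embedding \<open>\<iota>\<close> replaces the inclusion of \<open>R\<close> in its quotient field \<open>K\<close>, so that
  \<open>R\<close> and \<open>K\<close> may live on different types; \<open>\<iota> = id\<close> gives the case of a subring.\<close>

locale quotient_field = R?: domain R + K?: field K
  for R (structure) and K (structure) and \<iota> +
  assumes embedding_hom: "\<iota> \<in> ring_hom R K"
    and embedding_inj: "inj_on \<iota> (carrier R)"
    and fraction: "x \<in> carrier K \<Longrightarrow>
      \<exists>a \<in> carrier R. \<exists>b \<in> carrier R - {\<zero>\<^bsub>R\<^esub>}. x = \<iota> a \<otimes>\<^bsub>K\<^esub> inv\<^bsub>K\<^esub> (\<iota> b)"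

definition integral_element ::
    "('a, 'c) ring_scheme \<Rightarrow> ('k, 'd) ring_scheme \<Rightarrow> ('a \<Rightarrow> 'k) \<Rightarrow> 'k \<Rightarrow> bool"
  where "integral_element R K \<iota> x \<longleftrightarrow> x \<in> carrier K \<and>
    (\<exists>(n::nat) c. c \<in> {..<n} \<rightarrow> carrier R \<and>
      x [^]\<^bsub>K\<^esub> n \<oplus>\<^bsub>K\<^esub> (\<Oplus>\<^bsub>K\<^esub> i \<in> {..<n}. \<iota> (c i) \<otimes>\<^bsub>K\<^esub> x [^]\<^bsub>K\<^esub> i) = \<zero>\<^bsub>K\<^esub>)"

definition nonzero_primes :: "('a, 'c) ring_scheme \<Rightarrow> 'a set set"
  where "nonzero_primes R = {\<pp>. primeideal \<pp> R \<and> \<pp> \<noteq> {\<zero>\<^bsub>R\<^esub>}}"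

text \<open>Fields are not excluded.\<close>

locale dedekind_domain = noetherian_domain R + quotient_field R K \<iota>
  for R (structure) and K (structure) and \<iota> +
  assumes nonzero_prime_maximal: "\<pp> \<in> nonzero_primes R \<Longrightarrow> maximalideal \<pp> R"
    and integrally_closed: "integral_element R K \<iota> x \<Longrightarrow> x \<in> \<iota> ` carrier R"

locale local_ring = cring R for R (structure) +
  assumes unique_maximalideal: "\<exists>!\<mm>. maximalideal \<mm> R"

locale discrete_valuation_ring = principal_domain R + local_ring R for R (structure) +
  assumes not_field: "\<not> field R"

abbreviation ideal_power :: "('a, 'c) ring_scheme \<Rightarrow> 'a set \<Rightarrow> nat \<Rightarrow> 'a set"
  where "ideal_power R I n \<equiv> I [^]\<^bsub>ideals_set R\<^esub> n"


section \<open>Modules\<close>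

text \<open>The fields \<open>mult\<close> and \<open>one\<close> of a module record carry no information; in the
  constructions below they are filled arbitrarily. A submodule \<open>N\<close> of \<open>M\<close>, regarded as a
  module of its own, is \<open>M\<lparr>carrier := N\<rparr>\<close>.\<close>

definition mod_hom ::
    "('a, 'c) ring_scheme \<Rightarrow> ('a, 'b, 'e) module_scheme \<Rightarrow> ('a, 'd, 'f) module_scheme
      \<Rightarrow> ('b \<Rightarrow> 'd) set"
  where "mod_hom R M N = {h. h \<in> carrier M \<rightarrow> carrier N \<and>
    (\<forall>x \<in> carrier M. \<forall>y \<in> carrier M. h (x \<oplus>\<^bsub>M\<^esub> y) = h x \<oplus>\<^bsub>N\<^esub> h y) \<and>
    (\<forall>a \<in> carrier R. \<forall>x \<in> carrier M. h (a \<odot>\<^bsub>M\<^esub> x) = a \<odot>\<^bsub>N\<^esub> h x)}"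

definition mod_isomorphic ::
    "('a, 'c) ring_scheme \<Rightarrow> ('a, 'b, 'e) module_scheme \<Rightarrow> ('a, 'd, 'f) module_scheme \<Rightarrow> bool"
  where "mod_isomorphic R M N \<longleftrightarrow>
    (\<exists>h \<in> mod_hom R M N. bij_betw h (carrier M) (carrier N))"

text \<open>The ring \<open>S\<close> as a module over \<open>R\<close> along a ring homomorphism \<open>\<phi>\<close> from \<open>R\<close> to \<open>S\<close>.\<close>

definition scalar_module :: "('a \<Rightarrow> 's) \<Rightarrow> ('s, 'd) ring_scheme \<Rightarrow> ('a, 's) module"
  where "scalar_module \<phi> S = \<lparr>carrier = carrier S, monoid.mult = monoid.mult S, one = \<one>\<^bsub>S\<^esub>,
    zero = \<zero>\<^bsub>S\<^esub>, add = add S, smult = (\<lambda>a x. \<phi> a \<otimes>\<^bsub>S\<^esub> x)\<rparr>"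

abbreviation regular_module :: "('a, 'c) ring_scheme \<Rightarrow> ('a, 'a) module"
  where "regular_module R \<equiv> scalar_module (\<lambda>a. a) R"

definition quotient_module ::
    "('a, 'b, 'e) module_scheme \<Rightarrow> 'b set \<Rightarrow> ('a, 'b set) module"
  where "quotient_module M D = \<lparr>carrier = a_rcosets\<^bsub>M\<^esub> D, monoid.mult = undefined, one = undefined,
    zero = D, add = set_add M, smult = (\<lambda>a X. \<Union>x \<in> X. D +>\<^bsub>M\<^esub> (a \<odot>\<^bsub>M\<^esub> x))\<rparr>"

definition direct_sum_module ::
    "('a, 'b, 'e) module_scheme \<Rightarrow> ('a, 'd, 'f) module_scheme \<Rightarrow> ('a, 'b \<times> 'd) module"
  where "direct_sum_module M N = \<lparr>carrier = carrier M \<times> carrier N,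
    monoid.mult = undefined, one = undefined, zero = (\<zero>\<^bsub>M\<^esub>, \<zero>\<^bsub>N\<^esub>),
    add = (\<lambda>(x, y) (x', y'). (x \<oplus>\<^bsub>M\<^esub> x', y \<oplus>\<^bsub>N\<^esub> y')),
    smult = (\<lambda>a (x, y). (a \<odot>\<^bsub>M\<^esub> x, a \<odot>\<^bsub>N\<^esub> y))\<rparr>"

definition submodule_sum ::
    "('a, 'c) ring_scheme \<Rightarrow> ('a, 'b, 'e) module_scheme \<Rightarrow> 'i set \<Rightarrow> ('i \<Rightarrow> 'b set) \<Rightarrow> 'b set"
  where "submodule_sum R M I N = \<Inter> {H. submodule H R M \<and> (\<forall>i \<in> I. N i \<subseteq> H)}"

definition independent_submodules ::
    "('a, 'c) ring_scheme \<Rightarrow> ('a, 'b, 'e) module_scheme \<Rightarrow> 'i set \<Rightarrow> ('i \<Rightarrow> 'b set) \<Rightarrow> bool"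
  where "independent_submodules R M I N \<longleftrightarrow>
    (\<forall>i \<in> I. submodule (N i) R M \<and> N i \<inter> submodule_sum R M (I - {i}) N = {\<zero>\<^bsub>M\<^esub>})"

text \<open>\<open>S\<close> is the internal direct sum of the \<open>N i\<close>.\<close>

definition internal_direct_sum ::
    "('a, 'c) ring_scheme \<Rightarrow> ('a, 'b, 'e) module_scheme \<Rightarrow> 'i set \<Rightarrow> ('i \<Rightarrow> 'b set)
      \<Rightarrow> 'b set \<Rightarrow> bool"
  where "internal_direct_sum R M I N S \<longleftrightarrow>
    independent_submodules R M I N \<and> S = submodule_sum R M I N"

definition complementary ::
    "('a, 'c) ring_scheme \<Rightarrow> ('a, 'b, 'e) module_scheme \<Rightarrow> 'b set \<Rightarrow> 'b set \<Rightarrow> bool"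
  where "complementary R M D E \<longleftrightarrow> submodule D R M \<and> submodule E R M \<and>
    D \<inter> E = {\<zero>\<^bsub>M\<^esub>} \<and> D <+>\<^bsub>M\<^esub> E = carrier M"

definition direct_summand ::
    "('a, 'c) ring_scheme \<Rightarrow> ('a, 'b, 'e) module_scheme \<Rightarrow> 'b set \<Rightarrow> bool"
  where "direct_summand R M D \<longleftrightarrow> (\<exists>E. complementary R M D E)"

definition fully_invariant ::
    "('a, 'c) ring_scheme \<Rightarrow> ('a, 'b, 'e) module_scheme \<Rightarrow> 'b set \<Rightarrow> bool"
  where "fully_invariant R M D \<longleftrightarrow> submodule D R M \<and> (\<forall>h \<in> mod_hom R M M. h ` D \<subseteq> D)"

definition superfluous ::
    "('a, 'c) ring_scheme \<Rightarrow> ('a, 'b, 'e) module_scheme \<Rightarrow> 'b set \<Rightarrow> bool"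
  where "superfluous R B A \<longleftrightarrow> submodule A R B \<and>
    (\<forall>X. submodule X R B \<and> A <+>\<^bsub>B\<^esub> X = carrier B \<longrightarrow> X = carrier B)"

definition lies_above ::
    "('a, 'c) ring_scheme \<Rightarrow> ('a, 'b, 'e) module_scheme \<Rightarrow> 'b set \<Rightarrow> 'b set \<Rightarrow> bool"
  where "lies_above R M N D \<longleftrightarrow> D \<subseteq> N \<and> direct_summand R M D \<and>
    superfluous R (quotient_module M D) ((\<lambda>x. D +>\<^bsub>M\<^esub> x) ` N)"

text \<open>The sum of the images of a family of endomorphisms depends only on the set \<open>F\<close> of its
  members, so families are represented by sets (indexed by themselves); this avoids
  quantifying over a type of indices.\<close>

definition dual_strongly_self_CS_Baer ::
    "('a, 'c) ring_scheme \<Rightarrow> ('a, 'b, 'e) module_scheme \<Rightarrow> bool"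
  where "dual_strongly_self_CS_Baer R M \<longleftrightarrow>
    (\<forall>F \<subseteq> mod_hom R M M. \<exists>D. fully_invariant R M D \<and>
      lies_above R M (submodule_sum R M F (\<lambda>f. f ` carrier M)) D)"

definition primary_component ::
    "('a, 'c) ring_scheme \<Rightarrow> ('a, 'b, 'e) module_scheme \<Rightarrow> 'a set \<Rightarrow> 'b set"
  where "primary_component R M \<pp> =
    {x \<in> carrier M. \<exists>n::nat. \<forall>a \<in> ideal_power R \<pp> n. a \<odot>\<^bsub>M\<^esub> x = \<zero>\<^bsub>M\<^esub>}"

abbreviation primary_module ::
    "('a, 'c) ring_scheme \<Rightarrow> ('a, 'b, 'e) module_scheme \<Rightarrow> 'a set \<Rightarrow> ('a, 'b, 'e) module_scheme"
  where "primary_module R M \<pp> \<equiv> M\<lparr>carrier := primary_component R M \<pp>\<rparr>"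

text \<open>The modules \<open>R/I\<close>, \<open>K/R\<close> and \<open>R(\<pp>\<^sup>\<infinity>)\<close>.\<close>

definition cyclic_module :: "('a, 'c) ring_scheme \<Rightarrow> 'a set \<Rightarrow> ('a, 'a set) module"
  where "cyclic_module R I = quotient_module (regular_module R) I"

definition KmodR ::
    "('a, 'c) ring_scheme \<Rightarrow> ('k, 'd) ring_scheme \<Rightarrow> ('a \<Rightarrow> 'k) \<Rightarrow> ('a, 'k set) module"
  where "KmodR R K \<iota> = quotient_module (scalar_module \<iota> K) (\<iota> ` carrier R)"

definition pruefer_module ::
    "('a, 'c) ring_scheme \<Rightarrow> ('k, 'd) ring_scheme \<Rightarrow> ('a \<Rightarrow> 'k) \<Rightarrow> 'a set \<Rightarrow> ('a, 'k set) module"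
  where "pruefer_module R K \<iota> \<pp> = primary_module R (KmodR R K \<iota>) \<pp>"

end

(* Over a dual strongly self-CS-Baer module M every direct summand is an image, and comparing it
   with the fully invariant summand below it shows that all summands are fully invariant. So
   complements are unique, and there are no non-zero maps between complementary summands. If A is a
   divisible submodule for which maps into A extend, a Zorn argument gives complements of A
   containing the graph of any partial map into A; two different graphs would give two complements.
   Hence divisible primary components have simple socle and a torsion-free divisible part has rank
   one. A socle element of finite height splits off a cyclic summand, which is then the whole primary
   component; a torsion-free part that is not divisible forces M = R e and R to be local.
   For the converse, membership in a submodule is tested at each prime P, with \<pi> in P and \<tau> not in P
   such that \<tau> P is contained in \<pi> R, and the fully invariant summand below N is the sum of the
   primary components contained in N, together with L if L is contained in N. *)
theory Submission
  imports Defs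
begin

section \<open>Uniformizers in Dedekind domains\<close>

text \<open>No localization of rings or modules is formed. A statement over the local ring at P is
  written with a factor s outside P; this is why heights, saturation and purity below always carry
  such an s, and \<open>local_global\<close> returns from all primes to R. The pair
  \<open>\<pi>\<close>, \<open>\<tau>\<close> comes from integral closedness: if P = (aR : b),
  multiplication by b/a cannot map P into itself, so it sends some \<open>\<pi>\<close> in P to some
  \<open>\<tau>\<close> outside P. The model modules stay out of the structure theory as well. They
  are replaced by intrinsic conditions on submodules, and only the last part matches these with R,
  K, R/I and the Pruefer modules. The hard point is a torsion-free complement L that is not
  divisible: L is not known to be finitely generated, so Nakayama's lemma cannot lift a basis of
  L/PL. The multiplications by elements of P have sum of images PL, so a submodule that covers M
  modulo PL and contains the fully invariant summand below PL must be M.\<close>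

lemma (in noetherian_ring) exists_maximal_ideal_in:
  assumes "S \<subseteq> {I. ideal I R}" and "S \<noteq> {}"
  obtains I where "I \<in> S" and "\<And>J. J \<in> S \<Longrightarrow> I \<subseteq> J \<Longrightarrow> J = I"
proof -
  have "\<exists>I\<in>S. \<forall>J\<in>S. I \<subseteq> J \<longrightarrow> J = I"
  proof (rule subset_Zorn)
    fix C assume C: "subset.chain S C"
    show "\<exists>U\<in>S. \<forall>X\<in>C. X \<subseteq> U"
    proof (cases "C = {}")
      case True
      then show ?thesis using assms(2) by blast
    next
      case False
      \<comment> \<open>In a Noetherian ring a non-empty chain of ideals contains its union, so the
        family \<open>S\<close> need not be closed under unions of chains.\<close>
      have "subset.chain {I. ideal I R} C"
        using C assms(1) unfolding pred_on.chain_def by blast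
      then have "\<Union>C \<in> C" by (rule ideal_chain_is_trivial[OF False])
      moreover have "C \<subseteq> S" using C by (simp add: pred_on.chain_def)
      ultimately show ?thesis by (intro bexI[of _ "\<Union>C"]) auto
    qed
  qed
  then show ?thesis using that by blast
qed

lemma (in noetherian_ring) ideal_sequence_stabilizes:
  fixes J :: "nat \<Rightarrow> 'a set"
  assumes "\<And>n. ideal (J n) R" and "\<And>n. J n \<subseteq> J (Suc n)"
  obtains n where "J (Suc n) = J n"
proof -
  obtain I where "I \<in> range J" and "\<And>I'. I' \<in> range J \<Longrightarrow> I \<subseteq> I' \<Longrightarrow> I' = I"
    using exists_maximal_ideal_in[of "range J"] assms(1) by auto
  then show ?thesis using that assms(2) by (metis rangeE rangeI)
qed

lemma (in cring) ideal_if_lin_comb_closed: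
  assumes "I \<subseteq> carrier R" and "\<zero> \<in> I" and "\<And>x y. x \<in> I \<Longrightarrow> y \<in> I \<Longrightarrow> x \<oplus> y \<in> I"
    and "\<And>a x. a \<in> carrier R \<Longrightarrow> x \<in> I \<Longrightarrow> a \<otimes> x \<in> I"
  shows "ideal I R"
proof (rule idealI)
  show "ring R" by (rule ring_axioms)
  have "\<ominus> x \<in> I" if "x \<in> I" for x
    using assms(4)[of "\<ominus> \<one>" x] that assms(1) by (auto simp: l_minus)
  then show "subgroup I (add_monoid R)"
    using assms by (intro add.subgroupI) (auto simp: a_inv_def)
  show "a \<otimes> x \<in> I" if "x \<in> I" "a \<in> carrier R" for a x using assms(4) that by blast
  show "x \<otimes> a \<in> I" if "x \<in> I" "a \<in> carrier R" for a x
    using assms(1,4) that m_comm[of x a] by auto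
qed

text \<open>This is (aR : b), the annihilator of the class of b in R/aR. A prime of this form is an
  associated prime of R/aR.\<close>

definition colon_ideal :: "('a, 'c) ring_scheme \<Rightarrow> 'a \<Rightarrow> 'a \<Rightarrow> 'a set"
  where "colon_ideal R a b = {r \<in> carrier R. \<exists>c \<in> carrier R. r \<otimes>\<^bsub>R\<^esub> b = a \<otimes>\<^bsub>R\<^esub> c}"

lemma (in cring) ideal_colon_ideal:
  assumes a: "a \<in> carrier R" and b: "b \<in> carrier R"
  shows "ideal (colon_ideal R a b) R"
proof (rule ideal_if_lin_comb_closed)
  show "\<zero> \<in> colon_ideal R a b"
    using a b unfolding colon_ideal_def by (auto intro!: bexI[of _ \<zero>])
  show "x \<oplus> y \<in> colon_ideal R a b"
    if xy: "x \<in> colon_ideal R a b" "y \<in> colon_ideal R a b" for x y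
  proof -
    obtain c d where "c \<in> carrier R" "d \<in> carrier R" "x \<otimes> b = a \<otimes> c" "y \<otimes> b = a \<otimes> d"
      using xy unfolding colon_ideal_def by blast
    then have "(x \<oplus> y) \<otimes> b = a \<otimes> (c \<oplus> d)"
      using a b xy by (simp add: colon_ideal_def l_distr r_distr)
    then show ?thesis using xy \<open>c \<in> carrier R\<close> \<open>d \<in> carrier R\<close>
      unfolding colon_ideal_def by blast
  qed
  show "r \<otimes> x \<in> colon_ideal R a b" if r: "r \<in> carrier R" and x: "x \<in> colon_ideal R a b" for r x
  proof -
    obtain c where c: "c \<in> carrier R" "x \<otimes> b = a \<otimes> c"
      using x unfolding colon_ideal_def by blast
    have "(r \<otimes> x) \<otimes> b = r \<otimes> (x \<otimes> b)"
      using r x b by (simp add: colon_ideal_def m_assoc)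
    also have "\<dots> = a \<otimes> (r \<otimes> c)" unfolding c(2) using r a c(1) by (simp add: m_lcomm)
    finally have "(r \<otimes> x) \<otimes> b = a \<otimes> (r \<otimes> c)" .
    then show ?thesis using r x c unfolding colon_ideal_def by blast
  qed
qed (auto simp: colon_ideal_def)

section \<open>From integral closedness to uniformizers\<close>

lemma (in quotient_field) embedding_closed [simp]: "a \<in> carrier R \<Longrightarrow> \<iota> a \<in> carrier K"
  by (rule ring_hom_closed[OF embedding_hom])

lemma (in quotient_field) embedding_ring_hom_cring: "ring_hom_cring R K \<iota>"
  by (intro ring_hom_cring.intro ring_hom_cring_axioms.intro K.is_cring R.is_cring embedding_hom)

lemma (in quotient_field) embedding_eq_zero_iff:
  "a \<in> carrier R \<Longrightarrow> \<iota> a = \<zero>\<^bsub>K\<^esub> \<longleftrightarrow> a = \<zero>"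
  using inj_on_eq_iff[OF embedding_inj _ R.zero_closed, of a]
    ring_hom_zero[OF embedding_hom R.ring_axioms K.ring_axioms] by simp

lemma (in quotient_field) fraction_cross_mult:
  assumes "a \<in> carrier R" "b \<in> carrier R" "b \<noteq> \<zero>" "k \<in> carrier K"
  shows "k = \<iota> a \<otimes>\<^bsub>K\<^esub> inv\<^bsub>K\<^esub> (\<iota> b) \<longleftrightarrow> \<iota> b \<otimes>\<^bsub>K\<^esub> k = \<iota> a"
proof -
  have u: "\<iota> b \<in> Units K"
    using assms embedding_eq_zero_iff by (simp add: K.field_Units)
  show ?thesis
    using K.Units_r_inv[OF u] K.Units_inv_closed[OF u] assms u
    by (metis K.Units_closed K.m_assoc K.m_comm K.r_one embedding_closed)
qed

text \<open>Put x = b/a. Then x I \<subseteq> I, so every x^n a lies in I and hence in R. Instead of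
  the determinant trick, the spans of a, x a, ..., x^(n-1) a form an ascending chain of ideals of R.
  Where it stops growing, x^n a is a combination of the lower terms, and cancelling a leaves a monic
  equation for x.\<close>

lemma (in quotient_field) dvd_if_multiplier_preserves_ideal:
  assumes noetherian: "noetherian_ring R"
    and integrally_closed: "\<And>x. integral_element R K \<iota> x \<Longrightarrow> x \<in> \<iota> ` carrier R"
    and a: "a \<in> carrier R" "a \<noteq> \<zero>" and b: "b \<in> carrier R"
    and I: "ideal I R" "a \<in> I"
    and mult: "\<And>r. r \<in> I \<Longrightarrow> \<exists>r'\<in>I. b \<otimes> r = a \<otimes> r'"
  obtains d where "d \<in> carrier R" and "b = a \<otimes> d"
proof -
  interpret I: ideal I R by (rule I(1))
  interpret emb: ring_hom_cring R K \<iota> by (rule embedding_ring_hom_cring)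
  have Kc: "\<iota> r \<in> carrier K" if "r \<in> carrier R" for r using that by simp
  have ia: "\<iota> a \<noteq> \<zero>\<^bsub>K\<^esub>" using a embedding_eq_zero_iff by simp
  then have iaU: "\<iota> a \<in> Units K" using a by (simp add: K.field_Units)
  define x where "x = \<iota> b \<otimes>\<^bsub>K\<^esub> inv\<^bsub>K\<^esub> (\<iota> a)"
  have x: "x \<in> carrier K" unfolding x_def using iaU b by simp
  have ax: "\<iota> a \<otimes>\<^bsub>K\<^esub> x = \<iota> b"
    using fraction_cross_mult[OF b a x] x_def by simp
  \<comment> \<open>Iterating the choice of r', starting at a, realizes x^n a as an element
    \<open>c n\<close> of I.\<close>
  obtain step where step: "\<And>r. r \<in> I \<Longrightarrow> step r \<in> I \<and> b \<otimes> r = a \<otimes> step r"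
    using mult by metis
  define c where "c n = (step ^^ n) a" for n
  have cI: "c n \<in> I" for n unfolding c_def by (induction n) (use I(2) step in auto)
  then have cR: "c n \<in> carrier R" for n by (rule I.Icarr)
  have ci: "\<iota> (c n) = x [^]\<^bsub>K\<^esub> n \<otimes>\<^bsub>K\<^esub> \<iota> a" for n
  proof (induction n)
    case 0
    then show ?case using a by (simp add: c_def)
  next
    case (Suc n)
    have "c (Suc n) = step (c n)" by (simp add: c_def)
    then have "b \<otimes> c n = a \<otimes> c (Suc n)" using step[OF cI[of n]] by simp
    then have "\<iota> b \<otimes>\<^bsub>K\<^esub> \<iota> (c n) = \<iota> a \<otimes>\<^bsub>K\<^esub> \<iota> (c (Suc n))"
      using a b cR by (metis emb.hom_mult)
    then have "\<iota> a \<otimes>\<^bsub>K\<^esub> \<iota> (c (Suc n)) = \<iota> a \<otimes>\<^bsub>K\<^esub> (x \<otimes>\<^bsub>K\<^esub> \<iota> (c n))"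
      using ax a x cR by (metis K.m_assoc embedding_closed)
    then have "\<iota> (c (Suc n)) = x \<otimes>\<^bsub>K\<^esub> \<iota> (c n)"
      using K.m_lcancel[OF ia] a x cR by simp
    then show ?case
      unfolding Suc.IH using x a by (simp add: K.m_assoc K.m_comm K.m_lcomm)
  qed
  \<comment> \<open>Up to the embedding, \<open>J n\<close> is the set of elements of R in (R + R x
    + ... + R x^(n-1)) a.\<close>
  define J where "J n = {z \<in> carrier R. \<exists>r \<in> {..<n} \<rightarrow> carrier R.
    \<iota> z = (\<Oplus>\<^bsub>K\<^esub> i \<in> {..<n}. \<iota> (r i) \<otimes>\<^bsub>K\<^esub> x [^]\<^bsub>K\<^esub> i) \<otimes>\<^bsub>K\<^esub> \<iota> a}" for n :: nat
  have J_ideal: "ideal (J n) R" for n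
  proof (rule R.ideal_if_lin_comb_closed)
    show "\<zero> \<in> J n"
    proof -
      have "(\<Oplus>\<^bsub>K\<^esub> i \<in> {..<n}. \<iota> \<zero> \<otimes>\<^bsub>K\<^esub> x [^]\<^bsub>K\<^esub> i) = \<zero>\<^bsub>K\<^esub>"
        using x by (intro K.add.finprod_one_eqI) simp
      then show ?thesis unfolding J_def using a by (auto intro!: bexI[of _ "\<lambda>_. \<zero>"])
    qed
    show "y \<oplus> z \<in> J n" if yz: "y \<in> J n" "z \<in> J n" for y z
    proof -
      obtain r s where r: "r \<in> {..<n} \<rightarrow> carrier R"
          "\<iota> y = (\<Oplus>\<^bsub>K\<^esub> i \<in> {..<n}. \<iota> (r i) \<otimes>\<^bsub>K\<^esub> x [^]\<^bsub>K\<^esub> i) \<otimes>\<^bsub>K\<^esub> \<iota> a"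
        and s: "s \<in> {..<n} \<rightarrow> carrier R"
          "\<iota> z = (\<Oplus>\<^bsub>K\<^esub> i \<in> {..<n}. \<iota> (s i) \<otimes>\<^bsub>K\<^esub> x [^]\<^bsub>K\<^esub> i) \<otimes>\<^bsub>K\<^esub> \<iota> a"
        using yz unfolding J_def by blast
      have cl: "r i \<in> carrier R" "s i \<in> carrier R" if "i < n" for i using r(1) s(1) that by auto
      have "(\<Oplus>\<^bsub>K\<^esub> i \<in> {..<n}. \<iota> (r i \<oplus> s i) \<otimes>\<^bsub>K\<^esub> x [^]\<^bsub>K\<^esub> i)
        = (\<Oplus>\<^bsub>K\<^esub> i \<in> {..<n}. \<iota> (r i) \<otimes>\<^bsub>K\<^esub> x [^]\<^bsub>K\<^esub> i \<oplus>\<^bsub>K\<^esub> \<iota> (s i) \<otimes>\<^bsub>K\<^esub> x [^]\<^bsub>K\<^esub> i)"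
        using cl x by (intro K.add.finprod_cong') (auto simp: K.l_distr)
      also have "\<dots> = (\<Oplus>\<^bsub>K\<^esub> i \<in> {..<n}. \<iota> (r i) \<otimes>\<^bsub>K\<^esub> x [^]\<^bsub>K\<^esub> i)
          \<oplus>\<^bsub>K\<^esub> (\<Oplus>\<^bsub>K\<^esub> i \<in> {..<n}. \<iota> (s i) \<otimes>\<^bsub>K\<^esub> x [^]\<^bsub>K\<^esub> i)"
        using cl x by (intro K.finsum_addf) auto
      finally have "\<iota> (y \<oplus> z) = (\<Oplus>\<^bsub>K\<^esub> i \<in> {..<n}. \<iota> (r i \<oplus> s i) \<otimes>\<^bsub>K\<^esub> x [^]\<^bsub>K\<^esub> i) \<otimes>\<^bsub>K\<^esub> \<iota> a"
        using yz r s cl x a by (simp add: J_def K.l_distr Pi_iff)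
      then show ?thesis using yz cl unfolding J_def by (auto intro!: bexI[of _ "\<lambda>i. r i \<oplus> s i"])
    qed
    show "t \<otimes> z \<in> J n" if t: "t \<in> carrier R" and z: "z \<in> J n" for t z
    proof -
      obtain s where s: "s \<in> {..<n} \<rightarrow> carrier R"
          "\<iota> z = (\<Oplus>\<^bsub>K\<^esub> i \<in> {..<n}. \<iota> (s i) \<otimes>\<^bsub>K\<^esub> x [^]\<^bsub>K\<^esub> i) \<otimes>\<^bsub>K\<^esub> \<iota> a"
        using z unfolding J_def by blast
      have cl: "s i \<in> carrier R" if "i < n" for i using s(1) that by auto
      have "(\<Oplus>\<^bsub>K\<^esub> i \<in> {..<n}. \<iota> (t \<otimes> s i) \<otimes>\<^bsub>K\<^esub> x [^]\<^bsub>K\<^esub> i)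
        = (\<Oplus>\<^bsub>K\<^esub> i \<in> {..<n}. \<iota> t \<otimes>\<^bsub>K\<^esub> (\<iota> (s i) \<otimes>\<^bsub>K\<^esub> x [^]\<^bsub>K\<^esub> i))"
        using cl x t by (intro K.add.finprod_cong') (auto simp: K.m_assoc)
      also have "\<dots> = \<iota> t \<otimes>\<^bsub>K\<^esub> (\<Oplus>\<^bsub>K\<^esub> i \<in> {..<n}. \<iota> (s i) \<otimes>\<^bsub>K\<^esub> x [^]\<^bsub>K\<^esub> i)"
        using cl x t by (intro K.finsum_rdistr[symmetric]) auto
      finally have "\<iota> (t \<otimes> z) = (\<Oplus>\<^bsub>K\<^esub> i \<in> {..<n}. \<iota> (t \<otimes> s i) \<otimes>\<^bsub>K\<^esub> x [^]\<^bsub>K\<^esub> i) \<otimes>\<^bsub>K\<^esub> \<iota> a"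
        using z s cl x a t by (simp add: J_def K.m_assoc Pi_iff)
      then show ?thesis using z cl t unfolding J_def by (auto intro!: bexI[of _ "\<lambda>i. t \<otimes> s i"])
    qed
  qed (auto simp: J_def)
  have sum_Suc: "(\<Oplus>\<^bsub>K\<^esub> i \<in> {..<Suc n}. \<iota> ((r(n := t)) i) \<otimes>\<^bsub>K\<^esub> x [^]\<^bsub>K\<^esub> i)
      = \<iota> t \<otimes>\<^bsub>K\<^esub> x [^]\<^bsub>K\<^esub> n \<oplus>\<^bsub>K\<^esub> (\<Oplus>\<^bsub>K\<^esub> i \<in> {..<n}. \<iota> (r i) \<otimes>\<^bsub>K\<^esub> x [^]\<^bsub>K\<^esub> i)"
    if "r \<in> {..<n} \<rightarrow> carrier R" "t \<in> carrier R" for r t and n :: nat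
  proof -
    have cl: "r i \<in> carrier R" if "i < n" for i using \<open>r \<in> _\<close> that by auto
    have "(\<Oplus>\<^bsub>K\<^esub> i \<in> {..<n}. \<iota> ((r(n := t)) i) \<otimes>\<^bsub>K\<^esub> x [^]\<^bsub>K\<^esub> i)
      = (\<Oplus>\<^bsub>K\<^esub> i \<in> {..<n}. \<iota> (r i) \<otimes>\<^bsub>K\<^esub> x [^]\<^bsub>K\<^esub> i)"
      using cl x by (intro K.add.finprod_cong') auto
    then show ?thesis using cl x that(2)
      by (simp only: lessThan_Suc) (subst K.finsum_insert, auto)
  qed
  have "J n \<subseteq> J (Suc n)" for n
  proof
    fix z assume z: "z \<in> J n"
    then obtain r where r: "r \<in> {..<n} \<rightarrow> carrier R"
      "\<iota> z = (\<Oplus>\<^bsub>K\<^esub> i \<in> {..<n}. \<iota> (r i) \<otimes>\<^bsub>K\<^esub> x [^]\<^bsub>K\<^esub> i) \<otimes>\<^bsub>K\<^esub> \<iota> a"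
      unfolding J_def by blast
    have "(\<Oplus>\<^bsub>K\<^esub> i \<in> {..<n}. \<iota> (r i) \<otimes>\<^bsub>K\<^esub> x [^]\<^bsub>K\<^esub> i) \<in> carrier K"
      using r(1) x by (intro K.finsum_closed) auto
    then have "\<iota> z = (\<Oplus>\<^bsub>K\<^esub> i \<in> {..<Suc n}. \<iota> ((r(n := \<zero>)) i) \<otimes>\<^bsub>K\<^esub> x [^]\<^bsub>K\<^esub> i) \<otimes>\<^bsub>K\<^esub> \<iota> a"
      unfolding sum_Suc[OF r(1) R.zero_closed] using r(2) x by simp
    moreover have "r(n := \<zero>) \<in> {..<Suc n} \<rightarrow> carrier R"
      using r(1) by (auto simp: Pi_iff less_Suc_eq)
    ultimately show "z \<in> J (Suc n)" using z unfolding J_def by blast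
  qed
  then obtain n where n: "J (Suc n) = J n"
    using noetherian_ring.ideal_sequence_stabilizes[OF noetherian J_ideal] by blast
  have "c n \<in> J (Suc n)"
  proof -
    have z: "(\<lambda>_. \<zero>) \<in> {..<n} \<rightarrow> carrier R" by auto
    have "(\<Oplus>\<^bsub>K\<^esub> i \<in> {..<n}. \<iota> \<zero> \<otimes>\<^bsub>K\<^esub> x [^]\<^bsub>K\<^esub> i) = \<zero>\<^bsub>K\<^esub>"
      using x by (intro K.add.finprod_one_eqI) simp
    then have "\<iota> (c n) = (\<Oplus>\<^bsub>K\<^esub> i \<in> {..<Suc n}. \<iota> (((\<lambda>_. \<zero>)(n := \<one>)) i) \<otimes>\<^bsub>K\<^esub> x [^]\<^bsub>K\<^esub> i) \<otimes>\<^bsub>K\<^esub> \<iota> a"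
      unfolding sum_Suc[OF z R.one_closed] using ci x by simp
    moreover have "(\<lambda>_. \<zero>)(n := \<one>) \<in> {..<Suc n} \<rightarrow> carrier R" by auto
    ultimately show ?thesis using cR unfolding J_def by blast
  qed
  then obtain r where r: "r \<in> {..<n} \<rightarrow> carrier R"
    "\<iota> (c n) = (\<Oplus>\<^bsub>K\<^esub> i \<in> {..<n}. \<iota> (r i) \<otimes>\<^bsub>K\<^esub> x [^]\<^bsub>K\<^esub> i) \<otimes>\<^bsub>K\<^esub> \<iota> a"
    unfolding n unfolding J_def by blast
  define s where "s = (\<Oplus>\<^bsub>K\<^esub> i \<in> {..<n}. \<iota> (r i) \<otimes>\<^bsub>K\<^esub> x [^]\<^bsub>K\<^esub> i)"
  have sK: "s \<in> carrier K" unfolding s_def using r(1) x by (intro K.finsum_closed) auto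
  have "x [^]\<^bsub>K\<^esub> n = s"
    using r(2) ci[of n] K.m_rcancel[OF ia] a x sK unfolding s_def[symmetric] by simp
  \<comment> \<open>Integrality is stated with all terms on one side, so the coefficients found are
    negated.\<close>
  moreover have "(\<Oplus>\<^bsub>K\<^esub> i \<in> {..<n}. \<iota> (\<ominus> r i) \<otimes>\<^bsub>K\<^esub> x [^]\<^bsub>K\<^esub> i) = \<ominus>\<^bsub>K\<^esub> s"
  proof -
    have cl: "r i \<in> carrier R" if "i < n" for i using r(1) that by auto
    have "(\<Oplus>\<^bsub>K\<^esub> i \<in> {..<n}. \<iota> (\<ominus> r i) \<otimes>\<^bsub>K\<^esub> x [^]\<^bsub>K\<^esub> i)
        = (\<Oplus>\<^bsub>K\<^esub> i \<in> {..<n}. (\<ominus>\<^bsub>K\<^esub> \<one>\<^bsub>K\<^esub>) \<otimes>\<^bsub>K\<^esub> (\<iota> (r i) \<otimes>\<^bsub>K\<^esub> x [^]\<^bsub>K\<^esub> i))"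
      using cl x by (intro K.add.finprod_cong') (auto simp: K.l_minus)
    also have "\<dots> = (\<ominus>\<^bsub>K\<^esub> \<one>\<^bsub>K\<^esub>) \<otimes>\<^bsub>K\<^esub> s"
      unfolding s_def using cl x by (intro K.finsum_rdistr[symmetric]) auto
    finally show ?thesis using sK by (simp add: K.l_minus)
  qed
  moreover have "(\<lambda>i. \<ominus> r i) \<in> {..<n} \<rightarrow> carrier R" using r(1) by auto
  ultimately have "integral_element R K \<iota> x"
    unfolding integral_element_def using x sK K.r_neg
    by (auto intro!: exI[of _ n] exI[of _ "\<lambda>i. \<ominus> r i"])
  then obtain d where d: "d \<in> carrier R" "x = \<iota> d" using integrally_closed by blast
  have "\<iota> b = \<iota> (a \<otimes> d)" using ax d a by simp
  then have "b = a \<otimes> d" using inj_onD[OF embedding_inj] a(1) b d(1) by blast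
  then show ?thesis using that d by blast
qed

text \<open>The quotient field is eliminated: \<open>multiplier_dvd\<close> is the consequence of
  integral closedness stated inside R. The structure theory of modules below therefore mentions
  neither \<open>K\<close> nor \<open>\<iota>\<close>.\<close>

locale dedekind_ring = noetherian_domain R for R (structure) +
  assumes nonzero_prime_maximal: "P \<in> nonzero_primes R \<Longrightarrow> maximalideal P R"
    and multiplier_dvd: "\<lbrakk>a \<in> carrier R; a \<noteq> \<zero>; b \<in> carrier R; ideal I R; a \<in> I;
      \<And>r. r \<in> I \<Longrightarrow> \<exists>r'\<in>I. b \<otimes> r = a \<otimes> r'\<rbrakk> \<Longrightarrow> \<exists>d\<in>carrier R. b = a \<otimes> d"

lemma (in dedekind_domain) dedekind_ring: "dedekind_ring R"
proof (rule dedekind_ring.intro[OF dedekind_domain.axioms(1)[OF dedekind_domain_axioms]], rule dedekind_ring_axioms.intro)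
  show "maximalideal P R" if "P \<in> nonzero_primes R" for P
    using that by (rule nonzero_prime_maximal)
  show "\<exists>d\<in>carrier R. b = a \<otimes> d"
    if ab: "a \<in> carrier R" "a \<noteq> \<zero>" "b \<in> carrier R" "ideal I R" "a \<in> I"
      and mult: "\<And>r. r \<in> I \<Longrightarrow> \<exists>r'\<in>I. b \<otimes> r = a \<otimes> r'" for a b I
  proof -
    obtain d where "d \<in> carrier R" "b = a \<otimes> d"
      using dvd_if_multiplier_preserves_ideal[OF noetherian_domain.axioms(1)[OF dedekind_domain.axioms(1)[OF dedekind_domain_axioms]]
          integrally_closed ab mult] by auto
    then show ?thesis by auto
  qed
qed

text \<open>Fix a non-zero a in P. Among the colon ideals (aR : b) contained in P a maximal one
  exists by the Noetherian property, and it is prime. It contains a, so it is a non-zero prime,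
  hence a maximal ideal, hence equal to P.\<close>

lemma (in dedekind_ring) nonzero_prime_is_colon_ideal:
  assumes P: "P \<in> nonzero_primes R"
  obtains a b where "a \<in> P" "a \<noteq> \<zero>" "b \<in> carrier R" "P = colon_ideal R a b"
proof -
  interpret P: primeideal P R using P by (simp add: nonzero_primes_def)
  have "P \<noteq> {\<zero>}" using P by (simp add: nonzero_primes_def)
  then obtain a where a: "a \<in> P" "a \<noteq> \<zero>" using P.zero_closed by blast
  have aR: "a \<in> carrier R" using a P.Icarr by blast
  define S where "S = {colon_ideal R a b | b. b \<in> carrier R \<and> colon_ideal R a b \<subseteq> P}"
  have "colon_ideal R a \<one> \<subseteq> P"
    unfolding colon_ideal_def using a P.I_r_closed by auto
  then have "S \<noteq> {}" "S \<subseteq> {I. ideal I R}"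
    unfolding S_def using ideal_colon_ideal[OF aR] by auto
  then obtain Q where Q: "Q \<in> S" and Qmax: "\<And>J. J \<in> S \<Longrightarrow> Q \<subseteq> J \<Longrightarrow> J = Q"
    using exists_maximal_ideal_in by metis
  obtain b where b: "b \<in> carrier R" "Q = colon_ideal R a b" "Q \<subseteq> P"
    using Q unfolding S_def by blast
  have Qi: "ideal Q R" using b ideal_colon_ideal[OF aR] by simp
  have sub: "colon_ideal R a b \<subseteq> colon_ideal R a (b \<otimes> c)" if "c \<in> carrier R" for c
  proof
    fix r assume "r \<in> colon_ideal R a b"
    then obtain d where d: "r \<in> carrier R" "d \<in> carrier R" "r \<otimes> b = a \<otimes> d"
      unfolding colon_ideal_def by blast
    have "r \<otimes> (b \<otimes> c) = a \<otimes> (d \<otimes> c)"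
      using d that b(1) aR by (simp flip: m_assoc)
    then show "r \<in> colon_ideal R a (b \<otimes> c)"
      using d that unfolding colon_ideal_def by blast
  qed
  \<comment> \<open>By maximality of \<open>Q\<close>, an element \<open>c\<close> for which \<open>(a : b c)\<close> exceeds \<open>Q = (a : b)\<close> is
    killed modulo \<open>(a : b)\<close> by some element outside \<open>P\<close>.\<close>
  have escape: "\<exists>d \<in> carrier R - P. d \<otimes> c \<in> Q"
    if c: "c \<in> carrier R" and y: "y \<in> colon_ideal R a (b \<otimes> c)" "y \<notin> Q" for c y
  proof -
    have "\<not> colon_ideal R a (b \<otimes> c) \<subseteq> P"
    proof
      assume "colon_ideal R a (b \<otimes> c) \<subseteq> P"
      then have "colon_ideal R a (b \<otimes> c) \<in> S"
        unfolding S_def using b(1) c by blast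
      then have "colon_ideal R a (b \<otimes> c) = Q" using Qmax sub[OF c] b(2) by simp
      then show False using y by simp
    qed
    then obtain d e where d: "d \<in> carrier R" "d \<notin> P" "e \<in> carrier R" "d \<otimes> (b \<otimes> c) = a \<otimes> e"
      unfolding colon_ideal_def by blast
    then have "(d \<otimes> c) \<otimes> b = a \<otimes> e" using b(1) c by (simp add: m_ac)
    then show ?thesis using d c unfolding b(2) colon_ideal_def by auto
  qed
  have "primeideal Q R"
  proof (rule primeidealI[OF Qi is_cring])
    show "carrier R \<noteq> Q" using b(3) P.I_notcarr P.a_subset by blast
    fix x y assume xy: "x \<in> carrier R" "y \<in> carrier R" "x \<otimes> y \<in> Q"
    show "x \<in> Q \<or> y \<in> Q"
    proof (rule ccontr)
      assume n: "\<not> (x \<in> Q \<or> y \<in> Q)"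
      \<comment> \<open>The argument escapes twice. First x enlarges the colon ideal of b y, giving
        c outside P with c y in Q. Then y enlarges that of b c, giving d outside P with d c in Q
        \<subseteq> P, against primality of P.\<close>
      obtain e where "e \<in> carrier R" "(x \<otimes> y) \<otimes> b = a \<otimes> e"
        using xy(3) unfolding b(2) colon_ideal_def by blast
      then have "x \<in> colon_ideal R a (b \<otimes> y)"
        unfolding colon_ideal_def using xy b(1) by (auto simp: m_ac)
      then obtain c where c: "c \<in> carrier R" "c \<notin> P" "c \<otimes> y \<in> Q"
        using escape[OF xy(2)] n by blast
      obtain e where "e \<in> carrier R" "(c \<otimes> y) \<otimes> b = a \<otimes> e"
        using c(3) unfolding b(2) colon_ideal_def by blast
      then have "y \<in> colon_ideal R a (b \<otimes> c)"
        unfolding colon_ideal_def using xy b(1) c by (auto simp: m_ac)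
      then obtain d where "d \<in> carrier R" "d \<notin> P" "d \<otimes> c \<in> Q"
        using escape[OF c(1)] n by blast
      then show False using b(3) c P.I_prime by blast
    qed
  qed
  moreover have "a \<in> Q"
    unfolding b(2) colon_ideal_def using aR b(1) by blast
  ultimately have "maximalideal Q R"
    using a(2) nonzero_prime_maximal[of Q] unfolding nonzero_primes_def by blast
  then have "P = Q"
    using maximalideal.I_maximal[of Q R P] b(3) P.is_ideal P.a_subset P.I_notcarr by blast
  then show ?thesis using that a b by blast
qed

text \<open>With denominators cleared, this says that the local ring of R at P is a discrete
  valuation ring with uniformizer \<open>\<pi>\<close>: by \<open>\<tau>_mult\<close>,
  \<open>\<pi>\<close> generates P after inverting the single element \<open>\<tau>\<close>, and by
  \<open>valuation\<close> every non-zero r is a unit times a power of \<open>\<pi>\<close>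
  there.\<close>

locale uniformized_prime = domain R
  for R :: "('a, 'c) ring_scheme" (structure) and P :: "'a set" and \<pi> :: 'a and \<tau> :: 'a +
  assumes max_P: "maximalideal P R" and \<pi>_in_P: "\<pi> \<in> P" and \<pi>_nonzero: "\<pi> \<noteq> \<zero>"
    and \<tau>_closed [simp]: "\<tau> \<in> carrier R" and \<tau>_notin_P: "\<tau> \<notin> P"
    and \<tau>_mult: "r \<in> P \<Longrightarrow> \<exists>r'\<in>carrier R. \<tau> \<otimes> r = \<pi> \<otimes> r'"
    and valuation: "r \<in> carrier R \<Longrightarrow> r \<noteq> \<zero> \<Longrightarrow>
      \<exists>s\<in>carrier R - P. \<exists>t\<in>carrier R - P. \<exists>n::nat. s \<otimes> r = t \<otimes> \<pi> [^] n"

text \<open>Write P = (aR : b), so b P \<subseteq> aR. If b/a mapped P into P, then a would divide b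
  and P would contain 1. Hence b \<open>\<pi>\<close> = a \<open>\<tau>\<close> for some
  \<open>\<pi>\<close> in P and \<open>\<tau>\<close> outside P. For r in P with b r = a r',
  multiplying by \<open>\<pi>\<close> and cancelling a gives \<open>\<tau>\<close> r =
  \<open>\<pi>\<close> r'.\<close>

lemma (in dedekind_ring) exists_uniformizer:
  assumes P: "P \<in> nonzero_primes R"
  shows "\<exists>\<pi> \<tau>. uniformized_prime R P \<pi> \<tau>"
proof -
  interpret P: primeideal P R using P by (simp add: nonzero_primes_def)
  obtain a b where ab: "a \<in> P" "a \<noteq> \<zero>" "b \<in> carrier R" "P = colon_ideal R a b"
    using nonzero_prime_is_colon_ideal[OF P] .
  have aR: "a \<in> carrier R" using ab P.Icarr by blast
  have mult: "\<exists>r'\<in>carrier R. b \<otimes> r = a \<otimes> r'" if "r \<in> P" for r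
    using that m_comm[of r b] ab(3) unfolding ab(4) colon_ideal_def by auto
  have "\<not> (\<forall>r\<in>P. \<exists>r'\<in>P. b \<otimes> r = a \<otimes> r')"
  proof
    assume "\<forall>r\<in>P. \<exists>r'\<in>P. b \<otimes> r = a \<otimes> r'"
    then obtain d where "d \<in> carrier R" "b = a \<otimes> d"
      using multiplier_dvd[OF aR ab(2,3) P.is_ideal ab(1)] by blast
    then have "\<one> \<in> P" unfolding ab(4) colon_ideal_def using ab(3) by auto
    then show False using P.one_imp_carrier P.I_notcarr by blast
  qed
  then obtain \<pi> \<tau> where \<pi>: "\<pi> \<in> P" and \<tau>: "\<tau> \<in> carrier R" "\<tau> \<notin> P" and eq: "b \<otimes> \<pi> = a \<otimes> \<tau>"
    using mult by metis
  have \<pi>R: "\<pi> \<in> carrier R" using \<pi> P.Icarr by blast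
  have \<tau>_mult: "\<exists>r'\<in>carrier R. \<tau> \<otimes> r = \<pi> \<otimes> r'" if r: "r \<in> P" for r
  proof -
    have rR: "r \<in> carrier R" using r P.Icarr by blast
    obtain r' where r': "r' \<in> carrier R" "b \<otimes> r = a \<otimes> r'" using mult[OF r] by blast
    have "a \<otimes> (\<tau> \<otimes> r) = (b \<otimes> r) \<otimes> \<pi>"
      using eq aR \<tau> rR ab(3) \<pi>R by (metis m_assoc m_comm m_closed)
    also have "\<dots> = a \<otimes> (\<pi> \<otimes> r')" unfolding r'(2) using aR \<pi>R r'(1) by (simp add: m_ac)
    finally have "\<tau> \<otimes> r = \<pi> \<otimes> r'"
      using m_lcancel[OF ab(2)] aR \<tau> rR \<pi>R r' by simp
    then show ?thesis using r' by blast
  qed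
  have \<pi>0: "\<pi> \<noteq> \<zero>"
  proof
    assume "\<pi> = \<zero>"
    then have "a \<otimes> \<tau> = \<zero>" using eq ab(3) by simp
    then have "\<tau> = \<zero>" using ab(2) aR \<tau> integral by blast
    then show False using \<tau> P.zero_closed by simp
  qed
  have \<tau>pow: "\<tau> [^] n \<in> carrier R - P" for n :: nat
  proof (induction n)
    case 0
    then show ?case using P.one_imp_carrier P.I_notcarr by auto
  next
    case (Suc n)
    then show ?case using \<tau> P.I_prime[of "\<tau> [^] n" \<tau>] by auto
  qed
  have val: "\<exists>s\<in>carrier R - P. \<exists>t\<in>carrier R - P. \<exists>n::nat. s \<otimes> r = t \<otimes> \<pi> [^] n"
    if r: "r \<in> carrier R" "r \<noteq> \<zero>" for r
  proof (rule ccontr)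
    assume no: "\<not> ?thesis"
    \<comment> \<open>Without a valuation, the quotient z always lies in P, so r can be divided by
      \<open>\<pi>\<close> again and again, at the cost of one more factor \<open>\<tau>\<close>
      each time.\<close>
    have quot: "\<exists>z\<in>carrier R. \<tau> [^] n \<otimes> r = \<pi> [^] n \<otimes> z" for n :: nat
    proof (induction n)
      case 0
      then show ?case using r by auto
    next
      case (Suc n)
      then obtain z where z: "z \<in> carrier R" "\<tau> [^] n \<otimes> r = \<pi> [^] n \<otimes> z" by blast
      have "z \<in> P"
      proof (rule ccontr)
        assume "z \<notin> P"
        moreover have "\<tau> [^] n \<otimes> r = z \<otimes> \<pi> [^] n" using z \<pi>R by (simp add: m_comm)
        ultimately show False using no \<tau>pow[of n] z(1) by blast
      qed
      then obtain z' where z': "z' \<in> carrier R" "\<tau> \<otimes> z = \<pi> \<otimes> z'" using \<tau>_mult by blast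
      have "\<tau> [^] Suc n \<otimes> r = \<tau> \<otimes> (\<tau> [^] n \<otimes> r)" using \<tau> r by (simp add: m_ac)
      also have "\<dots> = \<pi> [^] n \<otimes> (\<tau> \<otimes> z)" unfolding z(2) using \<tau> \<pi>R z(1) by (simp add: m_ac)
      also have "\<dots> = \<pi> [^] Suc n \<otimes> z'" unfolding z'(2) using \<pi>R z'(1) by (simp add: m_ac)
      finally show ?case using z'(1) by blast
    qed
    \<comment> \<open>\<open>A n\<close> consists of the z with \<open>\<pi>\<close>^n z in r R
      locally at P. The ideals ascend; at the index where they stop, the quotient z of order n+1
      already satisfies the relation of order n. Cancelling r then puts s
      \<open>\<tau>\<close>^(n+1) into \<open>\<pi>\<close> R \<subseteq> P, which is
      impossible.\<close>
    define A where "A n = {z \<in> carrier R. \<exists>s\<in>carrier R - P. \<exists>w\<in>carrier R. s \<otimes> (\<pi> [^] n \<otimes> z) = w \<otimes> r}"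
      for n :: nat
    have "ideal (A n) R" for n
    proof (rule ideal_if_lin_comb_closed)
      have "\<tau> \<otimes> (\<pi> [^] n \<otimes> \<zero>) = \<zero> \<otimes> r" using \<tau> \<pi>R r by simp
      then show "\<zero> \<in> A n" unfolding A_def using \<tau> by blast
      show "x \<oplus> y \<in> A n" if xy: "x \<in> A n" "y \<in> A n" for x y
      proof -
        obtain s w s' w' where s: "s \<in> carrier R" "s \<notin> P" "w \<in> carrier R" "s \<otimes> (\<pi> [^] n \<otimes> x) = w \<otimes> r"
          and s': "s' \<in> carrier R" "s' \<notin> P" "w' \<in> carrier R" "s' \<otimes> (\<pi> [^] n \<otimes> y) = w' \<otimes> r"
          using xy unfolding A_def by blast
        have c: "x \<in> carrier R" "y \<in> carrier R" using xy unfolding A_def by auto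
        have "(s \<otimes> s') \<otimes> (\<pi> [^] n \<otimes> (x \<oplus> y))
            = s' \<otimes> (s \<otimes> (\<pi> [^] n \<otimes> x)) \<oplus> s \<otimes> (s' \<otimes> (\<pi> [^] n \<otimes> y))"
          using c s(1) s'(1) \<pi>R by (simp add: r_distr m_ac)
        also have "\<dots> = (s' \<otimes> w \<oplus> s \<otimes> w') \<otimes> r"
          unfolding s(4) s'(4) using s(1-3) s'(1-3) r by (simp add: l_distr m_assoc)
        finally have "(s \<otimes> s') \<otimes> (\<pi> [^] n \<otimes> (x \<oplus> y)) = (s' \<otimes> w \<oplus> s \<otimes> w') \<otimes> r" .
        moreover have "s \<otimes> s' \<in> carrier R - P" using s s' P.I_prime by blast
        moreover have "s' \<otimes> w \<oplus> s \<otimes> w' \<in> carrier R" "x \<oplus> y \<in> carrier R" using c s s' by auto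
        ultimately show ?thesis unfolding A_def by blast
      qed
      show "t \<otimes> x \<in> A n" if t: "t \<in> carrier R" and x: "x \<in> A n" for t x
      proof -
        obtain s w where s: "s \<in> carrier R" "s \<notin> P" "w \<in> carrier R" "s \<otimes> (\<pi> [^] n \<otimes> x) = w \<otimes> r"
          using x unfolding A_def by blast
        have c: "x \<in> carrier R" using x unfolding A_def by auto
        have "s \<otimes> (\<pi> [^] n \<otimes> (t \<otimes> x)) = t \<otimes> (s \<otimes> (\<pi> [^] n \<otimes> x))"
          using c s(1) \<pi>R t by (simp add: m_ac)
        also have "\<dots> = (t \<otimes> w) \<otimes> r" unfolding s(4) using s t r by (simp add: m_ac)
        finally have "s \<otimes> (\<pi> [^] n \<otimes> (t \<otimes> x)) = (t \<otimes> w) \<otimes> r" .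
        moreover have "t \<otimes> w \<in> carrier R" "t \<otimes> x \<in> carrier R" using c s t by auto
        ultimately show ?thesis unfolding A_def using s(1,2) by blast
      qed
    qed (auto simp: A_def)
    moreover have "A n \<subseteq> A (Suc n)" for n
    proof
      fix x assume x: "x \<in> A n"
      then obtain s w where s: "s \<in> carrier R" "s \<notin> P" "w \<in> carrier R" "s \<otimes> (\<pi> [^] n \<otimes> x) = w \<otimes> r"
        unfolding A_def by blast
      have c: "x \<in> carrier R" using x unfolding A_def by auto
      have "s \<otimes> (\<pi> [^] Suc n \<otimes> x) = \<pi> \<otimes> (s \<otimes> (\<pi> [^] n \<otimes> x))"
        using c s(1) \<pi>R by (simp add: m_ac)
      also have "\<dots> = (\<pi> \<otimes> w) \<otimes> r" unfolding s(4) using s \<pi>R r by (simp add: m_ac)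
      finally have "s \<otimes> (\<pi> [^] Suc n \<otimes> x) = (\<pi> \<otimes> w) \<otimes> r" .
      moreover have "\<pi> \<otimes> w \<in> carrier R" using s \<pi>R by auto
      ultimately show "x \<in> A (Suc n)" unfolding A_def using c s(1,2) by blast
    qed
    ultimately obtain n where n: "A (Suc n) = A n" using ideal_sequence_stabilizes by blast
    obtain z where z: "z \<in> carrier R" "\<tau> [^] Suc n \<otimes> r = \<pi> [^] Suc n \<otimes> z" using quot by blast
    have "\<one> \<otimes> (\<pi> [^] Suc n \<otimes> z) = \<tau> [^] Suc n \<otimes> r" unfolding z(2) using z(1) \<pi>R by simp
    moreover have "\<tau> [^] Suc n \<in> carrier R" "\<one> \<in> carrier R - P"
      using \<tau>(1) P.one_imp_carrier P.I_notcarr by auto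
    ultimately have "z \<in> A (Suc n)" unfolding A_def using z(1) by blast
    then obtain s w where s: "s \<in> carrier R" "s \<notin> P" "w \<in> carrier R" "s \<otimes> (\<pi> [^] n \<otimes> z) = w \<otimes> r"
      unfolding n unfolding A_def by blast
    have "(s \<otimes> \<tau> [^] Suc n) \<otimes> r = s \<otimes> (\<tau> [^] Suc n \<otimes> r)"
      using s \<tau> r by (intro m_assoc) auto
    also have "\<dots> = \<pi> \<otimes> (s \<otimes> (\<pi> [^] n \<otimes> z))"
      unfolding z(2) using s \<pi>R z(1) by (simp add: m_ac)
    also have "\<dots> = (\<pi> \<otimes> w) \<otimes> r" unfolding s(4) using \<pi>R s(3) r by (simp add: m_assoc)
    finally have "s \<otimes> \<tau> [^] Suc n = \<pi> \<otimes> w"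
      using m_rcancel[OF r(2)] s(1,3) \<tau>(1) \<pi>R r(1) by (metis m_closed nat_pow_closed)
    then have "s \<otimes> \<tau> [^] Suc n \<in> P" using \<pi> s(3) P.I_r_closed by metis
    then show False using s(1,2) \<tau>pow[of "Suc n"] P.I_prime by blast
  qed
  have "uniformized_prime R P \<pi> \<tau>"
    by (intro uniformized_prime.intro uniformized_prime_axioms.intro domain_axioms
        nonzero_prime_maximal[OF P] \<pi> \<pi>0 \<tau> \<tau>_mult val)
  then show ?thesis by blast
qed

section \<open>Submodules, homomorphisms and direct summands\<close>

context module
begin

lemma submoduleI':
  assumes "H \<subseteq> carrier M" "\<zero>\<^bsub>M\<^esub> \<in> H" "\<And>x y. x \<in> H \<Longrightarrow> y \<in> H \<Longrightarrow> x \<oplus>\<^bsub>M\<^esub> y \<in> H"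
    and "\<And>a x. a \<in> carrier R \<Longrightarrow> x \<in> H \<Longrightarrow> a \<odot>\<^bsub>M\<^esub> x \<in> H"
  shows "submodule H R M"
proof (rule submoduleI)
  show "\<ominus>\<^bsub>M\<^esub> x \<in> H" if "x \<in> H" for x
    using assms(1) assms(4)[of "\<ominus> \<one>" x] that by (auto simp: smult_l_minus)
qed (use assms in auto)

lemma submodule_subset: "submodule H R M \<Longrightarrow> x \<in> H \<Longrightarrow> x \<in> carrier M"
  using submoduleE(1) by blast

lemma submodule_zero: "submodule H R M \<Longrightarrow> \<zero>\<^bsub>M\<^esub> \<in> H"
  using subgroup.one_closed[OF submodule.axioms(1)] by fastforce

lemma submodule_add: "submodule H R M \<Longrightarrow> x \<in> H \<Longrightarrow> y \<in> H \<Longrightarrow> x \<oplus>\<^bsub>M\<^esub> y \<in> H"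
  by (rule submoduleE(5))

lemma submodule_smult: "submodule H R M \<Longrightarrow> a \<in> carrier R \<Longrightarrow> x \<in> H \<Longrightarrow> a \<odot>\<^bsub>M\<^esub> x \<in> H"
  by (rule submoduleE(4))

lemma submodule_diff: "submodule H R M \<Longrightarrow> x \<in> H \<Longrightarrow> y \<in> H \<Longrightarrow> x \<ominus>\<^bsub>M\<^esub> y \<in> H"
  unfolding a_minus_def by (intro submodule_add submoduleE(6))

lemma add_diff_cancel [simp]:
  "x \<in> carrier M \<Longrightarrow> y \<in> carrier M \<Longrightarrow> (x \<oplus>\<^bsub>M\<^esub> y) \<ominus>\<^bsub>M\<^esub> y = x"
  by (simp add: a_minus_def M.a_assoc M.r_neg)

lemma add_diff_cancel_left [simp]:
  "x \<in> carrier M \<Longrightarrow> y \<in> carrier M \<Longrightarrow> (x \<oplus>\<^bsub>M\<^esub> y) \<ominus>\<^bsub>M\<^esub> x = y"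
  by (metis M.a_comm add_diff_cancel)

lemma diff_add_cancel [simp]:
  "x \<in> carrier M \<Longrightarrow> y \<in> carrier M \<Longrightarrow> (x \<ominus>\<^bsub>M\<^esub> y) \<oplus>\<^bsub>M\<^esub> y = x"
  by (simp add: a_minus_def M.a_assoc M.l_neg)

lemma add_diff_cancel_right [simp]:
  "x \<in> carrier M \<Longrightarrow> y \<in> carrier M \<Longrightarrow> x \<oplus>\<^bsub>M\<^esub> (y \<ominus>\<^bsub>M\<^esub> x) = y"
  by (metis M.a_comm M.minus_closed diff_add_cancel)

lemma diff_eq_zero_iff:
  "x \<in> carrier M \<Longrightarrow> y \<in> carrier M \<Longrightarrow> x \<ominus>\<^bsub>M\<^esub> y = \<zero>\<^bsub>M\<^esub> \<longleftrightarrow> x = y"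
  by (metis M.l_zero M.r_neg a_minus_def diff_add_cancel)

lemma add_diff_swap:
  "\<lbrakk>x \<in> carrier M; y \<in> carrier M; x' \<in> carrier M; y' \<in> carrier M\<rbrakk> \<Longrightarrow>
    (x \<oplus>\<^bsub>M\<^esub> y) \<ominus>\<^bsub>M\<^esub> (x' \<oplus>\<^bsub>M\<^esub> y') = (x \<ominus>\<^bsub>M\<^esub> x') \<oplus>\<^bsub>M\<^esub> (y \<ominus>\<^bsub>M\<^esub> y')"
  by (simp add: a_minus_def M.minus_add M.a_ac)

lemma eq_add_imp_diff_eq:
  "\<lbrakk>x \<in> carrier M; y \<in> carrier M; x' \<in> carrier M; y' \<in> carrier M; x \<oplus>\<^bsub>M\<^esub> y = x' \<oplus>\<^bsub>M\<^esub> y'\<rbrakk> \<Longrightarrow>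
    x \<ominus>\<^bsub>M\<^esub> x' = y' \<ominus>\<^bsub>M\<^esub> y"
proof -
  assume c: "x \<in> carrier M" "y \<in> carrier M" "x' \<in> carrier M" "y' \<in> carrier M"
    and eq: "x \<oplus>\<^bsub>M\<^esub> y = x' \<oplus>\<^bsub>M\<^esub> y'"
  have "x' \<oplus>\<^bsub>M\<^esub> (y' \<ominus>\<^bsub>M\<^esub> y) = (x' \<oplus>\<^bsub>M\<^esub> y') \<ominus>\<^bsub>M\<^esub> y"
    using c by (simp add: a_minus_def M.a_assoc)
  also have "\<dots> = x" unfolding eq[symmetric] using c by simp
  finally show ?thesis using add_diff_cancel_left[of x' "y' \<ominus>\<^bsub>M\<^esub> y"] c by simp
qed

lemma smult_diff:
  "a \<in> carrier R \<Longrightarrow> x \<in> carrier M \<Longrightarrow> y \<in> carrier M \<Longrightarrow>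
    a \<odot>\<^bsub>M\<^esub> (x \<ominus>\<^bsub>M\<^esub> y) = a \<odot>\<^bsub>M\<^esub> x \<ominus>\<^bsub>M\<^esub> a \<odot>\<^bsub>M\<^esub> y"
  by (simp add: a_minus_def smult_r_distr smult_r_minus)

lemma smult_diff_left:
  "a \<in> carrier R \<Longrightarrow> b \<in> carrier R \<Longrightarrow> x \<in> carrier M \<Longrightarrow>
    (a \<ominus> b) \<odot>\<^bsub>M\<^esub> x = a \<odot>\<^bsub>M\<^esub> x \<ominus>\<^bsub>M\<^esub> b \<odot>\<^bsub>M\<^esub> x"
  by (simp add: a_minus_def smult_l_distr smult_l_minus)

lemma smult_swap:
  "a \<in> carrier R \<Longrightarrow> b \<in> carrier R \<Longrightarrow> x \<in> carrier M \<Longrightarrow>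
    a \<odot>\<^bsub>M\<^esub> (b \<odot>\<^bsub>M\<^esub> x) = b \<odot>\<^bsub>M\<^esub> (a \<odot>\<^bsub>M\<^esub> x)"
  by (metis R.m_comm smult_assoc1)

lemma submodule_add_cancel:
  assumes "submodule H R M" "x \<in> H" "x \<oplus>\<^bsub>M\<^esub> y \<in> H" "y \<in> carrier M"
  shows "y \<in> H"
  using submodule_diff[OF assms(1,3,2)] assms submodule_subset by simp

lemma submodule_diff_cancel:
  assumes "submodule H R M" "y \<in> H" "x \<ominus>\<^bsub>M\<^esub> y \<in> H" "x \<in> carrier M"
  shows "x \<in> H"
  using submodule_add[OF assms(1,3,2)] assms submodule_subset by simp

lemma zero_submodule: "submodule {\<zero>\<^bsub>M\<^esub>} R M"
  by (rule submoduleI') auto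

lemma submodule_Int: "submodule A R M \<Longrightarrow> submodule B R M \<Longrightarrow> submodule (A \<inter> B) R M"
  by (rule submoduleI') (auto intro: submodule_subset submodule_zero submodule_add submodule_smult)

definition cyclic_submodule :: "'c \<Rightarrow> 'c set"
  where "cyclic_submodule x = {a \<odot>\<^bsub>M\<^esub> x | a. a \<in> carrier R}"

lemma cyclic_submoduleI: "a \<in> carrier R \<Longrightarrow> a \<odot>\<^bsub>M\<^esub> x \<in> cyclic_submodule x"
  unfolding cyclic_submodule_def by blast

lemma cyclic_submoduleE:
  assumes "y \<in> cyclic_submodule x" obtains a where "a \<in> carrier R" "y = a \<odot>\<^bsub>M\<^esub> x"
  using assms unfolding cyclic_submodule_def by blast

lemma generator_in_cyclic_submodule: "x \<in> carrier M \<Longrightarrow> x \<in> cyclic_submodule x"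
  using cyclic_submoduleI[of \<one> x] by simp

lemma submodule_cyclic: "x \<in> carrier M \<Longrightarrow> submodule (cyclic_submodule x) R M"
proof (rule submoduleI')
  assume x: "x \<in> carrier M"
  show "cyclic_submodule x \<subseteq> carrier M" using x unfolding cyclic_submodule_def by auto
  show "\<zero>\<^bsub>M\<^esub> \<in> cyclic_submodule x" using cyclic_submoduleI[of \<zero> x] x by simp
  show "y \<oplus>\<^bsub>M\<^esub> z \<in> cyclic_submodule x" if "y \<in> cyclic_submodule x" "z \<in> cyclic_submodule x" for y z
    using that x by (metis (no_types) R.add.m_closed cyclic_submoduleE cyclic_submoduleI smult_l_distr)
  show "a \<odot>\<^bsub>M\<^esub> y \<in> cyclic_submodule x" if "a \<in> carrier R" "y \<in> cyclic_submodule x" for a y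
    using that x by (metis (no_types) R.m_closed cyclic_submoduleE cyclic_submoduleI smult_assoc1)
qed

lemma cyclic_submodule_subset:
  assumes "submodule H R M" "x \<in> H" shows "cyclic_submodule x \<subseteq> H"
  using assms unfolding cyclic_submodule_def by (auto intro: submodule_smult)

lemma mem_set_add: "z \<in> A <+>\<^bsub>M\<^esub> B \<longleftrightarrow> (\<exists>x\<in>A. \<exists>y\<in>B. z = x \<oplus>\<^bsub>M\<^esub> y)"
  unfolding set_add_def' by auto

lemma set_addE:
  assumes "z \<in> A <+>\<^bsub>M\<^esub> B" obtains x y where "x \<in> A" "y \<in> B" "z = x \<oplus>\<^bsub>M\<^esub> y"
  using assms mem_set_add by blast

lemma set_addI: "x \<in> A \<Longrightarrow> y \<in> B \<Longrightarrow> x \<oplus>\<^bsub>M\<^esub> y \<in> A <+>\<^bsub>M\<^esub> B"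
  using mem_set_add by blast

lemma submodule_set_add:
  assumes A: "submodule A R M" and B: "submodule B R M"
  shows "submodule (A <+>\<^bsub>M\<^esub> B) R M"
proof (rule submoduleI')
  note sub = submodule_subset[OF A] submodule_subset[OF B]
  show "A <+>\<^bsub>M\<^esub> B \<subseteq> carrier M" using sub by (auto simp: mem_set_add)
  show "\<zero>\<^bsub>M\<^esub> \<in> A <+>\<^bsub>M\<^esub> B"
    using set_addI[OF submodule_zero[OF A] submodule_zero[OF B]] by simp
  show "y \<oplus>\<^bsub>M\<^esub> z \<in> A <+>\<^bsub>M\<^esub> B" if y: "y \<in> A <+>\<^bsub>M\<^esub> B" and z: "z \<in> A <+>\<^bsub>M\<^esub> B" for y z
  proof -
    obtain a b where ab: "a \<in> A" "b \<in> B" "y = a \<oplus>\<^bsub>M\<^esub> b" using y by (rule set_addE)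
    obtain c d where cd: "c \<in> A" "d \<in> B" "z = c \<oplus>\<^bsub>M\<^esub> d" using z by (rule set_addE)
    have "y \<oplus>\<^bsub>M\<^esub> z = (a \<oplus>\<^bsub>M\<^esub> c) \<oplus>\<^bsub>M\<^esub> (b \<oplus>\<^bsub>M\<^esub> d)"
      using ab cd sub by (simp add: M.a_ac)
    then show ?thesis
      using set_addI[OF submodule_add[OF A ab(1) cd(1)] submodule_add[OF B ab(2) cd(2)]] by simp
  qed
  show "r \<odot>\<^bsub>M\<^esub> y \<in> A <+>\<^bsub>M\<^esub> B" if r: "r \<in> carrier R" and y: "y \<in> A <+>\<^bsub>M\<^esub> B" for r y
  proof -
    obtain a b where ab: "a \<in> A" "b \<in> B" "y = a \<oplus>\<^bsub>M\<^esub> b" using y by (rule set_addE)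
    have "r \<odot>\<^bsub>M\<^esub> y = r \<odot>\<^bsub>M\<^esub> a \<oplus>\<^bsub>M\<^esub> r \<odot>\<^bsub>M\<^esub> b"
      using ab r sub by (simp add: smult_r_distr)
    then show ?thesis
      using set_addI[OF submodule_smult[OF A r ab(1)] submodule_smult[OF B r ab(2)]] by simp
  qed
qed

lemma subset_set_add_left:
  assumes "submodule A R M" "submodule B R M" shows "A \<subseteq> A <+>\<^bsub>M\<^esub> B"
proof
  fix x assume x: "x \<in> A"
  show "x \<in> A <+>\<^bsub>M\<^esub> B"
    using set_addI[OF x submodule_zero[OF assms(2)]] submodule_subset[OF assms(1) x] by simp
qed

lemma subset_set_add_right:
  assumes "submodule A R M" "submodule B R M" shows "B \<subseteq> A <+>\<^bsub>M\<^esub> B"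
proof
  fix x assume x: "x \<in> B"
  show "x \<in> A <+>\<^bsub>M\<^esub> B"
    using set_addI[OF submodule_zero[OF assms(1)] x] submodule_subset[OF assms(2) x] by simp
qed

lemma set_add_subset:
  assumes "submodule H R M" "A \<subseteq> H" "B \<subseteq> H" shows "A <+>\<^bsub>M\<^esub> B \<subseteq> H"
proof
  fix z assume "z \<in> A <+>\<^bsub>M\<^esub> B"
  then obtain x y where "x \<in> A" "y \<in> B" "z = x \<oplus>\<^bsub>M\<^esub> y" by (rule set_addE)
  then show "z \<in> H" using assms submodule_add[OF assms(1)] by auto
qed

text \<open>The condition \<open>\<Phi>\<close> receives the submodule itself, because the purity
  condition used later asks for witnesses inside it. Monotonicity makes unions of chains admissible
  for Zorn's lemma. Maximality is returned in the form in which it gets used: adjoining any m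
  outside X breaks \<open>\<Phi>\<close> at some x + r m.\<close>

lemma exists_maximal_submodule:
  assumes Y: "submodule Y R M" "\<And>x. x \<in> Y \<Longrightarrow> \<Phi> Y x"
    and mono: "\<And>N N' x. N \<subseteq> N' \<Longrightarrow> \<Phi> N x \<Longrightarrow> \<Phi> N' x"
  obtains X where "submodule X R M" "Y \<subseteq> X" "\<forall>x\<in>X. \<Phi> X x"
    and "\<forall>m\<in>carrier M - X.
      \<exists>x\<in>X. \<exists>r\<in>carrier R. \<not> \<Phi> (X <+>\<^bsub>M\<^esub> cyclic_submodule m) (x \<oplus>\<^bsub>M\<^esub> r \<odot>\<^bsub>M\<^esub> m)"
proof -
  define S where "S = {X. submodule X R M \<and> Y \<subseteq> X \<and> (\<forall>x\<in>X. \<Phi> X x)}"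
  have "\<exists>X\<in>S. \<forall>X'\<in>S. X \<subseteq> X' \<longrightarrow> X' = X"
  proof (rule subset_Zorn)
    fix C assume C: "subset.chain S C"
    have CS: "C \<subseteq> S" using C by (simp add: pred_on.chain_def)
    have lin: "A \<subseteq> B \<or> B \<subseteq> A" if "A \<in> C" "B \<in> C" for A B
      using C that by (auto simp: pred_on.chain_def)
    show "\<exists>U\<in>S. \<forall>X\<in>C. X \<subseteq> U"
    proof (cases "C = {}")
      case True
      have "Y \<in> S" unfolding S_def using Y by simp
      then show ?thesis using True by blast
    next
      case False
      have sub: "submodule A R M" "Y \<subseteq> A" "\<And>x. x \<in> A \<Longrightarrow> \<Phi> A x" if "A \<in> C" for A
        using that CS unfolding S_def by auto
      have "submodule (\<Union>C) R M"
      proof (rule submoduleI')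
        show "\<Union>C \<subseteq> carrier M" using sub submodule_subset by blast
        show "\<zero>\<^bsub>M\<^esub> \<in> \<Union>C" using False sub submodule_zero by blast
        show "x \<oplus>\<^bsub>M\<^esub> y \<in> \<Union>C" if xy: "x \<in> \<Union>C" "y \<in> \<Union>C" for x y
        proof -
          obtain A B where AB: "A \<in> C" "B \<in> C" "x \<in> A" "y \<in> B" using xy by blast
          then obtain U where "U \<in> C" "x \<in> U" "y \<in> U" using lin[of A B] by blast
          then show ?thesis using submodule_add sub(1) by blast
        qed
        show "a \<odot>\<^bsub>M\<^esub> x \<in> \<Union>C" if "a \<in> carrier R" "x \<in> \<Union>C" for a x
          using that submodule_smult sub(1) by blast
      qed
      moreover have "Y \<subseteq> \<Union>C" using False sub(2) by blast
      moreover have "\<Phi> (\<Union>C) x" if "x \<in> \<Union>C" for x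
        using that sub(3) mono[of _ "\<Union>C"] by (meson UnionE Union_upper)
      ultimately have "\<Union>C \<in> S" unfolding S_def by simp
      then show ?thesis by (intro bexI[of _ "\<Union>C"]) auto
    qed
  qed
  then obtain X where X: "X \<in> S" and max: "\<And>X'. X' \<in> S \<Longrightarrow> X \<subseteq> X' \<Longrightarrow> X' = X" by metis
  have Xsub: "submodule X R M" "Y \<subseteq> X" "\<And>x. x \<in> X \<Longrightarrow> \<Phi> X x"
    using X unfolding S_def by auto
  have "\<exists>x\<in>X. \<exists>r\<in>carrier R. \<not> \<Phi> (X <+>\<^bsub>M\<^esub> cyclic_submodule m) (x \<oplus>\<^bsub>M\<^esub> r \<odot>\<^bsub>M\<^esub> m)"
    if m: "m \<in> carrier M" "m \<notin> X" for m
  proof (rule ccontr)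
    assume no: "\<not> ?thesis"
    define X' where "X' = X <+>\<^bsub>M\<^esub> cyclic_submodule m"
    have sub: "submodule X' R M"
      unfolding X'_def by (rule submodule_set_add[OF Xsub(1) submodule_cyclic[OF m(1)]])
    have X: "X \<subseteq> X'"
      unfolding X'_def by (rule subset_set_add_left[OF Xsub(1) submodule_cyclic[OF m(1)]])
    have "\<Phi> X' z" if "z \<in> X'" for z
      using that no unfolding X'_def by (metis cyclic_submoduleE set_addE)
    then have "X' = X" using max[of X'] sub X Xsub(2) unfolding S_def by blast
    moreover have "m \<in> X'"
      unfolding X'_def using generator_in_cyclic_submodule[OF m(1)]
        subset_set_add_right[OF Xsub(1) submodule_cyclic[OF m(1)]] by blast
    ultimately show False using m by simp
  qed
  then show ?thesis using that Xsub by blast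
qed

lemma exists_maximal_submodule_pointwise:
  assumes "submodule Y R M" "\<And>x. x \<in> Y \<Longrightarrow> \<psi> x"
  obtains X where "submodule X R M" "Y \<subseteq> X" "\<forall>x\<in>X. \<psi> x"
    and "\<forall>m\<in>carrier M - X. \<exists>x\<in>X. \<exists>r\<in>carrier R. \<not> \<psi> (x \<oplus>\<^bsub>M\<^esub> r \<odot>\<^bsub>M\<^esub> m)"
  by (rule exists_maximal_submodule[of Y "\<lambda>_. \<psi>", OF assms]) (assumption | rule that)+

lemma submodule_submodule_sum:
  assumes "\<And>i. i \<in> I \<Longrightarrow> N i \<subseteq> carrier M"
  shows "submodule (submodule_sum R M I N) R M"
proof (rule submoduleI')
  show "submodule_sum R M I N \<subseteq> carrier M"
    unfolding submodule_sum_def using assms carrier_is_submodule by blast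
qed (auto simp: submodule_sum_def intro: submodule_zero submodule_add submodule_smult)

lemma submodule_sum_upper: "i \<in> I \<Longrightarrow> N i \<subseteq> submodule_sum R M I N"
  unfolding submodule_sum_def by blast

lemma submodule_sum_least:
  "submodule H R M \<Longrightarrow> (\<And>i. i \<in> I \<Longrightarrow> N i \<subseteq> H) \<Longrightarrow> submodule_sum R M I N \<subseteq> H"
  unfolding submodule_sum_def by blast

end

section \<open>Homomorphisms, complements and projections\<close>

lemma mod_homI:
  assumes "\<And>x. x \<in> carrier M \<Longrightarrow> h x \<in> carrier N"
    and "\<And>x y. x \<in> carrier M \<Longrightarrow> y \<in> carrier M \<Longrightarrow> h (x \<oplus>\<^bsub>M\<^esub> y) = h x \<oplus>\<^bsub>N\<^esub> h y"
    and "\<And>a x. a \<in> carrier R \<Longrightarrow> x \<in> carrier M \<Longrightarrow> h (a \<odot>\<^bsub>M\<^esub> x) = a \<odot>\<^bsub>N\<^esub> h x"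
  shows "h \<in> mod_hom R M N"
  using assms unfolding mod_hom_def by auto

lemma mod_hom_closed: "h \<in> mod_hom R M N \<Longrightarrow> x \<in> carrier M \<Longrightarrow> h x \<in> carrier N"
  unfolding mod_hom_def by auto

lemma mod_hom_add:
  "h \<in> mod_hom R M N \<Longrightarrow> x \<in> carrier M \<Longrightarrow> y \<in> carrier M \<Longrightarrow> h (x \<oplus>\<^bsub>M\<^esub> y) = h x \<oplus>\<^bsub>N\<^esub> h y"
  unfolding mod_hom_def by auto

lemma mod_hom_smult:
  "h \<in> mod_hom R M N \<Longrightarrow> a \<in> carrier R \<Longrightarrow> x \<in> carrier M \<Longrightarrow> h (a \<odot>\<^bsub>M\<^esub> x) = a \<odot>\<^bsub>N\<^esub> h x"
  unfolding mod_hom_def by auto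

lemma mod_hom_zero:
  assumes "module R M" "module R N" "h \<in> mod_hom R M N"
  shows "h \<zero>\<^bsub>M\<^esub> = \<zero>\<^bsub>N\<^esub>"
proof -
  interpret M: module R M by fact
  interpret N: module R N by fact
  have "h (\<zero>\<^bsub>R\<^esub> \<odot>\<^bsub>M\<^esub> \<zero>\<^bsub>M\<^esub>) = \<zero>\<^bsub>R\<^esub> \<odot>\<^bsub>N\<^esub> h \<zero>\<^bsub>M\<^esub>"
    using assms(3) by (intro mod_hom_smult) auto
  then show ?thesis using mod_hom_closed[OF assms(3)] by simp
qed

lemma mod_hom_diff:
  assumes "module R M" "module R N" "h \<in> mod_hom R M N" "x \<in> carrier M" "y \<in> carrier M"
  shows "h (x \<ominus>\<^bsub>M\<^esub> y) = h x \<ominus>\<^bsub>N\<^esub> h y"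
proof -
  interpret M: module R M by fact
  interpret N: module R N by fact
  have "h x = h (x \<ominus>\<^bsub>M\<^esub> y) \<oplus>\<^bsub>N\<^esub> h y"
    using mod_hom_add[OF assms(3), of "x \<ominus>\<^bsub>M\<^esub> y" y] assms by simp
  then show ?thesis using assms mod_hom_closed[OF assms(3)] by simp
qed

lemma submodule_image:
  assumes "module R M" "module R N" "h \<in> mod_hom R M N" "submodule A R M"
  shows "submodule (h ` A) R N"
proof -
  interpret M: module R M by fact
  interpret N: module R N by fact
  have sub: "x \<in> carrier M" if "x \<in> A" for x using assms(4) that by (rule M.submodule_subset)
  show ?thesis
  proof (rule N.submoduleI')
    show "h ` A \<subseteq> carrier N" using sub mod_hom_closed[OF assms(3)] by blast
    show "\<zero>\<^bsub>N\<^esub> \<in> h ` A" using mod_hom_zero[OF assms(1-3)] M.submodule_zero[OF assms(4)] by force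
    show "x \<oplus>\<^bsub>N\<^esub> y \<in> h ` A" if xy: "x \<in> h ` A" "y \<in> h ` A" for x y
    proof -
      obtain u v where "u \<in> A" "v \<in> A" "x = h u" "y = h v" using xy by blast
      then show ?thesis using mod_hom_add[OF assms(3), of u v] sub M.submodule_add[OF assms(4)]
        by (metis imageI)
    qed
    show "a \<odot>\<^bsub>N\<^esub> x \<in> h ` A" if a: "a \<in> carrier R" and x: "x \<in> h ` A" for a x
    proof -
      obtain u where "u \<in> A" "x = h u" using x by blast
      then show ?thesis using mod_hom_smult[OF assms(3) a, of u] sub M.submodule_smult[OF assms(4) a]
        by (metis imageI)
    qed
  qed
qed

lemma submodule_vimage:
  assumes "module R M" "module R N" "h \<in> mod_hom R M N" "submodule B R N"
  shows "submodule {x \<in> carrier M. h x \<in> B} R M"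
proof -
  interpret M: module R M by fact
  interpret N: module R N by fact
  show ?thesis
    by (rule M.submoduleI')
      (auto simp: mod_hom_zero[OF assms(1-3)] mod_hom_add[OF assms(3)] mod_hom_smult[OF assms(3)]
        intro: N.submodule_zero N.submodule_add N.submodule_smult assms(4))
qed

context module
begin

lemma complementaryE:
  assumes "complementary R M D E"
  shows "submodule D R M" "submodule E R M"
    and "\<And>x. x \<in> D \<Longrightarrow> x \<in> E \<Longrightarrow> x = \<zero>\<^bsub>M\<^esub>"
    and "\<And>x. x \<in> carrier M \<Longrightarrow> \<exists>d\<in>D. \<exists>e\<in>E. x = d \<oplus>\<^bsub>M\<^esub> e"
  using assms unfolding complementary_def by (auto simp: mem_set_add)

lemma complementaryI:
  assumes D: "submodule D R M" and E: "submodule E R M"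
    and int: "\<And>x. x \<in> D \<Longrightarrow> x \<in> E \<Longrightarrow> x = \<zero>\<^bsub>M\<^esub>"
    and sum: "\<And>x. x \<in> carrier M \<Longrightarrow> \<exists>d\<in>D. \<exists>e\<in>E. x = d \<oplus>\<^bsub>M\<^esub> e"
  shows "complementary R M D E"
proof -
  have "D \<inter> E = {\<zero>\<^bsub>M\<^esub>}" using int submodule_zero[OF D] submodule_zero[OF E] by blast
  moreover have "D <+>\<^bsub>M\<^esub> E = carrier M"
    using sum submodule_subset[OF submodule_set_add[OF D E]] by (auto simp: mem_set_add)
  ultimately show ?thesis using D E unfolding complementary_def by blast
qed

lemma complementary_sym: "complementary R M D E \<Longrightarrow> complementary R M E D"
proof (rule complementaryI)
  assume c: "complementary R M D E"
  note cE = complementaryE[OF c]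
  show "submodule E R M" "submodule D R M" by (fact cE)+
  show "x = \<zero>\<^bsub>M\<^esub>" if "x \<in> E" "x \<in> D" for x using cE(3) that by blast
  show "\<exists>d\<in>E. \<exists>e\<in>D. x = d \<oplus>\<^bsub>M\<^esub> e" if "x \<in> carrier M" for x
    using cE(4)[OF that] M.a_comm submodule_subset[OF cE(1)] submodule_subset[OF cE(2)] by metis
qed

lemma complementary_decomp_unique:
  assumes c: "complementary R M D E" and "d \<in> D" "d' \<in> D" "e \<in> E" "e' \<in> E"
    and eq: "d \<oplus>\<^bsub>M\<^esub> e = d' \<oplus>\<^bsub>M\<^esub> e'"
  shows "d = d' \<and> e = e'"
proof -
  note cE = complementaryE[OF c]
  have car: "d \<in> carrier M" "d' \<in> carrier M" "e \<in> carrier M" "e' \<in> carrier M"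
    using assms submodule_subset[OF cE(1)] submodule_subset[OF cE(2)] by auto
  have "d \<ominus>\<^bsub>M\<^esub> d' = e' \<ominus>\<^bsub>M\<^esub> e" using car eq by (intro eq_add_imp_diff_eq) auto
  moreover have "d \<ominus>\<^bsub>M\<^esub> d' \<in> D" "e' \<ominus>\<^bsub>M\<^esub> e \<in> E"
    using assms submodule_diff[OF cE(1)] submodule_diff[OF cE(2)] by auto
  ultimately have "d \<ominus>\<^bsub>M\<^esub> d' = \<zero>\<^bsub>M\<^esub>" using cE(3) by simp
  then have "d = d'" using car by (simp add: diff_eq_zero_iff)
  then show ?thesis using eq car by simp
qed

text \<open>The projection is given as an endomorphism of M, since the property under study speaks
  about endomorphisms only. The last clause says that the complementary projection lands in
  E.\<close>

lemma complementary_projection: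
  assumes c: "complementary R M D E"
  obtains f where "f \<in> mod_hom R M M" "\<forall>x\<in>D. f x = x" "\<forall>x\<in>E. f x = \<zero>\<^bsub>M\<^esub>"
    "\<forall>x\<in>carrier M. f x \<in> D" "\<forall>x\<in>carrier M. x \<ominus>\<^bsub>M\<^esub> f x \<in> E"
proof -
  note cE = complementaryE[OF c]
  note sub = submodule_subset[OF cE(1)] submodule_subset[OF cE(2)]
  obtain f g where fg: "\<And>x. x \<in> carrier M \<Longrightarrow> f x \<in> D \<and> g x \<in> E \<and> x = f x \<oplus>\<^bsub>M\<^esub> g x"
    using cE(4) by metis
  have fI: "f x = d" if "d \<in> D" "e \<in> E" "x = d \<oplus>\<^bsub>M\<^esub> e" for x d e
  proof -
    have "x \<in> carrier M" using that sub by auto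
    then show ?thesis using complementary_decomp_unique[OF c, of "f x" d "g x" e] fg that by metis
  qed
  have hom: "f \<in> mod_hom R M M"
  proof (rule mod_homI)
    show "f x \<in> carrier M" if "x \<in> carrier M" for x using fg that sub by blast
    show "f (x \<oplus>\<^bsub>M\<^esub> y) = f x \<oplus>\<^bsub>M\<^esub> f y" if xy: "x \<in> carrier M" "y \<in> carrier M" for x y
    proof (rule fI)
      show "f x \<oplus>\<^bsub>M\<^esub> f y \<in> D" "g x \<oplus>\<^bsub>M\<^esub> g y \<in> E"
        using fg xy submodule_add[OF cE(1)] submodule_add[OF cE(2)] by auto
      have "(f x \<oplus>\<^bsub>M\<^esub> f y) \<oplus>\<^bsub>M\<^esub> (g x \<oplus>\<^bsub>M\<^esub> g y) = (f x \<oplus>\<^bsub>M\<^esub> g x) \<oplus>\<^bsub>M\<^esub> (f y \<oplus>\<^bsub>M\<^esub> g y)"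
        using fg xy sub by (simp add: M.a_ac)
      then show "x \<oplus>\<^bsub>M\<^esub> y = (f x \<oplus>\<^bsub>M\<^esub> f y) \<oplus>\<^bsub>M\<^esub> (g x \<oplus>\<^bsub>M\<^esub> g y)"
        using fg[OF xy(1)] fg[OF xy(2)] by simp
    qed
    show "f (a \<odot>\<^bsub>M\<^esub> x) = a \<odot>\<^bsub>M\<^esub> f x" if ax: "a \<in> carrier R" "x \<in> carrier M" for a x
    proof (rule fI)
      show "a \<odot>\<^bsub>M\<^esub> f x \<in> D" "a \<odot>\<^bsub>M\<^esub> g x \<in> E"
        using fg ax submodule_smult[OF cE(1)] submodule_smult[OF cE(2)] by auto
      show "a \<odot>\<^bsub>M\<^esub> x = a \<odot>\<^bsub>M\<^esub> f x \<oplus>\<^bsub>M\<^esub> a \<odot>\<^bsub>M\<^esub> g x"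
        using smult_r_distr[of a "f x" "g x"] fg[OF ax(2)] ax sub by simp
    qed
  qed
  show ?thesis
  proof (rule that[OF hom]; intro ballI)
    show "f x = x" if "x \<in> D" for x
      using fI[OF that submodule_zero[OF cE(2)]] sub that by simp
    show "f x = \<zero>\<^bsub>M\<^esub>" if "x \<in> E" for x
      using fI[OF submodule_zero[OF cE(1)] that] sub that by simp
    show "f x \<in> D" if "x \<in> carrier M" for x using fg that by blast
    show "x \<ominus>\<^bsub>M\<^esub> f x \<in> E" if "x \<in> carrier M" for x
      using add_diff_cancel_left[of "f x" "g x"] fg[OF that] sub by metis
  qed
qed

end

section \<open>Quotient modules\<close>

context module
begin

lemma rcoset_def': "D +>\<^bsub>M\<^esub> x = {d \<oplus>\<^bsub>M\<^esub> x | d. d \<in> D}"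
  unfolding a_r_coset_def r_coset_def by auto

lemma rcoset_eq_iff:
  assumes D: "submodule D R M" and x: "x \<in> carrier M" and y: "y \<in> carrier M"
  shows "D +>\<^bsub>M\<^esub> x = D +>\<^bsub>M\<^esub> y \<longleftrightarrow> x \<ominus>\<^bsub>M\<^esub> y \<in> D"
proof
  assume "D +>\<^bsub>M\<^esub> x = D +>\<^bsub>M\<^esub> y"
  moreover have "x \<in> D +>\<^bsub>M\<^esub> x"
    unfolding rcoset_def' using submodule_zero[OF D] x by (force intro: exI[of _ "\<zero>\<^bsub>M\<^esub>"])
  ultimately obtain d where "d \<in> D" "x = d \<oplus>\<^bsub>M\<^esub> y" unfolding rcoset_def' by blast
  then show "x \<ominus>\<^bsub>M\<^esub> y \<in> D" using submodule_subset[OF D] y by simp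
next
  assume d: "x \<ominus>\<^bsub>M\<^esub> y \<in> D"
  have *: "D +>\<^bsub>M\<^esub> u \<subseteq> D +>\<^bsub>M\<^esub> v" if "u \<ominus>\<^bsub>M\<^esub> v \<in> D" "u \<in> carrier M" "v \<in> carrier M" for u v
  proof
    fix z assume "z \<in> D +>\<^bsub>M\<^esub> u"
    then obtain e where e: "e \<in> D" "z = e \<oplus>\<^bsub>M\<^esub> u" unfolding rcoset_def' by blast
    have "z = (e \<oplus>\<^bsub>M\<^esub> (u \<ominus>\<^bsub>M\<^esub> v)) \<oplus>\<^bsub>M\<^esub> v"
      using e that submodule_subset[OF D e(1)] by (simp add: M.a_assoc)
    then show "z \<in> D +>\<^bsub>M\<^esub> v"
      unfolding rcoset_def' using submodule_add[OF D e(1) that(1)] by blast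
  qed
  have "y \<ominus>\<^bsub>M\<^esub> x = \<ominus>\<^bsub>M\<^esub> (x \<ominus>\<^bsub>M\<^esub> y)"
    using x y by (simp add: a_minus_def M.minus_add M.a_comm)
  then have "y \<ominus>\<^bsub>M\<^esub> x \<in> D" using submoduleE(6)[OF D d] by simp
  then show "D +>\<^bsub>M\<^esub> x = D +>\<^bsub>M\<^esub> y" using * d x y by blast
qed

lemma rcoset_zero: "submodule D R M \<Longrightarrow> D +>\<^bsub>M\<^esub> \<zero>\<^bsub>M\<^esub> = D"
proof -
  assume D: "submodule D R M"
  have "d \<oplus>\<^bsub>M\<^esub> \<zero>\<^bsub>M\<^esub> = d" if "d \<in> D" for d using submodule_subset[OF D that] by simp
  then show ?thesis unfolding rcoset_def' by force
qed

lemma rcoset_eq_self_iff: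
  assumes D: "submodule D R M" and x: "x \<in> carrier M"
  shows "D +>\<^bsub>M\<^esub> x = D \<longleftrightarrow> x \<in> D"
  using rcoset_eq_iff[OF D x M.zero_closed] rcoset_zero[OF D] x
    diff_add_cancel[OF x M.zero_closed] by simp

lemma carrier_quotient_module: "carrier (quotient_module M D) = (\<lambda>x. D +>\<^bsub>M\<^esub> x) ` carrier M"
  unfolding quotient_module_def A_RCOSETS_def RCOSETS_def a_r_coset_def by auto

lemma zero_quotient_module: "\<zero>\<^bsub>quotient_module M D\<^esub> = D"
  by (simp add: quotient_module_def)

lemma add_quotient_module:
  assumes D: "submodule D R M" and x: "x \<in> carrier M" and y: "y \<in> carrier M"
  shows "(D +>\<^bsub>M\<^esub> x) \<oplus>\<^bsub>quotient_module M D\<^esub> (D +>\<^bsub>M\<^esub> y) = D +>\<^bsub>M\<^esub> (x \<oplus>\<^bsub>M\<^esub> y)"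
proof -
  have "abelian_subgroup D M"
    by (intro abelian_subgroupI3 additive_subgroup.intro submodule.axioms(1)[OF D]
        M.abelian_group_axioms)
  then show ?thesis using x y by (simp add: quotient_module_def abelian_subgroup.a_rcos_sum)
qed

lemma smult_quotient_module:
  assumes D: "submodule D R M" and a: "a \<in> carrier R" and x: "x \<in> carrier M"
  shows "a \<odot>\<^bsub>quotient_module M D\<^esub> (D +>\<^bsub>M\<^esub> x) = D +>\<^bsub>M\<^esub> (a \<odot>\<^bsub>M\<^esub> x)"
proof -
  have "D +>\<^bsub>M\<^esub> (a \<odot>\<^bsub>M\<^esub> z) = D +>\<^bsub>M\<^esub> (a \<odot>\<^bsub>M\<^esub> x)" if z: "z \<in> D +>\<^bsub>M\<^esub> x" for z
  proof -
    obtain d where d: "d \<in> D" "z = d \<oplus>\<^bsub>M\<^esub> x" using z unfolding rcoset_def' by blast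
    have "d \<in> carrier M" using submodule_subset[OF D d(1)] .
    then have "a \<odot>\<^bsub>M\<^esub> z \<ominus>\<^bsub>M\<^esub> a \<odot>\<^bsub>M\<^esub> x = a \<odot>\<^bsub>M\<^esub> d"
      unfolding d(2) using a x by (simp add: smult_r_distr)
    then show ?thesis
      using rcoset_eq_iff[OF D, of "a \<odot>\<^bsub>M\<^esub> z" "a \<odot>\<^bsub>M\<^esub> x"] submodule_smult[OF D a d(1)]
        a x d \<open>d \<in> carrier M\<close> by simp
  qed
  moreover have "x \<in> D +>\<^bsub>M\<^esub> x"
    unfolding rcoset_def' using submodule_zero[OF D] x by (force intro: exI[of _ "\<zero>\<^bsub>M\<^esub>"])
  ultimately have "(\<Union>z\<in>D +>\<^bsub>M\<^esub> x. D +>\<^bsub>M\<^esub> (a \<odot>\<^bsub>M\<^esub> z)) = D +>\<^bsub>M\<^esub> (a \<odot>\<^bsub>M\<^esub> x)"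
    by (intro UN_constant_eq) blast+
  then show ?thesis by (simp add: quotient_module_def)
qed

lemma quotient_module_is_module:
  assumes D: "submodule D R M"
  shows "module R (quotient_module M D)"
proof -
  note rules = add_quotient_module[OF D] smult_quotient_module[OF D] zero_quotient_module
  have zero: "\<zero>\<^bsub>quotient_module M D\<^esub> = D +>\<^bsub>M\<^esub> \<zero>\<^bsub>M\<^esub>"
    by (simp add: rcoset_zero[OF D] zero_quotient_module)
  have "abelian_group (quotient_module M D)"
  proof (rule abelian_groupI)
    show "\<exists>y\<in>carrier (quotient_module M D). y \<oplus>\<^bsub>quotient_module M D\<^esub> X = \<zero>\<^bsub>quotient_module M D\<^esub>"
      if X: "X \<in> carrier (quotient_module M D)" for X
    proof -
      obtain x where x: "x \<in> carrier M" "X = D +>\<^bsub>M\<^esub> x" using X by (auto simp: carrier_quotient_module)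
      then have "(D +>\<^bsub>M\<^esub> (\<ominus>\<^bsub>M\<^esub> x)) \<oplus>\<^bsub>quotient_module M D\<^esub> X = \<zero>\<^bsub>quotient_module M D\<^esub>"
        by (simp add: zero add_quotient_module[OF D] M.l_neg)
      then show ?thesis using x by (auto simp: carrier_quotient_module)
    qed
  qed (auto simp: carrier_quotient_module add_quotient_module[OF D] zero M.a_ac)
  then show ?thesis
    by (intro moduleI R.is_cring)
      (auto simp: carrier_quotient_module rules smult_l_distr smult_r_distr smult_assoc1)
qed

lemma quotient_map_hom:
  assumes D: "submodule D R M"
  shows "(\<lambda>x. D +>\<^bsub>M\<^esub> x) \<in> mod_hom R M (quotient_module M D)"
  by (rule mod_homI)
    (auto simp: carrier_quotient_module add_quotient_module[OF D] smult_quotient_module[OF D])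

lemma lies_above_iff:
  assumes N: "submodule N R M"
  shows "lies_above R M N D \<longleftrightarrow> D \<subseteq> N \<and> direct_summand R M D \<and>
    (\<forall>X. submodule X R M \<and> D \<subseteq> X \<and> N <+>\<^bsub>M\<^esub> X = carrier M \<longrightarrow> X = carrier M)"
proof (cases "D \<subseteq> N \<and> direct_summand R M D")
  case True
  then have DN: "D \<subseteq> N" and D: "submodule D R M"
    unfolding direct_summand_def complementary_def by auto
  define q where "q x = D +>\<^bsub>M\<^esub> x" for x
  define Q where "Q = quotient_module M D"
  interpret Q: module R Q unfolding Q_def by (rule quotient_module_is_module[OF D])
  have q: "q \<in> mod_hom R M Q" unfolding q_def Q_def by (rule quotient_map_hom[OF D])
  have car: "carrier Q = q ` carrier M" unfolding q_def Q_def by (rule carrier_quotient_module)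
  have qeq: "q x = q y \<longleftrightarrow> x \<ominus>\<^bsub>M\<^esub> y \<in> D" if "x \<in> carrier M" "y \<in> carrier M" for x y
    unfolding q_def by (rule rcoset_eq_iff[OF D that])
  have Nc: "x \<in> carrier M" if "x \<in> N" for x using submodule_subset[OF N that] .
  have NQ: "submodule (q ` N) R Q" by (rule submodule_image[OF module_axioms Q.module_axioms q N])
  have "superfluous R Q (q ` N) \<longleftrightarrow>
    (\<forall>X. submodule X R M \<and> D \<subseteq> X \<and> N <+>\<^bsub>M\<^esub> X = carrier M \<longrightarrow> X = carrier M)" (is "_ \<longleftrightarrow> ?rhs")
  proof
    assume sup: "superfluous R Q (q ` N)"
    show ?rhs
    proof (intro allI impI)
      fix X assume X: "submodule X R M \<and> D \<subseteq> X \<and> N <+>\<^bsub>M\<^esub> X = carrier M"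
      then have Xs: "submodule X R M" and DX: "D \<subseteq> X" by auto
      have XQ: "submodule (q ` X) R Q"
        by (rule submodule_image[OF module_axioms Q.module_axioms q Xs])
      have "carrier Q \<subseteq> q ` N <+>\<^bsub>Q\<^esub> q ` X"
      proof
        fix z assume "z \<in> carrier Q"
        then obtain m where m: "m \<in> carrier M" "z = q m" unfolding car by blast
        then have "m \<in> N <+>\<^bsub>M\<^esub> X" using X by simp
        then obtain n x where nx: "n \<in> N" "x \<in> X" "m = n \<oplus>\<^bsub>M\<^esub> x" by (rule set_addE)
        then have "z = q n \<oplus>\<^bsub>Q\<^esub> q x"
          using mod_hom_add[OF q, of n x] m Nc submodule_subset[OF Xs] by simp
        then show "z \<in> q ` N <+>\<^bsub>Q\<^esub> q ` X" by (simp add: Q.set_addI nx(1,2))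
      qed
      then have "q ` N <+>\<^bsub>Q\<^esub> q ` X = carrier Q"
        using Q.submodule_subset[OF Q.submodule_set_add[OF NQ XQ]] by blast
      then have XQeq: "q ` X = carrier Q" using sup XQ unfolding superfluous_def by blast
      show "X = carrier M"
      proof
        show "X \<subseteq> carrier M" using submodule_subset[OF Xs] by blast
        show "carrier M \<subseteq> X"
        proof
          fix m assume m: "m \<in> carrier M"
          then obtain x where x: "x \<in> X" "q m = q x" using XQeq car by blast
          then have "m \<ominus>\<^bsub>M\<^esub> x \<in> X" using qeq[of m x] m submodule_subset[OF Xs] DX by blast
          then show "m \<in> X" using submodule_diff_cancel[OF Xs x(1)] m by blast
        qed
      qed
    qed
  next
    assume rhs: ?rhs
    show "superfluous R Q (q ` N)"
      unfolding superfluous_def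
    proof (intro conjI allI impI NQ)
      fix Y assume Y: "submodule Y R Q \<and> q ` N <+>\<^bsub>Q\<^esub> Y = carrier Q"
      define X where "X = {x \<in> carrier M. q x \<in> Y}"
      have Xs: "submodule X R M"
        unfolding X_def using Y by (intro submodule_vimage[OF module_axioms Q.module_axioms q]) blast
      have "q d = \<zero>\<^bsub>Q\<^esub>" if "d \<in> D" for d
        unfolding q_def Q_def zero_quotient_module
        using rcoset_eq_self_iff[OF D] that submodule_subset[OF D] by blast
      then have DX: "D \<subseteq> X"
        unfolding X_def using Y Q.submodule_zero submodule_subset[OF D] by auto
      have "carrier M \<subseteq> N <+>\<^bsub>M\<^esub> X"
      proof
        fix m assume m: "m \<in> carrier M"
        then have "q m \<in> q ` N <+>\<^bsub>Q\<^esub> Y" using Y car by simp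
        then obtain n' y where n': "n' \<in> q ` N" "y \<in> Y" "q m = n' \<oplus>\<^bsub>Q\<^esub> y"
          by (rule Q.set_addE)
        then obtain n where n: "n \<in> N" "y \<in> Y" "q m = q n \<oplus>\<^bsub>Q\<^esub> y" by auto
        have yc: "y \<in> carrier Q" using Q.submodule_subset[OF conjunct1[OF Y] n(2)] .
        have "q (m \<ominus>\<^bsub>M\<^esub> n) = q m \<ominus>\<^bsub>Q\<^esub> q n"
          using mod_hom_diff[OF module_axioms Q.module_axioms q m Nc[OF n(1)]] .
        also have "\<dots> = y" unfolding n(3) using yc mod_hom_closed[OF q Nc[OF n(1)]] by simp
        finally have "m \<ominus>\<^bsub>M\<^esub> n \<in> X" unfolding X_def using n m Nc by simp
        then have "n \<oplus>\<^bsub>M\<^esub> (m \<ominus>\<^bsub>M\<^esub> n) \<in> N <+>\<^bsub>M\<^esub> X" using n(1) by (intro set_addI)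
        then show "m \<in> N <+>\<^bsub>M\<^esub> X" using m Nc n(1) by simp
      qed
      then have "N <+>\<^bsub>M\<^esub> X = carrier M"
        using submodule_subset[OF submodule_set_add[OF N Xs]] by blast
      then have "X = carrier M" using rhs Xs DX by blast
      then have "carrier Q \<subseteq> Y" unfolding X_def car by blast
      then show "Y = carrier Q" using Y Q.submodule_subset by blast
    qed
  qed
  then show ?thesis using True unfolding lies_above_def Q_def q_def by simp
qed (auto simp: lies_above_def)

end

section \<open>Primary components\<close>

sublocale uniformized_prime \<subseteq> P: primeideal P R
  by (rule maximalideal_prime[OF max_P])

context uniformized_prime
begin

lemma \<pi>_closed [simp]: "\<pi> \<in> carrier R"
  using \<pi>_in_P by (rule P.Icarr)

lemma one_notin_P: "\<one> \<in> carrier R - P"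
  using P.one_imp_carrier P.I_notcarr by auto

lemma mult_notin_P: "s \<in> carrier R - P \<Longrightarrow> t \<in> carrier R - P \<Longrightarrow> s \<otimes> t \<in> carrier R - P"
  using P.I_prime by auto

lemma pow_notin_P: "s \<in> carrier R - P \<Longrightarrow> s [^] n \<in> carrier R - P" for n :: nat
proof (induction n)
  case 0
  then show ?case using one_notin_P by simp
next
  case (Suc n)
  then show ?case using mult_notin_P[of "s [^] n" s] by simp
qed

lemma \<tau>_pow_notin_P: "\<tau> [^] n \<in> carrier R - P" for n :: nat
  using pow_notin_P[of \<tau>] \<tau>_notin_P by simp

lemma ideal_power_0: "ideal_power R P 0 = carrier R"
  by (simp add: nat_pow_def ideals_set_def)

lemma ideal_power_Suc: "ideal_power R P (Suc n) = ideal_power R P n \<cdot> P"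
  by (simp add: nat_pow_def ideals_set_def)

lemma ideal_ideal_power: "ideal (ideal_power R P n) R"
proof (induction n)
  case 0
  then show ?case unfolding ideal_power_0 by (rule oneideal)
next
  case (Suc n)
  then show ?case unfolding ideal_power_Suc using P.is_ideal by (rule ideal_prod_is_ideal)
qed

lemma ideal_power_closed: "q \<in> ideal_power R P n \<Longrightarrow> q \<in> carrier R"
  by (rule ideal.Icarr[OF ideal_ideal_power])

lemma ideal_power_antimono: "n \<le> m \<Longrightarrow> ideal_power R P m \<subseteq> ideal_power R P n"
proof (rule lift_Suc_antimono_le[of "ideal_power R P"])
  show "ideal_power R P (Suc k) \<subseteq> ideal_power R P k" for k
    unfolding ideal_power_Suc using ideal_prod_inter[OF ideal_ideal_power P.is_ideal] by blast
qed

lemma pow_in_ideal_power: "a \<in> P \<Longrightarrow> a [^] n \<in> ideal_power R P n" for n :: nat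
proof (induction n)
  case 0
  then show ?case unfolding ideal_power_0 by simp
next
  case (Suc n)
  then have "a [^] n \<otimes> a \<in> ideal_power R P n \<cdot> P" by (intro ideal_prod.prod) auto
  then show ?case unfolding ideal_power_Suc by simp
qed

text \<open>The relation \<open>\<tau>\<close> P \<subseteq> \<open>\<pi>\<close> R passes to
  products, giving \<open>\<tau>\<close>^n P^n \<subseteq> \<open>\<pi>\<close>^n R. Annihilation by
  the ideal P^n is thereby reduced to annihilation by the single element
  \<open>\<pi>\<close>^n.\<close>

lemma \<tau>_pow_mult:
  "q \<in> ideal_power R P n \<Longrightarrow> \<exists>r\<in>carrier R. \<tau> [^] n \<otimes> q = \<pi> [^] n \<otimes> r"
proof (induction n arbitrary: q)
  case 0
  then show ?case using ideal_power_closed[OF 0] by auto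
next
  case (Suc n)
  have "q \<in> ideal_power R P n \<cdot> P" using Suc.prems unfolding ideal_power_Suc .
  \<comment> \<open>Membership in the carrier is part of the induction over the ideal product
    because the sum case needs it for distributivity.\<close>
  then have "q \<in> carrier R \<and> (\<exists>r\<in>carrier R. \<tau> [^] Suc n \<otimes> q = \<pi> [^] Suc n \<otimes> r)"
  proof (induction q)
    case (prod i j)
    have c: "i \<in> carrier R" "j \<in> carrier R" using prod ideal_power_closed P.Icarr by auto
    obtain r where r: "r \<in> carrier R" "\<tau> [^] n \<otimes> i = \<pi> [^] n \<otimes> r" using Suc.IH prod by blast
    obtain s where s: "s \<in> carrier R" "\<tau> \<otimes> j = \<pi> \<otimes> s" using \<tau>_mult prod by blast
    have "\<tau> [^] Suc n \<otimes> (i \<otimes> j) = (\<tau> [^] n \<otimes> i) \<otimes> (\<tau> \<otimes> j)" using c by (simp add: m_ac)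
    also have "\<dots> = \<pi> [^] Suc n \<otimes> (r \<otimes> s)" unfolding r(2) s(2) using r(1) s(1) by (simp add: m_ac)
    finally show ?case using c r(1) s(1) by blast
  next
    case (sum i j)
    then obtain r s where rs: "r \<in> carrier R" "s \<in> carrier R"
      "\<tau> [^] Suc n \<otimes> i = \<pi> [^] Suc n \<otimes> r" "\<tau> [^] Suc n \<otimes> j = \<pi> [^] Suc n \<otimes> s" by blast
    have "\<tau> [^] Suc n \<otimes> (i \<oplus> j) = \<tau> [^] Suc n \<otimes> i \<oplus> \<tau> [^] Suc n \<otimes> j"
      using sum by (intro r_distr) auto
    also have "\<dots> = \<pi> [^] Suc n \<otimes> (r \<oplus> s)"
      unfolding rs(3,4) using rs(1,2) by (intro r_distr[symmetric]) auto
    finally show ?case using rs(1,2) sum by blast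
  qed
  then show ?case by blast
qed

lemma inverse_mod_P:
  assumes s: "s \<in> carrier R - P"
  obtains u q where "u \<in> carrier R" "q \<in> P" "u \<otimes> s \<oplus> q = \<one>"
proof -
  define J where "J = {x. \<exists>u\<in>carrier R. \<exists>q\<in>P. x = u \<otimes> s \<oplus> q}"
  have sR: "s \<in> carrier R" using s by simp
  have "ideal J R"
  proof (rule ideal_if_lin_comb_closed)
    show "J \<subseteq> carrier R" unfolding J_def using sR P.Icarr by auto
    have "\<zero> = \<zero> \<otimes> s \<oplus> \<zero>" using sR by simp
    then show "\<zero> \<in> J" unfolding J_def using P.zero_closed by blast
    show "x \<oplus> y \<in> J" if xy: "x \<in> J" "y \<in> J" for x y
    proof -
      obtain u q where u: "u \<in> carrier R" "q \<in> P" "x = u \<otimes> s \<oplus> q" using xy unfolding J_def by blast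
      obtain v r where v: "v \<in> carrier R" "r \<in> P" "y = v \<otimes> s \<oplus> r" using xy unfolding J_def by blast
      have "x \<oplus> y = (u \<oplus> v) \<otimes> s \<oplus> (q \<oplus> r)"
        using u v sR P.Icarr by (simp add: l_distr add.m_ac)
      then show ?thesis unfolding J_def using u(1,2) v(1,2) P.a_closed by blast
    qed
    show "a \<otimes> x \<in> J" if a: "a \<in> carrier R" and x: "x \<in> J" for a x
    proof -
      obtain u q where u: "u \<in> carrier R" "q \<in> P" "x = u \<otimes> s \<oplus> q" using x unfolding J_def by blast
      have "a \<otimes> x = (a \<otimes> u) \<otimes> s \<oplus> a \<otimes> q"
        using u a sR P.Icarr by (simp add: r_distr m_assoc)
      then show ?thesis unfolding J_def using u(1,2) a P.I_l_closed by blast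
    qed
  qed
  moreover have "P \<subseteq> J"
  proof
    fix q assume q: "q \<in> P"
    have "q = \<zero> \<otimes> s \<oplus> q" using sR P.Icarr[OF q] by simp
    then show "q \<in> J" unfolding J_def using q by blast
  qed
  moreover have "s \<in> J"
  proof -
    have "s = \<one> \<otimes> s \<oplus> \<zero>" using sR by simp
    then show ?thesis unfolding J_def using P.zero_closed by blast
  qed
  moreover have "J \<subseteq> carrier R" unfolding J_def using sR P.Icarr by auto
  ultimately have "J = carrier R" using maximalideal.I_maximal[OF max_P, of J] s by blast
  then have "\<one> \<in> J" by simp
  then obtain u q where "u \<in> carrier R" "q \<in> P" "\<one> = u \<otimes> s \<oplus> q" unfolding J_def by blast
  then show ?thesis using that[of u q] by simp
qed

text \<open>If 1 = u s + q with q in P^n and 1 = v s + r with r in P, multiplying q by the second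
  equation gives 1 = (u + q v) s + q r with q r in P^(n+1). So elements outside P are units modulo
  every power of P.\<close>

lemma inverse_mod_ideal_power:
  assumes s: "s \<in> carrier R - P"
  shows "\<exists>u\<in>carrier R. \<exists>q\<in>ideal_power R P n. u \<otimes> s \<oplus> q = \<one>"
proof (induction n)
  case 0
  have "\<zero> \<otimes> s \<oplus> \<one> = \<one>" using s by simp
  then show ?case unfolding ideal_power_0 by blast
next
  case (Suc n)
  then obtain u q where u: "u \<in> carrier R" "q \<in> ideal_power R P n" "u \<otimes> s \<oplus> q = \<one>" by blast
  obtain v r where v: "v \<in> carrier R" "r \<in> P" "v \<otimes> s \<oplus> r = \<one>" using inverse_mod_P[OF s] .
  have c: "s \<in> carrier R" "q \<in> carrier R" "r \<in> carrier R"
    using s u v ideal_power_closed P.Icarr by auto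
  have "(u \<oplus> q \<otimes> v) \<otimes> s \<oplus> q \<otimes> r = u \<otimes> s \<oplus> q \<otimes> (v \<otimes> s \<oplus> r)"
    using c u(1) v(1) by (simp add: l_distr r_distr m_assoc a_assoc)
  also have "\<dots> = \<one>" unfolding v(3) using u c by simp
  finally have "(u \<oplus> q \<otimes> v) \<otimes> s \<oplus> q \<otimes> r = \<one>" .
  moreover have "q \<otimes> r \<in> ideal_power R P (Suc n)"
    unfolding ideal_power_Suc using u v by (intro ideal_prod.prod)
  ultimately show ?case using u v c by (metis add.m_closed m_closed)
qed

end

section \<open>The primary component at one prime\<close>

locale module_at_prime = module R M + uniformized_prime R P \<pi> \<tau>
  for R :: "('a, 'c) ring_scheme" (structure) and M :: "('a, 'b, 'e) module_scheme" (structure)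
    and P :: "'a set" and \<pi> :: 'a and \<tau> :: 'a
begin

abbreviation T :: "'b set" where "T \<equiv> primary_component R M P"

lemma T_closed: "x \<in> T \<Longrightarrow> x \<in> carrier M"
  unfolding primary_component_def by simp

lemma submodule_T: "submodule T R M"
proof (rule submoduleI')
  show "T \<subseteq> carrier M" using T_closed by blast
  show "\<zero>\<^bsub>M\<^esub> \<in> T"
    unfolding primary_component_def using ideal_power_closed by auto
  show "x \<oplus>\<^bsub>M\<^esub> y \<in> T" if xy: "x \<in> T" "y \<in> T" for x y
  proof -
    obtain n m where n: "\<forall>a\<in>ideal_power R P n. a \<odot>\<^bsub>M\<^esub> x = \<zero>\<^bsub>M\<^esub>"
      and m: "\<forall>a\<in>ideal_power R P m. a \<odot>\<^bsub>M\<^esub> y = \<zero>\<^bsub>M\<^esub>"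
      using xy unfolding primary_component_def by blast
    have "a \<odot>\<^bsub>M\<^esub> (x \<oplus>\<^bsub>M\<^esub> y) = \<zero>\<^bsub>M\<^esub>" if a: "a \<in> ideal_power R P (n + m)" for a
    proof -
      have "a \<in> ideal_power R P n" "a \<in> ideal_power R P m" "a \<in> carrier R"
        using a ideal_power_antimono[of n "n + m"] ideal_power_antimono[of m "n + m"]
          ideal_power_closed by auto
      then show ?thesis using n m T_closed xy by (simp add: smult_r_distr)
    qed
    then show ?thesis using T_closed[OF xy(1)] T_closed[OF xy(2)]
      unfolding primary_component_def by blast
  qed
  show "b \<odot>\<^bsub>M\<^esub> x \<in> T" if b: "b \<in> carrier R" and x: "x \<in> T" for b x
  proof -
    obtain n where n: "\<forall>a\<in>ideal_power R P n. a \<odot>\<^bsub>M\<^esub> x = \<zero>\<^bsub>M\<^esub>"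
      using x unfolding primary_component_def by blast
    have "a \<odot>\<^bsub>M\<^esub> (b \<odot>\<^bsub>M\<^esub> x) = \<zero>\<^bsub>M\<^esub>" if a: "a \<in> ideal_power R P n" for a
      using n a b T_closed[OF x] smult_swap[OF ideal_power_closed[OF a] b] by simp
    then show ?thesis using T_closed[OF x] b unfolding primary_component_def by blast
  qed
qed

lemma T_\<pi>_pow:
  assumes "x \<in> T" obtains n :: nat where "\<pi> [^] n \<odot>\<^bsub>M\<^esub> x = \<zero>\<^bsub>M\<^esub>"
  using assms pow_in_ideal_power[OF \<pi>_in_P] unfolding primary_component_def by blast

text \<open>The component \<open>T\<close> asks for annihilation by all of P^n, not just by
  \<open>\<pi>\<close>^n. The factor \<open>\<tau>\<close>^n closes the gap because
  \<open>\<tau>\<close>^n P^n \<subseteq> \<open>\<pi>\<close>^n R.\<close>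

lemma \<tau>_pow_in_T:
  fixes n :: nat
  assumes x: "x \<in> carrier M" and "\<pi> [^] n \<odot>\<^bsub>M\<^esub> x = \<zero>\<^bsub>M\<^esub>"
  shows "\<tau> [^] n \<odot>\<^bsub>M\<^esub> x \<in> T"
proof -
  have "a \<odot>\<^bsub>M\<^esub> (\<tau> [^] n \<odot>\<^bsub>M\<^esub> x) = \<zero>\<^bsub>M\<^esub>" if a: "a \<in> ideal_power R P n" for a
  proof -
    note aR = ideal_power_closed[OF a]
    obtain r where r: "r \<in> carrier R" "\<tau> [^] n \<otimes> a = \<pi> [^] n \<otimes> r" using \<tau>_pow_mult[OF a] by blast
    have "a \<odot>\<^bsub>M\<^esub> (\<tau> [^] n \<odot>\<^bsub>M\<^esub> x) = (\<tau> [^] n \<otimes> a) \<odot>\<^bsub>M\<^esub> x"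
      using aR x by (simp add: R.m_comm flip: smult_assoc1)
    also have "\<dots> = r \<odot>\<^bsub>M\<^esub> (\<pi> [^] n \<odot>\<^bsub>M\<^esub> x)"
      unfolding r(2) using r(1) x by (simp add: R.m_comm flip: smult_assoc1)
    finally show ?thesis using assms r by simp
  qed
  then show ?thesis unfolding primary_component_def using x by auto
qed

text \<open>Some P^n kills x, and s is invertible modulo P^n. Thus \<open>T\<close> behaves like a
  module over the local ring at P, and factors outside P can always be removed from its
  elements.\<close>

lemma T_inverse:
  assumes x: "x \<in> T" and s: "s \<in> carrier R - P"
  obtains u where "u \<in> carrier R" "u \<odot>\<^bsub>M\<^esub> (s \<odot>\<^bsub>M\<^esub> x) = x"
proof -
  note xM = T_closed[OF x]
  obtain n where n: "\<forall>a\<in>ideal_power R P n. a \<odot>\<^bsub>M\<^esub> x = \<zero>\<^bsub>M\<^esub>"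
    using x unfolding primary_component_def by blast
  obtain u q where u: "u \<in> carrier R" "q \<in> ideal_power R P n" "u \<otimes> s \<oplus> q = \<one>"
    using inverse_mod_ideal_power[OF s] by blast
  have "x = (u \<otimes> s \<oplus> q) \<odot>\<^bsub>M\<^esub> x" using u xM by simp
  also have "\<dots> = u \<odot>\<^bsub>M\<^esub> (s \<odot>\<^bsub>M\<^esub> x) \<oplus>\<^bsub>M\<^esub> q \<odot>\<^bsub>M\<^esub> x"
    using u(1) ideal_power_closed[OF u(2)] s xM by (simp add: smult_l_distr smult_assoc1)
  also have "\<dots> = u \<odot>\<^bsub>M\<^esub> (s \<odot>\<^bsub>M\<^esub> x)" using n u s xM by simp
  finally show ?thesis using that u by simp
qed

lemma T_mem_if_smult_mem:
  assumes "submodule N R M" "x \<in> T" "s \<in> carrier R - P" "s \<odot>\<^bsub>M\<^esub> x \<in> N"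
  shows "x \<in> N"
proof -
  obtain u where "u \<in> carrier R" "u \<odot>\<^bsub>M\<^esub> (s \<odot>\<^bsub>M\<^esub> x) = x" using T_inverse[OF assms(2,3)] .
  then show ?thesis using submodule_smult[OF assms(1), of u "s \<odot>\<^bsub>M\<^esub> x"] assms(4) by simp
qed

lemma T_smult_eq_zero:
  assumes "x \<in> T" "s \<in> carrier R - P" "s \<odot>\<^bsub>M\<^esub> x = \<zero>\<^bsub>M\<^esub>"
  shows "x = \<zero>\<^bsub>M\<^esub>"
  using T_mem_if_smult_mem[OF zero_submodule assms(1,2)] assms(3) by simp

text \<open>From \<open>\<tau>\<close> a = \<open>\<pi>\<close> r it follows that
  \<open>\<tau>\<close> kills a x, and \<open>\<tau>\<close> acts injectively on \<open>T\<close>.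
  So the socle of \<open>T\<close> can be described by \<open>\<pi>\<close> alone.\<close>

lemma T_P_smult_eq_zero:
  assumes x: "x \<in> T" "\<pi> \<odot>\<^bsub>M\<^esub> x = \<zero>\<^bsub>M\<^esub>" and a: "a \<in> P"
  shows "a \<odot>\<^bsub>M\<^esub> x = \<zero>\<^bsub>M\<^esub>"
proof -
  note xM = T_closed[OF x(1)]
  have aR: "a \<in> carrier R" using a by (rule P.Icarr)
  obtain r where r: "r \<in> carrier R" "\<tau> \<otimes> a = \<pi> \<otimes> r" using \<tau>_mult[OF a] by blast
  have "\<tau> \<odot>\<^bsub>M\<^esub> (a \<odot>\<^bsub>M\<^esub> x) = (\<pi> \<otimes> r) \<odot>\<^bsub>M\<^esub> x" using xM aR by (simp flip: r(2) smult_assoc1)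
  also have "\<dots> = r \<odot>\<^bsub>M\<^esub> (\<pi> \<odot>\<^bsub>M\<^esub> x)" using xM r(1) by (simp add: R.m_comm flip: smult_assoc1)
  finally have "\<tau> \<odot>\<^bsub>M\<^esub> (a \<odot>\<^bsub>M\<^esub> x) = \<zero>\<^bsub>M\<^esub>" using x r by simp
  then show ?thesis
    using T_smult_eq_zero[OF submodule_smult[OF submodule_T aR x(1)], of \<tau>] \<tau>_notin_P by simp
qed

text \<open>Write s c = t \<open>\<pi>\<close>^n with s, t outside P. Then \<open>\<pi>\<close>^n
  kills t x, and a further factor \<open>\<tau>\<close>^n moves t x into \<open>T\<close>.\<close>

lemma torsion_localizes_to_T:
  assumes x: "x \<in> carrier M" and c: "c \<in> carrier R" "c \<noteq> \<zero>" "c \<odot>\<^bsub>M\<^esub> x = \<zero>\<^bsub>M\<^esub>"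
  obtains s where "s \<in> carrier R - P" "s \<odot>\<^bsub>M\<^esub> x \<in> T"
proof -
  obtain s t n where s: "s \<in> carrier R - P" and t: "t \<in> carrier R - P" and eq: "s \<otimes> c = t \<otimes> \<pi> [^] (n::nat)"
    using valuation[OF c(1,2)] by blast
  have tx: "t \<odot>\<^bsub>M\<^esub> x \<in> carrier M" using t x by simp
  have "\<pi> [^] n \<odot>\<^bsub>M\<^esub> (t \<odot>\<^bsub>M\<^esub> x) = (s \<otimes> c) \<odot>\<^bsub>M\<^esub> x"
    unfolding eq using t x by (simp add: R.m_comm flip: smult_assoc1)
  also have "\<dots> = \<zero>\<^bsub>M\<^esub>" using s c x by (simp add: smult_assoc1)
  finally have "\<tau> [^] n \<odot>\<^bsub>M\<^esub> (t \<odot>\<^bsub>M\<^esub> x) \<in> T" by (rule \<tau>_pow_in_T[OF tx])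
  then have "(\<tau> [^] n \<otimes> t) \<odot>\<^bsub>M\<^esub> x \<in> T" using t x by (simp add: smult_assoc1)
  then show ?thesis using that mult_notin_P[OF \<tau>_pow_notin_P t] by blast
qed

text \<open>A power of any element of P outside Q does it: it lies in P^n but not in the prime
  Q.\<close>

lemma T_killed_outside_other_prime:
  assumes x: "x \<in> T" and Q: "primeideal Q R" "\<not> P \<subseteq> Q"
  obtains s where "s \<in> carrier R - Q" "s \<odot>\<^bsub>M\<^esub> x = \<zero>\<^bsub>M\<^esub>"
proof -
  interpret Q: primeideal Q R by (rule Q(1))
  obtain n where n: "\<forall>a\<in>ideal_power R P n. a \<odot>\<^bsub>M\<^esub> x = \<zero>\<^bsub>M\<^esub>"
    using x unfolding primary_component_def by blast
  obtain a where a: "a \<in> P" "a \<notin> Q" using Q(2) by blast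
  have aR: "a \<in> carrier R" using P.Icarr[OF a(1)] .
  have "a [^] k \<notin> Q" for k :: nat
  proof (induction k)
    case 0
    then show ?case using Q.one_imp_carrier Q.I_notcarr by auto
  next
    case (Suc k)
    then show ?case using Q.I_prime[of "a [^] k" a] aR a by auto
  qed
  then show ?thesis using that[of "a [^] n"] n pow_in_ideal_power[OF a(1)] aR by simp
qed

lemma T_nonzero_has_socle:
  assumes A: "submodule A R M" "A \<subseteq> T" and x: "x \<in> A" "x \<noteq> \<zero>\<^bsub>M\<^esub>"
  obtains k where "\<pi> [^] k \<odot>\<^bsub>M\<^esub> x \<in> A" "\<pi> [^] k \<odot>\<^bsub>M\<^esub> x \<noteq> \<zero>\<^bsub>M\<^esub>" "\<pi> [^] Suc k \<odot>\<^bsub>M\<^esub> x = \<zero>\<^bsub>M\<^esub>"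
    "\<pi> \<odot>\<^bsub>M\<^esub> (\<pi> [^] (k::nat) \<odot>\<^bsub>M\<^esub> x) = \<zero>\<^bsub>M\<^esub>"
proof -
  have xT: "x \<in> T" using x A by blast
  note xM = T_closed[OF xT]
  obtain n :: nat where n: "\<pi> [^] n \<odot>\<^bsub>M\<^esub> x = \<zero>\<^bsub>M\<^esub>" using T_\<pi>_pow[OF xT] .
  have n0: "\<not> \<pi> [^] (0::nat) \<odot>\<^bsub>M\<^esub> x = \<zero>\<^bsub>M\<^esub>" using x xM by simp
  obtain k where k: "\<not> \<pi> [^] k \<odot>\<^bsub>M\<^esub> x = \<zero>\<^bsub>M\<^esub>" "\<pi> [^] Suc k \<odot>\<^bsub>M\<^esub> x = \<zero>\<^bsub>M\<^esub>"
  proof -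
    define m where "m = (LEAST m::nat. \<pi> [^] m \<odot>\<^bsub>M\<^esub> x = \<zero>\<^bsub>M\<^esub>)"
    have m: "\<pi> [^] m \<odot>\<^bsub>M\<^esub> x = \<zero>\<^bsub>M\<^esub>" unfolding m_def 
      by (rule LeastI[of "\<lambda>m. \<pi> [^] m \<odot>\<^bsub>M\<^esub> x = \<zero>\<^bsub>M\<^esub>", OF n])
    then obtain k where k: "m = Suc k" using n0 by (cases m) auto
    have "\<not> \<pi> [^] k \<odot>\<^bsub>M\<^esub> x = \<zero>\<^bsub>M\<^esub>" 
      using not_less_Least[of k "\<lambda>m. \<pi> [^] m \<odot>\<^bsub>M\<^esub> x = \<zero>\<^bsub>M\<^esub>"] k unfolding m_def by simp
    then show ?thesis using that[of k] m k by simp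
  qed
  show ?thesis
  proof (rule that[OF _ k])
    show "\<pi> [^] k \<odot>\<^bsub>M\<^esub> x \<in> A" using submodule_smult[OF A(1) _ x(1)] by simp
    show "\<pi> \<odot>\<^bsub>M\<^esub> (\<pi> [^] k \<odot>\<^bsub>M\<^esub> x) = \<zero>\<^bsub>M\<^esub>"
      using k(2) xM by (simp add: R.m_comm flip: smult_assoc1)
  qed
qed

end

lemma mod_hom_primary_component:
  assumes "module R M" "module R N" "h \<in> mod_hom R M N" "x \<in> primary_component R M P"
    "\<And>n. ideal_power R P n \<subseteq> carrier R"
  shows "h x \<in> primary_component R N P"
proof -
  obtain n where x: "x \<in> carrier M" and n: "\<forall>a\<in>ideal_power R P n. a \<odot>\<^bsub>M\<^esub> x = \<zero>\<^bsub>M\<^esub>"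
    using assms(4) unfolding primary_component_def by blast
  have "a \<odot>\<^bsub>N\<^esub> h x = \<zero>\<^bsub>N\<^esub>" if "a \<in> ideal_power R P n" for a
  proof -
    have "a \<in> carrier R" using that assms(5) by blast
    then have "h (a \<odot>\<^bsub>M\<^esub> x) = a \<odot>\<^bsub>N\<^esub> h x" using x by (rule mod_hom_smult[OF assms(3)])
    then show ?thesis using mod_hom_zero[OF assms(1-3)] n that by simp
  qed
  then show ?thesis unfolding primary_component_def using mod_hom_closed[OF assms(3) x] by blast
qed

text \<open>Fields have no non-zero primes, so testing at all such primes would be vacuous over
  them; \<open>dedekind_domain\<close> admits fields, hence the extra assumption.\<close>

locale dedekind_module = module R M + dedekind_ring R
  for R :: "('a, 'c) ring_scheme" (structure) and M :: "('a, 'b, 'e) module_scheme" (structure) +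
  assumes not_field: "\<not> field R"
begin

lemma proper_ideal_subset_nonzero_prime:
  assumes I: "ideal I R" "I \<noteq> carrier R"
  obtains P where "P \<in> nonzero_primes R" "maximalideal P R" "I \<subseteq> P"
proof -
  define S where "S = {J. ideal J R \<and> I \<subseteq> J \<and> J \<noteq> carrier R}"
  have "S \<subseteq> {J. ideal J R}" "S \<noteq> {}" unfolding S_def using I by auto
  then obtain J where J: "J \<in> S" "\<And>J'. J' \<in> S \<Longrightarrow> J \<subseteq> J' \<Longrightarrow> J' = J"
    using exists_maximal_ideal_in by metis
  have max: "maximalideal J R"
  proof (rule maximalidealI)
    show "ideal J R" "carrier R \<noteq> J" using J(1) unfolding S_def by auto
    show "J' = J \<or> J' = carrier R" if "ideal J' R" "J \<subseteq> J'" "J' \<subseteq> carrier R" for J'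
      using J that unfolding S_def by auto
  qed
  have "J \<noteq> {\<zero>}" using max not_field R.zeromaximalideal_eq_field by auto
  then have "J \<in> nonzero_primes R"
    unfolding nonzero_primes_def using R.maximalideal_prime[OF max] by simp
  then show ?thesis using that max J(1) unfolding S_def by blast
qed

text \<open>The ideal of all r with r x in N is contained in no maximal ideal, so it contains 1.
  This replaces the statement that an element vanishing in every localization vanishes.\<close>

lemma local_global:
  assumes N: "submodule N R M" and x: "x \<in> carrier M"
    and loc: "\<And>P. P \<in> nonzero_primes R \<Longrightarrow> \<exists>s\<in>carrier R - P. s \<odot>\<^bsub>M\<^esub> x \<in> N"
  shows "x \<in> N"
proof -
  define I where "I = {r \<in> carrier R. r \<odot>\<^bsub>M\<^esub> x \<in> N}"
  have "ideal I R"
  proof (rule R.ideal_if_lin_comb_closed)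
    show "\<zero> \<in> I" unfolding I_def using submodule_zero[OF N] x by simp
    show "a \<oplus> b \<in> I" if "a \<in> I" "b \<in> I" for a b
      using that submodule_add[OF N] x unfolding I_def by (simp add: smult_l_distr)
    show "a \<otimes> b \<in> I" if "a \<in> carrier R" "b \<in> I" for a b
      using that submodule_smult[OF N] x unfolding I_def by (simp add: smult_assoc1)
  qed (auto simp: I_def)
  have "I = carrier R"
  proof (rule ccontr)
    assume "I \<noteq> carrier R"
    then obtain P where P: "P \<in> nonzero_primes R" "I \<subseteq> P"
      using proper_ideal_subset_nonzero_prime[OF \<open>ideal I R\<close>] by metis
    obtain s where "s \<in> carrier R - P" "s \<odot>\<^bsub>M\<^esub> x \<in> N" using loc[OF P(1)] by blast
    then show False using P(2) unfolding I_def by blast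
  qed
  then have "\<one> \<in> I" by simp
  then show ?thesis unfolding I_def using x by simp
qed

end

section \<open>Relatively injective submodules\<close>

context module
begin

text \<open>Over a Dedekind domain this Baer-type criterion covers the divisible submodules that are
  torsion-free or primary, which are the only injective ones needed.\<close>

definition relatively_injective :: "'c set \<Rightarrow> bool"
  where "relatively_injective A \<longleftrightarrow> submodule A R M \<and>
    (\<forall>I. ideal I R \<and> I \<noteq> {\<zero>} \<longrightarrow> (\<exists>a\<in>I. (\<forall>x\<in>A. \<exists>y\<in>A. x = a \<odot>\<^bsub>M\<^esub> y) \<and>
      (\<forall>r\<in>I. \<exists>s\<in>carrier R. \<exists>w\<in>carrier R. s \<otimes> r = w \<otimes> a \<and>
        (\<forall>x\<in>A. s \<odot>\<^bsub>M\<^esub> x = \<zero>\<^bsub>M\<^esub> \<longrightarrow> x = \<zero>\<^bsub>M\<^esub>))))"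

text \<open>Take X maximal among the submodules that contain Y and meet A trivially. If m were
  outside X + A, m could be moved by an element of A to some m' whose multiples landing in X + A all
  lie in X. Then X + R m' would still meet A trivially, against maximality. The graph of a partial
  map into A is a typical Y.\<close>

lemma relatively_injective_complement:
  assumes A: "relatively_injective A" and Y: "submodule Y R M"
    and YA: "\<And>x. x \<in> Y \<Longrightarrow> x \<in> A \<Longrightarrow> x = \<zero>\<^bsub>M\<^esub>"
  obtains X where "Y \<subseteq> X" "complementary R M X A"
proof -
  have As: "submodule A R M" using A unfolding relatively_injective_def by blast
  note Ac = submodule_subset[OF As]
  have YA': "x \<in> A \<longrightarrow> x = \<zero>\<^bsub>M\<^esub>" if "x \<in> Y" for x using YA[OF that] by blast
  obtain X where X: "submodule X R M" "Y \<subseteq> X" and XA: "\<forall>x\<in>X. x \<in> A \<longrightarrow> x = \<zero>\<^bsub>M\<^esub>"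
    and max: "\<forall>m\<in>carrier M - X. \<exists>x\<in>X. \<exists>r\<in>carrier R. \<not> (x \<oplus>\<^bsub>M\<^esub> r \<odot>\<^bsub>M\<^esub> m \<in> A \<longrightarrow> x \<oplus>\<^bsub>M\<^esub> r \<odot>\<^bsub>M\<^esub> m = \<zero>\<^bsub>M\<^esub>)"
    by (rule exists_maximal_submodule_pointwise[OF Y YA'])
  note Xc = submodule_subset[OF X(1)]
  have sum: "submodule (X <+>\<^bsub>M\<^esub> A) R M" by (rule submodule_set_add[OF X(1) As])
  have "m \<in> X <+>\<^bsub>M\<^esub> A" if m: "m \<in> carrier M" for m
  proof (rule ccontr)
    assume mn: "m \<notin> X <+>\<^bsub>M\<^esub> A"
    define I where "I = {r \<in> carrier R. r \<odot>\<^bsub>M\<^esub> m \<in> X <+>\<^bsub>M\<^esub> A}"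
    have I: "ideal I R"
    proof (rule R.ideal_if_lin_comb_closed)
      show "\<zero> \<in> I" unfolding I_def using submodule_zero[OF sum] m by simp
      show "a \<oplus> b \<in> I" if "a \<in> I" "b \<in> I" for a b
        using that submodule_add[OF sum] m unfolding I_def by (simp add: smult_l_distr)
      show "a \<otimes> b \<in> I" if "a \<in> carrier R" "b \<in> I" for a b
        using that submodule_smult[OF sum] m unfolding I_def by (simp add: smult_assoc1)
    qed (auto simp: I_def)
    have mX: "m \<notin> X" using mn subset_set_add_left[OF X(1) As] by blast
    \<comment> \<open>After a translation by an element of \<open>A\<close>, multiplication by \<open>I\<close> sends \<open>m\<close> into \<open>X\<close>.\<close>
    obtain m' where m': "m' \<in> carrier M" "m \<ominus>\<^bsub>M\<^esub> m' \<in> A" "\<And>r. r \<in> I \<Longrightarrow> r \<odot>\<^bsub>M\<^esub> m' \<in> X"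
    proof (cases "I = {\<zero>}")
      case True
      show ?thesis
      proof (rule that[OF m])
        show "m \<ominus>\<^bsub>M\<^esub> m \<in> A" using m submodule_zero[OF As] by (simp add: M.r_neg a_minus_def)
        show "r \<odot>\<^bsub>M\<^esub> m \<in> X" if "r \<in> I" for r using that True m submodule_zero[OF X(1)] by simp
      qed
    next
      case False
      then obtain a where a: "a \<in> I" and div: "\<forall>x\<in>A. \<exists>y\<in>A. x = a \<odot>\<^bsub>M\<^esub> y"
        and inj: "\<forall>r\<in>I. \<exists>s\<in>carrier R. \<exists>w\<in>carrier R. s \<otimes> r = w \<otimes> a \<and>
          (\<forall>x\<in>A. s \<odot>\<^bsub>M\<^esub> x = \<zero>\<^bsub>M\<^esub> \<longrightarrow> x = \<zero>\<^bsub>M\<^esub>)"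
        using A I unfolding relatively_injective_def by blast
      have aR: "a \<in> carrier R" using a unfolding I_def by blast
      have "a \<odot>\<^bsub>M\<^esub> m \<in> X <+>\<^bsub>M\<^esub> A" using a unfolding I_def by blast
      then obtain x p where xp: "x \<in> X" "p \<in> A" "a \<odot>\<^bsub>M\<^esub> m = x \<oplus>\<^bsub>M\<^esub> p" by (rule set_addE)
      obtain p' where p': "p' \<in> A" "p = a \<odot>\<^bsub>M\<^esub> p'" using div xp(2) by blast
      define m' where "m' = m \<ominus>\<^bsub>M\<^esub> p'"
      have m'c: "m' \<in> carrier M" unfolding m'_def using m Ac p' by simp
      have am': "a \<odot>\<^bsub>M\<^esub> m' = x"
        unfolding m'_def using smult_diff[OF aR m Ac[OF p'(1)]] xp p' Xc Ac aR by simp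
      show ?thesis
      proof (rule that[OF m'c])
        have "m = m' \<oplus>\<^bsub>M\<^esub> p'" unfolding m'_def using m Ac p' by simp
        then show "m \<ominus>\<^bsub>M\<^esub> m' \<in> A" using m'c Ac p' by simp
        show "r \<odot>\<^bsub>M\<^esub> m' \<in> X" if r: "r \<in> I" for r
        proof -
          have rR: "r \<in> carrier R" using r unfolding I_def by blast
          obtain s w where sw: "s \<in> carrier R" "w \<in> carrier R" "s \<otimes> r = w \<otimes> a"
            and sinj: "\<And>x. x \<in> A \<Longrightarrow> s \<odot>\<^bsub>M\<^esub> x = \<zero>\<^bsub>M\<^esub> \<Longrightarrow> x = \<zero>\<^bsub>M\<^esub>" using inj r by blast
          have "r \<odot>\<^bsub>M\<^esub> m \<in> X <+>\<^bsub>M\<^esub> A" using r unfolding I_def by blast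
          then obtain y q where yq: "y \<in> X" "q \<in> A" "r \<odot>\<^bsub>M\<^esub> m = y \<oplus>\<^bsub>M\<^esub> q" by (rule set_addE)
          \<comment> \<open>\<open>z\<close> is the component of r m' in A. From s r = w a one gets
            s (r m') = w (a m') = w x in X, so s z lies in both X and A and vanishes; since s is
            injective on A, z is zero.\<close>
          define z where "z = q \<ominus>\<^bsub>M\<^esub> r \<odot>\<^bsub>M\<^esub> p'"
          have zA: "z \<in> A" unfolding z_def
            using submodule_diff[OF As yq(2)] submodule_smult[OF As rR p'(1)] by blast
          have "r \<odot>\<^bsub>M\<^esub> m' = (y \<oplus>\<^bsub>M\<^esub> q) \<ominus>\<^bsub>M\<^esub> r \<odot>\<^bsub>M\<^esub> p'"
            unfolding m'_def using smult_diff[OF rR m Ac[OF p'(1)]] yq by simp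
          also have "\<dots> = y \<oplus>\<^bsub>M\<^esub> z"
            unfolding z_def using yq Xc Ac p' rR by (simp add: a_minus_def M.a_assoc)
          finally have rm': "r \<odot>\<^bsub>M\<^esub> m' = y \<oplus>\<^bsub>M\<^esub> z" .
          have "s \<odot>\<^bsub>M\<^esub> (r \<odot>\<^bsub>M\<^esub> m') = w \<odot>\<^bsub>M\<^esub> x"
            using sw rR aR m'c by (simp flip: smult_assoc1 am')
          then have "s \<odot>\<^bsub>M\<^esub> y \<oplus>\<^bsub>M\<^esub> s \<odot>\<^bsub>M\<^esub> z = w \<odot>\<^bsub>M\<^esub> x"
            unfolding rm' using sw yq Xc zA Ac by (simp add: smult_r_distr)
          then have "s \<odot>\<^bsub>M\<^esub> z \<in> X"
            using submodule_add_cancel[OF X(1) submodule_smult[OF X(1) sw(1) yq(1)]]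
              submodule_smult[OF X(1) sw(2) xp(1)] sw zA Ac by simp
          then have "s \<odot>\<^bsub>M\<^esub> z = \<zero>\<^bsub>M\<^esub>" using XA submodule_smult[OF As sw(1) zA] by blast
          then have "z = \<zero>\<^bsub>M\<^esub>" using sinj zA by blast
          then show ?thesis using rm' yq Xc by simp
        qed
      qed
    qed
    have mm': "m = m' \<oplus>\<^bsub>M\<^esub> (m \<ominus>\<^bsub>M\<^esub> m')" using m m'(1) by simp
    have "m' \<notin> X" using mn set_addI[of m' X "m \<ominus>\<^bsub>M\<^esub> m'" A] m'(2) mm' by auto
    then obtain x r where xr: "x \<in> X" "r \<in> carrier R" "x \<oplus>\<^bsub>M\<^esub> r \<odot>\<^bsub>M\<^esub> m' \<in> A"
      "x \<oplus>\<^bsub>M\<^esub> r \<odot>\<^bsub>M\<^esub> m' \<noteq> \<zero>\<^bsub>M\<^esub>" using max m'(1) by blast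
    define p where "p = x \<oplus>\<^bsub>M\<^esub> r \<odot>\<^bsub>M\<^esub> m'"
    have "r \<odot>\<^bsub>M\<^esub> m' = p \<ominus>\<^bsub>M\<^esub> x" unfolding p_def using xr Xc m' by simp
    have "r \<odot>\<^bsub>M\<^esub> m = r \<odot>\<^bsub>M\<^esub> m' \<oplus>\<^bsub>M\<^esub> r \<odot>\<^bsub>M\<^esub> (m \<ominus>\<^bsub>M\<^esub> m')"
      using smult_r_distr[of r m' "m \<ominus>\<^bsub>M\<^esub> m'"] m m'(1) xr(2) by simp
    moreover have "r \<odot>\<^bsub>M\<^esub> m' \<in> X <+>\<^bsub>M\<^esub> A"
      unfolding \<open>r \<odot>\<^bsub>M\<^esub> m' = p \<ominus>\<^bsub>M\<^esub> x\<close>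
      using submodule_diff[OF sum, of p x] subset_set_add_left[OF X(1) As]
        subset_set_add_right[OF X(1) As] xr p_def by blast
    moreover have "r \<odot>\<^bsub>M\<^esub> (m \<ominus>\<^bsub>M\<^esub> m') \<in> X <+>\<^bsub>M\<^esub> A"
      using submodule_smult[OF As xr(2) m'(2)] subset_set_add_right[OF X(1) As] by blast
    ultimately have "r \<in> I" unfolding I_def using submodule_add[OF sum] xr(2) by simp
    then have "r \<odot>\<^bsub>M\<^esub> m' \<in> X" by (rule m'(3))
    then have "x \<oplus>\<^bsub>M\<^esub> r \<odot>\<^bsub>M\<^esub> m' \<in> X" using submodule_add[OF X(1) xr(1)] by blast
    then show False using XA xr(3,4) by blast
  qed
  then have "complementary R M X A"
    by (intro complementaryI X(1) As) (use XA in \<open>auto simp: mem_set_add\<close>)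
  then show ?thesis using that X(2) by blast
qed

end

text \<open>Choose a in I of least valuation n at P. Up to factors outside P, which act bijectively
  on \<open>T\<close>, multiplication by a is multiplication by \<open>\<pi>\<close>^n, which is
  onto A. Any r in I has valuation at least n and is, up to such a factor, a multiple of a.\<close>

lemma (in module_at_prime) primary_divisible_relatively_injective:
  assumes A: "submodule A R M" "A \<subseteq> T" and div: "\<And>x. x \<in> A \<Longrightarrow> \<exists>y\<in>A. x = \<pi> \<odot>\<^bsub>M\<^esub> y"
  shows "relatively_injective A"
  unfolding relatively_injective_def
proof (intro conjI allI impI)
  fix I assume "ideal I R \<and> I \<noteq> {\<zero>}"
  then have I: "ideal I R" "I \<noteq> {\<zero>}" by auto
  note Ac = submodule_subset[OF A(1)]
  have divn: "\<exists>y\<in>A. x = \<pi> [^] n \<odot>\<^bsub>M\<^esub> y" if "x \<in> A" for x and n :: nat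
    using that
  proof (induction n arbitrary: x)
    case 0
    then show ?case using Ac by auto
  next
    case (Suc n)
    then obtain y z where "y \<in> A" "x = \<pi> [^] n \<odot>\<^bsub>M\<^esub> y" "z \<in> A" "y = \<pi> \<odot>\<^bsub>M\<^esub> z" using div by metis
    then have "x = \<pi> [^] Suc n \<odot>\<^bsub>M\<^esub> z" using Ac by (simp add: smult_assoc1)
    then show ?case using \<open>z \<in> A\<close> by blast
  qed
  \<comment> \<open>\<open>V n\<close> says that some element of I has valuation exactly n at
    P.\<close>
  define V where "V n \<longleftrightarrow> (\<exists>r\<in>I. \<exists>s\<in>carrier R - P. \<exists>t\<in>carrier R - P. s \<otimes> r = t \<otimes> \<pi> [^] n)" for n :: nat
  have IR: "r \<in> carrier R" if "r \<in> I" for r using ideal.Icarr[OF I(1) that] .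
  obtain r0 where r0: "r0 \<in> I" "r0 \<noteq> \<zero>"
    using I additive_subgroup.zero_closed[OF ideal.axioms(1)[OF I(1)]] by blast
  obtain n0 where n0: "V n0" unfolding V_def using valuation[OF IR[OF r0(1)] r0(2)] r0(1) by blast
  define n where "n = (LEAST n. V n)"
  have "V n" unfolding n_def by (rule LeastI[of V, OF n0])
  then obtain a s t where a: "a \<in> I" and s: "s \<in> carrier R - P" and t: "t \<in> carrier R - P"
    and eq: "s \<otimes> a = t \<otimes> \<pi> [^] n" unfolding V_def by blast
  have aR: "a \<in> carrier R" using IR[OF a] .
  show "\<exists>a\<in>I. (\<forall>x\<in>A. \<exists>y\<in>A. x = a \<odot>\<^bsub>M\<^esub> y) \<and> (\<forall>r\<in>I. \<exists>s\<in>carrier R. \<exists>w\<in>carrier R.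
      s \<otimes> r = w \<otimes> a \<and> (\<forall>x\<in>A. s \<odot>\<^bsub>M\<^esub> x = \<zero>\<^bsub>M\<^esub> \<longrightarrow> x = \<zero>\<^bsub>M\<^esub>))"
  proof (intro bexI[OF _ a] conjI ballI)
    fix x assume x: "x \<in> A"
    obtain y where y: "y \<in> A" "x = \<pi> [^] n \<odot>\<^bsub>M\<^esub> y" using divn[OF x] by blast
    obtain u where u: "u \<in> carrier R" "u \<odot>\<^bsub>M\<^esub> (t \<odot>\<^bsub>M\<^esub> y) = y"
      using T_inverse[OF _ t, of y] y A(2) by blast
    have "a \<odot>\<^bsub>M\<^esub> (u \<odot>\<^bsub>M\<^esub> (s \<odot>\<^bsub>M\<^esub> y)) = u \<odot>\<^bsub>M\<^esub> ((s \<otimes> a) \<odot>\<^bsub>M\<^esub> y)"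
      using aR u(1) s Ac[OF y(1)] by (simp add: m_ac flip: smult_assoc1)
    also have "\<dots> = \<pi> [^] n \<odot>\<^bsub>M\<^esub> (u \<odot>\<^bsub>M\<^esub> (t \<odot>\<^bsub>M\<^esub> y))"
      unfolding eq using aR u(1) t Ac[OF y(1)] by (simp add: m_ac flip: smult_assoc1)
    finally have "x = a \<odot>\<^bsub>M\<^esub> (u \<odot>\<^bsub>M\<^esub> (s \<odot>\<^bsub>M\<^esub> y))" using u y by simp
    moreover have "u \<odot>\<^bsub>M\<^esub> (s \<odot>\<^bsub>M\<^esub> y) \<in> A" using submodule_smult[OF A(1)] u(1) s y(1) by simp
    ultimately show "\<exists>y\<in>A. x = a \<odot>\<^bsub>M\<^esub> y" by blast
  next
    fix r assume r: "r \<in> I"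
    show "\<exists>s\<in>carrier R. \<exists>w\<in>carrier R. s \<otimes> r = w \<otimes> a \<and> (\<forall>x\<in>A. s \<odot>\<^bsub>M\<^esub> x = \<zero>\<^bsub>M\<^esub> \<longrightarrow> x = \<zero>\<^bsub>M\<^esub>)"
    proof (cases "r = \<zero>")
      case True
      have "\<one> \<otimes> r = \<zero> \<otimes> a" using True aR by simp
      moreover have "\<forall>x\<in>A. \<one> \<odot>\<^bsub>M\<^esub> x = \<zero>\<^bsub>M\<^esub> \<longrightarrow> x = \<zero>\<^bsub>M\<^esub>" using Ac by simp
      ultimately show ?thesis by blast
    next
      case False
      obtain s' t' m where s': "s' \<in> carrier R - P" and t': "t' \<in> carrier R - P"
        and eq': "s' \<otimes> r = t' \<otimes> \<pi> [^] (m::nat)" using valuation[OF IR[OF r] False] by blast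
      then have "V m" unfolding V_def using r by blast
      then have nm: "n \<le> m" unfolding n_def by (rule Least_le)
      have \<pi>m: "\<pi> [^] m = \<pi> [^] (m - n) \<otimes> \<pi> [^] n" using nm by (simp add: nat_pow_mult)
      have "(t \<otimes> s') \<otimes> r = t \<otimes> (s' \<otimes> r)" using t s' IR[OF r] by (simp add: m_assoc)
      also have "\<dots> = (t' \<otimes> \<pi> [^] (m - n)) \<otimes> (t \<otimes> \<pi> [^] n)"
        unfolding eq' \<pi>m using t t' by (simp add: m_ac)
      also have "\<dots> = (t' \<otimes> \<pi> [^] (m - n) \<otimes> s) \<otimes> a"
        unfolding eq[symmetric] using t' s aR by (simp add: m_assoc)
      finally have "(t \<otimes> s') \<otimes> r = (t' \<otimes> \<pi> [^] (m - n) \<otimes> s) \<otimes> a" .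
      moreover have "\<forall>x\<in>A. (t \<otimes> s') \<odot>\<^bsub>M\<^esub> x = \<zero>\<^bsub>M\<^esub> \<longrightarrow> x = \<zero>\<^bsub>M\<^esub>"
        using T_smult_eq_zero[OF _ mult_notin_P[OF t s']] A(2) by blast
      moreover have "t \<otimes> s' \<in> carrier R" "t' \<otimes> \<pi> [^] (m - n) \<otimes> s \<in> carrier R" using t s' t' s by auto
      ultimately show ?thesis by blast
    qed
  qed
qed (rule A(1))

text \<open>Any non-zero a in I serves: take s = a and w = r in a r = r a, and a is injective on A
  by torsion-freeness.\<close>

lemma (in module) torsion_free_divisible_relatively_injective:
  assumes A: "submodule A R M"
    and free: "\<And>r x. r \<in> carrier R \<Longrightarrow> r \<noteq> \<zero> \<Longrightarrow> x \<in> A \<Longrightarrow> r \<odot>\<^bsub>M\<^esub> x = \<zero>\<^bsub>M\<^esub> \<Longrightarrow> x = \<zero>\<^bsub>M\<^esub>"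
    and div: "\<And>r x. r \<in> carrier R \<Longrightarrow> r \<noteq> \<zero> \<Longrightarrow> x \<in> A \<Longrightarrow> \<exists>y\<in>A. x = r \<odot>\<^bsub>M\<^esub> y"
  shows "relatively_injective A"
  unfolding relatively_injective_def
proof (intro conjI allI impI)
  fix I assume "ideal I R \<and> I \<noteq> {\<zero>}"
  then have I: "ideal I R" "I \<noteq> {\<zero>}" by auto
  have IR: "r \<in> carrier R" if "r \<in> I" for r using ideal.Icarr[OF I(1) that] .
  obtain a where a: "a \<in> I" "a \<noteq> \<zero>"
    using I additive_subgroup.zero_closed[OF ideal.axioms(1)[OF I(1)]] by blast
  show "\<exists>a\<in>I. (\<forall>x\<in>A. \<exists>y\<in>A. x = a \<odot>\<^bsub>M\<^esub> y) \<and> (\<forall>r\<in>I. \<exists>s\<in>carrier R. \<exists>w\<in>carrier R.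
      s \<otimes> r = w \<otimes> a \<and> (\<forall>x\<in>A. s \<odot>\<^bsub>M\<^esub> x = \<zero>\<^bsub>M\<^esub> \<longrightarrow> x = \<zero>\<^bsub>M\<^esub>))"
  proof (intro bexI[OF _ a(1)] conjI ballI)
    show "\<exists>y\<in>A. x = a \<odot>\<^bsub>M\<^esub> y" if "x \<in> A" for x using div[OF IR[OF a(1)] a(2) that] .
    show "\<exists>s\<in>carrier R. \<exists>w\<in>carrier R. s \<otimes> r = w \<otimes> a \<and> (\<forall>x\<in>A. s \<odot>\<^bsub>M\<^esub> x = \<zero>\<^bsub>M\<^esub> \<longrightarrow> x = \<zero>\<^bsub>M\<^esub>)"
      if r: "r \<in> I" for r
      using R.m_comm[OF IR[OF a(1)] IR[OF r]] IR[OF a(1)] IR[OF r] free[OF IR[OF a(1)] a(2)] by blast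
  qed
qed (rule A)

section \<open>Dual strongly self-CS-Baer modules\<close>

context module
begin

definition torsion_part :: "'c set"
  where "torsion_part = {x \<in> carrier M. \<exists>r\<in>carrier R. r \<noteq> \<zero> \<and> r \<odot>\<^bsub>M\<^esub> x = \<zero>\<^bsub>M\<^esub>}"

text \<open>The intrinsic form of N being isomorphic to R/I; the generator y corresponds to the
  class of 1. For I = P^0 = R it describes the zero module.\<close>

definition cyclic_with_annihilator :: "'c set \<Rightarrow> 'a set \<Rightarrow> bool"
  where "cyclic_with_annihilator N I \<longleftrightarrow> (\<exists>y\<in>carrier M. N = cyclic_submodule y \<and>
    (\<forall>a\<in>carrier R. a \<odot>\<^bsub>M\<^esub> y = \<zero>\<^bsub>M\<^esub> \<longleftrightarrow> a \<in> I))"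

text \<open>The intrinsic form of L being isomorphic to the quotient field: non-zero, torsion-free,
  divisible, and any element is linearly dependent on any non-zero one.\<close>

definition rank_one_divisible :: "'c set \<Rightarrow> bool"
  where "rank_one_divisible L \<longleftrightarrow> L \<noteq> {\<zero>\<^bsub>M\<^esub>} \<and>
    (\<forall>r\<in>carrier R - {\<zero>}. \<forall>x\<in>L. r \<odot>\<^bsub>M\<^esub> x = \<zero>\<^bsub>M\<^esub> \<longrightarrow> x = \<zero>\<^bsub>M\<^esub>) \<and>
    (\<forall>r\<in>carrier R - {\<zero>}. \<forall>x\<in>L. \<exists>y\<in>L. x = r \<odot>\<^bsub>M\<^esub> y) \<and>
    (\<forall>x\<in>L. \<forall>b\<in>L - {\<zero>\<^bsub>M\<^esub>}. \<exists>a\<in>carrier R - {\<zero>}. \<exists>r\<in>carrier R. a \<odot>\<^bsub>M\<^esub> x = r \<odot>\<^bsub>M\<^esub> b)"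

text \<open>For a P-primary N and a uniformizer \<open>\<pi>\<close> at P this characterizes the
  Pruefer module: divisible by \<open>\<pi>\<close>, with a simple socle. Divisibility by other
  elements is not asked for, since elements outside P act bijectively anyway.\<close>

definition pruefer_like :: "'a \<Rightarrow> 'c set \<Rightarrow> bool"
  where "pruefer_like \<pi> N \<longleftrightarrow> N \<noteq> {\<zero>\<^bsub>M\<^esub>} \<and> (\<forall>x\<in>N. \<exists>y\<in>N. x = \<pi> \<odot>\<^bsub>M\<^esub> y) \<and>
    (\<forall>x\<in>N. \<forall>x'\<in>N. \<pi> \<odot>\<^bsub>M\<^esub> x = \<zero>\<^bsub>M\<^esub> \<and> \<pi> \<odot>\<^bsub>M\<^esub> x' = \<zero>\<^bsub>M\<^esub> \<and> x \<noteq> \<zero>\<^bsub>M\<^esub> \<longrightarrow>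
      x' \<in> cyclic_submodule x)"

lemma submodule_sum_images:
  assumes "F \<subseteq> mod_hom R M M"
  shows "submodule (submodule_sum R M F (\<lambda>f. f ` carrier M)) R M"
proof (rule submodule_submodule_sum)
  fix f assume "f \<in> F"
  then have f: "f \<in> mod_hom R M M" using assms by blast
  show "f ` carrier M \<subseteq> carrier M" by (rule image_subsetI) (rule mod_hom_closed[OF f])
qed

lemma dual_strongly_self_CS_BaerE:
  assumes "dual_strongly_self_CS_Baer R M" and F: "F \<subseteq> mod_hom R M M"
  obtains D E where "D \<subseteq> submodule_sum R M F (\<lambda>f. f ` carrier M)" "complementary R M D E"
    "\<forall>h\<in>mod_hom R M M. h ` D \<subseteq> D"
    "\<forall>X. submodule X R M \<and> D \<subseteq> X \<and>
      submodule_sum R M F (\<lambda>f. f ` carrier M) <+>\<^bsub>M\<^esub> X = carrier M \<longrightarrow> X = carrier M"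
proof -
  obtain D where D: "fully_invariant R M D" "lies_above R M (submodule_sum R M F (\<lambda>f. f ` carrier M)) D"
    using assms unfolding dual_strongly_self_CS_Baer_def by blast
  note D' = D(2)[unfolded lies_above_iff[OF submodule_sum_images[OF F]]]
  obtain E where "complementary R M D E" using D' unfolding direct_summand_def by blast
  then show ?thesis using that[of D E] D' D(1) unfolding fully_invariant_def by blast
qed

lemma dual_strongly_self_CS_BaerI:
  assumes "\<And>F. F \<subseteq> mod_hom R M M \<Longrightarrow> \<exists>D E. D \<subseteq> submodule_sum R M F (\<lambda>f. f ` carrier M) \<and>
    complementary R M D E \<and> (\<forall>h\<in>mod_hom R M M. h ` D \<subseteq> D) \<and>
    (\<forall>X. submodule X R M \<and> D \<subseteq> X \<and>
      submodule_sum R M F (\<lambda>f. f ` carrier M) <+>\<^bsub>M\<^esub> X = carrier M \<longrightarrow> X = carrier M)"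
  shows "dual_strongly_self_CS_Baer R M"
  unfolding dual_strongly_self_CS_Baer_def
proof (intro allI impI)
  fix F assume F: "F \<subseteq> mod_hom R M M"
  obtain D E where D: "D \<subseteq> submodule_sum R M F (\<lambda>f. f ` carrier M)" "complementary R M D E"
    "\<forall>h\<in>mod_hom R M M. h ` D \<subseteq> D"
    "\<forall>X. submodule X R M \<and> D \<subseteq> X \<and>
      submodule_sum R M F (\<lambda>f. f ` carrier M) <+>\<^bsub>M\<^esub> X = carrier M \<longrightarrow> X = carrier M"
    using assms[OF F] by (elim exE conjE)
  have "fully_invariant R M D"
    unfolding fully_invariant_def using D(3) complementaryE(1)[OF D(2)] by blast
  moreover have "lies_above R M (submodule_sum R M F (\<lambda>f. f ` carrier M)) D"
    unfolding lies_above_iff[OF submodule_sum_images[OF F]] direct_summand_def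
    using D(1,2,4) by (intro conjI) auto
  ultimately show "\<exists>D. fully_invariant R M D \<and>
      lies_above R M (submodule_sum R M F (\<lambda>f. f ` carrier M)) D" by blast
qed

text \<open>The endomorphism is the projection onto the cyclic summand followed by a y \<mapsto> a
  u, which is well defined by the condition on annihilators.\<close>

lemma cyclic_summand_hom:
  assumes c: "complementary R M (cyclic_submodule y) C" and y: "y \<in> carrier M" and u: "u \<in> carrier M"
    and ann: "\<And>a. a \<in> carrier R \<Longrightarrow> a \<odot>\<^bsub>M\<^esub> y = \<zero>\<^bsub>M\<^esub> \<Longrightarrow> a \<odot>\<^bsub>M\<^esub> u = \<zero>\<^bsub>M\<^esub>"
  obtains h where "h \<in> mod_hom R M M" "h y = u"
proof -
  obtain f where f: "f \<in> mod_hom R M M" "\<forall>x\<in>cyclic_submodule y. f x = x"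
    "\<forall>x\<in>C. f x = \<zero>\<^bsub>M\<^esub>" "\<forall>x\<in>carrier M. f x \<in> cyclic_submodule y" "\<forall>x\<in>carrier M. x \<ominus>\<^bsub>M\<^esub> f x \<in> C"
    by (rule complementary_projection[OF c])
  have "\<forall>x\<in>carrier M. \<exists>a. a \<in> carrier R \<and> f x = a \<odot>\<^bsub>M\<^esub> y"
    using f(4) unfolding cyclic_submodule_def by blast
  from bchoice[OF this] obtain \<alpha>
    where "\<forall>x\<in>carrier M. \<alpha> x \<in> carrier R \<and> f x = \<alpha> x \<odot>\<^bsub>M\<^esub> y" by (elim exE)
  then have \<alpha>: "\<alpha> x \<in> carrier R \<and> f x = \<alpha> x \<odot>\<^bsub>M\<^esub> y" if "x \<in> carrier M" for x
    using that by (rule bspec)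
  \<comment> \<open>The coefficient function \<alpha> is merely chosen and need not be additive;
    \<open>eqI\<close> lets every law for \<alpha> x u be checked on \<alpha> x y instead.\<close>
  have eqI: "a \<odot>\<^bsub>M\<^esub> u = b \<odot>\<^bsub>M\<^esub> u"
    if "a \<in> carrier R" "b \<in> carrier R" "a \<odot>\<^bsub>M\<^esub> y = b \<odot>\<^bsub>M\<^esub> y" for a b
  proof -
    have "(a \<ominus> b) \<odot>\<^bsub>M\<^esub> y = \<zero>\<^bsub>M\<^esub>" using that y by (simp add: smult_diff_left diff_eq_zero_iff)
    then have "(a \<ominus> b) \<odot>\<^bsub>M\<^esub> u = \<zero>\<^bsub>M\<^esub>" using ann[of "a \<ominus> b"] that by simp
    then show ?thesis using that u by (simp add: smult_diff_left diff_eq_zero_iff)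
  qed
  have "(\<lambda>x. \<alpha> x \<odot>\<^bsub>M\<^esub> u) \<in> mod_hom R M M"
  proof (rule mod_homI)
    show "\<alpha> x \<odot>\<^bsub>M\<^esub> u \<in> carrier M" if "x \<in> carrier M" for x using \<alpha>[OF that] u by simp
    show "\<alpha> (x \<oplus>\<^bsub>M\<^esub> z) \<odot>\<^bsub>M\<^esub> u = \<alpha> x \<odot>\<^bsub>M\<^esub> u \<oplus>\<^bsub>M\<^esub> \<alpha> z \<odot>\<^bsub>M\<^esub> u"
      if xz: "x \<in> carrier M" "z \<in> carrier M" for x z
    proof -
      have "\<alpha> (x \<oplus>\<^bsub>M\<^esub> z) \<odot>\<^bsub>M\<^esub> u = (\<alpha> x \<oplus> \<alpha> z) \<odot>\<^bsub>M\<^esub> u"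
      proof (rule eqI)
        have "\<alpha> (x \<oplus>\<^bsub>M\<^esub> z) \<odot>\<^bsub>M\<^esub> y = f (x \<oplus>\<^bsub>M\<^esub> z)" using \<alpha> xz by simp
        also have "\<dots> = \<alpha> x \<odot>\<^bsub>M\<^esub> y \<oplus>\<^bsub>M\<^esub> \<alpha> z \<odot>\<^bsub>M\<^esub> y" using mod_hom_add[OF f(1) xz] \<alpha> xz by simp
        finally show "\<alpha> (x \<oplus>\<^bsub>M\<^esub> z) \<odot>\<^bsub>M\<^esub> y = (\<alpha> x \<oplus> \<alpha> z) \<odot>\<^bsub>M\<^esub> y" using \<alpha> xz y by (simp add: smult_l_distr)
      qed (use \<alpha> xz in auto)
      then show ?thesis using \<alpha> xz u by (simp add: smult_l_distr)
    qed
    show "\<alpha> (a \<odot>\<^bsub>M\<^esub> x) \<odot>\<^bsub>M\<^esub> u = a \<odot>\<^bsub>M\<^esub> (\<alpha> x \<odot>\<^bsub>M\<^esub> u)"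
      if ax: "a \<in> carrier R" "x \<in> carrier M" for a x
    proof -
      have "\<alpha> (a \<odot>\<^bsub>M\<^esub> x) \<odot>\<^bsub>M\<^esub> u = (a \<otimes> \<alpha> x) \<odot>\<^bsub>M\<^esub> u"
      proof (rule eqI)
        have "\<alpha> (a \<odot>\<^bsub>M\<^esub> x) \<odot>\<^bsub>M\<^esub> y = f (a \<odot>\<^bsub>M\<^esub> x)" using \<alpha> ax by simp
        also have "\<dots> = a \<odot>\<^bsub>M\<^esub> (\<alpha> x \<odot>\<^bsub>M\<^esub> y)" using mod_hom_smult[OF f(1) ax] \<alpha> ax by simp
        finally show "\<alpha> (a \<odot>\<^bsub>M\<^esub> x) \<odot>\<^bsub>M\<^esub> y = (a \<otimes> \<alpha> x) \<odot>\<^bsub>M\<^esub> y" using \<alpha> ax y by (simp add: smult_assoc1)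
      qed (use \<alpha> ax in auto)
      then show ?thesis using \<alpha> ax u by (simp add: smult_assoc1)
    qed
  qed
  moreover have "\<alpha> y \<odot>\<^bsub>M\<^esub> u = u"
  proof -
    have "\<alpha> y \<odot>\<^bsub>M\<^esub> y = \<one> \<odot>\<^bsub>M\<^esub> y" using \<alpha>[OF y] f(2) generator_in_cyclic_submodule[OF y] y by simp
    then show ?thesis using eqI[of "\<alpha> y" \<one>] \<alpha>[OF y] u by simp
  qed
  ultimately show ?thesis using that by blast
qed

end

text \<open>Since s is invertible modulo P^n, it can be cancelled from s a in P^n.\<close>

lemma (in uniformized_prime) mem_ideal_power_if_valuation_ge:
  assumes "a \<in> carrier R" "s \<in> carrier R - P" "t \<in> carrier R" "s \<otimes> a = t \<otimes> \<pi> [^] (i::nat)" "n \<le> i"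
  shows "a \<in> ideal_power R P n"
proof -
  interpret I: ideal "ideal_power R P n" R by (rule ideal_ideal_power)
  obtain u q where u: "u \<in> carrier R" "q \<in> ideal_power R P n" "u \<otimes> s \<oplus> q = \<one>"
    using inverse_mod_ideal_power[OF assms(2)] by blast
  have "\<pi> [^] i \<in> ideal_power R P n"
    using pow_in_ideal_power[OF \<pi>_in_P] ideal_power_antimono[OF assms(5)] by blast
  then have "s \<otimes> a \<in> ideal_power R P n" unfolding assms(4) using assms(3) by (rule I.I_l_closed)
  then have "u \<otimes> (s \<otimes> a) \<oplus> q \<otimes> a \<in> ideal_power R P n"
    using u(1,2) assms(1) I.I_l_closed I.I_r_closed I.a_closed by blast
  moreover have "u \<otimes> (s \<otimes> a) \<oplus> q \<otimes> a = (u \<otimes> s \<oplus> q) \<otimes> a"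
    using assms(1,2) u(1) I.Icarr[OF u(2)] by (simp add: l_distr m_assoc)
  ultimately show ?thesis unfolding u(3) using assms(1) by simp
qed

section \<open>Rigidity of direct summands\<close>

locale dedekind_baer_module = dedekind_module R M
  for R :: "('a, 'c) ring_scheme" (structure) and M :: "('a, 'b, 'e) module_scheme" (structure) +
  assumes baer: "dual_strongly_self_CS_Baer R M"
begin

lemma summand_invariant:
  assumes c: "complementary R M A B" and h: "h \<in> mod_hom R M M" and x: "x \<in> A"
  shows "h x \<in> A"
proof -
  note cE = complementaryE[OF c]
  obtain f where f: "f \<in> mod_hom R M M" "\<forall>x\<in>A. f x = x" "\<forall>x\<in>B. f x = \<zero>\<^bsub>M\<^esub>"
    "\<forall>x\<in>carrier M. f x \<in> A" "\<forall>x\<in>carrier M. x \<ominus>\<^bsub>M\<^esub> f x \<in> B"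
    by (rule complementary_projection[OF c])
  define N where "N = submodule_sum R M {f} (\<lambda>f. f ` carrier M)"
  have F: "{f} \<subseteq> mod_hom R M M" using f by simp
  obtain D E where D: "D \<subseteq> N" "complementary R M D E" "\<forall>h\<in>mod_hom R M M. h ` D \<subseteq> D"
    "\<forall>X. submodule X R M \<and> D \<subseteq> X \<and> N <+>\<^bsub>M\<^esub> X = carrier M \<longrightarrow> X = carrier M"
    by (rule dual_strongly_self_CS_BaerE[OF baer F, folded N_def])
  have NA: "N = A"
  proof
    show "N \<subseteq> A" unfolding N_def using f(4) by (intro submodule_sum_least[OF cE(1)]) auto
    have "f ` carrier M \<subseteq> N" unfolding N_def
      using submodule_sum_upper[of f "{f}" "\<lambda>f. f ` carrier M"] by simp
    then show "A \<subseteq> N" using f(2) submodule_subset[OF cE(1)] by force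
  qed
  have Ds: "submodule D R M" using complementaryE(1)[OF D(2)] .
  \<comment> \<open>Here \<open>N\<close> = A. The submodule B + D contains D and together with A
    spans M, so it is M. As D \<subseteq> A and A meets B trivially, this forces A = D.\<close>
  have BD: "submodule (B <+>\<^bsub>M\<^esub> D) R M" by (rule submodule_set_add[OF cE(2) Ds])
  have "carrier M \<subseteq> N <+>\<^bsub>M\<^esub> (B <+>\<^bsub>M\<^esub> D)"
  proof
    fix m assume "m \<in> carrier M"
    then obtain a b where ab: "a \<in> A" "b \<in> B" "m = a \<oplus>\<^bsub>M\<^esub> b" using cE(4) by blast
    have "b \<in> B <+>\<^bsub>M\<^esub> D" using subset_set_add_left[OF cE(2) Ds] ab by blast
    then show "m \<in> N <+>\<^bsub>M\<^esub> (B <+>\<^bsub>M\<^esub> D)" unfolding NA ab(3) by (rule set_addI[OF ab(1)])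
  qed
  then have "N <+>\<^bsub>M\<^esub> (B <+>\<^bsub>M\<^esub> D) = carrier M"
    using submodule_subset[OF submodule_set_add[OF _ BD]] cE(1) NA by blast
  then have all: "B <+>\<^bsub>M\<^esub> D = carrier M"
    using D(4) BD subset_set_add_right[OF cE(2) Ds] by blast
  have "x \<in> B <+>\<^bsub>M\<^esub> D" unfolding all using submodule_subset[OF cE(1) x] .
  then obtain b d where bd: "b \<in> B" "d \<in> D" "x = b \<oplus>\<^bsub>M\<^esub> d" by (rule set_addE)
  have dA: "d \<in> A" using bd(2) D(1) NA by blast
  have "b = x \<ominus>\<^bsub>M\<^esub> d" unfolding bd(3) using submodule_subset[OF cE(2) bd(1)] submodule_subset[OF cE(1) dA] by simp
  then have "b \<in> A" using submodule_diff[OF cE(1) x dA] by simp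
  then have "b = \<zero>\<^bsub>M\<^esub>" using cE(3) bd(1) by blast
  then have "x \<in> D" using bd submodule_subset[OF cE(1) dA] by simp
  then have "h x \<in> D" using D(3) h by blast
  then show ?thesis using D(1) NA by blast
qed

text \<open>The projection to A along B maps B' into A, and also into B' because summands are
  invariant. So it kills B', which means B' \<subseteq> B.\<close>

lemma complement_unique:
  assumes "complementary R M A B" "complementary R M A B'"
  shows "B = B'"
proof -
  have *: "B' \<subseteq> B" if c: "complementary R M A B" and c': "complementary R M A B'" for B B'
  proof
    fix x assume x: "x \<in> B'"
    note cE = complementaryE[OF c] and cE' = complementaryE[OF c']
    have xc: "x \<in> carrier M" using submodule_subset[OF cE'(2) x] .
    obtain f where f: "f \<in> mod_hom R M M" "\<forall>x\<in>A. f x = x" "\<forall>x\<in>B. f x = \<zero>\<^bsub>M\<^esub>"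
      "\<forall>x\<in>carrier M. f x \<in> A" "\<forall>x\<in>carrier M. x \<ominus>\<^bsub>M\<^esub> f x \<in> B"
      by (rule complementary_projection[OF c])
    have "f x \<in> B'" by (rule summand_invariant[OF complementary_sym[OF c'] f(1) x])
    then have "f x = \<zero>\<^bsub>M\<^esub>" using cE'(3) f(4) xc by blast
    then show "x \<in> B" using bspec[OF f(5) xc] submodule_diff_cancel[OF cE(2) submodule_zero[OF cE(2)]] xc by simp
  qed
  show ?thesis using *[OF assms] *[OF assms(2,1)] by blast
qed

text \<open>Two complements of \<open>A\<close> obtained from the graphs of two different maps on a cyclic submodule
  would contradict the uniqueness of complements.\<close>

lemma no_twisted_cyclic_complement:
  assumes A: "relatively_injective A" and y: "y \<in> carrier M" and p: "p \<in> A" "p \<noteq> \<zero>\<^bsub>M\<^esub>"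
    and 1: "\<And>r. r \<in> carrier R \<Longrightarrow> r \<odot>\<^bsub>M\<^esub> y \<in> A \<Longrightarrow> r \<odot>\<^bsub>M\<^esub> y = \<zero>\<^bsub>M\<^esub>"
    and 2: "\<And>r. r \<in> carrier R \<Longrightarrow> r \<odot>\<^bsub>M\<^esub> y \<in> A \<Longrightarrow> r \<odot>\<^bsub>M\<^esub> p = \<zero>\<^bsub>M\<^esub>"
  shows False
proof -
  have As: "submodule A R M" using A unfolding relatively_injective_def by blast
  have pc: "p \<in> carrier M" using submodule_subset[OF As p(1)] .
  obtain C where C: "cyclic_submodule y \<subseteq> C" "complementary R M C A"
    by (rule relatively_injective_complement[OF A submodule_cyclic[OF y]])
      (use 1 in \<open>auto elim: cyclic_submoduleE\<close>)
  have yp: "y \<oplus>\<^bsub>M\<^esub> p \<in> carrier M" using y pc by simp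
  have "x = \<zero>\<^bsub>M\<^esub>" if x: "x \<in> cyclic_submodule (y \<oplus>\<^bsub>M\<^esub> p)" "x \<in> A" for x
  proof -
    obtain r where r: "r \<in> carrier R" "x = r \<odot>\<^bsub>M\<^esub> (y \<oplus>\<^bsub>M\<^esub> p)" using x(1) by (rule cyclic_submoduleE)
    have x': "x = r \<odot>\<^bsub>M\<^esub> y \<oplus>\<^bsub>M\<^esub> r \<odot>\<^bsub>M\<^esub> p" using r y pc by (simp add: smult_r_distr)
    have "r \<odot>\<^bsub>M\<^esub> y = x \<ominus>\<^bsub>M\<^esub> r \<odot>\<^bsub>M\<^esub> p" unfolding x' using r y pc by simp
    then have "r \<odot>\<^bsub>M\<^esub> y \<in> A" using submodule_diff[OF As x(2) submodule_smult[OF As r(1) p(1)]] by simp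
    then have "r \<odot>\<^bsub>M\<^esub> y = \<zero>\<^bsub>M\<^esub>" "r \<odot>\<^bsub>M\<^esub> p = \<zero>\<^bsub>M\<^esub>" using 1[OF r(1)] 2[OF r(1)] by auto
    then show ?thesis unfolding x' by simp
  qed
  then obtain C' where C': "cyclic_submodule (y \<oplus>\<^bsub>M\<^esub> p) \<subseteq> C'" "complementary R M C' A"
    using relatively_injective_complement[OF A submodule_cyclic[OF yp]] by blast
  \<comment> \<open>Both are complements of A, one containing y and the other y + p. Being equal,
    they contain the non-zero element p of A.\<close>
  have "C = C'"
    using complement_unique[OF complementary_sym[OF C(2)] complementary_sym[OF C'(2)]] .
  then have "y \<in> C" "y \<oplus>\<^bsub>M\<^esub> p \<in> C"
    using C(1) C'(1) generator_in_cyclic_submodule[OF y] generator_in_cyclic_submodule[OF yp] by auto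
  then have "p \<in> C" using submodule_add_cancel[OF complementaryE(1)[OF C(2)]] pc by blast
  then show False using complementaryE(3)[OF C(2)] p by blast
qed

text \<open>The map y \<mapsto> u would carry the invariant summand generated by y into its
  complement.\<close>

lemma cyclic_summand_hom_zero:
  assumes c: "complementary R M (cyclic_submodule y) C" and y: "y \<in> carrier M" and u: "u \<in> C"
    and ann: "\<And>a. a \<in> carrier R \<Longrightarrow> a \<odot>\<^bsub>M\<^esub> y = \<zero>\<^bsub>M\<^esub> \<Longrightarrow> a \<odot>\<^bsub>M\<^esub> u = \<zero>\<^bsub>M\<^esub>"
  shows "u = \<zero>\<^bsub>M\<^esub>"
proof -
  note cE = complementaryE[OF c]
  obtain h where "h \<in> mod_hom R M M" "h y = u"
    using cyclic_summand_hom[OF c y submodule_subset[OF cE(2) u] ann] by blast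
  then have "u \<in> cyclic_submodule y"
    using summand_invariant[OF c _ generator_in_cyclic_submodule[OF y]] by blast
  then show ?thesis using cE(3) u by blast
qed

end

section \<open>Primary components: cyclic or of Pruefer type\<close>

locale baer_module_at_prime = dedekind_baer_module R M + module_at_prime R M P \<pi> \<tau>
  for R :: "('a, 'c) ring_scheme" (structure) and M :: "('a, 'b, 'e) module_scheme" (structure)
    and P :: "'a set" and \<pi> :: 'a and \<tau> :: 'a
begin

text \<open>A socle element \<open>x0\<close> of height exactly k is, up to factors outside P,
  \<open>\<pi>\<close>^k y with y in \<open>T\<close>. A submodule X that is maximal among those
  containing all elements of height above k and avoiding x = \<open>\<pi>\<close>^k y turns out to
  be a complement of R y. The cyclic summand exhausts \<open>T\<close>, because a socle element of
  \<open>T\<close> in X would be a homomorphic image of y.\<close>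

lemma finite_height_cyclic:
  fixes k :: nat
  assumes x0: "x0 \<in> T" "\<pi> \<odot>\<^bsub>M\<^esub> x0 = \<zero>\<^bsub>M\<^esub>" "x0 \<noteq> \<zero>\<^bsub>M\<^esub>"
    and height_ge: "\<exists>s\<in>carrier R - P. \<exists>z\<in>carrier M. s \<odot>\<^bsub>M\<^esub> x0 = \<pi> [^] k \<odot>\<^bsub>M\<^esub> z"
    and height_le: "\<not> (\<exists>s\<in>carrier R - P. \<exists>z\<in>carrier M. s \<odot>\<^bsub>M\<^esub> x0 = \<pi> [^] Suc k \<odot>\<^bsub>M\<^esub> z)"
  shows "cyclic_with_annihilator T (ideal_power R P (Suc k)) \<and> direct_summand R M T"
proof -
  note x0M = T_closed[OF x0(1)]
  obtain s0 z0 where s0: "s0 \<in> carrier R - P" and z0: "z0 \<in> carrier M"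
    and eq0: "s0 \<odot>\<^bsub>M\<^esub> x0 = \<pi> [^] k \<odot>\<^bsub>M\<^esub> z0" using height_ge by blast
  have s0R: "s0 \<in> carrier R" using s0 by simp
  \<comment> \<open>Since \<open>\<pi>\<close>^(k+1) kills \<open>z0\<close>, the factor
    \<open>\<tau>\<close>^(k+1) moves \<open>z0\<close> into \<open>T\<close>; on the multiple of
    \<open>x0\<close> it only contributes a unit at P.\<close>
  define y where "y = \<tau> [^] Suc k \<odot>\<^bsub>M\<^esub> z0"
  define x where "x = \<pi> [^] k \<odot>\<^bsub>M\<^esub> y"
  have "\<pi> [^] Suc k \<odot>\<^bsub>M\<^esub> z0 = \<pi> \<odot>\<^bsub>M\<^esub> (\<pi> [^] k \<odot>\<^bsub>M\<^esub> z0)"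
    using z0 by (simp add: R.m_comm flip: smult_assoc1)
  also have "\<dots> = s0 \<odot>\<^bsub>M\<^esub> (\<pi> \<odot>\<^bsub>M\<^esub> x0)" unfolding eq0[symmetric] using s0R x0M by (simp add: smult_swap)
  finally have pz0: "\<pi> [^] Suc k \<odot>\<^bsub>M\<^esub> z0 = \<zero>\<^bsub>M\<^esub>" using x0 s0R by simp
  have yT: "y \<in> T" unfolding y_def by (rule \<tau>_pow_in_T[OF z0 pz0])
  note yM = T_closed[OF yT]
  have py: "\<pi> [^] Suc k \<odot>\<^bsub>M\<^esub> y = \<zero>\<^bsub>M\<^esub>"
    unfolding y_def using pz0 smult_swap[of "\<pi> [^] Suc k" "\<tau> [^] Suc k" z0] z0 by simp
  have xT: "x \<in> T" unfolding x_def using submodule_smult[OF submodule_T _ yT] by simp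
  note xM = T_closed[OF xT]
  have x_x0: "x = (\<tau> [^] Suc k \<otimes> s0) \<odot>\<^bsub>M\<^esub> x0"
  proof -
    have "x = \<tau> [^] Suc k \<odot>\<^bsub>M\<^esub> (\<pi> [^] k \<odot>\<^bsub>M\<^esub> z0)"
      unfolding x_def y_def using z0 by (intro smult_swap) auto
    then show ?thesis unfolding eq0[symmetric] using s0R x0M by (simp add: smult_assoc1)
  qed
  have ts: "\<tau> [^] Suc k \<otimes> s0 \<in> carrier R - P" by (rule mult_notin_P[OF \<tau>_pow_notin_P s0])
  have xnz: "x \<noteq> \<zero>\<^bsub>M\<^esub>" using T_smult_eq_zero[OF x0(1) ts] x0(3) x_x0 by auto
  have px: "\<pi> \<odot>\<^bsub>M\<^esub> x = \<zero>\<^bsub>M\<^esub>"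
    unfolding x_x0 using smult_swap[of \<pi> "\<tau> [^] Suc k \<otimes> s0" x0] ts x0 x0M by simp
  \<comment> \<open>The elements of height at least k+1 at P. In particular \<open>W\<close>
    contains \<open>\<pi>\<close>^(k+1) M, which later bounds the induction that shows M = R y +
    X.\<close>
  define W where "W = {z \<in> carrier M. \<exists>s\<in>carrier R - P. \<exists>w\<in>carrier M. s \<odot>\<^bsub>M\<^esub> z = \<pi> [^] Suc k \<odot>\<^bsub>M\<^esub> w}"
  have W: "submodule W R M"
  proof (rule submoduleI')
    show "W \<subseteq> carrier M" unfolding W_def by blast
    have "\<one> \<odot>\<^bsub>M\<^esub> \<zero>\<^bsub>M\<^esub> = \<pi> [^] Suc k \<odot>\<^bsub>M\<^esub> \<zero>\<^bsub>M\<^esub>" by simp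
    then show "\<zero>\<^bsub>M\<^esub> \<in> W" unfolding W_def using one_notin_P by blast
    show "a \<oplus>\<^bsub>M\<^esub> b \<in> W" if ab: "a \<in> W" "b \<in> W" for a b
    proof -
      obtain s v t w where s: "s \<in> carrier R - P" "v \<in> carrier M" "s \<odot>\<^bsub>M\<^esub> a = \<pi> [^] Suc k \<odot>\<^bsub>M\<^esub> v"
        and t: "t \<in> carrier R - P" "w \<in> carrier M" "t \<odot>\<^bsub>M\<^esub> b = \<pi> [^] Suc k \<odot>\<^bsub>M\<^esub> w"
        using ab unfolding W_def by blast
      have c: "a \<in> carrier M" "b \<in> carrier M" "s \<in> carrier R" "t \<in> carrier R" using ab s t unfolding W_def by auto
      have "(s \<otimes> t) \<odot>\<^bsub>M\<^esub> (a \<oplus>\<^bsub>M\<^esub> b) = t \<odot>\<^bsub>M\<^esub> (s \<odot>\<^bsub>M\<^esub> a) \<oplus>\<^bsub>M\<^esub> s \<odot>\<^bsub>M\<^esub> (t \<odot>\<^bsub>M\<^esub> b)"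
        using c by (simp add: smult_r_distr R.m_comm flip: smult_assoc1)
      also have "\<dots> = \<pi> [^] Suc k \<odot>\<^bsub>M\<^esub> (t \<odot>\<^bsub>M\<^esub> v \<oplus>\<^bsub>M\<^esub> s \<odot>\<^bsub>M\<^esub> w)"
        unfolding s(3) t(3) using c s(2) t(2)
          smult_swap[of t "\<pi> [^] Suc k" v] smult_swap[of s "\<pi> [^] Suc k" w]
          smult_r_distr[of "\<pi> [^] Suc k" "t \<odot>\<^bsub>M\<^esub> v" "s \<odot>\<^bsub>M\<^esub> w"] by (simp del: nat_pow_Suc)
      finally have "(s \<otimes> t) \<odot>\<^bsub>M\<^esub> (a \<oplus>\<^bsub>M\<^esub> b) = \<pi> [^] Suc k \<odot>\<^bsub>M\<^esub> (t \<odot>\<^bsub>M\<^esub> v \<oplus>\<^bsub>M\<^esub> s \<odot>\<^bsub>M\<^esub> w)" .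
      moreover have "a \<oplus>\<^bsub>M\<^esub> b \<in> carrier M" "t \<odot>\<^bsub>M\<^esub> v \<oplus>\<^bsub>M\<^esub> s \<odot>\<^bsub>M\<^esub> w \<in> carrier M" using c s(2) t(2) by auto
      ultimately show ?thesis unfolding W_def using mult_notin_P[OF s(1) t(1)] by blast
    qed
    show "r \<odot>\<^bsub>M\<^esub> a \<in> W" if r: "r \<in> carrier R" and a: "a \<in> W" for r a
    proof -
      obtain s v where s: "s \<in> carrier R - P" "v \<in> carrier M" "s \<odot>\<^bsub>M\<^esub> a = \<pi> [^] Suc k \<odot>\<^bsub>M\<^esub> v"
        using a unfolding W_def by blast
      have c: "a \<in> carrier M" "s \<in> carrier R" using a s unfolding W_def by auto
      have "s \<odot>\<^bsub>M\<^esub> (r \<odot>\<^bsub>M\<^esub> a) = \<pi> [^] Suc k \<odot>\<^bsub>M\<^esub> (r \<odot>\<^bsub>M\<^esub> v)"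
        using smult_swap[of s r a] smult_swap[of r "\<pi> [^] Suc k" v] s c r by (simp del: nat_pow_Suc)
      then show ?thesis unfolding W_def using s(1,2) c(1) r smult_closed by blast
    qed
  qed
  have Wx: "m \<noteq> x" if "m \<in> W" for m
  proof
    assume "m = x"
    then have "x \<in> W" using that by simp
    then obtain s w where s: "s \<in> carrier R - P" "w \<in> carrier M" "s \<odot>\<^bsub>M\<^esub> x = \<pi> [^] Suc k \<odot>\<^bsub>M\<^esub> w"
      unfolding W_def by blast
    have "(s \<otimes> (\<tau> [^] Suc k \<otimes> s0)) \<odot>\<^bsub>M\<^esub> x0 = \<pi> [^] Suc k \<odot>\<^bsub>M\<^esub> w"
      using s x_x0 x0M ts by (simp add: smult_assoc1)
    then show False using height_le mult_notin_P[OF s(1) ts] s(2) by blast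
  qed
  obtain X where X: "submodule X R M" "W \<subseteq> X" and Xx: "\<forall>m\<in>X. m \<noteq> x"
    and max: "\<forall>m\<in>carrier M - X. \<exists>u\<in>X. \<exists>r\<in>carrier R. \<not> (u \<oplus>\<^bsub>M\<^esub> r \<odot>\<^bsub>M\<^esub> m \<noteq> x)"
    by (rule exists_maximal_submodule_pointwise[OF W Wx])
  note XM = submodule_subset[OF X(1)]
  have xX: "x \<notin> X" using Xx by blast
  have adjoin: "\<exists>u\<in>X. \<exists>r\<in>carrier R. x = u \<oplus>\<^bsub>M\<^esub> r \<odot>\<^bsub>M\<^esub> m" if m: "m \<in> carrier M" "m \<notin> X" for m
  proof -
    have "\<exists>u\<in>X. \<exists>r\<in>carrier R. \<not> (u \<oplus>\<^bsub>M\<^esub> r \<odot>\<^bsub>M\<^esub> m \<noteq> x)" using bspec[OF max, of m] m by simp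
    then obtain u r where u: "u \<in> X" "r \<in> carrier R" "\<not> (u \<oplus>\<^bsub>M\<^esub> r \<odot>\<^bsub>M\<^esub> m \<noteq> x)" by (elim bexE)
    show ?thesis by (rule bexI[OF _ u(1)], rule bexI[OF _ u(2)]) (use u(3) in simp)
  qed
  \<comment> \<open>If s m were in X but m not, maximality would express x as u + r m, so s x would
    lie in X, and then x too because s is invertible on \<open>T\<close>.\<close>
  have sat: "m \<in> X" if m: "m \<in> carrier M" and s: "s \<in> carrier R - P" "s \<odot>\<^bsub>M\<^esub> m \<in> X" for m s
  proof (rule ccontr)
    assume "m \<notin> X"
    from adjoin[OF m this] obtain u r
      where u: "u \<in> X" "r \<in> carrier R" "x = u \<oplus>\<^bsub>M\<^esub> r \<odot>\<^bsub>M\<^esub> m" by (elim bexE)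
    have "s \<odot>\<^bsub>M\<^esub> x = s \<odot>\<^bsub>M\<^esub> u \<oplus>\<^bsub>M\<^esub> r \<odot>\<^bsub>M\<^esub> (s \<odot>\<^bsub>M\<^esub> m)"
      unfolding u(3) using XM u(1,2) m s smult_swap[of s r m] by (simp add: smult_r_distr)
    moreover have "s \<odot>\<^bsub>M\<^esub> u \<in> X" "r \<odot>\<^bsub>M\<^esub> (s \<odot>\<^bsub>M\<^esub> m) \<in> X"
      using submodule_smult[OF X(1)] u s by auto
    ultimately have "s \<odot>\<^bsub>M\<^esub> x \<in> X" using submodule_add[OF X(1)] by simp
    then show False using T_mem_if_smult_mem[OF X(1) xT s(1)] xX by blast
  qed
  define S where "S = cyclic_submodule y <+>\<^bsub>M\<^esub> X"
  have cy: "submodule (cyclic_submodule y) R M" by (rule submodule_cyclic[OF yM])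
  have S: "submodule S R M" unfolding S_def by (rule submodule_set_add[OF cy X(1)])
  have XS: "X \<subseteq> S" unfolding S_def by (rule subset_set_add_right[OF cy X(1)])
  have cS: "cyclic_submodule y \<subseteq> S" unfolding S_def by (rule subset_set_add_left[OF cy X(1)])
  \<comment> \<open>Induction on the power j of \<open>\<pi>\<close> needed to bring m into X; the
    bound j \<le> k+1 ensures that \<open>\<pi>\<close>^(k - j) makes sense in the step.\<close>
  have span: "m \<in> S" if "m \<in> carrier M" "\<pi> [^] j \<odot>\<^bsub>M\<^esub> m \<in> X" "j \<le> Suc k" for m and j :: nat
    using that
  proof (induction j arbitrary: m)
    case 0
    then show ?case using XS by auto
  next
    case (Suc j)
    note m = Suc.prems(1)
    have pjm: "\<pi> [^] j \<odot>\<^bsub>M\<^esub> m \<in> carrier M" using m by simp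
    show ?case
    proof (cases "\<pi> [^] j \<odot>\<^bsub>M\<^esub> m \<in> X")
      case True
      then show ?thesis using Suc by simp
    next
      case False
      from adjoin[OF pjm this] obtain u r
        where u: "u \<in> X" "r \<in> carrier R" "x = u \<oplus>\<^bsub>M\<^esub> r \<odot>\<^bsub>M\<^esub> (\<pi> [^] j \<odot>\<^bsub>M\<^esub> m)" by (elim bexE)
      have "r \<notin> P"
      proof
        assume "r \<in> P"
        then obtain r' where r': "r' \<in> carrier R" "\<tau> \<otimes> r = \<pi> \<otimes> r'" using \<tau>_mult by blast
        have "\<tau> \<odot>\<^bsub>M\<^esub> (r \<odot>\<^bsub>M\<^esub> (\<pi> [^] j \<odot>\<^bsub>M\<^esub> m)) = (\<pi> \<otimes> r') \<odot>\<^bsub>M\<^esub> (\<pi> [^] j \<odot>\<^bsub>M\<^esub> m)"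
          unfolding r'(2)[symmetric] using u(2) pjm by (simp add: smult_assoc1)
        also have "\<dots> = r' \<odot>\<^bsub>M\<^esub> (\<pi> [^] Suc j \<odot>\<^bsub>M\<^esub> m)"
          using r'(1) m by (simp add: m_ac flip: smult_assoc1)
        finally have "\<tau> \<odot>\<^bsub>M\<^esub> x = \<tau> \<odot>\<^bsub>M\<^esub> u \<oplus>\<^bsub>M\<^esub> r' \<odot>\<^bsub>M\<^esub> (\<pi> [^] Suc j \<odot>\<^bsub>M\<^esub> m)"
          unfolding u(3) using XM u(1,2) pjm by (simp add: smult_r_distr)
        moreover have "\<tau> \<odot>\<^bsub>M\<^esub> u \<in> X" "r' \<odot>\<^bsub>M\<^esub> (\<pi> [^] Suc j \<odot>\<^bsub>M\<^esub> m) \<in> X"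
          using submodule_smult[OF X(1)] u r'(1) Suc.prems(2) by auto
        ultimately have "\<tau> \<odot>\<^bsub>M\<^esub> x \<in> X" using submodule_add[OF X(1)] by simp
        then show False using T_mem_if_smult_mem[OF X(1) xT, of \<tau>] xX \<tau>_notin_P by simp
      qed
      then have rP: "r \<in> carrier R - P" using u by simp
      \<comment> \<open>Chosen so that \<open>\<pi>\<close>^j m' = r \<open>\<pi>\<close>^j m - x =
        -u lies in X, which allows the induction hypothesis to be applied to m'.\<close>
      define m' where "m' = r \<odot>\<^bsub>M\<^esub> m \<ominus>\<^bsub>M\<^esub> \<pi> [^] (k - j) \<odot>\<^bsub>M\<^esub> y"
      have m'M: "m' \<in> carrier M" unfolding m'_def using u m yM by simp
      have pk: "\<pi> [^] j \<odot>\<^bsub>M\<^esub> (\<pi> [^] (k - j) \<odot>\<^bsub>M\<^esub> y) = x"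
        unfolding x_def using Suc.prems(3) yM by (simp add: nat_pow_mult flip: smult_assoc1)
      have "\<pi> [^] j \<odot>\<^bsub>M\<^esub> m' = \<pi> [^] j \<odot>\<^bsub>M\<^esub> (r \<odot>\<^bsub>M\<^esub> m) \<ominus>\<^bsub>M\<^esub> x"
        unfolding m'_def using u m yM pk by (simp add: smult_diff)
      also have "\<pi> [^] j \<odot>\<^bsub>M\<^esub> (r \<odot>\<^bsub>M\<^esub> m) = r \<odot>\<^bsub>M\<^esub> (\<pi> [^] j \<odot>\<^bsub>M\<^esub> m)"
        using u m by (simp add: smult_swap)
      also have "\<dots> = x \<ominus>\<^bsub>M\<^esub> u" unfolding u(3) using XM u(1,2) pjm by simp
      also have "(x \<ominus>\<^bsub>M\<^esub> u) \<ominus>\<^bsub>M\<^esub> x = \<ominus>\<^bsub>M\<^esub> u"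
        using xM XM[OF u(1)] add_diff_cancel[of "\<ominus>\<^bsub>M\<^esub> u" x] M.a_comm[of x "\<ominus>\<^bsub>M\<^esub> u"]
        unfolding a_minus_def by simp
      finally have "\<pi> [^] j \<odot>\<^bsub>M\<^esub> m' \<in> X" using submoduleE(6)[OF X(1) u(1)] by simp
      then have "m' \<in> S" using Suc.IH[OF m'M] Suc.prems(3) by simp
      moreover have "\<pi> [^] (k - j) \<odot>\<^bsub>M\<^esub> y \<in> S" using cS cyclic_submoduleI by auto
      ultimately have "r \<odot>\<^bsub>M\<^esub> m \<in> S"
        using submodule_diff_cancel[OF S, of "\<pi> [^] (k - j) \<odot>\<^bsub>M\<^esub> y" "r \<odot>\<^bsub>M\<^esub> m"] u m unfolding m'_def by simp
      then obtain z x' where z: "z \<in> cyclic_submodule y" "x' \<in> X" "r \<odot>\<^bsub>M\<^esub> m = z \<oplus>\<^bsub>M\<^esub> x'"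
        unfolding S_def by (rule set_addE)
      have zT: "z \<in> T" using cyclic_submodule_subset[OF submodule_T yT] z(1) by blast
      obtain v where v: "v \<in> carrier R" "v \<odot>\<^bsub>M\<^esub> (r \<odot>\<^bsub>M\<^esub> z) = z" using T_inverse[OF zT rP] .
      have vz: "v \<odot>\<^bsub>M\<^esub> z \<in> cyclic_submodule y" using submodule_smult[OF cy v(1) z(1)] .
      have "r \<odot>\<^bsub>M\<^esub> (m \<ominus>\<^bsub>M\<^esub> v \<odot>\<^bsub>M\<^esub> z) = r \<odot>\<^bsub>M\<^esub> m \<ominus>\<^bsub>M\<^esub> z"
        using u m v T_closed[OF zT] smult_swap[of r v z] by (simp add: smult_diff)
      also have "\<dots> = x'" unfolding z(3) using T_closed[OF zT] XM z by simp
      finally have "m \<ominus>\<^bsub>M\<^esub> v \<odot>\<^bsub>M\<^esub> z \<in> X" using sat[OF _ rP] m v T_closed[OF zT] z(2) by simp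
      then show ?thesis
        using submodule_diff_cancel[OF S, of "v \<odot>\<^bsub>M\<^esub> z" m] vz cS XS m by blast
    qed
  qed
  have all: "m \<in> S" if m: "m \<in> carrier M" for m
  proof (rule span[OF m _ order_refl])
    have "\<one> \<odot>\<^bsub>M\<^esub> (\<pi> [^] Suc k \<odot>\<^bsub>M\<^esub> m) = \<pi> [^] Suc k \<odot>\<^bsub>M\<^esub> m" using m by simp
    moreover have "\<pi> [^] Suc k \<odot>\<^bsub>M\<^esub> m \<in> carrier M" using m by simp
    ultimately have "\<pi> [^] Suc k \<odot>\<^bsub>M\<^esub> m \<in> W" unfolding W_def using m one_notin_P by blast
    then show "\<pi> [^] Suc k \<odot>\<^bsub>M\<^esub> m \<in> X" using X(2) by blast
  qed
  \<comment> \<open>If a had valuation i \<le> k, then t x = \<open>\<pi>\<close>^(k - i) s (a y)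
    would be in X. The bound gives both the trivial intersection of R y with X and the annihilator
    of y.\<close>
  have ann_small: "\<exists>s\<in>carrier R - P. \<exists>t\<in>carrier R - P. \<exists>i\<ge>Suc k. s \<otimes> a = t \<otimes> \<pi> [^] (i::nat)"
    if a: "a \<in> carrier R" "a \<noteq> \<zero>" and aX: "a \<odot>\<^bsub>M\<^esub> y \<in> X" for a
  proof -
    obtain s t i where s: "s \<in> carrier R - P" and t: "t \<in> carrier R - P" and eq: "s \<otimes> a = t \<otimes> \<pi> [^] (i::nat)"
      using valuation[OF a] by blast
    have "Suc k \<le> i"
    proof (rule ccontr)
      assume "\<not> Suc k \<le> i"
      then have "\<pi> [^] k = \<pi> [^] (k - i) \<otimes> \<pi> [^] i" by (simp add: nat_pow_mult)
      then have "t \<odot>\<^bsub>M\<^esub> x = (\<pi> [^] (k - i) \<otimes> (t \<otimes> \<pi> [^] i)) \<odot>\<^bsub>M\<^esub> y"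
        unfolding x_def using t yM by (simp add: m_ac flip: smult_assoc1)
      also have "\<dots> = (\<pi> [^] (k - i) \<otimes> s) \<odot>\<^bsub>M\<^esub> (a \<odot>\<^bsub>M\<^esub> y)"
        unfolding eq[symmetric] using s a yM by (simp add: m_assoc flip: smult_assoc1)
      finally have "t \<odot>\<^bsub>M\<^esub> x \<in> X" using submodule_smult[OF X(1) _ aX] s by simp
      then show False using T_mem_if_smult_mem[OF X(1) xT t] xX by blast
    qed
    then show ?thesis using s t eq by blast
  qed
  have ann_X: "a \<odot>\<^bsub>M\<^esub> y = \<zero>\<^bsub>M\<^esub>" "a \<in> ideal_power R P (Suc k)"
    if a: "a \<in> carrier R" and aX: "a \<odot>\<^bsub>M\<^esub> y \<in> X" for a
  proof -
    have "a \<odot>\<^bsub>M\<^esub> y = \<zero>\<^bsub>M\<^esub> \<and> a \<in> ideal_power R P (Suc k)"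
    proof (cases "a = \<zero>")
      case True
      then show ?thesis
        using yM additive_subgroup.zero_closed[OF ideal.axioms(1)[OF ideal_ideal_power[of "Suc k"]]]
        by (simp del: nat_pow_Suc monoid.nat_pow_Suc)
    next
      case False
      then obtain s t i where s: "s \<in> carrier R - P" and t: "t \<in> carrier R - P"
        and i: "Suc k \<le> i" and eq: "s \<otimes> a = t \<otimes> \<pi> [^] (i::nat)" using ann_small[OF a _ aX] by blast
      have "\<pi> [^] i = \<pi> [^] (i - Suc k) \<otimes> \<pi> [^] Suc k" using i by (simp only: nat_pow_mult \<pi>_closed) simp
      then have "(s \<otimes> a) \<odot>\<^bsub>M\<^esub> y = (t \<otimes> \<pi> [^] (i - Suc k)) \<odot>\<^bsub>M\<^esub> (\<pi> [^] Suc k \<odot>\<^bsub>M\<^esub> y)"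
        unfolding eq using t yM by (simp add: m_assoc flip: smult_assoc1)
      then have "s \<odot>\<^bsub>M\<^esub> (a \<odot>\<^bsub>M\<^esub> y) = \<zero>\<^bsub>M\<^esub>" unfolding py using s t a yM by (simp add: smult_assoc1)
      then have "a \<odot>\<^bsub>M\<^esub> y = \<zero>\<^bsub>M\<^esub>"
        using T_smult_eq_zero[OF submodule_smult[OF submodule_T a yT] s] by blast
      then show ?thesis using mem_ideal_power_if_valuation_ge[OF a s _ eq i] t by simp
    qed
    then show "a \<odot>\<^bsub>M\<^esub> y = \<zero>\<^bsub>M\<^esub>" "a \<in> ideal_power R P (Suc k)" by auto
  qed
  have compl: "complementary R M (cyclic_submodule y) X"
  proof (rule complementaryI[OF cy X(1)])
    show "z = \<zero>\<^bsub>M\<^esub>" if z: "z \<in> cyclic_submodule y" "z \<in> X" for z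
    proof -
      obtain a where "a \<in> carrier R" "z = a \<odot>\<^bsub>M\<^esub> y" using z(1) by (rule cyclic_submoduleE)
      then show ?thesis using ann_X(1)[of a] z(2) by simp
    qed
    show "\<exists>d\<in>cyclic_submodule y. \<exists>e\<in>X. z = d \<oplus>\<^bsub>M\<^esub> e" if "z \<in> carrier M" for z
      using all[OF that] unfolding S_def mem_set_add .
  qed
  \<comment> \<open>The annihilator of y lies in P, and P kills the socle of \<open>T\<close>; so y
    can be mapped to any socle element, which by rigidity excludes non-zero ones in X.\<close>
  have TX: "z = \<zero>\<^bsub>M\<^esub>" if z: "z \<in> T" "z \<in> X" for z
  proof (rule ccontr)
    assume nz: "z \<noteq> \<zero>\<^bsub>M\<^esub>"
    obtain j :: nat where j: "\<pi> [^] j \<odot>\<^bsub>M\<^esub> z \<in> T" "\<pi> [^] j \<odot>\<^bsub>M\<^esub> z \<noteq> \<zero>\<^bsub>M\<^esub>"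
      "\<pi> \<odot>\<^bsub>M\<^esub> (\<pi> [^] j \<odot>\<^bsub>M\<^esub> z) = \<zero>\<^bsub>M\<^esub>"
      using T_nonzero_has_socle[OF submodule_T order_refl z(1) nz] by blast
    have "\<pi> [^] j \<odot>\<^bsub>M\<^esub> z = \<zero>\<^bsub>M\<^esub>"
    proof (rule cyclic_summand_hom_zero[OF compl yM])
      show "\<pi> [^] j \<odot>\<^bsub>M\<^esub> z \<in> X" using submodule_smult[OF X(1) _ z(2)] by simp
      show "a \<odot>\<^bsub>M\<^esub> (\<pi> [^] j \<odot>\<^bsub>M\<^esub> z) = \<zero>\<^bsub>M\<^esub>" if a: "a \<in> carrier R" "a \<odot>\<^bsub>M\<^esub> y = \<zero>\<^bsub>M\<^esub>" for a
      proof -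
        have "a \<in> P"
        proof (rule ccontr)
          assume "a \<notin> P"
          then have "y = \<zero>\<^bsub>M\<^esub>" using T_smult_eq_zero[OF yT, of a] a by simp
          then show False using xnz unfolding x_def by simp
        qed
        then show ?thesis using T_P_smult_eq_zero[OF j(1,3)] by blast
      qed
    qed
    then show False using j(2) by blast
  qed
  have "T = cyclic_submodule y"
  proof
    show "cyclic_submodule y \<subseteq> T" by (rule cyclic_submodule_subset[OF submodule_T yT])
    show "T \<subseteq> cyclic_submodule y"
    proof
      fix z assume z: "z \<in> T"
      obtain c e where ce: "c \<in> cyclic_submodule y" "e \<in> X" "z = c \<oplus>\<^bsub>M\<^esub> e"
        using complementaryE(4)[OF compl T_closed[OF z]] by blast
      have cT: "c \<in> T" using ce(1) \<open>cyclic_submodule y \<subseteq> T\<close> by blast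
      have "e \<in> T" using submodule_add_cancel[OF submodule_T cT, of e] ce z XM by simp
      then have "e = \<zero>\<^bsub>M\<^esub>" using TX ce(2) by blast
      then show "z \<in> cyclic_submodule y" using ce T_closed[OF cT] by simp
    qed
  qed
  moreover have "a \<odot>\<^bsub>M\<^esub> y = \<zero>\<^bsub>M\<^esub> \<longleftrightarrow> a \<in> ideal_power R P (Suc k)" if a: "a \<in> carrier R" for a
  proof
    assume "a \<odot>\<^bsub>M\<^esub> y = \<zero>\<^bsub>M\<^esub>"
    then show "a \<in> ideal_power R P (Suc k)" using ann_X(2)[OF a] submodule_zero[OF X(1)] by simp
  next
    assume "a \<in> ideal_power R P (Suc k)"
    then obtain r where r: "r \<in> carrier R" "\<tau> [^] Suc k \<otimes> a = \<pi> [^] Suc k \<otimes> r" using \<tau>_pow_mult by blast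
    have "\<tau> [^] Suc k \<odot>\<^bsub>M\<^esub> (a \<odot>\<^bsub>M\<^esub> y) = (\<tau> [^] Suc k \<otimes> a) \<odot>\<^bsub>M\<^esub> y"
      using a yM by (simp add: smult_assoc1 del: nat_pow_Suc)
    also have "\<dots> = r \<odot>\<^bsub>M\<^esub> (\<pi> [^] Suc k \<odot>\<^bsub>M\<^esub> y)"
      unfolding r(2) using r(1) yM smult_swap[of "\<pi> [^] Suc k" r y]
      by (simp add: smult_assoc1 del: nat_pow_Suc)
    finally show "a \<odot>\<^bsub>M\<^esub> y = \<zero>\<^bsub>M\<^esub>"
      using T_smult_eq_zero[OF submodule_smult[OF submodule_T a yT] \<tau>_pow_notin_P[of "Suc k"]] py r(1) by simp
  qed
  ultimately have "cyclic_with_annihilator T (ideal_power R P (Suc k))"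
    unfolding cyclic_with_annihilator_def by (intro bexI[of _ y] conjI ballI yM)
  moreover have "direct_summand R M T"
    unfolding direct_summand_def \<open>T = cyclic_submodule y\<close> using compl by (rule exI)
  ultimately show ?thesis ..
qed

end

context module_at_prime
begin

text \<open>For socle elements, the factors s and \<open>\<tau>\<close>^(k+1) are removed by
  inverting them on \<open>T\<close>, so the division by \<open>\<pi>\<close>^k takes place inside
  \<open>T\<close>. Induction on the exponent of \<open>\<pi>\<close> that kills x extends
  divisibility by \<open>\<pi>\<close> from the socle to all of \<open>T\<close>.\<close>

lemma divisible_if_socle_infinite_height:
  assumes height: "\<And>x k. x \<in> T \<Longrightarrow> \<pi> \<odot>\<^bsub>M\<^esub> x = \<zero>\<^bsub>M\<^esub> \<Longrightarrow>
      \<exists>s\<in>carrier R - P. \<exists>z\<in>carrier M. s \<odot>\<^bsub>M\<^esub> x = \<pi> [^] (k::nat) \<odot>\<^bsub>M\<^esub> z"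
    and x: "x \<in> T"
  shows "\<exists>y\<in>T. x = \<pi> \<odot>\<^bsub>M\<^esub> y"
proof -
  have socle: "\<exists>z\<in>T. x = \<pi> [^] k \<odot>\<^bsub>M\<^esub> z" if xT: "x \<in> T" and px: "\<pi> \<odot>\<^bsub>M\<^esub> x = \<zero>\<^bsub>M\<^esub>" for x and k :: nat
  proof -
    obtain s z where s: "s \<in> carrier R - P" and z: "z \<in> carrier M"
      and eq: "s \<odot>\<^bsub>M\<^esub> x = \<pi> [^] k \<odot>\<^bsub>M\<^esub> z" using height[OF xT px, of k] by (elim bexE)
    have sR: "s \<in> carrier R" using s by simp
    note xM = T_closed[OF xT]
    have "\<pi> [^] Suc k \<odot>\<^bsub>M\<^esub> z = \<pi> \<odot>\<^bsub>M\<^esub> (\<pi> [^] k \<odot>\<^bsub>M\<^esub> z)"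
      using z by (simp add: R.m_comm flip: smult_assoc1)
    also have "\<dots> = s \<odot>\<^bsub>M\<^esub> (\<pi> \<odot>\<^bsub>M\<^esub> x)" unfolding eq[symmetric] using sR xM by (simp add: smult_swap)
    finally have "\<pi> [^] Suc k \<odot>\<^bsub>M\<^esub> z = \<zero>\<^bsub>M\<^esub>" using px sR by simp
    from \<tau>_pow_in_T[OF z this] have zT: "\<tau> [^] Suc k \<odot>\<^bsub>M\<^esub> z \<in> T" .
    have st: "\<tau> [^] Suc k \<otimes> s \<in> carrier R - P" by (rule mult_notin_P[OF \<tau>_pow_notin_P s])
    obtain u where u: "u \<in> carrier R" "u \<odot>\<^bsub>M\<^esub> ((\<tau> [^] Suc k \<otimes> s) \<odot>\<^bsub>M\<^esub> x) = x"
      using T_inverse[OF xT st] .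
    have "(\<tau> [^] Suc k \<otimes> s) \<odot>\<^bsub>M\<^esub> x = \<tau> [^] Suc k \<odot>\<^bsub>M\<^esub> (\<pi> [^] k \<odot>\<^bsub>M\<^esub> z)"
      unfolding eq[symmetric] using sR xM by (intro smult_assoc1) auto
    also have "\<dots> = \<pi> [^] k \<odot>\<^bsub>M\<^esub> (\<tau> [^] Suc k \<odot>\<^bsub>M\<^esub> z)"
      using z by (intro smult_swap) auto
    finally have "x = u \<odot>\<^bsub>M\<^esub> (\<pi> [^] k \<odot>\<^bsub>M\<^esub> (\<tau> [^] Suc k \<odot>\<^bsub>M\<^esub> z))" using u(2) by simp
    also have "\<dots> = \<pi> [^] k \<odot>\<^bsub>M\<^esub> (u \<odot>\<^bsub>M\<^esub> (\<tau> [^] Suc k \<odot>\<^bsub>M\<^esub> z))"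
      using z u(1) by (intro smult_swap) auto
    finally show ?thesis using submodule_smult[OF submodule_T u(1) zT] by (rule bexI)
  qed
  have "\<exists>y\<in>T. x = \<pi> \<odot>\<^bsub>M\<^esub> y" if "x \<in> T" "\<pi> [^] n \<odot>\<^bsub>M\<^esub> x = \<zero>\<^bsub>M\<^esub>" for x and n :: nat
    using that
  proof (induction n arbitrary: x)
    case 0
    then have "x = \<pi> \<odot>\<^bsub>M\<^esub> \<zero>\<^bsub>M\<^esub>" using T_closed by simp
    then show ?case using submodule_zero[OF submodule_T] by (rule bexI)
  next
    case (Suc n)
    note xT = Suc.prems(1)
    note xM = T_closed[OF xT]
    have pxT: "\<pi> [^] n \<odot>\<^bsub>M\<^esub> x \<in> T" using submodule_smult[OF submodule_T _ xT] by simp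
    have "\<pi> \<odot>\<^bsub>M\<^esub> (\<pi> [^] n \<odot>\<^bsub>M\<^esub> x) = \<pi> [^] Suc n \<odot>\<^bsub>M\<^esub> x"
      using xM by (simp add: R.m_comm flip: smult_assoc1)
    then have "\<pi> \<odot>\<^bsub>M\<^esub> (\<pi> [^] n \<odot>\<^bsub>M\<^esub> x) = \<zero>\<^bsub>M\<^esub>" using Suc.prems(2) by simp
    \<comment> \<open>One power more than n is requested: then \<open>\<pi>\<close>^n kills x -
      \<open>\<pi>\<close> z, and the induction hypothesis divides this difference by
      \<open>\<pi>\<close>.\<close>
    from socle[OF pxT this, of "Suc n"] obtain z
      where z: "z \<in> T" "\<pi> [^] n \<odot>\<^bsub>M\<^esub> x = \<pi> [^] Suc n \<odot>\<^bsub>M\<^esub> z" by (elim bexE)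
    note zM = T_closed[OF z(1)]
    have pzT: "\<pi> \<odot>\<^bsub>M\<^esub> z \<in> T" using submodule_smult[OF submodule_T _ z(1)] by simp
    have "\<pi> [^] Suc n \<odot>\<^bsub>M\<^esub> z = \<pi> [^] n \<odot>\<^bsub>M\<^esub> (\<pi> \<odot>\<^bsub>M\<^esub> z)" using zM by (simp flip: smult_assoc1)
    then have "\<pi> [^] n \<odot>\<^bsub>M\<^esub> (x \<ominus>\<^bsub>M\<^esub> \<pi> \<odot>\<^bsub>M\<^esub> z) = \<zero>\<^bsub>M\<^esub>"
      using z(2) xM zM by (simp add: smult_diff diff_eq_zero_iff)
    from Suc.IH[OF submodule_diff[OF submodule_T xT pzT] this] obtain y
      where y: "y \<in> T" "x \<ominus>\<^bsub>M\<^esub> \<pi> \<odot>\<^bsub>M\<^esub> z = \<pi> \<odot>\<^bsub>M\<^esub> y" by (elim bexE)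
    have "x = (x \<ominus>\<^bsub>M\<^esub> \<pi> \<odot>\<^bsub>M\<^esub> z) \<oplus>\<^bsub>M\<^esub> \<pi> \<odot>\<^bsub>M\<^esub> z" using xM zM by simp
    also have "\<dots> = \<pi> \<odot>\<^bsub>M\<^esub> (y \<oplus>\<^bsub>M\<^esub> z)" unfolding y(2) using T_closed[OF y(1)] zM by (simp add: smult_r_distr)
    finally show ?case using submodule_add[OF submodule_T y(1) z(1)] by (rule bexI)
  qed
  moreover obtain n :: nat where "\<pi> [^] n \<odot>\<^bsub>M\<^esub> x = \<zero>\<^bsub>M\<^esub>" using T_\<pi>_pow[OF x] .
  ultimately show ?thesis using x by metis
qed

end

context baer_module_at_prime
begin

text \<open>A non-torsion c has no non-zero multiple in the torsion module \<open>T\<close>, so c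
  can be twisted by any p in \<open>T\<close> without creating an intersection with
  \<open>T\<close>. As \<open>T\<close> is relatively injective, this contradicts uniqueness of
  complements.\<close>

lemma divisible_primary_torsion:
  assumes div: "\<And>x. x \<in> T \<Longrightarrow> \<exists>y\<in>T. x = \<pi> \<odot>\<^bsub>M\<^esub> y" and nz: "p \<in> T" "p \<noteq> \<zero>\<^bsub>M\<^esub>"
  shows "torsion_part = carrier M"
proof -
  have inj: "relatively_injective T"
    by (rule primary_divisible_relatively_injective[OF submodule_T order_refl div])
  have "c \<in> torsion_part" if c: "c \<in> carrier M" for c
  proof (rule ccontr)
    assume "c \<notin> torsion_part"
    then have free: "r = \<zero>" if "r \<in> carrier R" "r \<odot>\<^bsub>M\<^esub> c = \<zero>\<^bsub>M\<^esub>" for r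
      using that c unfolding torsion_part_def by blast
    have zero: "r = \<zero>" if r: "r \<in> carrier R" "r \<odot>\<^bsub>M\<^esub> c \<in> T" for r
    proof -
      obtain n :: nat where "\<pi> [^] n \<odot>\<^bsub>M\<^esub> (r \<odot>\<^bsub>M\<^esub> c) = \<zero>\<^bsub>M\<^esub>" using T_\<pi>_pow[OF r(2)] .
      then have "\<pi> [^] n \<otimes> r = \<zero>" using free[of "\<pi> [^] n \<otimes> r"] r c by (simp add: smult_assoc1)
      moreover have "\<pi> [^] n \<noteq> \<zero>"
        using \<pi>_nonzero by (induction n) (auto simp: integral_iff)
      ultimately show ?thesis using r(1) by (simp add: integral_iff)
    qed
    show False
    proof (rule no_twisted_cyclic_complement[OF inj c nz])
      show "r \<odot>\<^bsub>M\<^esub> c = \<zero>\<^bsub>M\<^esub>" if "r \<in> carrier R" "r \<odot>\<^bsub>M\<^esub> c \<in> T" for r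
        using zero[OF that] c by simp
      show "r \<odot>\<^bsub>M\<^esub> p = \<zero>\<^bsub>M\<^esub>" if "r \<in> carrier R" "r \<odot>\<^bsub>M\<^esub> c \<in> T" for r
        using zero[OF that] T_closed[OF nz(1)] by simp
    qed
  qed
  then show ?thesis unfolding torsion_part_def by blast
qed

text \<open>If x were not a multiple of x', a submodule A of \<open>T\<close> maximal with x' in A
  and x not in A would still be divisible, hence relatively injective. The multiples of x in A have
  coefficients in P and vanish, and P also kills x', so x could be twisted by x'.\<close>

lemma divisible_primary_socle:
  assumes div: "\<And>x. x \<in> T \<Longrightarrow> \<exists>y\<in>T. x = \<pi> \<odot>\<^bsub>M\<^esub> y"
    and x: "x \<in> T" "\<pi> \<odot>\<^bsub>M\<^esub> x = \<zero>\<^bsub>M\<^esub>" and x': "x' \<in> T" "\<pi> \<odot>\<^bsub>M\<^esub> x' = \<zero>\<^bsub>M\<^esub>" "x' \<noteq> \<zero>\<^bsub>M\<^esub>"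
  shows "x \<in> cyclic_submodule x'"
proof (rule ccontr)
  assume xx': "x \<notin> cyclic_submodule x'"
  note xM = T_closed[OF x(1)] and x'M = T_closed[OF x'(1)]
  have xnz: "x \<noteq> \<zero>\<^bsub>M\<^esub>" using xx' submodule_zero[OF submodule_cyclic[OF x'M]] by blast
  have start: "m \<in> T \<and> m \<noteq> x" if "m \<in> cyclic_submodule x'" for m
    using that xx' cyclic_submodule_subset[OF submodule_T x'(1)] by blast
  obtain A where A: "submodule A R M" "cyclic_submodule x' \<subseteq> A" "\<forall>m\<in>A. m \<in> T \<and> m \<noteq> x"
    and max: "\<forall>m\<in>carrier M - A. \<exists>u\<in>A. \<exists>r\<in>carrier R. \<not> (u \<oplus>\<^bsub>M\<^esub> r \<odot>\<^bsub>M\<^esub> m \<in> T \<and> u \<oplus>\<^bsub>M\<^esub> r \<odot>\<^bsub>M\<^esub> m \<noteq> x)"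
    by (rule exists_maximal_submodule_pointwise[OF submodule_cyclic[OF x'M] start])
  note AM = submodule_subset[OF A(1)]
  have AT: "A \<subseteq> T" and xA: "x \<notin> A" using A(3) by auto
  have x'A: "x' \<in> A" using A(2) generator_in_cyclic_submodule[OF x'M] by blast
  \<comment> \<open>If z = \<open>\<pi>\<close> w with w outside A, maximality gives x = u + r w
    with r outside P. Multiplying by \<open>\<pi>\<close> yields r z = -\<open>\<pi>\<close> u, and
    inverting r on \<open>T\<close> divides z by \<open>\<pi>\<close> within A.\<close>
  have divA: "\<exists>y\<in>A. z = \<pi> \<odot>\<^bsub>M\<^esub> y" if z: "z \<in> A" for z
  proof -
    obtain w where w: "w \<in> T" "z = \<pi> \<odot>\<^bsub>M\<^esub> w" using div[of z] AT z by auto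
    note wM = T_closed[OF w(1)]
    show ?thesis
    proof (cases "w \<in> A")
      case True
      show ?thesis using w(2) True by (rule bexI)
    next
      case False
      have "\<exists>u\<in>A. \<exists>r\<in>carrier R. \<not> (u \<oplus>\<^bsub>M\<^esub> r \<odot>\<^bsub>M\<^esub> w \<in> T \<and> u \<oplus>\<^bsub>M\<^esub> r \<odot>\<^bsub>M\<^esub> w \<noteq> x)"
        using bspec[OF max, of w] wM False by simp
      then obtain u r where u: "u \<in> A" "r \<in> carrier R"
        "\<not> (u \<oplus>\<^bsub>M\<^esub> r \<odot>\<^bsub>M\<^esub> w \<in> T \<and> u \<oplus>\<^bsub>M\<^esub> r \<odot>\<^bsub>M\<^esub> w \<noteq> x)" by (elim bexE)
      have uT: "u \<in> T" using u(1) AT by blast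
      have "u \<oplus>\<^bsub>M\<^esub> r \<odot>\<^bsub>M\<^esub> w \<in> T"
        by (rule submodule_add[OF submodule_T uT submodule_smult[OF submodule_T u(2) w(1)]])
      then have xeq: "x = u \<oplus>\<^bsub>M\<^esub> r \<odot>\<^bsub>M\<^esub> w" using u(3) by simp
      have uM: "u \<in> carrier M" using AM[OF u(1)] .
      have rP: "r \<in> carrier R - P"
      proof (rule ccontr)
        assume "r \<notin> carrier R - P"
        then have "r \<in> P" using u(2) by simp
        then obtain r' where r': "r' \<in> carrier R" "\<tau> \<otimes> r = \<pi> \<otimes> r'" using \<tau>_mult by blast
        have "\<tau> \<odot>\<^bsub>M\<^esub> (r \<odot>\<^bsub>M\<^esub> w) = (\<pi> \<otimes> r') \<odot>\<^bsub>M\<^esub> w"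
          unfolding r'(2)[symmetric] using u(2) wM by (simp add: smult_assoc1)
        also have "\<dots> = r' \<odot>\<^bsub>M\<^esub> z" unfolding w(2) using r'(1) wM by (simp add: R.m_comm flip: smult_assoc1)
        finally have "\<tau> \<odot>\<^bsub>M\<^esub> x = \<tau> \<odot>\<^bsub>M\<^esub> u \<oplus>\<^bsub>M\<^esub> r' \<odot>\<^bsub>M\<^esub> z"
          unfolding xeq using uM u(2) wM by (simp add: smult_r_distr)
        moreover have "\<tau> \<odot>\<^bsub>M\<^esub> u \<in> A" "r' \<odot>\<^bsub>M\<^esub> z \<in> A" using submodule_smult[OF A(1)] u(1) r'(1) z by auto
        ultimately have "\<tau> \<odot>\<^bsub>M\<^esub> x \<in> A" using submodule_add[OF A(1)] by simp
        then show False using T_mem_if_smult_mem[OF A(1) x(1), of \<tau>] xA \<tau>_notin_P by simp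
      qed
      have "\<zero>\<^bsub>M\<^esub> = \<pi> \<odot>\<^bsub>M\<^esub> u \<oplus>\<^bsub>M\<^esub> \<pi> \<odot>\<^bsub>M\<^esub> (r \<odot>\<^bsub>M\<^esub> w)"
        using x(2) unfolding xeq using uM u(2) wM by (simp add: smult_r_distr)
      also have "\<pi> \<odot>\<^bsub>M\<^esub> (r \<odot>\<^bsub>M\<^esub> w) = r \<odot>\<^bsub>M\<^esub> z" unfolding w(2) using u(2) wM by (simp add: smult_swap)
      finally have "r \<odot>\<^bsub>M\<^esub> z = \<ominus>\<^bsub>M\<^esub> (\<pi> \<odot>\<^bsub>M\<^esub> u)"
        using uM u(2) AM[OF z] by (metis M.minus_equality M.a_comm M.minus_minus smult_closed \<pi>_closed)
      also have "\<dots> = \<pi> \<odot>\<^bsub>M\<^esub> (\<ominus>\<^bsub>M\<^esub> u)" using uM by (simp add: smult_r_minus)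
      finally have rz: "r \<odot>\<^bsub>M\<^esub> z = \<pi> \<odot>\<^bsub>M\<^esub> (\<ominus>\<^bsub>M\<^esub> u)" .
      have zT: "z \<in> T" using z AT by blast
      obtain v where v: "v \<in> carrier R" "v \<odot>\<^bsub>M\<^esub> (r \<odot>\<^bsub>M\<^esub> z) = z" using T_inverse[OF zT rP] .
      have "z = \<pi> \<odot>\<^bsub>M\<^esub> (v \<odot>\<^bsub>M\<^esub> (\<ominus>\<^bsub>M\<^esub> u))"
        using v(2) unfolding rz using smult_swap[of v \<pi> "\<ominus>\<^bsub>M\<^esub> u"] v(1) uM by simp
      moreover have "v \<odot>\<^bsub>M\<^esub> (\<ominus>\<^bsub>M\<^esub> u) \<in> A"
        by (rule submodule_smult[OF A(1) v(1) submoduleE(6)[OF A(1) u(1)]])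
      ultimately show ?thesis by (rule bexI)
    qed
  qed
  have inj: "relatively_injective A" by (rule primary_divisible_relatively_injective[OF A(1) AT divA])
  have rP: "r \<in> P" if r: "r \<in> carrier R" "r \<odot>\<^bsub>M\<^esub> x \<in> A" for r
    using T_mem_if_smult_mem[OF A(1) x(1), of r] r xA by blast
  show False
    by (rule no_twisted_cyclic_complement[OF inj xM x'A x'(3)])
      (use rP T_P_smult_eq_zero[OF x] T_P_smult_eq_zero[OF x'(1,2)] in auto)
qed

text \<open>A socle element of finite height makes \<open>T\<close> a cyclic summand; if all socle
  elements have infinite height, \<open>T\<close> is divisible, and divisibility forces both a
  simple socle and a torsion M.\<close>

lemma primary_component_cases:
  "(\<exists>n. cyclic_with_annihilator T (ideal_power R P n)) \<and> direct_summand R M T \<or>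
    pruefer_like \<pi> T \<and> torsion_part = carrier M"
proof (cases "T = {\<zero>\<^bsub>M\<^esub>}")
  case True
  have "cyclic_submodule \<zero>\<^bsub>M\<^esub> = {\<zero>\<^bsub>M\<^esub>}"
    unfolding cyclic_submodule_def by (auto intro!: exI[of _ \<zero>])
  \<comment> \<open>The zero component counts as cyclic, with exponent 0 because P^0 = R.\<close>
  then have "cyclic_with_annihilator T (ideal_power R P 0)"
    unfolding cyclic_with_annihilator_def True ideal_power_0 by (intro bexI[of _ "\<zero>\<^bsub>M\<^esub>"]) simp_all
  moreover have "complementary R M T (carrier M)"
    unfolding True by (rule complementaryI[OF zero_submodule carrier_is_submodule]) auto
  ultimately show ?thesis unfolding direct_summand_def by blast
next
  case False
  then obtain p where p: "p \<in> T" "p \<noteq> \<zero>\<^bsub>M\<^esub>" using submodule_zero[OF submodule_T] by blast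
  show ?thesis
  proof (cases "\<exists>x\<in>T. \<pi> \<odot>\<^bsub>M\<^esub> x = \<zero>\<^bsub>M\<^esub> \<and> (\<exists>n::nat.
      \<not> (\<exists>s\<in>carrier R - P. \<exists>z\<in>carrier M. s \<odot>\<^bsub>M\<^esub> x = \<pi> [^] n \<odot>\<^bsub>M\<^esub> z))")
    case True
    then obtain x n where x: "x \<in> T" "\<pi> \<odot>\<^bsub>M\<^esub> x = \<zero>\<^bsub>M\<^esub>"
      and n: "\<not> (\<exists>s\<in>carrier R - P. \<exists>z\<in>carrier M. s \<odot>\<^bsub>M\<^esub> x = \<pi> [^] (n::nat) \<odot>\<^bsub>M\<^esub> z)"
      by (elim bexE conjE exE)
    note xM = T_closed[OF x(1)]
    \<comment> \<open>\<open>H k\<close> says that x has height at least k at P; it holds at 0 and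
      fails at n, so it fails first right after some k.\<close>
    define H where "H k \<longleftrightarrow> (\<exists>s\<in>carrier R - P. \<exists>z\<in>carrier M. s \<odot>\<^bsub>M\<^esub> x = \<pi> [^] k \<odot>\<^bsub>M\<^esub> z)" for k :: nat
    have "\<one> \<odot>\<^bsub>M\<^esub> x = \<pi> [^] (0::nat) \<odot>\<^bsub>M\<^esub> x" using xM by simp
    then have H0: "H 0" unfolding H_def using one_notin_P xM by blast
    have "\<not> H n" unfolding H_def by (rule n)
    then obtain k where k: "H k" "\<not> H (Suc k)" using H0 by (induction n) auto
    have "x \<noteq> \<zero>\<^bsub>M\<^esub>"
    proof
      assume "x = \<zero>\<^bsub>M\<^esub>"
      then have "\<one> \<odot>\<^bsub>M\<^esub> x = \<pi> [^] n \<odot>\<^bsub>M\<^esub> \<zero>\<^bsub>M\<^esub>" by simp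
      then show False using n one_notin_P M.zero_closed by blast
    qed
    from finite_height_cyclic[OF x this k(1)[unfolded H_def] k(2)[unfolded H_def]] show ?thesis by blast
  next
    case False
    have div: "\<exists>y\<in>T. x = \<pi> \<odot>\<^bsub>M\<^esub> y" if "x \<in> T" for x
      by (rule divisible_if_socle_infinite_height[OF _ that]) (use False in blast)
    have "pruefer_like \<pi> T"
      unfolding pruefer_like_def
      using \<open>T \<noteq> {\<zero>\<^bsub>M\<^esub>}\<close> div divisible_primary_socle[OF div] by blast
    then show ?thesis using divisible_primary_torsion[OF div p] by blast
  qed
qed

end

section \<open>The torsion part and its complement\<close>

context dedekind_module
begin

lemma submodule_torsion_part: "submodule torsion_part R M"
proof (rule submoduleI')
  show "torsion_part \<subseteq> carrier M" unfolding torsion_part_def by blast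
  have "\<one> \<odot>\<^bsub>M\<^esub> \<zero>\<^bsub>M\<^esub> = \<zero>\<^bsub>M\<^esub>" by simp
  then show "\<zero>\<^bsub>M\<^esub> \<in> torsion_part" unfolding torsion_part_def using R.one_closed one_not_zero M.zero_closed by blast
  show "x \<oplus>\<^bsub>M\<^esub> y \<in> torsion_part" if xy: "x \<in> torsion_part" "y \<in> torsion_part" for x y
  proof -
    obtain r s where r: "r \<in> carrier R" "r \<noteq> \<zero>" "r \<odot>\<^bsub>M\<^esub> x = \<zero>\<^bsub>M\<^esub>"
      and s: "s \<in> carrier R" "s \<noteq> \<zero>" "s \<odot>\<^bsub>M\<^esub> y = \<zero>\<^bsub>M\<^esub>" using xy unfolding torsion_part_def by blast
    have c: "x \<in> carrier M" "y \<in> carrier M" using xy unfolding torsion_part_def by auto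
    have "(r \<otimes> s) \<odot>\<^bsub>M\<^esub> (x \<oplus>\<^bsub>M\<^esub> y) = s \<odot>\<^bsub>M\<^esub> (r \<odot>\<^bsub>M\<^esub> x) \<oplus>\<^bsub>M\<^esub> r \<odot>\<^bsub>M\<^esub> (s \<odot>\<^bsub>M\<^esub> y)"
      using c r(1) s(1) by (simp add: smult_r_distr R.m_comm flip: smult_assoc1)
    then have "(r \<otimes> s) \<odot>\<^bsub>M\<^esub> (x \<oplus>\<^bsub>M\<^esub> y) = \<zero>\<^bsub>M\<^esub>" unfolding r(3) s(3) using r s by simp
    moreover have "r \<otimes> s \<noteq> \<zero>" using r s integral by blast
    ultimately show ?thesis
      unfolding torsion_part_def using c r(1) s(1) R.m_closed M.add.m_closed by blast
  qed
  show "a \<odot>\<^bsub>M\<^esub> x \<in> torsion_part" if a: "a \<in> carrier R" and x: "x \<in> torsion_part" for a x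
  proof -
    obtain r where r: "r \<in> carrier R" "r \<noteq> \<zero>" "r \<odot>\<^bsub>M\<^esub> x = \<zero>\<^bsub>M\<^esub>" and c: "x \<in> carrier M"
      using x unfolding torsion_part_def by blast
    have "r \<odot>\<^bsub>M\<^esub> (a \<odot>\<^bsub>M\<^esub> x) = \<zero>\<^bsub>M\<^esub>" using smult_swap[OF r(1) a c] r(3) a by simp
    then show ?thesis unfolding torsion_part_def using r(1,2) a c smult_closed by blast
  qed
qed

lemma exists_module_at_prime:
  assumes "P \<in> nonzero_primes R"
  obtains \<pi> \<tau> where "module_at_prime R M P \<pi> \<tau>"
proof -
  obtain \<pi> \<tau> where "uniformized_prime R P \<pi> \<tau>" using exists_uniformizer[OF assms] by blast
  then have "module_at_prime R M P \<pi> \<tau>" by (intro module_at_prime.intro module_axioms)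
  then show ?thesis by (rule that)
qed

lemma submodule_primary_component: "P \<in> nonzero_primes R \<Longrightarrow> submodule (primary_component R M P) R M"
  using exists_module_at_prime module_at_prime.submodule_T by metis

lemma primary_component_subset_torsion_part:
  assumes P: "P \<in> nonzero_primes R" shows "primary_component R M P \<subseteq> torsion_part"
proof
  fix x assume x: "x \<in> primary_component R M P"
  obtain \<pi> \<tau> where "module_at_prime R M P \<pi> \<tau>" using exists_module_at_prime[OF P] .
  then interpret module_at_prime R M P \<pi> \<tau> .
  obtain n :: nat where n: "\<pi> [^] n \<odot>\<^bsub>M\<^esub> x = \<zero>\<^bsub>M\<^esub>" using T_\<pi>_pow[OF x] .
  have "\<pi> [^] n \<noteq> \<zero>" using \<pi>_nonzero by (induction n) (auto simp: integral_iff)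
  moreover have "\<pi> [^] n \<in> carrier R" by simp
  ultimately show "x \<in> torsion_part"
    unfolding torsion_part_def using n T_closed[OF x] by blast
qed

text \<open>A torsion element can be moved into the primary component at each prime by a factor
  outside that prime, and \<open>local_global\<close> glues. So the torsion part is generated by the
  primary components, without decomposing individual elements.\<close>

lemma torsion_part_subset:
  assumes N: "submodule N R M" and T: "\<And>P. P \<in> nonzero_primes R \<Longrightarrow> primary_component R M P \<subseteq> N"
  shows "torsion_part \<subseteq> N"
proof
  fix x assume x: "x \<in> torsion_part"
  then obtain c where c: "x \<in> carrier M" "c \<in> carrier R" "c \<noteq> \<zero>" "c \<odot>\<^bsub>M\<^esub> x = \<zero>\<^bsub>M\<^esub>"
    unfolding torsion_part_def by blast
  show "x \<in> N"
  proof (rule local_global[OF N c(1)])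
    fix P assume P: "P \<in> nonzero_primes R"
    obtain \<pi> \<tau> where "module_at_prime R M P \<pi> \<tau>" using exists_module_at_prime[OF P] .
    then interpret module_at_prime R M P \<pi> \<tau> .
    obtain s where "s \<in> carrier R - P" "s \<odot>\<^bsub>M\<^esub> x \<in> T" using torsion_localizes_to_T[OF c] .
    then show "\<exists>s\<in>carrier R - P. s \<odot>\<^bsub>M\<^esub> x \<in> N" using T[OF P] by blast
  qed
qed

end

context dedekind_baer_module
begin

text \<open>The property is applied to all endomorphisms with image in one primary component: their
  images add up to the torsion part. It remains to see that the summand D below it contains every
  primary component, so that D is the torsion part.\<close>

lemma torsion_part_summand:
  assumes cyc: "\<And>P. P \<in> nonzero_primes R \<Longrightarrow>
    (\<exists>n. cyclic_with_annihilator (primary_component R M P) (ideal_power R P n)) \<and>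
    direct_summand R M (primary_component R M P)"
  obtains L where "complementary R M torsion_part L"
proof -
  define F where "F = {f \<in> mod_hom R M M. \<exists>P\<in>nonzero_primes R. f ` carrier M \<subseteq> primary_component R M P}"
  define N where "N = submodule_sum R M F (\<lambda>f. f ` carrier M)"
  have F: "F \<subseteq> mod_hom R M M" unfolding F_def by blast
  have Ns: "submodule N R M" unfolding N_def by (rule submodule_sum_images[OF F])
  have N1: "N \<subseteq> torsion_part" unfolding N_def
  proof (rule submodule_sum_least[OF submodule_torsion_part])
    fix f assume "f \<in> F"
    then obtain P where P: "P \<in> nonzero_primes R" "f ` carrier M \<subseteq> primary_component R M P"
      unfolding F_def by blast
    show "f ` carrier M \<subseteq> torsion_part" using primary_component_subset_torsion_part[OF P(1)] P(2) by simp
  qed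
  have N2: "primary_component R M P \<subseteq> N" if P: "P \<in> nonzero_primes R" for P
  proof
    fix x assume x: "x \<in> primary_component R M P"
    obtain C where C: "complementary R M (primary_component R M P) C"
      using cyc[OF P] unfolding direct_summand_def by blast
    obtain f where f: "f \<in> mod_hom R M M" "\<forall>x\<in>primary_component R M P. f x = x"
      "\<forall>x\<in>C. f x = \<zero>\<^bsub>M\<^esub>" "\<forall>x\<in>carrier M. f x \<in> primary_component R M P" "\<forall>x\<in>carrier M. x \<ominus>\<^bsub>M\<^esub> f x \<in> C"
      by (rule complementary_projection[OF C])
    have "f ` carrier M \<subseteq> primary_component R M P" using f(4) by blast
    then have "f \<in> F" unfolding F_def using f(1) P by blast
    then have "f ` carrier M \<subseteq> N" unfolding N_def
      by (rule submodule_sum_upper[of f F "\<lambda>f. f ` carrier M"])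
    moreover have "x \<in> carrier M" using submodule_subset[OF complementaryE(1)[OF C] x] .
    ultimately have "f x \<in> N" by blast
    then show "x \<in> N" using f(2) x by simp
  qed
  obtain D E where D: "D \<subseteq> N" "complementary R M D E" "\<forall>h\<in>mod_hom R M M. h ` D \<subseteq> D"
    "\<forall>X. submodule X R M \<and> D \<subseteq> X \<and> N <+>\<^bsub>M\<^esub> X = carrier M \<longrightarrow> X = carrier M"
    by (rule dual_strongly_self_CS_BaerE[OF baer F, folded N_def])
  note cE = complementaryE[OF D(2)]
  obtain g where g: "g \<in> mod_hom R M M" "\<forall>x\<in>D. g x = x" "\<forall>x\<in>E. g x = \<zero>\<^bsub>M\<^esub>"
    "\<forall>x\<in>carrier M. g x \<in> D" "\<forall>x\<in>carrier M. x \<ominus>\<^bsub>M\<^esub> g x \<in> E"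
    by (rule complementary_projection[OF D(2)])
  have TD: "primary_component R M P \<subseteq> D" if P: "P \<in> nonzero_primes R" for P
  proof -
    obtain \<pi> \<tau> where "module_at_prime R M P \<pi> \<tau>" using exists_module_at_prime[OF P] .
    then interpret module_at_prime R M P \<pi> \<tau> .
    obtain C where C: "complementary R M T C" using cyc[OF P] unfolding direct_summand_def by blast
    obtain y where y: "y \<in> carrier M" "T = cyclic_submodule y"
      using cyc[OF P] unfolding cyclic_with_annihilator_def by blast
    have yT: "y \<in> T" unfolding y(2) by (rule generator_in_cyclic_submodule[OF y(1)])
    \<comment> \<open>The projection \<open>g\<close> onto D acts on the generator y as a scalar a.
      One of a and 1 - a is outside P, hence invertible on \<open>T\<close>, so \<open>T\<close>
      lies in D or in E.\<close>
    have "g y \<in> T" by (rule summand_invariant[OF C g(1) yT])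
    then obtain a where a: "a \<in> carrier R" "g y = a \<odot>\<^bsub>M\<^esub> y" unfolding y(2) by (rule cyclic_submoduleE)
    show ?thesis
    proof (cases "a \<in> P")
      case False
      have "a \<odot>\<^bsub>M\<^esub> y \<in> D" using g(4) y(1) a(2) by metis
      then have "y \<in> D" using T_mem_if_smult_mem[OF cE(1) yT, of a] False a(1) by simp
      then show ?thesis unfolding y(2) by (rule cyclic_submodule_subset[OF cE(1)])
    next
      case True
      have "(\<one> \<ominus> a) \<odot>\<^bsub>M\<^esub> y = y \<ominus>\<^bsub>M\<^esub> g y" using a y(1) by (simp add: smult_diff_left)
      then have "(\<one> \<ominus> a) \<odot>\<^bsub>M\<^esub> y \<in> E" using g(5) y(1) by simp
      moreover have "\<one> \<ominus> a \<in> carrier R - P"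
      proof -
        have "\<one> = (\<one> \<ominus> a) \<oplus> a" using a(1) by (simp add: R.minus_eq R.a_assoc R.l_neg)
        then have "\<one> \<ominus> a \<notin> P" using True P.a_closed[of "\<one> \<ominus> a" a] one_notin_P by auto
        then show ?thesis using a(1) by simp
      qed
      ultimately have "y \<in> E" using T_mem_if_smult_mem[OF cE(2) yT] by blast
      then have TE: "T \<subseteq> E" unfolding y(2) by (rule cyclic_submodule_subset[OF cE(2)])
      note cC = complementaryE[OF C]
      have CE: "submodule (C \<inter> E) R M" by (rule submodule_Int[OF cC(2) cE(2)])
      define X where "X = D <+>\<^bsub>M\<^esub> (C \<inter> E)"
      have X: "submodule X R M" unfolding X_def by (rule submodule_set_add[OF cE(1) CE])
      have DX: "D \<subseteq> X" unfolding X_def by (rule subset_set_add_left[OF cE(1) CE])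
      have "carrier M \<subseteq> N <+>\<^bsub>M\<^esub> X"
      proof
        fix m assume m: "m \<in> carrier M"
        obtain d e where de: "d \<in> D" "e \<in> E" "m = d \<oplus>\<^bsub>M\<^esub> e" using cE(4)[OF m] by (elim bexE)
        have eM: "e \<in> carrier M" and dM: "d \<in> carrier M"
          using submodule_subset[OF cE(2) de(2)] submodule_subset[OF cE(1) de(1)] by auto
        obtain t c where tc: "t \<in> T" "c \<in> C" "e = t \<oplus>\<^bsub>M\<^esub> c" using cC(4)[OF eM] by (elim bexE)
        have cM: "c \<in> carrier M" using submodule_subset[OF cC(2) tc(2)] .
        have "c \<in> E" using submodule_add_cancel[OF cE(2), of t c] TE tc de(2) cM by auto
        then have "d \<oplus>\<^bsub>M\<^esub> c \<in> X" unfolding X_def using de(1) tc(2) by (intro set_addI) auto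
        moreover have "t \<in> N" using N2[OF P] tc(1) by blast
        moreover have "m = t \<oplus>\<^bsub>M\<^esub> (d \<oplus>\<^bsub>M\<^esub> c)"
          unfolding de(3) tc(3) using dM cM T_closed[OF tc(1)] by (simp add: M.a_lcomm)
        ultimately show "m \<in> N <+>\<^bsub>M\<^esub> X" by (simp add: set_addI)
      qed
      then have "N <+>\<^bsub>M\<^esub> X = carrier M" using submodule_subset[OF submodule_set_add[OF Ns X]] by blast
      then have "X = carrier M" using D(4) X DX by blast
      then have "y \<in> X" using y(1) by simp
      then obtain d c where dc: "d \<in> D" "c \<in> C \<inter> E" "y = d \<oplus>\<^bsub>M\<^esub> c" unfolding X_def by (rule set_addE)
      have dM: "d \<in> carrier M" and cM: "c \<in> carrier M"
        using submodule_subset[OF cE(1) dc(1)] submodule_subset[OF CE dc(2)] by auto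
      have "d = y \<ominus>\<^bsub>M\<^esub> c" unfolding dc(3) using dM cM by simp
      then have "d \<in> E" using submodule_diff[OF cE(2) \<open>y \<in> E\<close>, of c] dc(2) by simp
      then have "d = \<zero>\<^bsub>M\<^esub>" using cE(3) dc(1) by blast
      then have "y = c" using dc(3) cM by simp
      then have "y = \<zero>\<^bsub>M\<^esub>" using cC(3)[OF yT] dc(2) by simp
      then have "y \<in> D" using submodule_zero[OF cE(1)] by simp
      then show ?thesis unfolding y(2) by (rule cyclic_submodule_subset[OF cE(1)])
    qed
  qed
  have "torsion_part = D"
    using torsion_part_subset[OF cE(1) TD] D(1) N1 by blast
  then show ?thesis using that[of E] D(2) by simp
qed

text \<open>The elements of L dependent on b form a divisible torsion-free submodule A. An x in L
  outside A has no non-zero multiple in A, so it could be twisted by b.\<close>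

lemma divisible_complement_rank_one:
  assumes c: "complementary R M torsion_part L" and L: "L \<noteq> {\<zero>\<^bsub>M\<^esub>}"
    and div: "\<And>r x. r \<in> carrier R \<Longrightarrow> r \<noteq> \<zero> \<Longrightarrow> x \<in> L \<Longrightarrow> \<exists>y\<in>L. x = r \<odot>\<^bsub>M\<^esub> y"
  shows "rank_one_divisible L"
proof -
  note cE = complementaryE[OF c]
  note LM = submodule_subset[OF cE(2)]
  have free: "x = \<zero>\<^bsub>M\<^esub>" if "r \<in> carrier R" "r \<noteq> \<zero>" "x \<in> L" "r \<odot>\<^bsub>M\<^esub> x = \<zero>\<^bsub>M\<^esub>" for r x
  proof -
    have "x \<in> torsion_part" unfolding torsion_part_def using that LM by blast
    then show ?thesis using cE(3) that(3) by blast
  qed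
  have rank: "\<exists>a\<in>carrier R - {\<zero>}. \<exists>r\<in>carrier R. a \<odot>\<^bsub>M\<^esub> x = r \<odot>\<^bsub>M\<^esub> b"
    if x: "x \<in> L" and b: "b \<in> L" "b \<noteq> \<zero>\<^bsub>M\<^esub>" for x b
  proof -
    define A where "A = {l \<in> L. \<exists>a\<in>carrier R - {\<zero>}. \<exists>r\<in>carrier R. a \<odot>\<^bsub>M\<^esub> l = r \<odot>\<^bsub>M\<^esub> b}"
    have bM: "b \<in> carrier M" using LM[OF b(1)] .
    have AI: "l \<in> A" if "l \<in> L" "a \<in> carrier R" "a \<noteq> \<zero>" "r \<in> carrier R" "a \<odot>\<^bsub>M\<^esub> l = r \<odot>\<^bsub>M\<^esub> b" for l a r
      unfolding A_def using that by blast
    have AE: "\<exists>a r. a \<in> carrier R \<and> a \<noteq> \<zero> \<and> r \<in> carrier R \<and> a \<odot>\<^bsub>M\<^esub> l = r \<odot>\<^bsub>M\<^esub> b" if "l \<in> A" for l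
      using that unfolding A_def by blast
    have AL: "l \<in> L" if "l \<in> A" for l using that unfolding A_def by blast
    have A: "submodule A R M"
    proof (rule submoduleI')
      show "A \<subseteq> carrier M" using AL LM by blast
      show "\<zero>\<^bsub>M\<^esub> \<in> A" by (rule AI[of _ \<one> \<zero>]) (use submodule_zero[OF cE(2)] bM in auto)
      show "l \<oplus>\<^bsub>M\<^esub> l' \<in> A" if ll: "l \<in> A" "l' \<in> A" for l l'
      proof -
        obtain a r where a: "a \<in> carrier R" "a \<noteq> \<zero>" "r \<in> carrier R" "a \<odot>\<^bsub>M\<^esub> l = r \<odot>\<^bsub>M\<^esub> b"
          using AE[OF ll(1)] by (elim exE conjE)
        obtain a' r' where a': "a' \<in> carrier R" "a' \<noteq> \<zero>" "r' \<in> carrier R" "a' \<odot>\<^bsub>M\<^esub> l' = r' \<odot>\<^bsub>M\<^esub> b"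
          using AE[OF ll(2)] by (elim exE conjE)
        have lM: "l \<in> carrier M" "l' \<in> carrier M" using ll AL LM by auto
        show ?thesis
        proof (rule AI)
          show "l \<oplus>\<^bsub>M\<^esub> l' \<in> L" using submodule_add[OF cE(2)] ll AL by blast
          show "a \<otimes> a' \<in> carrier R" "a' \<otimes> r \<oplus> a \<otimes> r' \<in> carrier R" using a a' by auto
          show "a \<otimes> a' \<noteq> \<zero>" using a a' integral by blast
          have "(a \<otimes> a') \<odot>\<^bsub>M\<^esub> (l \<oplus>\<^bsub>M\<^esub> l') = a' \<odot>\<^bsub>M\<^esub> (a \<odot>\<^bsub>M\<^esub> l) \<oplus>\<^bsub>M\<^esub> a \<odot>\<^bsub>M\<^esub> (a' \<odot>\<^bsub>M\<^esub> l')"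
            using a(1) a'(1) lM by (simp add: smult_r_distr R.m_comm flip: smult_assoc1)
          then show "(a \<otimes> a') \<odot>\<^bsub>M\<^esub> (l \<oplus>\<^bsub>M\<^esub> l') = (a' \<otimes> r \<oplus> a \<otimes> r') \<odot>\<^bsub>M\<^esub> b"
            unfolding a(4) a'(4) using a(1,3) a'(1,3) bM by (simp add: smult_l_distr smult_assoc1)
        qed
      qed
      show "s \<odot>\<^bsub>M\<^esub> l \<in> A" if s: "s \<in> carrier R" and l: "l \<in> A" for s l
      proof -
        obtain a r where a: "a \<in> carrier R" "a \<noteq> \<zero>" "r \<in> carrier R" "a \<odot>\<^bsub>M\<^esub> l = r \<odot>\<^bsub>M\<^esub> b"
          using AE[OF l] by (elim exE conjE)
        show ?thesis
        proof (rule AI[OF _ a(1,2)])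
          show "s \<odot>\<^bsub>M\<^esub> l \<in> L" using submodule_smult[OF cE(2) s AL[OF l]] .
          show "s \<otimes> r \<in> carrier R" using s a by simp
          show "a \<odot>\<^bsub>M\<^esub> (s \<odot>\<^bsub>M\<^esub> l) = (s \<otimes> r) \<odot>\<^bsub>M\<^esub> b"
            using smult_swap[OF a(1) s LM[OF AL[OF l]]] a s bM by (simp add: smult_assoc1)
        qed
      qed
    qed
    \<comment> \<open>A is closed under division inside L; this makes it inherit divisibility from L
      and shows that R x meets A trivially for x outside A.\<close>
    have mulA: "l \<in> A" if l: "l \<in> L" "r \<in> carrier R" "r \<noteq> \<zero>" "r \<odot>\<^bsub>M\<^esub> l \<in> A" for l r
    proof -
      obtain a q where a: "a \<in> carrier R" "a \<noteq> \<zero>" "q \<in> carrier R" "a \<odot>\<^bsub>M\<^esub> (r \<odot>\<^bsub>M\<^esub> l) = q \<odot>\<^bsub>M\<^esub> b"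
        using AE[OF l(4)] by (elim exE conjE)
      show ?thesis
      proof (rule AI[OF l(1)])
        show "a \<otimes> r \<noteq> \<zero>" using a l integral by blast
        show "(a \<otimes> r) \<odot>\<^bsub>M\<^esub> l = q \<odot>\<^bsub>M\<^esub> b" using a l LM by (simp add: smult_assoc1)
      qed (use a l in auto)
    qed
    have inj: "relatively_injective A"
    proof (rule torsion_free_divisible_relatively_injective[OF A])
      show "z = \<zero>\<^bsub>M\<^esub>" if "r \<in> carrier R" "r \<noteq> \<zero>" "z \<in> A" "r \<odot>\<^bsub>M\<^esub> z = \<zero>\<^bsub>M\<^esub>" for r z
        using free that AL by blast
      show "\<exists>y\<in>A. z = r \<odot>\<^bsub>M\<^esub> y" if r: "r \<in> carrier R" "r \<noteq> \<zero>" and z: "z \<in> A" for r z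
      proof -
        obtain y where y: "y \<in> L" "z = r \<odot>\<^bsub>M\<^esub> y" using div[OF r AL[OF z]] by (elim bexE)
        have "y \<in> A" using mulA[OF y(1) r] z y(2) by simp
        with y(2) show ?thesis by (rule bexI)
      qed
    qed
    have bA: "b \<in> A" by (rule AI[OF b(1), of \<one> \<one>]) auto
    have "x \<in> A"
    proof (rule ccontr)
      assume xA: "x \<notin> A"
      have zero: "r = \<zero>" if "r \<in> carrier R" "r \<odot>\<^bsub>M\<^esub> x \<in> A" for r
        using mulA[OF x that(1) _ that(2)] xA by blast
      show False
      proof (rule no_twisted_cyclic_complement[OF inj LM[OF x] bA b(2)])
        show "r \<odot>\<^bsub>M\<^esub> x = \<zero>\<^bsub>M\<^esub>" if "r \<in> carrier R" "r \<odot>\<^bsub>M\<^esub> x \<in> A" for r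
          using zero[OF that] LM[OF x] by simp
        show "r \<odot>\<^bsub>M\<^esub> b = \<zero>\<^bsub>M\<^esub>" if "r \<in> carrier R" "r \<odot>\<^bsub>M\<^esub> x \<in> A" for r
          using zero[OF that] bM by simp
      qed
    qed
    then show ?thesis unfolding A_def by blast
  qed
  show ?thesis unfolding rank_one_divisible_def using L free div rank by blast
qed

end

context dedekind_baer_module
begin

lemma nondivisible_complement_free_cyclic:
  assumes c: "complementary R M torsion_part L"
    and r0: "r0 \<in> carrier R" "r0 \<noteq> \<zero>" and x0: "x0 \<in> L" "\<not> (\<exists>y\<in>L. x0 = r0 \<odot>\<^bsub>M\<^esub> y)"
  shows "\<exists>e\<in>carrier M. carrier M = cyclic_submodule e \<and>
    (\<forall>a\<in>carrier R. a \<odot>\<^bsub>M\<^esub> e = \<zero>\<^bsub>M\<^esub> \<longrightarrow> a = \<zero>)"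
proof -
  note cE = complementaryE[OF c]
  note LM = submodule_subset[OF cE(2)]
  have free: "x = \<zero>\<^bsub>M\<^esub>" if "r \<in> carrier R" "r \<noteq> \<zero>" "x \<in> L" "r \<odot>\<^bsub>M\<^esub> x = \<zero>\<^bsub>M\<^esub>" for r x
  proof -
    have "x \<in> torsion_part" unfolding torsion_part_def using that LM by blast
    then show ?thesis using cE(3) that(3) by blast
  qed
  have rL: "submodule {r0 \<odot>\<^bsub>M\<^esub> y | y. y \<in> L} R M"
  proof (rule submoduleI')
    show "{r0 \<odot>\<^bsub>M\<^esub> y | y. y \<in> L} \<subseteq> carrier M" using LM r0 by auto
    have "\<zero>\<^bsub>M\<^esub> = r0 \<odot>\<^bsub>M\<^esub> \<zero>\<^bsub>M\<^esub>" using r0 by simp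
    then show "\<zero>\<^bsub>M\<^esub> \<in> {r0 \<odot>\<^bsub>M\<^esub> y | y. y \<in> L}" using submodule_zero[OF cE(2)] by blast
    show "u \<oplus>\<^bsub>M\<^esub> v \<in> {r0 \<odot>\<^bsub>M\<^esub> y | y. y \<in> L}"
      if uv: "u \<in> {r0 \<odot>\<^bsub>M\<^esub> y | y. y \<in> L}" "v \<in> {r0 \<odot>\<^bsub>M\<^esub> y | y. y \<in> L}" for u v
    proof -
      obtain a b where ab: "a \<in> L" "b \<in> L" "u = r0 \<odot>\<^bsub>M\<^esub> a" "v = r0 \<odot>\<^bsub>M\<^esub> b" using uv by blast
      then have "u \<oplus>\<^bsub>M\<^esub> v = r0 \<odot>\<^bsub>M\<^esub> (a \<oplus>\<^bsub>M\<^esub> b)" using LM r0 by (simp add: smult_r_distr)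
      then show ?thesis using submodule_add[OF cE(2) ab(1,2)] by blast
    qed
    show "s \<odot>\<^bsub>M\<^esub> u \<in> {r0 \<odot>\<^bsub>M\<^esub> y | y. y \<in> L}"
      if s: "s \<in> carrier R" and u: "u \<in> {r0 \<odot>\<^bsub>M\<^esub> y | y. y \<in> L}" for s u
    proof -
      obtain a where a: "a \<in> L" "u = r0 \<odot>\<^bsub>M\<^esub> a" using u by blast
      then have "s \<odot>\<^bsub>M\<^esub> u = r0 \<odot>\<^bsub>M\<^esub> (s \<odot>\<^bsub>M\<^esub> a)" using smult_swap[OF s r0(1) LM[OF a(1)]] by simp
      then show ?thesis using submodule_smult[OF cE(2) s a(1)] by blast
    qed
  qed
  have "x0 \<notin> {r0 \<odot>\<^bsub>M\<^esub> y | y. y \<in> L}" using x0(2) by blast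
  then obtain P where P: "P \<in> nonzero_primes R"
    and noloc: "\<not> (\<exists>s\<in>carrier R - P. s \<odot>\<^bsub>M\<^esub> x0 \<in> {r0 \<odot>\<^bsub>M\<^esub> y | y. y \<in> L})"
    using local_global[OF rL LM[OF x0(1)]] by blast
  obtain \<pi> \<tau> where "module_at_prime R M P \<pi> \<tau>" using exists_module_at_prime[OF P] .
  then interpret module_at_prime R M P \<pi> \<tau> .
  \<comment> \<open>\<open>W\<close> is written as the elements of L divisible by
    \<open>\<pi>\<close> locally at P. It turns out to be PL, the sum of the images in
    \<open>N\<close> below.\<close>
  define W where "W = {z \<in> L. \<exists>s\<in>carrier R - P. \<exists>w\<in>L. s \<odot>\<^bsub>M\<^esub> z = \<pi> \<odot>\<^bsub>M\<^esub> w}"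
  have WI: "z \<in> W" if "z \<in> L" "s \<in> carrier R - P" "w \<in> L" "s \<odot>\<^bsub>M\<^esub> z = \<pi> \<odot>\<^bsub>M\<^esub> w" for z s w
    unfolding W_def using that by blast
  have WE: "\<exists>s w. s \<in> carrier R - P \<and> w \<in> L \<and> s \<odot>\<^bsub>M\<^esub> z = \<pi> \<odot>\<^bsub>M\<^esub> w" if "z \<in> W" for z
    using that unfolding W_def by blast
  have WL: "z \<in> L" if "z \<in> W" for z using that unfolding W_def by blast
  have W: "submodule W R M"
  proof (rule submoduleI')
    show "W \<subseteq> carrier M" using WL LM by blast
    show "\<zero>\<^bsub>M\<^esub> \<in> W" by (rule WI[OF _ one_notin_P, of _ "\<zero>\<^bsub>M\<^esub>"]) (use submodule_zero[OF cE(2)] in auto)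
    show "a \<oplus>\<^bsub>M\<^esub> b \<in> W" if ab: "a \<in> W" "b \<in> W" for a b
    proof -
      obtain s v where s: "s \<in> carrier R - P" "v \<in> L" "s \<odot>\<^bsub>M\<^esub> a = \<pi> \<odot>\<^bsub>M\<^esub> v" using WE[OF ab(1)] by (elim exE conjE)
      obtain t w where t: "t \<in> carrier R - P" "w \<in> L" "t \<odot>\<^bsub>M\<^esub> b = \<pi> \<odot>\<^bsub>M\<^esub> w" using WE[OF ab(2)] by (elim exE conjE)
      have cl: "a \<in> carrier M" "b \<in> carrier M" "v \<in> carrier M" "w \<in> carrier M" "s \<in> carrier R" "t \<in> carrier R"
        using ab WL LM s t by auto
      show ?thesis
      proof (rule WI)
        show "a \<oplus>\<^bsub>M\<^esub> b \<in> L" using submodule_add[OF cE(2)] WL ab by blast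
        show "s \<otimes> t \<in> carrier R - P" by (rule mult_notin_P[OF s(1) t(1)])
        show "t \<odot>\<^bsub>M\<^esub> v \<oplus>\<^bsub>M\<^esub> s \<odot>\<^bsub>M\<^esub> w \<in> L"
          using submodule_add[OF cE(2)] submodule_smult[OF cE(2)] cl s(2) t(2) by blast
        have "(s \<otimes> t) \<odot>\<^bsub>M\<^esub> (a \<oplus>\<^bsub>M\<^esub> b) = t \<odot>\<^bsub>M\<^esub> (s \<odot>\<^bsub>M\<^esub> a) \<oplus>\<^bsub>M\<^esub> s \<odot>\<^bsub>M\<^esub> (t \<odot>\<^bsub>M\<^esub> b)"
          using cl by (simp add: smult_r_distr R.m_comm flip: smult_assoc1)
        then show "(s \<otimes> t) \<odot>\<^bsub>M\<^esub> (a \<oplus>\<^bsub>M\<^esub> b) = \<pi> \<odot>\<^bsub>M\<^esub> (t \<odot>\<^bsub>M\<^esub> v \<oplus>\<^bsub>M\<^esub> s \<odot>\<^bsub>M\<^esub> w)"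
          unfolding s(3) t(3) using cl by (simp add: smult_r_distr smult_swap[of _ \<pi>])
      qed
    qed
    show "r \<odot>\<^bsub>M\<^esub> a \<in> W" if r: "r \<in> carrier R" and a: "a \<in> W" for r a
    proof -
      obtain s v where s: "s \<in> carrier R - P" "v \<in> L" "s \<odot>\<^bsub>M\<^esub> a = \<pi> \<odot>\<^bsub>M\<^esub> v" using WE[OF a] by (elim exE conjE)
      have cl: "a \<in> carrier M" "v \<in> carrier M" "s \<in> carrier R" using a WL LM s by auto
      show ?thesis
      proof (rule WI[OF _ s(1)])
        show "r \<odot>\<^bsub>M\<^esub> a \<in> L" "r \<odot>\<^bsub>M\<^esub> v \<in> L" using submodule_smult[OF cE(2) r] WL[OF a] s(2) by auto
        show "s \<odot>\<^bsub>M\<^esub> (r \<odot>\<^bsub>M\<^esub> a) = \<pi> \<odot>\<^bsub>M\<^esub> (r \<odot>\<^bsub>M\<^esub> v)"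
          using smult_swap[of s r a] smult_swap[of r \<pi> v] s(3) cl r by simp
      qed
    qed
  qed
  have PL: "q \<odot>\<^bsub>M\<^esub> z \<in> W" if q: "q \<in> P" and z: "z \<in> L" for q z
  proof -
    have qR: "q \<in> carrier R" using q by (rule P.Icarr)
    obtain q' where q': "q' \<in> carrier R" "\<tau> \<otimes> q = \<pi> \<otimes> q'" using \<tau>_mult[OF q] by blast
    show ?thesis
    proof (rule WI)
      show "q \<odot>\<^bsub>M\<^esub> z \<in> L" "q' \<odot>\<^bsub>M\<^esub> z \<in> L" using submodule_smult[OF cE(2) _ z] qR q'(1) by auto
      show "\<tau> \<in> carrier R - P" using \<tau>_notin_P by simp
      show "\<tau> \<odot>\<^bsub>M\<^esub> (q \<odot>\<^bsub>M\<^esub> z) = \<pi> \<odot>\<^bsub>M\<^esub> (q' \<odot>\<^bsub>M\<^esub> z)"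
        using q'(1) qR LM[OF z] by (simp add: q'(2) flip: smult_assoc1)
    qed
  qed
  have Wsat: "z \<in> W" if z: "z \<in> L" and s: "s \<in> carrier R - P" "s \<odot>\<^bsub>M\<^esub> z \<in> W" for z s
  proof -
    obtain t v where t: "t \<in> carrier R - P" "v \<in> L" "t \<odot>\<^bsub>M\<^esub> (s \<odot>\<^bsub>M\<^esub> z) = \<pi> \<odot>\<^bsub>M\<^esub> v"
      using WE[OF s(2)] by (elim exE conjE)
    show ?thesis
      by (rule WI[OF z mult_notin_P[OF t(1) s(1)] t(2)]) (use t s z LM in \<open>simp add: smult_assoc1\<close>)
  qed
  \<comment> \<open>If all of L were divisible by \<open>\<pi>\<close> at P, then by iteration it
    would be divisible by \<open>\<pi>\<close>^n, and by \<open>valuation\<close> also by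
    \<open>r0\<close>, against the choice of P.\<close>
  have "\<exists>e\<in>L. e \<notin> W"
  proof (rule ccontr)
    assume "\<not> (\<exists>e\<in>L. e \<notin> W)"
    then have all: "z \<in> W" if "z \<in> L" for z using that by blast
    have pow: "\<exists>s\<in>carrier R - P. \<exists>w\<in>L. s \<odot>\<^bsub>M\<^esub> x0 = \<pi> [^] n \<odot>\<^bsub>M\<^esub> w" for n :: nat
    proof (induction n)
      case 0
      have "\<one> \<odot>\<^bsub>M\<^esub> x0 = \<pi> [^] (0::nat) \<odot>\<^bsub>M\<^esub> x0" using LM[OF x0(1)] by simp
      then show ?case using one_notin_P x0(1) by blast
    next
      case (Suc n)
      then obtain s w where s: "s \<in> carrier R - P" "w \<in> L" "s \<odot>\<^bsub>M\<^esub> x0 = \<pi> [^] n \<odot>\<^bsub>M\<^esub> w" by (elim bexE)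
      obtain t v where t: "t \<in> carrier R - P" "v \<in> L" "t \<odot>\<^bsub>M\<^esub> w = \<pi> \<odot>\<^bsub>M\<^esub> v"
        using WE[OF all[OF s(2)]] by (elim exE conjE)
      have cl: "w \<in> carrier M" "v \<in> carrier M" "x0 \<in> carrier M" "s \<in> carrier R" "t \<in> carrier R"
        using LM s t x0 by auto
      have "(t \<otimes> s) \<odot>\<^bsub>M\<^esub> x0 = t \<odot>\<^bsub>M\<^esub> (\<pi> [^] n \<odot>\<^bsub>M\<^esub> w)" unfolding s(3)[symmetric] using cl by (intro smult_assoc1)
      also have "\<dots> = \<pi> [^] n \<odot>\<^bsub>M\<^esub> (t \<odot>\<^bsub>M\<^esub> w)" using cl by (intro smult_swap) auto
      also have "\<dots> = \<pi> [^] Suc n \<odot>\<^bsub>M\<^esub> v" unfolding t(3) using cl by (simp flip: smult_assoc1)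
      finally have "(t \<otimes> s) \<odot>\<^bsub>M\<^esub> x0 = \<pi> [^] Suc n \<odot>\<^bsub>M\<^esub> v" .
      then show ?case using mult_notin_P[OF t(1) s(1)] t(2) by blast
    qed
    obtain s t n where s: "s \<in> carrier R - P" and t: "t \<in> carrier R - P" and eq: "s \<otimes> r0 = t \<otimes> \<pi> [^] (n::nat)"
      using valuation[OF r0] by (elim bexE exE)
    obtain u w where u: "u \<in> carrier R - P" "w \<in> L" "u \<odot>\<^bsub>M\<^esub> x0 = \<pi> [^] n \<odot>\<^bsub>M\<^esub> w"
      using pow[of n] by (elim bexE)
    have cl: "w \<in> carrier M" "x0 \<in> carrier M" "s \<in> carrier R" "t \<in> carrier R" "u \<in> carrier R"
      using LM s t u x0 by auto
    have "(t \<otimes> u) \<odot>\<^bsub>M\<^esub> x0 = t \<odot>\<^bsub>M\<^esub> (\<pi> [^] n \<odot>\<^bsub>M\<^esub> w)" unfolding u(3)[symmetric] using cl by (intro smult_assoc1)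
    also have "\<dots> = (s \<otimes> r0) \<odot>\<^bsub>M\<^esub> w" unfolding eq using cl by (simp add: smult_assoc1)
    also have "\<dots> = r0 \<odot>\<^bsub>M\<^esub> (s \<odot>\<^bsub>M\<^esub> w)" using cl r0(1) by (simp add: R.m_comm flip: smult_assoc1)
    finally have "(t \<otimes> u) \<odot>\<^bsub>M\<^esub> x0 = r0 \<odot>\<^bsub>M\<^esub> (s \<odot>\<^bsub>M\<^esub> w)" .
    moreover have "s \<odot>\<^bsub>M\<^esub> w \<in> L" by (rule submodule_smult[OF cE(2) cl(3) u(2)])
    ultimately show False using noloc mult_notin_P[OF t u(1)] by blast
  qed
  then obtain e where e: "e \<in> L" "e \<notin> W" by blast
  note eM = LM[OF e(1)]
  have eP: "r \<in> P" if "r \<in> carrier R" "r \<odot>\<^bsub>M\<^esub> e \<in> W" for r using Wsat[OF e(1), of r] that e(2) by blast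
  obtain f where f: "f \<in> mod_hom R M M" "\<forall>x\<in>L. f x = x" "\<forall>x\<in>torsion_part. f x = \<zero>\<^bsub>M\<^esub>"
    "\<forall>x\<in>carrier M. f x \<in> L" "\<forall>x\<in>carrier M. x \<ominus>\<^bsub>M\<^esub> f x \<in> torsion_part"
    by (rule complementary_projection[OF complementary_sym[OF c]])
  \<comment> \<open>Multiplication by a in P, composed with the projection to L: the images add up
    to PL.\<close>
  define F where "F = {(\<lambda>x. a \<odot>\<^bsub>M\<^esub> f x) | a. a \<in> P}"
  define N where "N = submodule_sum R M F (\<lambda>f. f ` carrier M)"
  have F: "F \<subseteq> mod_hom R M M"
  proof
    fix h assume "h \<in> F"
    then obtain a where a: "a \<in> P" "h = (\<lambda>x. a \<odot>\<^bsub>M\<^esub> f x)" unfolding F_def by blast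
    have aR: "a \<in> carrier R" using a(1) by (rule P.Icarr)
    have fM: "f x \<in> carrier M" if "x \<in> carrier M" for x using mod_hom_closed[OF f(1) that] .
    show "h \<in> mod_hom R M M" unfolding a(2)
    proof (rule mod_homI)
      show "a \<odot>\<^bsub>M\<^esub> f x \<in> carrier M" if "x \<in> carrier M" for x using fM[OF that] aR by simp
      show "a \<odot>\<^bsub>M\<^esub> f (x \<oplus>\<^bsub>M\<^esub> y) = a \<odot>\<^bsub>M\<^esub> f x \<oplus>\<^bsub>M\<^esub> a \<odot>\<^bsub>M\<^esub> f y" if "x \<in> carrier M" "y \<in> carrier M" for x y
        using mod_hom_add[OF f(1) that] fM that aR by (simp add: smult_r_distr)
      show "a \<odot>\<^bsub>M\<^esub> f (b \<odot>\<^bsub>M\<^esub> x) = b \<odot>\<^bsub>M\<^esub> (a \<odot>\<^bsub>M\<^esub> f x)" if "b \<in> carrier R" "x \<in> carrier M" for b x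
        using mod_hom_smult[OF f(1) that] smult_swap[OF aR that(1) fM[OF that(2)]] by simp
    qed
  qed
  have Ns: "submodule N R M" unfolding N_def by (rule submodule_sum_images[OF F])
  have aN: "a \<odot>\<^bsub>M\<^esub> z \<in> N" if a: "a \<in> P" and z: "z \<in> L" for a z
  proof -
    have "(\<lambda>x. a \<odot>\<^bsub>M\<^esub> f x) \<in> F" unfolding F_def using a by blast
    then have "(\<lambda>x. a \<odot>\<^bsub>M\<^esub> f x) ` carrier M \<subseteq> N" unfolding N_def
      by (rule submodule_sum_upper[of _ F "\<lambda>f. f ` carrier M"])
    moreover have "a \<odot>\<^bsub>M\<^esub> z = a \<odot>\<^bsub>M\<^esub> f z" using f(2) z by simp
    ultimately show ?thesis using LM[OF z] by auto
  qed
  have NW: "N \<subseteq> W" unfolding N_def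
  proof (rule submodule_sum_least[OF W])
    fix h assume "h \<in> F"
    then obtain a where a: "a \<in> P" "h = (\<lambda>x. a \<odot>\<^bsub>M\<^esub> f x)" unfolding F_def by blast
    show "h ` carrier M \<subseteq> W" unfolding a(2) using PL[OF a(1)] f(4) by auto
  qed
  have WN: "W \<subseteq> N"
  proof
    fix z assume z: "z \<in> W"
    obtain s v where s: "s \<in> carrier R - P" "v \<in> L" "s \<odot>\<^bsub>M\<^esub> z = \<pi> \<odot>\<^bsub>M\<^esub> v" using WE[OF z] by (elim exE conjE)
    \<comment> \<open>An inverse u of s modulo P writes z = u s z + q z, and both terms lie in
      PL.\<close>
    obtain u q where u: "u \<in> carrier R" "q \<in> P" "u \<otimes> s \<oplus> q = \<one>" using inverse_mod_P[OF s(1)] .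
    have zM: "z \<in> carrier M" and qR: "q \<in> carrier R" using WL[OF z] LM P.Icarr[OF u(2)] by auto
    have "z = (u \<otimes> s \<oplus> q) \<odot>\<^bsub>M\<^esub> z" unfolding u(3) using zM by simp
    also have "\<dots> = u \<odot>\<^bsub>M\<^esub> (\<pi> \<odot>\<^bsub>M\<^esub> v) \<oplus>\<^bsub>M\<^esub> q \<odot>\<^bsub>M\<^esub> z"
      using u(1) s(1) qR zM by (simp add: smult_l_distr smult_assoc1 flip: s(3))
    finally show "z \<in> N"
      using submodule_add[OF Ns submodule_smult[OF Ns u(1) aN[OF \<pi>_in_P s(2)]] aN[OF u(2) WL[OF z]]] by simp
  qed
  obtain D E where D: "D \<subseteq> N" "complementary R M D E" "\<forall>h\<in>mod_hom R M M. h ` D \<subseteq> D"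
    "\<forall>X. submodule X R M \<and> D \<subseteq> X \<and> N <+>\<^bsub>M\<^esub> X = carrier M \<longrightarrow> X = carrier M"
    by (rule dual_strongly_self_CS_BaerE[OF baer F, folded N_def])
  note cD = complementaryE[OF D(2)]
  have DW: "D \<subseteq> W" using D(1) NW by blast
  obtain g where g: "g \<in> mod_hom R M M" "\<forall>x\<in>D. g x = x" "\<forall>x\<in>E. g x = \<zero>\<^bsub>M\<^esub>"
    "\<forall>x\<in>carrier M. g x \<in> D" "\<forall>x\<in>carrier M. x \<ominus>\<^bsub>M\<^esub> g x \<in> E"
    by (rule complementary_projection[OF D(2)])
  text \<open>\<open>Y\<close> is maximal such that \<open>R e + Y\<close> is a direct sum, pure at \<open>P\<close>.\<close>
  define \<Phi> where "\<Phi> Y y \<longleftrightarrow> y \<in> L \<and> (\<forall>r\<in>carrier R. r \<odot>\<^bsub>M\<^esub> e \<oplus>\<^bsub>M\<^esub> y \<in> W \<longrightarrow>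
      r \<in> P \<and> (\<exists>s\<in>carrier R - P. \<exists>y'\<in>Y. s \<odot>\<^bsub>M\<^esub> y = \<pi> \<odot>\<^bsub>M\<^esub> y'))" for Y y
  have \<Phi>D: "\<Phi> D y" if y: "y \<in> D" for y
    unfolding \<Phi>_def
  proof (intro conjI ballI impI)
    have yW: "y \<in> W" using y DW by blast
    then show "y \<in> L" by (rule WL)
    fix r assume r: "r \<in> carrier R" "r \<odot>\<^bsub>M\<^esub> e \<oplus>\<^bsub>M\<^esub> y \<in> W"
    have "r \<odot>\<^bsub>M\<^esub> e = (r \<odot>\<^bsub>M\<^esub> e \<oplus>\<^bsub>M\<^esub> y) \<ominus>\<^bsub>M\<^esub> y" using r(1) eM LM[OF WL[OF yW]] by simp
    then have "r \<odot>\<^bsub>M\<^esub> e \<in> W" using submodule_diff[OF W r(2) yW] by simp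
    then show "r \<in> P" by (rule eP[OF r(1)])
    obtain s w where s: "s \<in> carrier R - P" "w \<in> L" "s \<odot>\<^bsub>M\<^esub> y = \<pi> \<odot>\<^bsub>M\<^esub> w" using WE[OF yW] by (elim exE conjE)
    have sR: "s \<in> carrier R" using s by simp
    \<comment> \<open>The witness w for divisibility lies in L only; applying the projection
      \<open>g\<close> onto D replaces it by one in D. So the Zorn argument can start at D.\<close>
    have "s \<odot>\<^bsub>M\<^esub> y = g (s \<odot>\<^bsub>M\<^esub> y)" using g(2) submodule_smult[OF cD(1) sR y] by simp
    also have "\<dots> = \<pi> \<odot>\<^bsub>M\<^esub> g w" unfolding s(3) by (rule mod_hom_smult[OF g(1) \<pi>_closed LM[OF s(2)]])
    finally have "s \<odot>\<^bsub>M\<^esub> y = \<pi> \<odot>\<^bsub>M\<^esub> g w" .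
    moreover have "g w \<in> D" using g(4) LM[OF s(2)] by blast
    ultimately show "\<exists>s\<in>carrier R - P. \<exists>y'\<in>D. s \<odot>\<^bsub>M\<^esub> y = \<pi> \<odot>\<^bsub>M\<^esub> y'" using s(1) by blast
  qed
  have mono: "\<Phi> B y" if "A \<subseteq> B" "\<Phi> A y" for A B y using that unfolding \<Phi>_def by blast
  obtain Y where Y: "submodule Y R M" "D \<subseteq> Y" "\<forall>y\<in>Y. \<Phi> Y y"
    and max: "\<forall>m\<in>carrier M - Y. \<exists>x\<in>Y. \<exists>r\<in>carrier R.
      \<not> \<Phi> (Y <+>\<^bsub>M\<^esub> cyclic_submodule m) (x \<oplus>\<^bsub>M\<^esub> r \<odot>\<^bsub>M\<^esub> m)"
    by (rule exists_maximal_submodule[of D \<Phi>, OF cD(1) \<Phi>D mono])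
  note YM = submodule_subset[OF Y(1)]
  have YL: "y \<in> L" if "y \<in> Y" for y using bspec[OF Y(3) that] unfolding \<Phi>_def by (elim conjE)
  have Yp: "r \<in> P \<and> (\<exists>s\<in>carrier R - P. \<exists>y'\<in>Y. s \<odot>\<^bsub>M\<^esub> y = \<pi> \<odot>\<^bsub>M\<^esub> y')"
    if "y \<in> Y" "r \<in> carrier R" "r \<odot>\<^bsub>M\<^esub> e \<oplus>\<^bsub>M\<^esub> y \<in> W" for y r
    using bspec[OF Y(3) that(1)] that(2,3) unfolding \<Phi>_def by blast
  have ce: "submodule (cyclic_submodule e) R M" by (rule submodule_cyclic[OF eM])
  define X where "X = cyclic_submodule e <+>\<^bsub>M\<^esub> Y"
  have X: "submodule X R M" unfolding X_def by (rule submodule_set_add[OF ce Y(1)])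
  define S where "S = X <+>\<^bsub>M\<^esub> W"
  have S: "submodule S R M" unfolding S_def by (rule submodule_set_add[OF X W])
  have XS: "X \<subseteq> S" "W \<subseteq> S" unfolding S_def
    using subset_set_add_left[OF X W] subset_set_add_right[OF X W] by auto
  have YX: "Y \<subseteq> X" "cyclic_submodule e \<subseteq> X" unfolding X_def
    using subset_set_add_left[OF ce Y(1)] subset_set_add_right[OF ce Y(1)] by auto
  \<comment> \<open>If z were outside R e + Y + PL, adjoining it to Y would break purity at some
    relation r e + y + t z in \<open>W\<close>. Here t must be in P, since otherwise z would be in
    the span. Then t z is in PL, so r e + y is in \<open>W\<close>, and purity of Y supplies the
    very witnesses that were missing, t z being divisible by \<open>\<pi>\<close> up to
    \<open>\<tau>\<close>.\<close>
  have span: "z \<in> S" if z: "z \<in> L" for z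
  proof (rule ccontr)
    assume zS: "z \<notin> S"
    have zM: "z \<in> carrier M" using LM[OF z] .
    have "z \<notin> Y" using zS YX XS by blast
    then have "\<exists>y\<in>Y. \<exists>t\<in>carrier R. \<not> \<Phi> (Y <+>\<^bsub>M\<^esub> cyclic_submodule z) (y \<oplus>\<^bsub>M\<^esub> t \<odot>\<^bsub>M\<^esub> z)"
      using bspec[OF max, of z] zM by simp
    then obtain y t where y: "y \<in> Y" "t \<in> carrier R"
      "\<not> \<Phi> (Y <+>\<^bsub>M\<^esub> cyclic_submodule z) (y \<oplus>\<^bsub>M\<^esub> t \<odot>\<^bsub>M\<^esub> z)" by (elim bexE)
    have yM: "y \<in> carrier M" using YM[OF y(1)] .
    have "y \<oplus>\<^bsub>M\<^esub> t \<odot>\<^bsub>M\<^esub> z \<in> L"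
      by (rule submodule_add[OF cE(2) YL[OF y(1)] submodule_smult[OF cE(2) y(2) z]])
    then obtain r where r: "r \<in> carrier R" "r \<odot>\<^bsub>M\<^esub> e \<oplus>\<^bsub>M\<^esub> (y \<oplus>\<^bsub>M\<^esub> t \<odot>\<^bsub>M\<^esub> z) \<in> W"
      and nr: "\<not> (r \<in> P \<and> (\<exists>s\<in>carrier R - P. \<exists>y'\<in>Y <+>\<^bsub>M\<^esub> cyclic_submodule z.
        s \<odot>\<^bsub>M\<^esub> (y \<oplus>\<^bsub>M\<^esub> t \<odot>\<^bsub>M\<^esub> z) = \<pi> \<odot>\<^bsub>M\<^esub> y'))"
      using y(3) unfolding \<Phi>_def by blast
    have reM: "r \<odot>\<^bsub>M\<^esub> e \<in> carrier M" and tzM: "t \<odot>\<^bsub>M\<^esub> z \<in> carrier M" using r(1) eM y(2) zM by auto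
    have split: "(r \<odot>\<^bsub>M\<^esub> e \<oplus>\<^bsub>M\<^esub> y) \<oplus>\<^bsub>M\<^esub> t \<odot>\<^bsub>M\<^esub> z \<in> W" using r(2) reM yM tzM by (simp add: M.a_assoc)
    have reyX: "r \<odot>\<^bsub>M\<^esub> e \<oplus>\<^bsub>M\<^esub> y \<in> X" unfolding X_def by (rule set_addI[OF cyclic_submoduleI[OF r(1)] y(1)])
    have tP: "t \<in> P"
    proof (rule ccontr)
      assume "t \<notin> P"
      then obtain v q where v: "v \<in> carrier R" "q \<in> P" "v \<otimes> t \<oplus> q = \<one>"
        using inverse_mod_P[of t] y(2) by auto
      have qR: "q \<in> carrier R" using P.Icarr[OF v(2)] .
      have "t \<odot>\<^bsub>M\<^esub> z \<in> S"
        by (rule submodule_add_cancel[OF S _ _ tzM, of "r \<odot>\<^bsub>M\<^esub> e \<oplus>\<^bsub>M\<^esub> y"]) (use split reyX XS in auto)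
      then have "v \<odot>\<^bsub>M\<^esub> (t \<odot>\<^bsub>M\<^esub> z) \<oplus>\<^bsub>M\<^esub> q \<odot>\<^bsub>M\<^esub> z \<in> S"
        using submodule_add[OF S submodule_smult[OF S v(1)]] PL[OF v(2) z] XS(2) by blast
      moreover have "v \<odot>\<^bsub>M\<^esub> (t \<odot>\<^bsub>M\<^esub> z) \<oplus>\<^bsub>M\<^esub> q \<odot>\<^bsub>M\<^esub> z = (v \<otimes> t \<oplus> q) \<odot>\<^bsub>M\<^esub> z"
        using v(1) y(2) qR zM by (simp add: smult_l_distr smult_assoc1)
      ultimately show False using zS zM unfolding v(3) by simp
    qed
    have "r \<odot>\<^bsub>M\<^esub> e \<oplus>\<^bsub>M\<^esub> y = ((r \<odot>\<^bsub>M\<^esub> e \<oplus>\<^bsub>M\<^esub> y) \<oplus>\<^bsub>M\<^esub> t \<odot>\<^bsub>M\<^esub> z) \<ominus>\<^bsub>M\<^esub> t \<odot>\<^bsub>M\<^esub> z" using reM yM tzM by simp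
    then have reyW: "r \<odot>\<^bsub>M\<^esub> e \<oplus>\<^bsub>M\<^esub> y \<in> W" using submodule_diff[OF W split PL[OF tP z]] by simp
    from Yp[OF y(1) r(1) this] obtain s y' where rP: "r \<in> P" and s: "s \<in> carrier R - P" "y' \<in> Y"
      "s \<odot>\<^bsub>M\<^esub> y = \<pi> \<odot>\<^bsub>M\<^esub> y'" by (elim conjE bexE)
    obtain t' where t': "t' \<in> carrier R" "\<tau> \<otimes> t = \<pi> \<otimes> t'" using \<tau>_mult[OF tP] by blast
    have cl: "s \<in> carrier R" "y' \<in> carrier M" using s YM by auto
    have "(\<tau> \<otimes> s) \<odot>\<^bsub>M\<^esub> (y \<oplus>\<^bsub>M\<^esub> t \<odot>\<^bsub>M\<^esub> z) = \<tau> \<odot>\<^bsub>M\<^esub> (s \<odot>\<^bsub>M\<^esub> y) \<oplus>\<^bsub>M\<^esub> s \<odot>\<^bsub>M\<^esub> ((\<tau> \<otimes> t) \<odot>\<^bsub>M\<^esub> z)"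
      using cl y(2) yM zM by (simp add: smult_r_distr m_ac flip: smult_assoc1)
    also have "\<dots> = \<pi> \<odot>\<^bsub>M\<^esub> (\<tau> \<odot>\<^bsub>M\<^esub> y' \<oplus>\<^bsub>M\<^esub> (s \<otimes> t') \<odot>\<^bsub>M\<^esub> z)"
      unfolding s(3) t'(2) using cl t'(1) zM by (simp add: smult_r_distr m_ac flip: smult_assoc1)
    finally have eq: "(\<tau> \<otimes> s) \<odot>\<^bsub>M\<^esub> (y \<oplus>\<^bsub>M\<^esub> t \<odot>\<^bsub>M\<^esub> z) = \<pi> \<odot>\<^bsub>M\<^esub> (\<tau> \<odot>\<^bsub>M\<^esub> y' \<oplus>\<^bsub>M\<^esub> (s \<otimes> t') \<odot>\<^bsub>M\<^esub> z)" .
    have "\<tau> \<odot>\<^bsub>M\<^esub> y' \<oplus>\<^bsub>M\<^esub> (s \<otimes> t') \<odot>\<^bsub>M\<^esub> z \<in> Y <+>\<^bsub>M\<^esub> cyclic_submodule z"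
      by (rule set_addI[OF submodule_smult[OF Y(1) \<tau>_closed s(2)] cyclic_submoduleI]) (use cl t' in simp)
    moreover have "\<tau> \<otimes> s \<in> carrier R - P" by (rule mult_notin_P[OF _ s(1)]) (use \<tau>_notin_P in simp)
    ultimately show False using nr rP eq by blast
  qed
  define C where "C = torsion_part <+>\<^bsub>M\<^esub> Y"
  have C: "submodule C R M" unfolding C_def by (rule submodule_set_add[OF cE(1) Y(1)])
  define Z where "Z = torsion_part <+>\<^bsub>M\<^esub> X"
  have Z: "submodule Z R M" unfolding Z_def by (rule submodule_set_add[OF cE(1) X])
  have XZ: "X \<subseteq> Z" "torsion_part \<subseteq> Z" unfolding Z_def
    using subset_set_add_right[OF cE(1) X] subset_set_add_left[OF cE(1) X] by auto
  have "carrier M \<subseteq> N <+>\<^bsub>M\<^esub> Z"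
  proof
    fix m assume m: "m \<in> carrier M"
    have fm: "f m \<in> L" "m \<ominus>\<^bsub>M\<^esub> f m \<in> torsion_part" using f(4,5) m by auto
    have "f m \<in> S" using span[OF fm(1)] .
    then obtain x w where xw: "x \<in> X" "w \<in> W" "f m = x \<oplus>\<^bsub>M\<^esub> w" unfolding S_def by (rule set_addE)
    have cl: "x \<in> carrier M" "w \<in> carrier M" "m \<ominus>\<^bsub>M\<^esub> f m \<in> carrier M"
      using submodule_subset[OF X xw(1)] submodule_subset[OF W xw(2)] m mod_hom_closed[OF f(1) m] by auto
    have "(m \<ominus>\<^bsub>M\<^esub> f m) \<oplus>\<^bsub>M\<^esub> x \<in> Z" unfolding Z_def by (rule set_addI[OF fm(2) xw(1)])
    moreover have "w \<in> N" using xw(2) WN by blast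
    moreover have "m = w \<oplus>\<^bsub>M\<^esub> ((m \<ominus>\<^bsub>M\<^esub> f m) \<oplus>\<^bsub>M\<^esub> x)"
    proof -
      have "m = (m \<ominus>\<^bsub>M\<^esub> f m) \<oplus>\<^bsub>M\<^esub> f m" using m mod_hom_closed[OF f(1) m] by simp
      also have "\<dots> = (m \<ominus>\<^bsub>M\<^esub> f m) \<oplus>\<^bsub>M\<^esub> (x \<oplus>\<^bsub>M\<^esub> w)" using xw(3) by simp
      also have "\<dots> = w \<oplus>\<^bsub>M\<^esub> ((m \<ominus>\<^bsub>M\<^esub> f m) \<oplus>\<^bsub>M\<^esub> x)"
        using cl M.a_comm[of "(m \<ominus>\<^bsub>M\<^esub> f m) \<oplus>\<^bsub>M\<^esub> x" w] by (simp add: M.a_assoc)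
      finally show ?thesis .
    qed
    ultimately show "m \<in> N <+>\<^bsub>M\<^esub> Z" using set_addI by metis
  qed
  then have "N <+>\<^bsub>M\<^esub> Z = carrier M" using submodule_subset[OF submodule_set_add[OF Ns Z]] by blast
  then have Zall: "Z = carrier M" using D(4) Z Y(2) YX(1) XZ(1) by blast
  \<comment> \<open>Induction on n. For n = 0, take y = -t e in the purity condition: t e + y = 0 is
    in \<open>W\<close>, so t would be in P. In the step, purity divides the element of Y by
    \<open>\<pi>\<close>, and torsion-freeness of L cancels \<open>\<pi>\<close>.\<close>
  have eY: False if "t \<in> carrier R - P" "(t \<otimes> \<pi> [^] n) \<odot>\<^bsub>M\<^esub> e \<in> Y" for t and n :: nat
    using that
  proof (induction n arbitrary: t)
    case 0
    have tR: "t \<in> carrier R" using 0 by simp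
    have "t \<odot>\<^bsub>M\<^esub> e \<in> Y" using 0(2) tR by simp
    then have mY: "\<ominus>\<^bsub>M\<^esub> (t \<odot>\<^bsub>M\<^esub> e) \<in> Y" by (rule submoduleE(6)[OF Y(1)])
    have "t \<odot>\<^bsub>M\<^esub> e \<oplus>\<^bsub>M\<^esub> \<ominus>\<^bsub>M\<^esub> (t \<odot>\<^bsub>M\<^esub> e) \<in> W"
      using submodule_zero[OF W] tR eM by (simp add: M.r_neg)
    then show ?case using Yp[OF mY tR] 0(1) by blast
  next
    case (Suc n)
    have tR: "t \<in> carrier R" using Suc by simp
    define y where "y = (t \<otimes> \<pi> [^] Suc n) \<odot>\<^bsub>M\<^esub> e"
    have yY: "y \<in> Y" unfolding y_def by (rule Suc.prems(2))
    have cY: "(t \<otimes> \<pi> [^] n) \<odot>\<^bsub>M\<^esub> e \<in> L" using submodule_smult[OF cE(2) _ e(1)] tR by simp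
    have yeq: "y = \<pi> \<odot>\<^bsub>M\<^esub> ((t \<otimes> \<pi> [^] n) \<odot>\<^bsub>M\<^esub> e)" unfolding y_def using tR eM by (simp add: m_ac flip: smult_assoc1)
    have "y \<in> W" by (rule WI[OF YL[OF yY] one_notin_P cY]) (use YM[OF yY] yeq in simp)
    then have "\<zero> \<odot>\<^bsub>M\<^esub> e \<oplus>\<^bsub>M\<^esub> y \<in> W" using eM YM[OF yY] by simp
    from Yp[OF yY R.zero_closed this] obtain s y'
      where s: "s \<in> carrier R - P" "y' \<in> Y" "s \<odot>\<^bsub>M\<^esub> y = \<pi> \<odot>\<^bsub>M\<^esub> y'" by (elim conjE bexE)
    have cl: "s \<in> carrier R" "y' \<in> carrier M" using s YM by auto
    define x where "x = (s \<otimes> t \<otimes> \<pi> [^] n) \<odot>\<^bsub>M\<^esub> e"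
    have xL: "x \<in> L" unfolding x_def using submodule_smult[OF cE(2) _ e(1)] tR cl by simp
    have "\<pi> \<odot>\<^bsub>M\<^esub> x = s \<odot>\<^bsub>M\<^esub> y" unfolding x_def yeq using tR cl eM by (simp add: m_ac flip: smult_assoc1)
    then have "\<pi> \<odot>\<^bsub>M\<^esub> (x \<ominus>\<^bsub>M\<^esub> y') = \<zero>\<^bsub>M\<^esub>"
      using s(3) LM[OF xL] cl by (simp add: smult_diff diff_eq_zero_iff)
    then have "x \<ominus>\<^bsub>M\<^esub> y' = \<zero>\<^bsub>M\<^esub>"
      using free[OF \<pi>_closed \<pi>_nonzero submodule_diff[OF cE(2) xL YL[OF s(2)]]] by simp
    then have "x = y'" using LM[OF xL] cl by (simp add: diff_eq_zero_iff)
    then have "(s \<otimes> t \<otimes> \<pi> [^] n) \<odot>\<^bsub>M\<^esub> e \<in> Y" using s(2) unfolding x_def by simp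
    then show ?case using Suc.IH[OF mult_notin_P[OF s(1) Suc.prems(1)]] by blast
  qed
  have reY: "r = \<zero>" if r: "r \<in> carrier R" "r \<odot>\<^bsub>M\<^esub> e \<in> Y" for r
  proof (rule ccontr)
    assume "r \<noteq> \<zero>"
    from valuation[OF r(1) this] obtain s t n where s: "s \<in> carrier R - P" and t: "t \<in> carrier R - P" and eq: "s \<otimes> r = t \<otimes> \<pi> [^] (n::nat)"
      by (elim bexE exE)
    have "(t \<otimes> \<pi> [^] n) \<odot>\<^bsub>M\<^esub> e = s \<odot>\<^bsub>M\<^esub> (r \<odot>\<^bsub>M\<^esub> e)"
      unfolding eq[symmetric] using s r eM by (simp add: smult_assoc1)
    then have "(t \<otimes> \<pi> [^] n) \<odot>\<^bsub>M\<^esub> e \<in> Y" using submodule_smult[OF Y(1) _ r(2)] s by simp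
    then show False using eY[OF t] by blast
  qed
  have eT: "r = \<zero>" if r: "r \<in> carrier R" "r \<odot>\<^bsub>M\<^esub> e = \<zero>\<^bsub>M\<^esub>" for r
    using reY[OF r(1)] r(2) submodule_zero[OF Y(1)] by simp
  have compl: "complementary R M (cyclic_submodule e) C"
  proof (rule complementaryI[OF ce C])
    show "x = \<zero>\<^bsub>M\<^esub>" if x: "x \<in> cyclic_submodule e" "x \<in> C" for x
    proof -
      obtain r where r: "r \<in> carrier R" "x = r \<odot>\<^bsub>M\<^esub> e" using x(1) by (rule cyclic_submoduleE)
      obtain t y where ty: "t \<in> torsion_part" "y \<in> Y" "x = t \<oplus>\<^bsub>M\<^esub> y" using x(2) unfolding C_def by (rule set_addE)
      have cl: "t \<in> carrier M" "y \<in> carrier M" using submodule_subset[OF cE(1) ty(1)] YM[OF ty(2)] by auto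
      have "t = x \<ominus>\<^bsub>M\<^esub> y" unfolding ty(3) using cl by simp
      then have "t \<in> L" using submodule_diff[OF cE(2) _ YL[OF ty(2)]] submodule_smult[OF cE(2) r(1) e(1)] r(2) by simp
      then have "t = \<zero>\<^bsub>M\<^esub>" using cE(3) ty(1) by blast
      then have "r \<odot>\<^bsub>M\<^esub> e \<in> Y" using ty cl r(2) by simp
      then have "r = \<zero>" using reY[OF r(1)] by blast
      then show ?thesis using r(2) eM by simp
    qed
    show "\<exists>d\<in>cyclic_submodule e. \<exists>u\<in>C. x = d \<oplus>\<^bsub>M\<^esub> u" if x: "x \<in> carrier M" for x
    proof -
      have "x \<in> Z" using x Zall by simp
      then obtain t z where tz: "t \<in> torsion_part" "z \<in> X" "x = t \<oplus>\<^bsub>M\<^esub> z" unfolding Z_def by (rule set_addE)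
      obtain d y where dy: "d \<in> cyclic_submodule e" "y \<in> Y" "z = d \<oplus>\<^bsub>M\<^esub> y" using tz(2) unfolding X_def by (rule set_addE)
      have cl: "t \<in> carrier M" "d \<in> carrier M" "y \<in> carrier M"
        using submodule_subset[OF cE(1) tz(1)] submodule_subset[OF ce dy(1)] YM[OF dy(2)] by auto
      have "x = d \<oplus>\<^bsub>M\<^esub> (t \<oplus>\<^bsub>M\<^esub> y)" unfolding tz(3) dy(3) using cl by (simp add: M.a_lcomm)
      moreover have "t \<oplus>\<^bsub>M\<^esub> y \<in> C" unfolding C_def by (rule set_addI[OF tz(1) dy(2)])
      ultimately show ?thesis using dy(1) by blast
    qed
  qed
  \<comment> \<open>Only 0 annihilates e, so the condition on annihilators in the rigidity lemma
    holds for every u.\<close>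
  have C0: "u = \<zero>\<^bsub>M\<^esub>" if u: "u \<in> C" for u
  proof (rule cyclic_summand_hom_zero[OF compl eM u])
    show "a \<odot>\<^bsub>M\<^esub> u = \<zero>\<^bsub>M\<^esub>" if "a \<in> carrier R" "a \<odot>\<^bsub>M\<^esub> e = \<zero>\<^bsub>M\<^esub>" for a
      using eT[OF that] submodule_subset[OF C u] by simp
  qed
  have "carrier M = cyclic_submodule e"
  proof
    show "cyclic_submodule e \<subseteq> carrier M" using submodule_subset[OF ce] by blast
    show "carrier M \<subseteq> cyclic_submodule e"
    proof
      fix x assume x: "x \<in> carrier M"
      obtain d u where du: "d \<in> cyclic_submodule e" "u \<in> C" "x = d \<oplus>\<^bsub>M\<^esub> u"
        using complementaryE(4)[OF compl x] by (elim bexE)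
      then show "x \<in> cyclic_submodule e" using C0[OF du(2)] submodule_subset[OF ce du(1)] by simp
    qed
  qed
  then show ?thesis using eM eT by blast
qed

lemma free_cyclic_local:
  assumes e: "e \<in> carrier M" "carrier M = cyclic_submodule e"
    and free: "\<And>a. a \<in> carrier R \<Longrightarrow> a \<odot>\<^bsub>M\<^esub> e = \<zero>\<^bsub>M\<^esub> \<Longrightarrow> a = \<zero>"
  shows "local_ring R"
proof -
  have inj: "a = b" if "a \<in> carrier R" "b \<in> carrier R" "a \<odot>\<^bsub>M\<^esub> e = b \<odot>\<^bsub>M\<^esub> e" for a b
  proof -
    have "(a \<ominus> b) \<odot>\<^bsub>M\<^esub> e = \<zero>\<^bsub>M\<^esub>" using that e(1) by (simp add: smult_diff_left diff_eq_zero_iff)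
    then have "a \<ominus> b = \<zero>" using free[of "a \<ominus> b"] that by simp
    then show ?thesis using that by simp
  qed
  have sub: "P \<subseteq> Q" if P: "maximalideal P R" and Q: "maximalideal Q R" for P Q
  proof (rule ccontr)
    assume "\<not> P \<subseteq> Q"
    interpret P: maximalideal P R by (rule P)
    interpret Q: maximalideal Q R by (rule Q)
    interpret PQ: ideal "P <+>\<^bsub>R\<^esub> Q" R by (rule R.add_ideals[OF P.is_ideal Q.is_ideal])
    have PsQ: "x \<in> P <+>\<^bsub>R\<^esub> Q \<longleftrightarrow> (\<exists>p\<in>P. \<exists>q\<in>Q. x = p \<oplus> q)" for x
      unfolding set_add_def' by auto
    have "Q \<subseteq> P <+>\<^bsub>R\<^esub> Q"
    proof
      fix q assume q: "q \<in> Q"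
      have "q = \<zero> \<oplus> q" using Q.Icarr[OF q] by simp
      then show "q \<in> P <+>\<^bsub>R\<^esub> Q" unfolding PsQ using q P.zero_closed by blast
    qed
    moreover have "P \<subseteq> P <+>\<^bsub>R\<^esub> Q"
    proof
      fix p assume p: "p \<in> P"
      have "p = p \<oplus> \<zero>" using P.Icarr[OF p] by simp
      then show "p \<in> P <+>\<^bsub>R\<^esub> Q" unfolding PsQ using p Q.zero_closed by blast
    qed
    ultimately have "P <+>\<^bsub>R\<^esub> Q = carrier R"
      using Q.I_maximal[OF PQ.is_ideal] PQ.a_subset \<open>\<not> P \<subseteq> Q\<close> by blast
    then have "\<one> \<in> P <+>\<^bsub>R\<^esub> Q" by simp
    then obtain p q where pq: "p \<in> P" "q \<in> Q" "\<one> = p \<oplus> q" unfolding PsQ by blast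
    have mulM: "submodule {a \<odot>\<^bsub>M\<^esub> e | a. a \<in> I} R M" if "ideal I R" for I
    proof -
      interpret I: ideal I R by (rule that)
      show ?thesis
      proof (rule submoduleI')
        show "{a \<odot>\<^bsub>M\<^esub> e | a. a \<in> I} \<subseteq> carrier M" using I.Icarr e(1) by auto
        have "\<zero>\<^bsub>M\<^esub> = \<zero> \<odot>\<^bsub>M\<^esub> e" using e(1) by simp
        then show "\<zero>\<^bsub>M\<^esub> \<in> {a \<odot>\<^bsub>M\<^esub> e | a. a \<in> I}" using I.zero_closed by blast
        show "x \<oplus>\<^bsub>M\<^esub> y \<in> {a \<odot>\<^bsub>M\<^esub> e | a. a \<in> I}"
          if xy: "x \<in> {a \<odot>\<^bsub>M\<^esub> e | a. a \<in> I}" "y \<in> {a \<odot>\<^bsub>M\<^esub> e | a. a \<in> I}" for x y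
        proof -
          obtain a b where ab: "a \<in> I" "b \<in> I" "x = a \<odot>\<^bsub>M\<^esub> e" "y = b \<odot>\<^bsub>M\<^esub> e" using xy by blast
          have "x \<oplus>\<^bsub>M\<^esub> y = (a \<oplus> b) \<odot>\<^bsub>M\<^esub> e" using ab I.Icarr e(1) by (simp add: smult_l_distr)
          then show ?thesis using I.a_closed[OF ab(1,2)] by blast
        qed
        show "r \<odot>\<^bsub>M\<^esub> x \<in> {a \<odot>\<^bsub>M\<^esub> e | a. a \<in> I}"
          if r: "r \<in> carrier R" and x: "x \<in> {a \<odot>\<^bsub>M\<^esub> e | a. a \<in> I}" for r x
        proof -
          obtain a where a: "a \<in> I" "x = a \<odot>\<^bsub>M\<^esub> e" using x by blast
          have "r \<odot>\<^bsub>M\<^esub> x = (r \<otimes> a) \<odot>\<^bsub>M\<^esub> e" using a r I.Icarr e(1) by (simp add: smult_assoc1)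
          then show ?thesis using I.I_l_closed[OF a(1) r] by blast
        qed
      qed
    qed
    define PM where "PM = {a \<odot>\<^bsub>M\<^esub> e | a. a \<in> P}"
    define QM where "QM = {a \<odot>\<^bsub>M\<^esub> e | a. a \<in> Q}"
    have PM: "submodule PM R M" and QM: "submodule QM R M"
      unfolding PM_def QM_def by (rule mulM[OF P.is_ideal], rule mulM[OF Q.is_ideal])
    define F where "F = {(\<lambda>x. a \<odot>\<^bsub>M\<^esub> x) | a. a \<in> P}"
    define N where "N = submodule_sum R M F (\<lambda>f. f ` carrier M)"
    have F: "F \<subseteq> mod_hom R M M"
    proof
      fix h assume "h \<in> F"
      then obtain a where a: "a \<in> P" "h = (\<lambda>x. a \<odot>\<^bsub>M\<^esub> x)" unfolding F_def by blast
      show "h \<in> mod_hom R M M" unfolding a(2)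
        by (rule mod_homI) (use P.Icarr[OF a(1)] in \<open>simp_all add: smult_r_distr smult_swap[of a]\<close>)
    qed
    have Ns: "submodule N R M" unfolding N_def by (rule submodule_sum_images[OF F])
    have NP: "N \<subseteq> PM" unfolding N_def
    proof (rule submodule_sum_least[OF PM])
      fix h assume "h \<in> F"
      then obtain a where a: "a \<in> P" "h = (\<lambda>x. a \<odot>\<^bsub>M\<^esub> x)" unfolding F_def by blast
      show "h ` carrier M \<subseteq> PM"
      proof
        fix z assume "z \<in> h ` carrier M"
        then obtain x where x: "x \<in> carrier M" "z = a \<odot>\<^bsub>M\<^esub> x" unfolding a(2) by blast
        obtain r where r: "r \<in> carrier R" "x = r \<odot>\<^bsub>M\<^esub> e" using x(1) unfolding e(2) by (rule cyclic_submoduleE)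
        have "z = (a \<otimes> r) \<odot>\<^bsub>M\<^esub> e" unfolding x(2) r(2) using P.Icarr[OF a(1)] r(1) e(1) by (simp add: smult_assoc1)
        then show "z \<in> PM" unfolding PM_def using P.I_r_closed[OF a(1) r(1)] by blast
      qed
    qed
    have pN: "p \<odot>\<^bsub>M\<^esub> x \<in> N" if "x \<in> carrier M" for x
    proof -
      have "(\<lambda>x. p \<odot>\<^bsub>M\<^esub> x) \<in> F" unfolding F_def using pq(1) by blast
      then have "(\<lambda>x. p \<odot>\<^bsub>M\<^esub> x) ` carrier M \<subseteq> N" unfolding N_def
        by (rule submodule_sum_upper[of _ F "\<lambda>f. f ` carrier M"])
      then show ?thesis using that by blast
    qed
    obtain D E where D: "D \<subseteq> N" "complementary R M D E" "\<forall>h\<in>mod_hom R M M. h ` D \<subseteq> D"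
      "\<forall>X. submodule X R M \<and> D \<subseteq> X \<and> N <+>\<^bsub>M\<^esub> X = carrier M \<longrightarrow> X = carrier M"
      by (rule dual_strongly_self_CS_BaerE[OF baer F, folded N_def])
    note cE = complementaryE[OF D(2)]
    have "D = {\<zero>\<^bsub>M\<^esub>}"
    proof (rule ccontr)
      assume "D \<noteq> {\<zero>\<^bsub>M\<^esub>}"
      then obtain d where d: "d \<in> D" "d \<noteq> \<zero>\<^bsub>M\<^esub>" using submodule_zero[OF cE(1)] by blast
      have dM: "d \<in> cyclic_submodule e" using submodule_subset[OF cE(1) d(1)] e(2) by simp
      obtain a where a: "a \<in> carrier R" "d = a \<odot>\<^bsub>M\<^esub> e" using dM by (rule cyclic_submoduleE)
      have a0: "a \<noteq> \<zero>" using d(2) a(2) e(1) by auto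
      \<comment> \<open>With d = a e in D and x = b e in E, the element a b e lies in both D and E,
        so a b = 0 and b = 0. Hence E vanishes and D is all of M.\<close>
      have "x = \<zero>\<^bsub>M\<^esub>" if x: "x \<in> E" for x
      proof -
        have "x \<in> cyclic_submodule e" using submodule_subset[OF cE(2) x] e(2) by simp
        then obtain b where b: "b \<in> carrier R" "x = b \<odot>\<^bsub>M\<^esub> e" by (rule cyclic_submoduleE)
        have "a \<odot>\<^bsub>M\<^esub> x \<in> D"
          using submodule_smult[OF cE(1) b(1) d(1)] smult_swap[OF a(1) b(1) e(1)] a(2) b(2) by simp
        then have "a \<odot>\<^bsub>M\<^esub> x = \<zero>\<^bsub>M\<^esub>" using cE(3) submodule_smult[OF cE(2) a(1) x] by blast
        then have "a \<otimes> b = \<zero>" using free[of "a \<otimes> b"] a(1) b e(1) by (simp add: smult_assoc1)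
        then have "b = \<zero>" using a0 a(1) b(1) integral by blast
        then show ?thesis using b(2) e(1) by simp
      qed
      then have "e \<in> D"
        using cE(4)[OF e(1)] submodule_subset[OF cE(1)] by (metis M.r_zero)
      then have "e \<in> PM" using D(1) NP by blast
      then obtain b where b: "b \<in> P" "e = b \<odot>\<^bsub>M\<^esub> e" unfolding PM_def by blast
      have "\<one> = b" by (rule inj) (use P.Icarr[OF b(1)] b(2) e(1) in auto)
      then show False using b(1) P.one_imp_carrier P.I_notcarr by simp
    qed
    then have DQ: "D \<subseteq> QM" using submodule_zero[OF QM] by blast
    have "carrier M \<subseteq> N <+>\<^bsub>M\<^esub> QM"
    proof
      fix x assume x: "x \<in> carrier M"
      obtain r where r: "r \<in> carrier R" "x = r \<odot>\<^bsub>M\<^esub> e" using x unfolding e(2) by (rule cyclic_submoduleE)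
      have qR: "p \<in> carrier R" "q \<in> carrier R" using P.Icarr[OF pq(1)] Q.Icarr[OF pq(2)] by auto
      have "x = (p \<oplus> q) \<odot>\<^bsub>M\<^esub> x" unfolding pq(3)[symmetric] using x by simp
      also have "\<dots> = p \<odot>\<^bsub>M\<^esub> x \<oplus>\<^bsub>M\<^esub> q \<odot>\<^bsub>M\<^esub> x" using qR x by (simp add: smult_l_distr)
      finally have "x = p \<odot>\<^bsub>M\<^esub> x \<oplus>\<^bsub>M\<^esub> q \<odot>\<^bsub>M\<^esub> x" .
      moreover have "q \<odot>\<^bsub>M\<^esub> x = (q \<otimes> r) \<odot>\<^bsub>M\<^esub> e" unfolding r(2) using qR r(1) e(1) by (simp add: smult_assoc1)
      then have "q \<odot>\<^bsub>M\<^esub> x \<in> QM" unfolding QM_def using Q.I_r_closed[OF pq(2) r(1)] by blast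
      ultimately show "x \<in> N <+>\<^bsub>M\<^esub> QM" using set_addI[OF pN[OF x]] by metis
    qed
    then have "N <+>\<^bsub>M\<^esub> QM = carrier M" using submodule_subset[OF submodule_set_add[OF Ns QM]] by blast
    then have "QM = carrier M" using D(4) QM DQ by blast
    then have "e \<in> QM" using e(1) by simp
    then obtain b where b: "b \<in> Q" "e = b \<odot>\<^bsub>M\<^esub> e" unfolding QM_def by blast
    have "\<one> = b" by (rule inj) (use Q.Icarr[OF b(1)] b(2) e(1) in auto)
    then show False using b(1) Q.one_imp_carrier Q.I_notcarr by simp
  qed
  have "{\<zero>} \<noteq> carrier R" using one_not_zero by blast
  then obtain P where P: "maximalideal P R" using proper_ideal_subset_nonzero_prime[OF R.zeroideal] by metis
  have "\<exists>!P. maximalideal P R"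
    by (rule ex1I[of _ P]) (use sub P in blast)+
  then show ?thesis by (intro local_ring.intro local_ring_axioms.intro R.is_cring)
qed

text \<open>A component of Pruefer type forces M to be torsion. If M is not torsion, all components
  are therefore cyclic summands, the torsion part splits off, and its non-zero complement is either
  divisible, hence of rank one, or forces M to be free cyclic over a local ring.\<close>

theorem baer_module_cases:
  obtains (free) e where "e \<in> carrier M" "carrier M = cyclic_submodule e"
      "\<forall>a\<in>carrier R. a \<odot>\<^bsub>M\<^esub> e = \<zero>\<^bsub>M\<^esub> \<longrightarrow> a = \<zero>" "local_ring R"
  | (divisible) L where "complementary R M torsion_part L" "rank_one_divisible L"
      "\<forall>P\<in>nonzero_primes R. \<exists>n. cyclic_with_annihilator (primary_component R M P) (ideal_power R P n)"
  | (torsion) "torsion_part = carrier M"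
      "\<forall>P\<in>nonzero_primes R. (\<exists>\<pi> \<tau>. uniformized_prime R P \<pi> \<tau> \<and> pruefer_like \<pi> (primary_component R M P)) \<or>
        (\<exists>n. cyclic_with_annihilator (primary_component R M P) (ideal_power R P n))"
proof -
  have dich: "(\<exists>n. cyclic_with_annihilator (primary_component R M P) (ideal_power R P n)) \<and>
      direct_summand R M (primary_component R M P) \<or>
      (\<exists>\<pi> \<tau>. uniformized_prime R P \<pi> \<tau> \<and> pruefer_like \<pi> (primary_component R M P)) \<and>
      torsion_part = carrier M" if P: "P \<in> nonzero_primes R" for P
  proof -
    obtain \<pi> \<tau> where u: "uniformized_prime R P \<pi> \<tau>" using exists_uniformizer[OF P] by blast
    interpret baer_module_at_prime R M P \<pi> \<tau>
      by (intro baer_module_at_prime.intro module_at_prime.intro dedekind_baer_module_axioms module_axioms u)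
    show ?thesis using primary_component_cases u by blast
  qed
  show ?thesis
  proof (cases "torsion_part = carrier M")
    case True
    show ?thesis by (rule torsion[OF True]) (use dich in blast)
  next
    case False
    then have cyc: "(\<exists>n. cyclic_with_annihilator (primary_component R M P) (ideal_power R P n)) \<and>
        direct_summand R M (primary_component R M P)" if "P \<in> nonzero_primes R" for P
      using dich[OF that] by blast
    obtain L where L: "complementary R M torsion_part L" using torsion_part_summand[OF cyc] .
    note cE = complementaryE[OF L]
    have L0: "L \<noteq> {\<zero>\<^bsub>M\<^esub>}"
    proof
      assume "L = {\<zero>\<^bsub>M\<^esub>}"
      then have "x \<in> torsion_part" if "x \<in> carrier M" for x
        using cE(4)[OF that] submodule_subset[OF cE(1)] by auto
      then show False using False submodule_subset[OF cE(1)] by blast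
    qed
    show ?thesis
    proof (cases "\<forall>r\<in>carrier R. r \<noteq> \<zero> \<longrightarrow> (\<forall>x\<in>L. \<exists>y\<in>L. x = r \<odot>\<^bsub>M\<^esub> y)")
      case True
      have "rank_one_divisible L"
        by (rule divisible_complement_rank_one[OF L L0]) (use True in blast)
      then show ?thesis by (rule divisible[OF L]) (use cyc in blast)
    next
      case False
      then obtain r x where rx: "r \<in> carrier R" "r \<noteq> \<zero>" "x \<in> L" "\<not> (\<exists>y\<in>L. x = r \<odot>\<^bsub>M\<^esub> y)" by blast
      obtain e where e: "e \<in> carrier M" "carrier M = cyclic_submodule e"
        "\<forall>a\<in>carrier R. a \<odot>\<^bsub>M\<^esub> e = \<zero>\<^bsub>M\<^esub> \<longrightarrow> a = \<zero>"
        using nondivisible_complement_free_cyclic[OF L rx] by (elim bexE conjE)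
      have "local_ring R" by (rule free_cyclic_local[OF e(1,2)]) (use e(3) in blast)
      then show ?thesis by (rule free[OF e])
    qed
  qed
qed

end

section \<open>The converse: constructing the fully invariant summand\<close>

context module_at_prime
begin

text \<open>The image of \<open>T\<close> is a non-zero divisible submodule of \<open>T\<close>, so
  it contains the simple socle. By induction on n it contains everything killed by
  \<open>\<pi>\<close>^n: the socle element \<open>\<pi>\<close>^n x equals \<open>\<pi>\<close>^n b
  with b in the image, and x - b has smaller order.\<close>

lemma pruefer_like_endomorphic_image:
  assumes pr: "pruefer_like \<pi> T" and f: "f \<in> mod_hom R M M" and z: "z \<in> T" "f z \<noteq> \<zero>\<^bsub>M\<^esub>"
  shows "T \<subseteq> f ` carrier M"
proof -
  define A where "A = f ` T"
  have fT: "f x \<in> T" if "x \<in> T" for x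
    using mod_hom_primary_component[OF module_axioms module_axioms f that] ideal_power_closed by blast
  have A: "submodule A R M" unfolding A_def by (rule submodule_image[OF module_axioms module_axioms f submodule_T])
  have AT: "A \<subseteq> T" unfolding A_def using fT by blast
  have div: "\<exists>y\<in>T. x = \<pi> \<odot>\<^bsub>M\<^esub> y" if "x \<in> T" for x using pr that unfolding pruefer_like_def by (elim conjE) (rule bspec)
  have soc: "v \<in> cyclic_submodule u"
    if "u \<in> T" "v \<in> T" "\<pi> \<odot>\<^bsub>M\<^esub> u = \<zero>\<^bsub>M\<^esub>" "\<pi> \<odot>\<^bsub>M\<^esub> v = \<zero>\<^bsub>M\<^esub>" "u \<noteq> \<zero>\<^bsub>M\<^esub>" for u v
    using pr that unfolding pruefer_like_def by metis
  have divn: "\<exists>b\<in>A. v = \<pi> [^] n \<odot>\<^bsub>M\<^esub> b" if "v \<in> A" for v and n :: nat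
    using that
  proof (induction n arbitrary: v)
    case 0
    then have "v = \<pi> [^] (0::nat) \<odot>\<^bsub>M\<^esub> v" using submodule_subset[OF A] by simp
    then show ?case using 0 by (rule bexI)
  next
    case (Suc n)
    obtain b where b: "b \<in> A" "v = \<pi> [^] n \<odot>\<^bsub>M\<^esub> b" using Suc.IH[OF Suc.prems] by (elim bexE)
    obtain x where x: "x \<in> T" "b = f x" using b(1) unfolding A_def by blast
    obtain y where y: "y \<in> T" "x = \<pi> \<odot>\<^bsub>M\<^esub> y" using div[OF x(1)] by (elim bexE)
    have yM: "y \<in> carrier M" and fyM: "f y \<in> carrier M" using T_closed y(1) fT by auto
    have "b = \<pi> \<odot>\<^bsub>M\<^esub> f y" unfolding x(2) y(2) by (rule mod_hom_smult[OF f \<pi>_closed yM])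
    then have "v = \<pi> [^] Suc n \<odot>\<^bsub>M\<^esub> f y" unfolding b(2) using fyM by (simp flip: smult_assoc1)
    moreover have "f y \<in> A" unfolding A_def using y(1) by blast
    ultimately show ?case by (rule bexI)
  qed
  have fzA: "f z \<in> A" unfolding A_def using z(1) by blast
  obtain k :: nat where k: "\<pi> [^] k \<odot>\<^bsub>M\<^esub> f z \<in> A" "\<pi> [^] k \<odot>\<^bsub>M\<^esub> f z \<noteq> \<zero>\<^bsub>M\<^esub>"
    "\<pi> [^] Suc k \<odot>\<^bsub>M\<^esub> f z = \<zero>\<^bsub>M\<^esub>" "\<pi> \<odot>\<^bsub>M\<^esub> (\<pi> [^] k \<odot>\<^bsub>M\<^esub> f z) = \<zero>\<^bsub>M\<^esub>"
    by (rule T_nonzero_has_socle[OF A AT fzA z(2)])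
  define u where "u = \<pi> [^] k \<odot>\<^bsub>M\<^esub> f z"
  have u: "u \<in> A" "u \<noteq> \<zero>\<^bsub>M\<^esub>" "\<pi> \<odot>\<^bsub>M\<^esub> u = \<zero>\<^bsub>M\<^esub>" "u \<in> T" using k AT unfolding u_def by auto
  have all: "x \<in> A" if "x \<in> T" "\<pi> [^] n \<odot>\<^bsub>M\<^esub> x = \<zero>\<^bsub>M\<^esub>" for x and n :: nat
    using that
  proof (induction n arbitrary: x)
    case 0
    then show ?case using T_closed[OF 0(1)] submodule_zero[OF A] by simp
  next
    case (Suc n)
    have xM: "x \<in> carrier M" using T_closed[OF Suc.prems(1)] .
    define v where "v = \<pi> [^] n \<odot>\<^bsub>M\<^esub> x"
    have vT: "v \<in> T" unfolding v_def using submodule_smult[OF submodule_T _ Suc.prems(1)] by simp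
    have "\<pi> \<odot>\<^bsub>M\<^esub> v = \<pi> [^] Suc n \<odot>\<^bsub>M\<^esub> x" unfolding v_def using xM by (simp add: R.m_comm flip: smult_assoc1)
    then have "\<pi> \<odot>\<^bsub>M\<^esub> v = \<zero>\<^bsub>M\<^esub>" using Suc.prems(2) by simp
    then have "v \<in> cyclic_submodule u" by (rule soc[OF u(4) vT u(3) _ u(2)])
    then have "v \<in> A" using cyclic_submodule_subset[OF A u(1)] by blast
    then obtain b where b: "b \<in> A" "v = \<pi> [^] n \<odot>\<^bsub>M\<^esub> b" using divn by blast
    have bM: "b \<in> carrier M" using submodule_subset[OF A b(1)] .
    have "\<pi> [^] n \<odot>\<^bsub>M\<^esub> (x \<ominus>\<^bsub>M\<^esub> b) = \<zero>\<^bsub>M\<^esub>"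
      using b(2) xM bM unfolding v_def by (simp add: smult_diff diff_eq_zero_iff)
    moreover have "x \<ominus>\<^bsub>M\<^esub> b \<in> T" using submodule_diff[OF submodule_T Suc.prems(1)] b(1) AT by blast
    ultimately have "x \<ominus>\<^bsub>M\<^esub> b \<in> A" using Suc.IH by blast
    then show ?case by (rule submodule_diff_cancel[OF A b(1) _ xM])
  qed
  show ?thesis
  proof
    fix x assume x: "x \<in> T"
    obtain n :: nat where "\<pi> [^] n \<odot>\<^bsub>M\<^esub> x = \<zero>\<^bsub>M\<^esub>" using T_\<pi>_pow[OF x] .
    then have "x \<in> A" by (rule all[OF x])
    then show "x \<in> f ` carrier M" unfolding A_def using T_closed by blast
  qed
qed

lemma pow_\<pi>_nonzero: "\<pi> [^] n \<noteq> \<zero>" for n :: nat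
  using \<pi>_nonzero by (induction n) (auto simp: integral_iff)

lemma cyclic_T_bounded:
  assumes "T = cyclic_submodule y" "y \<in> carrier M"
  obtains n :: nat where "\<forall>z\<in>T. \<pi> [^] n \<odot>\<^bsub>M\<^esub> z = \<zero>\<^bsub>M\<^esub>"
proof -
  have "y \<in> T" unfolding assms(1) by (rule generator_in_cyclic_submodule[OF assms(2)])
  then obtain n :: nat where n: "\<pi> [^] n \<odot>\<^bsub>M\<^esub> y = \<zero>\<^bsub>M\<^esub>" using T_\<pi>_pow by blast
  have "\<pi> [^] n \<odot>\<^bsub>M\<^esub> z = \<zero>\<^bsub>M\<^esub>" if z: "z \<in> T" for z
  proof -
    obtain a where a: "a \<in> carrier R" "z = a \<odot>\<^bsub>M\<^esub> y" using z unfolding assms(1) by (rule cyclic_submoduleE)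
    show ?thesis unfolding a(2) using smult_swap[of "\<pi> [^] n" a y] n a(1) assms(2) by simp
  qed
  then show ?thesis using that by blast
qed

end

context dedekind_module
begin

lemma local_cyclic_baer:
  assumes e: "e \<in> carrier M" "carrier M = cyclic_submodule e" and loc: "local_ring R"
  shows "dual_strongly_self_CS_Baer R M"
proof (rule dual_strongly_self_CS_BaerI)
  fix F assume F: "F \<subseteq> mod_hom R M M"
  define N where "N = submodule_sum R M F (\<lambda>f. f ` carrier M)"
  have N: "submodule N R M" unfolding N_def by (rule submodule_sum_images[OF F])
  have car: "submodule (carrier M) R M" by (rule carrier_is_submodule)
  have gen: "H = carrier M" if "submodule H R M" "e \<in> H" for H
    using cyclic_submodule_subset[OF that] e(2) submodule_subset[OF that(1)] by blast
  show "\<exists>D E. D \<subseteq> submodule_sum R M F (\<lambda>f. f ` carrier M) \<and> complementary R M D E \<and>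
      (\<forall>h\<in>mod_hom R M M. h ` D \<subseteq> D) \<and>
      (\<forall>X. submodule X R M \<and> D \<subseteq> X \<and> submodule_sum R M F (\<lambda>f. f ` carrier M) <+>\<^bsub>M\<^esub> X = carrier M
        \<longrightarrow> X = carrier M)"
    unfolding N_def[symmetric]
  proof (cases "e \<in> N")
    case True
    have NM: "N = carrier M" by (rule gen[OF N True])
    have "complementary R M (carrier M) {\<zero>\<^bsub>M\<^esub>}"
      by (rule complementary_sym, rule complementaryI[OF zero_submodule car]) auto
    moreover have "\<forall>h\<in>mod_hom R M M. h ` carrier M \<subseteq> carrier M"
      using mod_hom_closed[of _ R M M] by blast
    moreover have "\<forall>X. submodule X R M \<and> carrier M \<subseteq> X \<and> N <+>\<^bsub>M\<^esub> X = carrier M \<longrightarrow> X = carrier M"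
      using submodule_subset by blast
    ultimately show "\<exists>D E. D \<subseteq> N \<and> complementary R M D E \<and> (\<forall>h\<in>mod_hom R M M. h ` D \<subseteq> D) \<and>
        (\<forall>X. submodule X R M \<and> D \<subseteq> X \<and> N <+>\<^bsub>M\<^esub> X = carrier M \<longrightarrow> X = carrier M)"
      using NM by (intro exI[of _ "carrier M"] exI[of _ "{\<zero>\<^bsub>M\<^esub>}"]) simp
  next
    case False
    have proper: "\<exists>m. maximalideal m R \<and> {a \<in> carrier R. a \<odot>\<^bsub>M\<^esub> e \<in> H} \<subseteq> m"
      if H: "submodule H R M" "e \<notin> H" for H
    proof -
      have I: "ideal {a \<in> carrier R. a \<odot>\<^bsub>M\<^esub> e \<in> H} R"
      proof (rule R.ideal_if_lin_comb_closed)
        show "\<zero> \<in> {a \<in> carrier R. a \<odot>\<^bsub>M\<^esub> e \<in> H}" using submodule_zero[OF H(1)] e(1) by simp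
        show "a \<oplus> b \<in> {a \<in> carrier R. a \<odot>\<^bsub>M\<^esub> e \<in> H}"
          if "a \<in> {a \<in> carrier R. a \<odot>\<^bsub>M\<^esub> e \<in> H}" "b \<in> {a \<in> carrier R. a \<odot>\<^bsub>M\<^esub> e \<in> H}" for a b
          using that submodule_add[OF H(1)] e(1) by (simp add: smult_l_distr)
        show "a \<otimes> b \<in> {a \<in> carrier R. a \<odot>\<^bsub>M\<^esub> e \<in> H}"
          if "a \<in> carrier R" "b \<in> {a \<in> carrier R. a \<odot>\<^bsub>M\<^esub> e \<in> H}" for a b
          using that submodule_smult[OF H(1)] e(1) by (simp add: smult_assoc1)
      qed auto
      have "\<one> \<notin> {a \<in> carrier R. a \<odot>\<^bsub>M\<^esub> e \<in> H}" using H(2) e(1) by simp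
      then have "{a \<in> carrier R. a \<odot>\<^bsub>M\<^esub> e \<in> H} \<noteq> carrier R" by auto
      then obtain m where "m \<in> nonzero_primes R" "maximalideal m R" "{a \<in> carrier R. a \<odot>\<^bsub>M\<^esub> e \<in> H} \<subseteq> m"
        by (rule proper_ideal_subset_nonzero_prime[OF I])
      then show ?thesis by blast
    qed
    obtain m where m: "maximalideal m R" "{a \<in> carrier R. a \<odot>\<^bsub>M\<^esub> e \<in> N} \<subseteq> m"
      using proper[OF N False] by (elim exE conjE)
    interpret m: maximalideal m R by (rule m(1))
    have sup: "X = carrier M" if X: "submodule X R M" "N <+>\<^bsub>M\<^esub> X = carrier M" for X
    proof (rule ccontr)
      assume "X \<noteq> carrier M"
      then have "e \<notin> X" using gen[OF X(1)] by blast
      from proper[OF X(1) this] obtain m'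
        where m': "maximalideal m' R" "{a \<in> carrier R. a \<odot>\<^bsub>M\<^esub> e \<in> X} \<subseteq> m'" by (elim exE conjE)
      have "m' = m" using local_ring.unique_maximalideal[OF loc] m(1) m'(1) by blast
      have "e \<in> N <+>\<^bsub>M\<^esub> X" using X(2) e(1) by simp
      then obtain n x where nx: "n \<in> N" "x \<in> X" "e = n \<oplus>\<^bsub>M\<^esub> x" by (rule set_addE)
      have "n \<in> cyclic_submodule e" "x \<in> cyclic_submodule e"
        using submodule_subset[OF N nx(1)] submodule_subset[OF X(1) nx(2)] e(2) by auto
      then obtain a b where ab: "a \<in> carrier R" "n = a \<odot>\<^bsub>M\<^esub> e" "b \<in> carrier R" "x = b \<odot>\<^bsub>M\<^esub> e"
        by (elim cyclic_submoduleE)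
      have "a \<odot>\<^bsub>M\<^esub> e \<in> N" "b \<odot>\<^bsub>M\<^esub> e \<in> X" using nx(1,2) ab(2,4) by auto
      then have am: "a \<in> m" "b \<in> m" using ab(1,3) m(2) m'(2) \<open>m' = m\<close> by auto
      \<comment> \<open>The annihilator of e is contained in the ideal of coefficients of
        \<open>N\<close>, hence in m. From a and b in m, this puts 1 into m.\<close>
      have "(\<one> \<ominus> (a \<oplus> b)) \<odot>\<^bsub>M\<^esub> e = e \<ominus>\<^bsub>M\<^esub> (n \<oplus>\<^bsub>M\<^esub> x)"
        using ab e(1) by (simp add: smult_diff_left smult_l_distr)
      also have "\<dots> = \<zero>\<^bsub>M\<^esub>" using nx(3)[symmetric] e(1) by (simp add: diff_eq_zero_iff)
      finally have "\<one> \<ominus> (a \<oplus> b) \<in> m" using m(2) submodule_zero[OF N] ab by auto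
      then have "(\<one> \<ominus> (a \<oplus> b)) \<oplus> (a \<oplus> b) \<in> m" using am m.a_closed by blast
      moreover have "(\<one> \<ominus> (a \<oplus> b)) \<oplus> (a \<oplus> b) = \<one>" using ab by (simp add: R.minus_eq R.a_assoc R.l_neg)
      ultimately show False using m.one_imp_carrier m.I_notcarr by simp
    qed
    have "complementary R M {\<zero>\<^bsub>M\<^esub>} (carrier M)" by (rule complementaryI[OF zero_submodule car]) auto
    moreover have "\<forall>h\<in>mod_hom R M M. h ` {\<zero>\<^bsub>M\<^esub>} \<subseteq> {\<zero>\<^bsub>M\<^esub>}"
      using mod_hom_zero[OF module_axioms module_axioms] by simp
    moreover have "{\<zero>\<^bsub>M\<^esub>} \<subseteq> N" using submodule_zero[OF N] by simp
    moreover have "\<forall>X. submodule X R M \<and> {\<zero>\<^bsub>M\<^esub>} \<subseteq> X \<and> N <+>\<^bsub>M\<^esub> X = carrier M \<longrightarrow> X = carrier M"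
      by (intro allI impI, elim conjE, rule sup)
    ultimately show "\<exists>D E. D \<subseteq> N \<and> complementary R M D E \<and> (\<forall>h\<in>mod_hom R M M. h ` D \<subseteq> D) \<and>
        (\<forall>X. submodule X R M \<and> D \<subseteq> X \<and> N <+>\<^bsub>M\<^esub> X = carrier M \<longrightarrow> X = carrier M)"
      by (intro exI[of _ "{\<zero>\<^bsub>M\<^esub>}"] exI[of _ "carrier M"] conjI)
  qed
qed

text \<open>The sum of the primary components at the primes in \<open>G\<close>, encoded by support:
  at every prime outside \<open>G\<close> the element becomes zero. Sums over infinite families of
  primes are avoided, and the sets for \<open>G\<close> and its complement split the torsion
  part.\<close>

definition torsion_supported :: "'a set set \<Rightarrow> 'b set"
  where "torsion_supported G = {x \<in> torsion_part. \<forall>P\<in>nonzero_primes R. P \<notin> G \<longrightarrow>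
    (\<exists>s\<in>carrier R - P. s \<odot>\<^bsub>M\<^esub> x = \<zero>\<^bsub>M\<^esub>)}"

lemma torsion_supported_submodule: "submodule (torsion_supported G) R M"
proof (rule submoduleI')
  note tM = submodule_subset[OF submodule_torsion_part]
  show "torsion_supported G \<subseteq> carrier M" unfolding torsion_supported_def using tM by blast
  show "\<zero>\<^bsub>M\<^esub> \<in> torsion_supported G"
    unfolding torsion_supported_def
  proof (intro CollectI conjI ballI impI submodule_zero[OF submodule_torsion_part])
    fix P assume "P \<in> nonzero_primes R"
    then obtain \<pi> \<tau> where "module_at_prime R M P \<pi> \<tau>" using exists_module_at_prime by blast
    then interpret module_at_prime R M P \<pi> \<tau> .
    have "\<one> \<odot>\<^bsub>M\<^esub> \<zero>\<^bsub>M\<^esub> = \<zero>\<^bsub>M\<^esub>" by simp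
    then show "\<exists>s\<in>carrier R - P. s \<odot>\<^bsub>M\<^esub> \<zero>\<^bsub>M\<^esub> = \<zero>\<^bsub>M\<^esub>" using one_notin_P by (rule bexI)
  qed
  show "x \<oplus>\<^bsub>M\<^esub> y \<in> torsion_supported G" if xy: "x \<in> torsion_supported G" "y \<in> torsion_supported G" for x y
    unfolding torsion_supported_def
  proof (intro CollectI conjI ballI impI)
    have t: "x \<in> torsion_part" "y \<in> torsion_part" using xy unfolding torsion_supported_def by auto
    then show "x \<oplus>\<^bsub>M\<^esub> y \<in> torsion_part" by (rule submodule_add[OF submodule_torsion_part])
    fix P assume P: "P \<in> nonzero_primes R" "P \<notin> G"
    obtain \<pi> \<tau> where "module_at_prime R M P \<pi> \<tau>" using exists_module_at_prime[OF P(1)] .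
    then interpret module_at_prime R M P \<pi> \<tau> .
    obtain s r where s: "s \<in> carrier R - P" "s \<odot>\<^bsub>M\<^esub> x = \<zero>\<^bsub>M\<^esub>" and r: "r \<in> carrier R - P" "r \<odot>\<^bsub>M\<^esub> y = \<zero>\<^bsub>M\<^esub>"
      using xy P unfolding torsion_supported_def by blast
    have "(s \<otimes> r) \<odot>\<^bsub>M\<^esub> (x \<oplus>\<^bsub>M\<^esub> y) = r \<odot>\<^bsub>M\<^esub> (s \<odot>\<^bsub>M\<^esub> x) \<oplus>\<^bsub>M\<^esub> s \<odot>\<^bsub>M\<^esub> (r \<odot>\<^bsub>M\<^esub> y)"
      using s(1) r(1) tM t by (simp add: smult_r_distr R.m_comm flip: smult_assoc1)
    then have "(s \<otimes> r) \<odot>\<^bsub>M\<^esub> (x \<oplus>\<^bsub>M\<^esub> y) = \<zero>\<^bsub>M\<^esub>" unfolding s(2) r(2) using s(1) r(1) by simp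
    then show "\<exists>s\<in>carrier R - P. s \<odot>\<^bsub>M\<^esub> (x \<oplus>\<^bsub>M\<^esub> y) = \<zero>\<^bsub>M\<^esub>" using mult_notin_P[OF s(1) r(1)] by (rule bexI)
  qed
  show "a \<odot>\<^bsub>M\<^esub> x \<in> torsion_supported G" if a: "a \<in> carrier R" and x: "x \<in> torsion_supported G" for a x
    unfolding torsion_supported_def
  proof (intro CollectI conjI ballI impI)
    have t: "x \<in> torsion_part" using x unfolding torsion_supported_def by auto
    then show "a \<odot>\<^bsub>M\<^esub> x \<in> torsion_part" by (rule submodule_smult[OF submodule_torsion_part a])
    fix P assume P: "P \<in> nonzero_primes R" "P \<notin> G"
    obtain s where s: "s \<in> carrier R - P" "s \<odot>\<^bsub>M\<^esub> x = \<zero>\<^bsub>M\<^esub>"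
      using x P unfolding torsion_supported_def by blast
    have "s \<odot>\<^bsub>M\<^esub> (a \<odot>\<^bsub>M\<^esub> x) = \<zero>\<^bsub>M\<^esub>" using smult_swap[of s a x] s a tM[OF t] by simp
    then show "\<exists>s\<in>carrier R - P. s \<odot>\<^bsub>M\<^esub> (a \<odot>\<^bsub>M\<^esub> x) = \<zero>\<^bsub>M\<^esub>" using s(1) by (rule bexI)
  qed
qed

lemma primary_component_killed_outside:
  assumes P: "P \<in> nonzero_primes R" and Q: "Q \<in> nonzero_primes R" "Q \<noteq> P"
    and x: "x \<in> primary_component R M P"
  shows "\<exists>s\<in>carrier R - Q. s \<odot>\<^bsub>M\<^esub> x = \<zero>\<^bsub>M\<^esub>"
proof -
  obtain \<pi> \<tau> where "module_at_prime R M P \<pi> \<tau>" using exists_module_at_prime[OF P] .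
  then interpret module_at_prime R M P \<pi> \<tau> .
  interpret Q: primeideal Q R using Q(1) unfolding nonzero_primes_def by simp
  have "\<not> P \<subseteq> Q"
    using maximalideal.I_maximal[OF max_P Q.is_ideal] Q.a_subset Q(2) Q.I_notcarr by blast
  then obtain s where "s \<in> carrier R - Q" "s \<odot>\<^bsub>M\<^esub> x = \<zero>\<^bsub>M\<^esub>"
    using T_killed_outside_other_prime[OF x Q.primeideal] by blast
  then show ?thesis by blast
qed

lemma primary_component_subset_torsion_supported:
  assumes "P \<in> nonzero_primes R" "P \<in> G"
  shows "primary_component R M P \<subseteq> torsion_supported G"
proof
  fix x assume x: "x \<in> primary_component R M P"
  show "x \<in> torsion_supported G"
    unfolding torsion_supported_def
  proof (intro CollectI conjI ballI impI)
    show "x \<in> torsion_part" using primary_component_subset_torsion_part[OF assms(1)] x by blast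
    fix Q assume "Q \<in> nonzero_primes R" "Q \<notin> G"
    then show "\<exists>s\<in>carrier R - Q. s \<odot>\<^bsub>M\<^esub> x = \<zero>\<^bsub>M\<^esub>"
      using primary_component_killed_outside[OF assms(1) _ _ x, of Q] assms(2) by blast
  qed
qed

lemma torsion_localizes:
  assumes "P \<in> nonzero_primes R" "x \<in> torsion_part"
  shows "\<exists>s\<in>carrier R - P. s \<odot>\<^bsub>M\<^esub> x \<in> primary_component R M P"
proof -
  obtain \<pi> \<tau> where "module_at_prime R M P \<pi> \<tau>" using exists_module_at_prime[OF assms(1)] .
  then interpret module_at_prime R M P \<pi> \<tau> .
  obtain c where c: "x \<in> carrier M" "c \<in> carrier R" "c \<noteq> \<zero>" "c \<odot>\<^bsub>M\<^esub> x = \<zero>\<^bsub>M\<^esub>"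
    using assms(2) unfolding torsion_part_def by blast
  obtain s where "s \<in> carrier R - P" "s \<odot>\<^bsub>M\<^esub> x \<in> T" using torsion_localizes_to_T[OF c] .
  then show ?thesis by blast
qed

lemma torsion_supported_subset:
  assumes N: "submodule N R M" and T: "\<And>P. P \<in> nonzero_primes R \<Longrightarrow> P \<in> G \<Longrightarrow> primary_component R M P \<subseteq> N"
  shows "torsion_supported G \<subseteq> N"
proof
  fix x assume x: "x \<in> torsion_supported G"
  then have t: "x \<in> torsion_part" unfolding torsion_supported_def by simp
  show "x \<in> N"
  proof (rule local_global[OF N submodule_subset[OF submodule_torsion_part t]])
    fix P assume P: "P \<in> nonzero_primes R"
    show "\<exists>s\<in>carrier R - P. s \<odot>\<^bsub>M\<^esub> x \<in> N"
    proof (cases "P \<in> G")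
      case True
      then show ?thesis using torsion_localizes[OF P t] T[OF P True] by blast
    next
      case False
      then obtain s where "s \<in> carrier R - P" "s \<odot>\<^bsub>M\<^esub> x = \<zero>\<^bsub>M\<^esub>"
        using x P unfolding torsion_supported_def by blast
      then show ?thesis using submodule_zero[OF N] by (intro bexI[of _ s]) simp_all
    qed
  qed
qed

text \<open>Every prime is outside \<open>G\<close> or outside its complement, so x vanishes locally
  everywhere.\<close>

lemma torsion_supported_disjoint:
  assumes "x \<in> torsion_supported G" "x \<in> torsion_supported (- G)"
  shows "x = \<zero>\<^bsub>M\<^esub>"
proof -
  have t: "x \<in> torsion_part" using assms(1) unfolding torsion_supported_def by simp
  have "x \<in> {\<zero>\<^bsub>M\<^esub>}"
  proof (rule local_global[OF zero_submodule submodule_subset[OF submodule_torsion_part t]])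
    fix P assume P: "P \<in> nonzero_primes R"
    then have "\<exists>s\<in>carrier R - P. s \<odot>\<^bsub>M\<^esub> x = \<zero>\<^bsub>M\<^esub>"
      using assms unfolding torsion_supported_def by (cases "P \<in> G") auto
    then show "\<exists>s\<in>carrier R - P. s \<odot>\<^bsub>M\<^esub> x \<in> {\<zero>\<^bsub>M\<^esub>}" by simp
  qed
  then show ?thesis by simp
qed

lemma torsion_supported_sum:
  "torsion_part \<subseteq> torsion_supported G <+>\<^bsub>M\<^esub> torsion_supported (- G)"
proof (rule torsion_part_subset)
  note G = torsion_supported_submodule
  show "submodule (torsion_supported G <+>\<^bsub>M\<^esub> torsion_supported (- G)) R M" by (rule submodule_set_add[OF G G])
  fix P assume P: "P \<in> nonzero_primes R"
  show "primary_component R M P \<subseteq> torsion_supported G <+>\<^bsub>M\<^esub> torsion_supported (- G)"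
    using primary_component_subset_torsion_supported[OF P, of G]
      primary_component_subset_torsion_supported[OF P, of "- G"]
      subset_set_add_left[OF G[of G] G[of "- G"]] subset_set_add_right[OF G[of G] G[of "- G"]] by blast
qed

lemma torsion_part_hom:
  assumes f: "f \<in> mod_hom R M M" and x: "x \<in> torsion_part" shows "f x \<in> torsion_part"
proof -
  obtain c where c: "x \<in> carrier M" "c \<in> carrier R" "c \<noteq> \<zero>" "c \<odot>\<^bsub>M\<^esub> x = \<zero>\<^bsub>M\<^esub>"
    using x unfolding torsion_part_def by blast
  have "c \<odot>\<^bsub>M\<^esub> f x = \<zero>\<^bsub>M\<^esub>"
    using mod_hom_smult[OF f c(2,1)] c(4) mod_hom_zero[OF module_axioms module_axioms f] by simp
  then show ?thesis unfolding torsion_part_def using c(2,3) mod_hom_closed[OF f c(1)] by blast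
qed

lemma torsion_supported_hom:
  assumes f: "f \<in> mod_hom R M M" and x: "x \<in> torsion_supported G" shows "f x \<in> torsion_supported G"
  unfolding torsion_supported_def
proof (intro CollectI conjI ballI impI)
  have t: "x \<in> torsion_part" using x unfolding torsion_supported_def by simp
  then show "f x \<in> torsion_part" by (rule torsion_part_hom[OF f])
  fix P assume P: "P \<in> nonzero_primes R" "P \<notin> G"
  then obtain s where s: "s \<in> carrier R - P" "s \<odot>\<^bsub>M\<^esub> x = \<zero>\<^bsub>M\<^esub>"
    using x unfolding torsion_supported_def by blast
  have "s \<odot>\<^bsub>M\<^esub> f x = f (s \<odot>\<^bsub>M\<^esub> x)"
    using mod_hom_smult[OF f, of s x] s(1) submodule_subset[OF submodule_torsion_part t] by simp
  then have "s \<odot>\<^bsub>M\<^esub> f x = \<zero>\<^bsub>M\<^esub>" unfolding s(2) using mod_hom_zero[OF module_axioms module_axioms f] by simp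
  then show "\<exists>s\<in>carrier R - P. s \<odot>\<^bsub>M\<^esub> f x = \<zero>\<^bsub>M\<^esub>" using s(1) by (rule bexI)
qed

text \<open>The torsion component t of f l must vanish at every prime P: a fixed power of
  \<open>\<pi>\<close> kills the cyclic primary component, while l is divisible by that power in
  L.\<close>

lemma rank_one_divisible_invariant:
  assumes c: "complementary R M torsion_part L" and L: "rank_one_divisible L"
    and cyc: "\<And>P. P \<in> nonzero_primes R \<Longrightarrow> \<exists>y\<in>carrier M. primary_component R M P = cyclic_submodule y"
    and f: "f \<in> mod_hom R M M" and l: "l \<in> L"
  shows "f l \<in> L"
proof -
  note cE = complementaryE[OF c]
  have lM: "l \<in> carrier M" using submodule_subset[OF cE(2) l] .
  obtain t l' where t: "t \<in> torsion_part" "l' \<in> L" "f l = t \<oplus>\<^bsub>M\<^esub> l'"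
    using cE(4)[OF mod_hom_closed[OF f lM]] by (elim bexE)
  have tM: "t \<in> carrier M" using submodule_subset[OF cE(1) t(1)] .
  have "t \<in> {\<zero>\<^bsub>M\<^esub>}"
  proof (rule local_global[OF zero_submodule tM])
    fix P assume P: "P \<in> nonzero_primes R"
    obtain \<pi> \<tau> where "module_at_prime R M P \<pi> \<tau>" using exists_module_at_prime[OF P] .
    then interpret module_at_prime R M P \<pi> \<tau> .
    obtain n :: nat where n: "\<forall>z\<in>T. \<pi> [^] n \<odot>\<^bsub>M\<^esub> z = \<zero>\<^bsub>M\<^esub>" using cyclic_T_bounded cyc[OF P] by blast
    have "\<pi> [^] n \<in> carrier R - {\<zero>}" using pow_\<pi>_nonzero by simp
    then obtain k where k: "k \<in> L" "l = \<pi> [^] n \<odot>\<^bsub>M\<^esub> k" using L l unfolding rank_one_divisible_def by blast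
    have kM: "k \<in> carrier M" using submodule_subset[OF cE(2) k(1)] .
    obtain u k' where u: "u \<in> torsion_part" "k' \<in> L" "f k = u \<oplus>\<^bsub>M\<^esub> k'"
      using cE(4)[OF mod_hom_closed[OF f kM]] by (elim bexE)
    have uM: "u \<in> carrier M" "k' \<in> carrier M"
      using submodule_subset[OF cE(1) u(1)] submodule_subset[OF cE(2) u(2)] by auto
    have "f l = \<pi> [^] n \<odot>\<^bsub>M\<^esub> f k" unfolding k(2) using kM by (intro mod_hom_smult[OF f]) auto
    also have "\<dots> = \<pi> [^] n \<odot>\<^bsub>M\<^esub> u \<oplus>\<^bsub>M\<^esub> \<pi> [^] n \<odot>\<^bsub>M\<^esub> k'" unfolding u(3) using uM by (simp add: smult_r_distr)
    finally have "t \<oplus>\<^bsub>M\<^esub> l' = \<pi> [^] n \<odot>\<^bsub>M\<^esub> u \<oplus>\<^bsub>M\<^esub> \<pi> [^] n \<odot>\<^bsub>M\<^esub> k'" using t(3) by simp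
    then have tu: "t = \<pi> [^] n \<odot>\<^bsub>M\<^esub> u"
      using complementary_decomp_unique[OF c t(1) submodule_smult[OF cE(1) _ u(1), of "\<pi> [^] n"]
          t(2) submodule_smult[OF cE(2) _ u(2), of "\<pi> [^] n"]] by simp
    obtain s where s: "s \<in> carrier R - P" "s \<odot>\<^bsub>M\<^esub> u \<in> T" using torsion_localizes[OF P u(1)] by (elim bexE)
    have "s \<odot>\<^bsub>M\<^esub> t = \<pi> [^] n \<odot>\<^bsub>M\<^esub> (s \<odot>\<^bsub>M\<^esub> u)" unfolding tu using s(1) uM by (intro smult_swap) auto
    then have "s \<odot>\<^bsub>M\<^esub> t \<in> {\<zero>\<^bsub>M\<^esub>}" using n s(2) by simp
    then show "\<exists>s\<in>carrier R - P. s \<odot>\<^bsub>M\<^esub> t \<in> {\<zero>\<^bsub>M\<^esub>}" using s(1) by (rule bexI)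
  qed
  then show ?thesis using t submodule_subset[OF cE(2) t(2)] by simp
qed

text \<open>Let X contain D with \<open>N\<close> + X = M. First L \<subseteq> X is shown. Then, at
  a prime whose component is not contained in \<open>N\<close>, the maps in \<open>F\<close> send
  the component into \<open>\<pi>\<close> times itself in the cyclic case and to 0 in the Pruefer
  case, so a Nakayama argument puts the component into X.\<close>

theorem structured_module_baer:
  assumes c: "complementary R M torsion_part L"
    and L: "L = {\<zero>\<^bsub>M\<^esub>} \<or> rank_one_divisible L \<and>
      (\<forall>P\<in>nonzero_primes R. \<exists>y\<in>carrier M. primary_component R M P = cyclic_submodule y)"
    and prim: "\<And>P. P \<in> nonzero_primes R \<Longrightarrow>
      (\<exists>y\<in>carrier M. primary_component R M P = cyclic_submodule y) \<or>
      (\<exists>\<pi> \<tau>. uniformized_prime R P \<pi> \<tau> \<and> pruefer_like \<pi> (primary_component R M P))"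
  shows "dual_strongly_self_CS_Baer R M"
proof (rule dual_strongly_self_CS_BaerI)
  fix F assume F: "F \<subseteq> mod_hom R M M"
  define N where "N = submodule_sum R M F (\<lambda>f. f ` carrier M)"
  have N: "submodule N R M" unfolding N_def by (rule submodule_sum_images[OF F])
  have FN: "f x \<in> N" if "f \<in> F" "x \<in> carrier M" for f x
    unfolding N_def using submodule_sum_upper[of f F "\<lambda>f. f ` carrier M"] that by blast
  have FH: "f \<in> mod_hom R M M" if "f \<in> F" for f using F that by blast
  note cE = complementaryE[OF c]
  note tM = submodule_subset[OF cE(1)] and LM = submodule_subset[OF cE(2)]
  have Linv: "f l \<in> L" if "f \<in> mod_hom R M M" "l \<in> L" for f l
  proof (cases "L = {\<zero>\<^bsub>M\<^esub>}")
    case True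
    then show ?thesis using mod_hom_zero[OF module_axioms module_axioms that(1)] that(2) by simp
  next
    case False
    then show ?thesis using L rank_one_divisible_invariant[OF c _ _ that] by blast
  qed
  define G where "G = {P. primary_component R M P \<subseteq> N}"
  \<comment> \<open>Only the two extreme choices for the part of D in L are needed: if L is not
    contained in \<open>N\<close>, every map in \<open>F\<close> vanishes on L.\<close>
  define L1 where "L1 = (if L \<subseteq> N then L else {\<zero>\<^bsub>M\<^esub>})"
  define L2 where "L2 = (if L \<subseteq> N then {\<zero>\<^bsub>M\<^esub>} else L)"
  have L1: "submodule L1 R M" "L1 \<subseteq> L" "L1 \<subseteq> N" and L2: "submodule L2 R M" "L2 \<subseteq> L"
    unfolding L1_def L2_def using cE(2) zero_submodule submodule_zero[OF cE(2)] submodule_zero[OF N] by auto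
  define TG where "TG = torsion_supported G"
  define TC where "TC = torsion_supported (- G)"
  have TG: "submodule TG R M" "TG \<subseteq> torsion_part" and TC: "submodule TC R M" "TC \<subseteq> torsion_part"
    unfolding TG_def TC_def
    by (intro torsion_supported_submodule, simp add: torsion_supported_def subset_iff,
        intro torsion_supported_submodule, simp add: torsion_supported_def subset_iff)
  define D where "D = TG <+>\<^bsub>M\<^esub> L1"
  define E where "E = TC <+>\<^bsub>M\<^esub> L2"
  have D: "submodule D R M" unfolding D_def by (rule submodule_set_add[OF TG(1) L1(1)])
  have E: "submodule E R M" unfolding E_def by (rule submodule_set_add[OF TC(1) L2(1)])
  have TGN: "TG \<subseteq> N" unfolding TG_def by (rule torsion_supported_subset[OF N]) (simp add: G_def)
  have DN: "D \<subseteq> N" unfolding D_def by (rule set_add_subset[OF N TGN L1(3)])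
  have DE: "complementary R M D E"
  proof (rule complementaryI[OF D E])
    show "x = \<zero>\<^bsub>M\<^esub>" if x: "x \<in> D" "x \<in> E" for x
    proof -
      obtain t l where tl: "t \<in> TG" "l \<in> L1" "x = t \<oplus>\<^bsub>M\<^esub> l" using x(1) unfolding D_def by (rule set_addE)
      obtain t' l' where tl': "t' \<in> TC" "l' \<in> L2" "x = t' \<oplus>\<^bsub>M\<^esub> l'" using x(2) unfolding E_def by (rule set_addE)
      have "t = t' \<and> l = l'"
        by (rule complementary_decomp_unique[OF c]) (use tl tl' TG(2) TC(2) L1(2) L2(2) in auto)
      then have "t = \<zero>\<^bsub>M\<^esub>" "l = \<zero>\<^bsub>M\<^esub>"
        using torsion_supported_disjoint[of t G] tl tl' unfolding TG_def TC_def L1_def L2_def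
        by (auto split: if_splits)
      then show ?thesis using tl(3) by simp
    qed
    show "\<exists>d\<in>D. \<exists>e\<in>E. x = d \<oplus>\<^bsub>M\<^esub> e" if x: "x \<in> carrier M" for x
    proof -
      obtain t l where tl: "t \<in> torsion_part" "l \<in> L" "x = t \<oplus>\<^bsub>M\<^esub> l" using cE(4)[OF x] by (elim bexE)
      have "t \<in> TG <+>\<^bsub>M\<^esub> TC" unfolding TG_def TC_def using torsion_supported_sum tl(1) by blast
      then obtain t1 t2 where t12: "t1 \<in> TG" "t2 \<in> TC" "t = t1 \<oplus>\<^bsub>M\<^esub> t2" by (rule set_addE)
      have cl: "t1 \<in> carrier M" "t2 \<in> carrier M" "l \<in> carrier M"
        using submodule_subset[OF TG(1) t12(1)] submodule_subset[OF TC(1) t12(2)] LM[OF tl(2)] by auto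
      have "\<exists>l1\<in>L1. \<exists>l2\<in>L2. l = l1 \<oplus>\<^bsub>M\<^esub> l2"
      proof (cases "L \<subseteq> N")
        case True
        have "l = l \<oplus>\<^bsub>M\<^esub> \<zero>\<^bsub>M\<^esub>" using cl by simp
        moreover have "l \<in> L1" "\<zero>\<^bsub>M\<^esub> \<in> L2" using True tl(2) unfolding L1_def L2_def by auto
        ultimately show ?thesis by blast
      next
        case False
        have "l = \<zero>\<^bsub>M\<^esub> \<oplus>\<^bsub>M\<^esub> l" using cl by simp
        moreover have "\<zero>\<^bsub>M\<^esub> \<in> L1" "l \<in> L2" using False tl(2) unfolding L1_def L2_def by auto
        ultimately show ?thesis by blast
      qed
      then obtain l1 l2 where l12: "l1 \<in> L1" "l2 \<in> L2" "l = l1 \<oplus>\<^bsub>M\<^esub> l2" by (elim bexE)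
      have cl': "l1 \<in> carrier M" "l2 \<in> carrier M"
        using submodule_subset[OF L1(1) l12(1)] submodule_subset[OF L2(1) l12(2)] by auto
      have "x = (t1 \<oplus>\<^bsub>M\<^esub> l1) \<oplus>\<^bsub>M\<^esub> (t2 \<oplus>\<^bsub>M\<^esub> l2)"
        unfolding tl(3) t12(3) l12(3) using cl cl' by (simp add: M.a_ac)
      moreover have "t1 \<oplus>\<^bsub>M\<^esub> l1 \<in> D" unfolding D_def by (rule set_addI[OF t12(1) l12(1)])
      moreover have "t2 \<oplus>\<^bsub>M\<^esub> l2 \<in> E" unfolding E_def by (rule set_addI[OF t12(2) l12(2)])
      ultimately show ?thesis by blast
    qed
  qed
  have inv: "h ` D \<subseteq> D" if h: "h \<in> mod_hom R M M" for h
  proof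
    fix z assume "z \<in> h ` D"
    then obtain x where x: "x \<in> D" "z = h x" by blast
    obtain t l where tl: "t \<in> TG" "l \<in> L1" "x = t \<oplus>\<^bsub>M\<^esub> l" using x(1) unfolding D_def by (rule set_addE)
    have "h t \<in> TG" using torsion_supported_hom[OF h] tl(1) unfolding TG_def by blast
    moreover have "h l \<in> L1"
      using Linv[OF h] mod_hom_zero[OF module_axioms module_axioms h] tl(2) unfolding L1_def by (auto split: if_splits)
    moreover have "z = h t \<oplus>\<^bsub>M\<^esub> h l" unfolding x(2) tl(3)
      by (rule mod_hom_add[OF h submodule_subset[OF TG(1) tl(1)] submodule_subset[OF L1(1) tl(2)]])
    ultimately show "z \<in> D" unfolding D_def by (simp add: set_addI)
  qed
  have sup: "X = carrier M" if X: "submodule X R M" "D \<subseteq> X" "N <+>\<^bsub>M\<^esub> X = carrier M" for X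
  proof -
    have dec: "\<exists>n\<in>N. \<exists>x\<in>X. m = n \<oplus>\<^bsub>M\<^esub> x" if "m \<in> carrier M" for m
      using that unfolding X(3)[symmetric] mem_set_add .
    have LX: "L \<subseteq> X"
    proof (cases "L \<subseteq> N")
      case True
      then have "L = L1" unfolding L1_def by simp
      then show ?thesis unfolding D_def using X(2)[unfolded D_def] subset_set_add_right[OF TG(1) L1(1)] by blast
    next
      case False
      have "L \<noteq> {\<zero>\<^bsub>M\<^esub>}" using False submodule_zero[OF N] by auto
      then have rk: "rank_one_divisible L"
        and cyc: "\<forall>P\<in>nonzero_primes R. \<exists>y\<in>carrier M. primary_component R M P = cyclic_submodule y" using L by auto
      have fL0: "f l = \<zero>\<^bsub>M\<^esub>" if f: "f \<in> F" and l: "l \<in> L" for f l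
      proof (rule ccontr)
        assume nz: "f l \<noteq> \<zero>\<^bsub>M\<^esub>"
        have "k \<in> N" if k: "k \<in> L" for k
        proof -
          obtain a r where a: "a \<in> carrier R" "a \<noteq> \<zero>" "r \<in> carrier R" "a \<odot>\<^bsub>M\<^esub> k = r \<odot>\<^bsub>M\<^esub> f l"
            using rk k Linv[OF FH[OF f] l] nz unfolding rank_one_divisible_def by blast
          have "r \<odot>\<^bsub>M\<^esub> l \<in> L" by (rule submodule_smult[OF cE(2) a(3) l])
          \<comment> \<open>Since a k = r f l, dividing r l by a gives a preimage: a f l1 = f (r l)
            = a k, and torsion-freeness yields k = f l1. So one non-zero value of f on L would put
            all of L into \<open>N\<close>.\<close>
          then obtain l1 where l1: "l1 \<in> L" "r \<odot>\<^bsub>M\<^esub> l = a \<odot>\<^bsub>M\<^esub> l1"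
            using rk a(1,2) unfolding rank_one_divisible_def by blast
          have "a \<odot>\<^bsub>M\<^esub> f l1 = f (r \<odot>\<^bsub>M\<^esub> l)"
            unfolding l1(2) using mod_hom_smult[OF FH[OF f] a(1) LM[OF l1(1)]] by simp
          also have "\<dots> = a \<odot>\<^bsub>M\<^esub> k" unfolding a(4) by (rule mod_hom_smult[OF FH[OF f] a(3) LM[OF l]])
          finally have "a \<odot>\<^bsub>M\<^esub> (k \<ominus>\<^bsub>M\<^esub> f l1) = \<zero>\<^bsub>M\<^esub>"
            using a(1) LM[OF k] LM[OF Linv[OF FH[OF f] l1(1)]] by (simp add: smult_diff diff_eq_zero_iff)
          moreover have "k \<ominus>\<^bsub>M\<^esub> f l1 \<in> L" by (rule submodule_diff[OF cE(2) k Linv[OF FH[OF f] l1(1)]])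
          ultimately have "k \<ominus>\<^bsub>M\<^esub> f l1 = \<zero>\<^bsub>M\<^esub>" using rk a(1,2) unfolding rank_one_divisible_def by blast
          then have "k = f l1" using LM[OF k] LM[OF Linv[OF FH[OF f] l1(1)]] by (simp add: diff_eq_zero_iff)
          then show ?thesis using FN[OF f LM[OF l1(1)]] by simp
        qed
        then show False using False by blast
      qed
      have Nt: "N \<subseteq> torsion_part" unfolding N_def
      proof (rule submodule_sum_least[OF cE(1)])
        fix f assume f: "f \<in> F"
        show "f ` carrier M \<subseteq> torsion_part"
        proof
          fix z assume "z \<in> f ` carrier M"
          then obtain m where m: "m \<in> carrier M" "z = f m" by blast
          obtain t l where tl: "t \<in> torsion_part" "l \<in> L" "m = t \<oplus>\<^bsub>M\<^esub> l" using cE(4)[OF m(1)] by (elim bexE)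
          have ft: "f t \<in> torsion_part" by (rule torsion_part_hom[OF FH[OF f] tl(1)])
          have "z = f t \<oplus>\<^bsub>M\<^esub> f l" unfolding m(2) tl(3) by (rule mod_hom_add[OF FH[OF f] tM[OF tl(1)] LM[OF tl(2)]])
          then have "z = f t" using fL0[OF f tl(2)] tM[OF ft] by simp
          then show "z \<in> torsion_part" using ft by simp
        qed
      qed
      show ?thesis
      proof
        fix l assume l: "l \<in> L"
        show "l \<in> X"
        proof (rule local_global[OF X(1) LM[OF l]])
          fix P assume P: "P \<in> nonzero_primes R"
          obtain \<pi> \<tau> where "module_at_prime R M P \<pi> \<tau>" using exists_module_at_prime[OF P] .
          then interpret module_at_prime R M P \<pi> \<tau> .
          obtain k :: nat where k: "\<forall>z\<in>T. \<pi> [^] k \<odot>\<^bsub>M\<^esub> z = \<zero>\<^bsub>M\<^esub>" using cyclic_T_bounded cyc P by blast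
          \<comment> \<open>Here \<open>N\<close> is torsion. Writing l as \<open>\<pi>\<close>^k l'
            and splitting l' along \<open>N\<close> + X, the summand from \<open>N\<close> is killed
            by \<open>\<pi>\<close>^k locally at P.\<close>
          have "\<pi> [^] k \<in> carrier R - {\<zero>}" using pow_\<pi>_nonzero by simp
          then obtain l' where l': "l' \<in> L" "l = \<pi> [^] k \<odot>\<^bsub>M\<^esub> l'" using rk l unfolding rank_one_divisible_def by blast
          obtain n x where nx: "n \<in> N" "x \<in> X" "l' = n \<oplus>\<^bsub>M\<^esub> x" using dec[OF LM[OF l'(1)]] by (elim bexE)
          have cl: "n \<in> carrier M" "x \<in> carrier M" using submodule_subset[OF N nx(1)] submodule_subset[OF X(1) nx(2)] by auto
          obtain s where s: "s \<in> carrier R - P" "s \<odot>\<^bsub>M\<^esub> n \<in> T" using torsion_localizes[OF P] nx(1) Nt by blast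
          have "s \<odot>\<^bsub>M\<^esub> l = \<pi> [^] k \<odot>\<^bsub>M\<^esub> (s \<odot>\<^bsub>M\<^esub> n) \<oplus>\<^bsub>M\<^esub> \<pi> [^] k \<odot>\<^bsub>M\<^esub> (s \<odot>\<^bsub>M\<^esub> x)"
            unfolding l'(2) nx(3) using cl s(1) by (simp add: smult_r_distr smult_swap[of s])
          also have "\<dots> = \<pi> [^] k \<odot>\<^bsub>M\<^esub> (s \<odot>\<^bsub>M\<^esub> x)" using k s cl by simp
          finally have "s \<odot>\<^bsub>M\<^esub> l \<in> X" using submodule_smult[OF X(1)] s(1) nx(2) by simp
          then show "\<exists>s\<in>carrier R - P. s \<odot>\<^bsub>M\<^esub> l \<in> X" using s(1) by (rule bexI)
        qed
      qed
    qed
    have TX: "primary_component R M P \<subseteq> X" if P: "P \<in> nonzero_primes R" for P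
    proof (cases "P \<in> G")
      case True
      then show ?thesis
        using primary_component_subset_torsion_supported[OF P True] subset_set_add_left[OF TG(1) L1(1)] X(2)
        unfolding D_def TG_def by blast
    next
      case False
      then have PN: "\<not> primary_component R M P \<subseteq> N" unfolding G_def by simp
      \<comment> \<open>Let all maps in \<open>F\<close> send the component at P into Q. Locally at
        P the torsion component of an element of \<open>N\<close> then lies in Q; as L \<subseteq>
        X, every y agrees modulo X with a torsion element t lying in Q locally.\<close>
      have key: "\<exists>s\<in>carrier R - P. \<exists>t\<in>carrier M. s \<odot>\<^bsub>M\<^esub> t \<in> Q \<and> y \<ominus>\<^bsub>M\<^esub> t \<in> X"
        if Q: "submodule Q R M" and FQ: "\<forall>f\<in>F. \<forall>z\<in>primary_component R M P. f z \<in> Q"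
          and y: "y \<in> carrier M" for Q y
      proof -
        obtain \<pi> \<tau> where "module_at_prime R M P \<pi> \<tau>" using exists_module_at_prime[OF P] .
        then interpret module_at_prime R M P \<pi> \<tau> .
        define A where "A = {t \<in> torsion_part. \<exists>s\<in>carrier R - P. s \<odot>\<^bsub>M\<^esub> t \<in> Q}"
        have A: "submodule A R M"
        proof (rule submoduleI')
          show "A \<subseteq> carrier M" unfolding A_def using tM by blast
          have "\<one> \<odot>\<^bsub>M\<^esub> \<zero>\<^bsub>M\<^esub> \<in> Q" using submodule_zero[OF Q] by simp
          then show "\<zero>\<^bsub>M\<^esub> \<in> A" unfolding A_def using one_notin_P submodule_zero[OF cE(1)] by blast
          show "u \<oplus>\<^bsub>M\<^esub> v \<in> A" if uv: "u \<in> A" "v \<in> A" for u v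
          proof -
            obtain s r where s: "s \<in> carrier R - P" "s \<odot>\<^bsub>M\<^esub> u \<in> Q" and r: "r \<in> carrier R - P" "r \<odot>\<^bsub>M\<^esub> v \<in> Q"
              and t: "u \<in> torsion_part" "v \<in> torsion_part" using uv unfolding A_def by blast
            have "(s \<otimes> r) \<odot>\<^bsub>M\<^esub> (u \<oplus>\<^bsub>M\<^esub> v) = r \<odot>\<^bsub>M\<^esub> (s \<odot>\<^bsub>M\<^esub> u) \<oplus>\<^bsub>M\<^esub> s \<odot>\<^bsub>M\<^esub> (r \<odot>\<^bsub>M\<^esub> v)"
              using s(1) r(1) tM t by (simp add: smult_r_distr R.m_comm flip: smult_assoc1)
            then have "(s \<otimes> r) \<odot>\<^bsub>M\<^esub> (u \<oplus>\<^bsub>M\<^esub> v) \<in> Q"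
              using submodule_add[OF Q] submodule_smult[OF Q] s r by simp
            then show ?thesis
              unfolding A_def using mult_notin_P[OF s(1) r(1)] submodule_add[OF cE(1) t] by blast
          qed
          show "a \<odot>\<^bsub>M\<^esub> u \<in> A" if a: "a \<in> carrier R" and u: "u \<in> A" for a u
          proof -
            obtain s where s: "s \<in> carrier R - P" "s \<odot>\<^bsub>M\<^esub> u \<in> Q" and t: "u \<in> torsion_part"
              using u unfolding A_def by blast
            have "s \<odot>\<^bsub>M\<^esub> (a \<odot>\<^bsub>M\<^esub> u) \<in> Q"
              using smult_swap[of s a u] submodule_smult[OF Q a s(2)] s(1) a tM[OF t] by simp
            then show ?thesis unfolding A_def using s(1) submodule_smult[OF cE(1) a t] by blast
          qed
        qed
        have AL: "submodule (A <+>\<^bsub>M\<^esub> L) R M" by (rule submodule_set_add[OF A cE(2)])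
        have "N \<subseteq> A <+>\<^bsub>M\<^esub> L" unfolding N_def
        proof (rule submodule_sum_least[OF AL])
          fix f assume f: "f \<in> F"
          show "f ` carrier M \<subseteq> A <+>\<^bsub>M\<^esub> L"
          proof
            fix z assume "z \<in> f ` carrier M"
            then obtain m where m: "m \<in> carrier M" "z = f m" by blast
            obtain t l where tl: "t \<in> torsion_part" "l \<in> L" "m = t \<oplus>\<^bsub>M\<^esub> l" using cE(4)[OF m(1)] by (elim bexE)
            have zz: "z = f t \<oplus>\<^bsub>M\<^esub> f l" unfolding m(2) tl(3)
              by (rule mod_hom_add[OF FH[OF f] tM[OF tl(1)] LM[OF tl(2)]])
            obtain s where s: "s \<in> carrier R - P" "s \<odot>\<^bsub>M\<^esub> t \<in> T" using torsion_localizes[OF P tl(1)] by (elim bexE)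
            have "s \<odot>\<^bsub>M\<^esub> f t = f (s \<odot>\<^bsub>M\<^esub> t)" using mod_hom_smult[OF FH[OF f], of s t] s(1) tM[OF tl(1)] by simp
            then have "s \<odot>\<^bsub>M\<^esub> f t \<in> Q" using FQ f s(2) by simp
            then have "f t \<in> A" unfolding A_def using s(1) torsion_part_hom[OF FH[OF f] tl(1)] by blast
            then show "z \<in> A <+>\<^bsub>M\<^esub> L" unfolding zz using Linv[OF FH[OF f] tl(2)] by (rule set_addI)
          qed
        qed
        moreover obtain n x where nx: "n \<in> N" "x \<in> X" "y = n \<oplus>\<^bsub>M\<^esub> x" using dec[OF y] by (elim bexE)
        ultimately have "n \<in> A <+>\<^bsub>M\<^esub> L" by blast
        then obtain t l where tl: "t \<in> A" "l \<in> L" "n = t \<oplus>\<^bsub>M\<^esub> l" by (rule set_addE)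
        have cl: "t \<in> carrier M" "l \<in> carrier M" "x \<in> carrier M"
          using submodule_subset[OF A tl(1)] LM[OF tl(2)] submodule_subset[OF X(1) nx(2)] by auto
        have "y = t \<oplus>\<^bsub>M\<^esub> (l \<oplus>\<^bsub>M\<^esub> x)" unfolding nx(3) tl(3) using cl by (simp add: M.a_assoc)
        then have "y \<ominus>\<^bsub>M\<^esub> t = l \<oplus>\<^bsub>M\<^esub> x" using cl by simp
        then have "y \<ominus>\<^bsub>M\<^esub> t \<in> X" using submodule_add[OF X(1) _ nx(2)] LX tl(2) by auto
        then show ?thesis using tl(1) cl(1) unfolding A_def by blast
      qed
      from prim[OF P] show ?thesis
      proof
        assume "\<exists>y\<in>carrier M. primary_component R M P = cyclic_submodule y"
        then obtain y where y: "y \<in> carrier M" "primary_component R M P = cyclic_submodule y" by blast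
        obtain \<pi> \<tau> where "module_at_prime R M P \<pi> \<tau>" using exists_module_at_prime[OF P] .
        then interpret module_at_prime R M P \<pi> \<tau> .
        have yT: "y \<in> T" unfolding y(2) by (rule generator_in_cyclic_submodule[OF y(1)])
        \<comment> \<open>For a cyclic component \<open>T\<close> = R y the right Q is
          \<open>\<pi>\<close> \<open>T\<close>: if f y = a y with a outside P, then y, and with it
          \<open>T\<close>, would be in \<open>N\<close>.\<close>
        define Q where "Q = cyclic_submodule (\<pi> \<odot>\<^bsub>M\<^esub> y)"
        have pyM: "\<pi> \<odot>\<^bsub>M\<^esub> y \<in> carrier M" using y(1) by simp
        have Q: "submodule Q R M" unfolding Q_def by (rule submodule_cyclic[OF pyM])
        have FQ: "\<forall>f\<in>F. \<forall>z\<in>T. f z \<in> Q"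
        proof (intro ballI)
          fix f z assume f: "f \<in> F" and z: "z \<in> T"
          have "f y \<in> T"
            using mod_hom_primary_component[OF module_axioms module_axioms FH[OF f] yT] ideal_power_closed by blast
          then obtain a where a: "a \<in> carrier R" "f y = a \<odot>\<^bsub>M\<^esub> y" unfolding y(2) by (rule cyclic_submoduleE)
          have ayT: "a \<odot>\<^bsub>M\<^esub> y \<in> T" by (rule submodule_smult[OF submodule_T a(1) yT])
          have "a \<in> P"
          proof (rule ccontr)
            assume "a \<notin> P"
            moreover have "a \<odot>\<^bsub>M\<^esub> y \<in> N" using FN[OF f y(1)] a(2) by simp
            ultimately have "y \<in> N" using T_mem_if_smult_mem[OF N yT, of a] a(1) by simp
            then show False using PN cyclic_submodule_subset[OF N] y(2) by simp
          qed
          then obtain a' where a': "a' \<in> carrier R" "\<tau> \<otimes> a = \<pi> \<otimes> a'" using \<tau>_mult by blast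
          have "\<tau> \<odot>\<^bsub>M\<^esub> (a \<odot>\<^bsub>M\<^esub> y) = a' \<odot>\<^bsub>M\<^esub> (\<pi> \<odot>\<^bsub>M\<^esub> y)"
            using a(1) a'(1) y(1) smult_swap[of a' \<pi> y] by (simp add: a'(2) flip: smult_assoc1)
          then have "\<tau> \<odot>\<^bsub>M\<^esub> (a \<odot>\<^bsub>M\<^esub> y) \<in> Q" unfolding Q_def using cyclic_submoduleI[OF a'(1)] by simp
          then have fyQ: "f y \<in> Q" unfolding a(2) using T_mem_if_smult_mem[OF Q ayT, of \<tau>] \<tau>_notin_P by simp
          obtain b where b: "b \<in> carrier R" "z = b \<odot>\<^bsub>M\<^esub> y" using z unfolding y(2) by (rule cyclic_submoduleE)
          show "f z \<in> Q" unfolding b(2) mod_hom_smult[OF FH[OF f] b(1) y(1)] by (rule submodule_smult[OF Q b(1) fyQ])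
        qed
        obtain s t where s: "s \<in> carrier R - P" "t \<in> carrier M" "s \<odot>\<^bsub>M\<^esub> t \<in> Q" "y \<ominus>\<^bsub>M\<^esub> t \<in> X"
          using key[OF Q FQ y(1)] by (elim bexE conjE)
        obtain b where b: "b \<in> carrier R" "s \<odot>\<^bsub>M\<^esub> t = b \<odot>\<^bsub>M\<^esub> (\<pi> \<odot>\<^bsub>M\<^esub> y)"
          using s(3) unfolding Q_def by (rule cyclic_submoduleE)
        have sR: "s \<in> carrier R" using s(1) by simp
        \<comment> \<open>The Nakayama step: modulo X, s y equals b \<open>\<pi>\<close> y, and s -
          b \<open>\<pi>\<close> is outside P, hence invertible on \<open>T\<close>.\<close>
        have "(s \<ominus> b \<otimes> \<pi>) \<odot>\<^bsub>M\<^esub> y = s \<odot>\<^bsub>M\<^esub> y \<ominus>\<^bsub>M\<^esub> s \<odot>\<^bsub>M\<^esub> t"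
          using sR b y(1) by (simp add: smult_diff_left smult_assoc1)
        also have "\<dots> = s \<odot>\<^bsub>M\<^esub> (y \<ominus>\<^bsub>M\<^esub> t)" using sR y(1) s(2) by (simp add: smult_diff)
        finally have "(s \<ominus> b \<otimes> \<pi>) \<odot>\<^bsub>M\<^esub> y \<in> X" using submodule_smult[OF X(1) sR s(4)] by simp
        moreover have "s \<ominus> b \<otimes> \<pi> \<in> carrier R - P"
        proof -
          have bp: "b \<otimes> \<pi> \<in> P" using P.I_l_closed[OF \<pi>_in_P b(1)] .
          have "s = (s \<ominus> b \<otimes> \<pi>) \<oplus> b \<otimes> \<pi>" using sR b(1) by (simp add: R.minus_eq R.a_assoc R.l_neg)
          then have "s \<ominus> b \<otimes> \<pi> \<notin> P" using P.a_closed[OF _ bp, of "s \<ominus> b \<otimes> \<pi>"] s(1) by auto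
          then show ?thesis using sR b(1) by simp
        qed
        ultimately have "y \<in> X" using T_mem_if_smult_mem[OF X(1) yT] by blast
        then show ?thesis unfolding y(2) by (rule cyclic_submodule_subset[OF X(1)])
      next
        assume "\<exists>\<pi> \<tau>. uniformized_prime R P \<pi> \<tau> \<and> pruefer_like \<pi> (primary_component R M P)"
        then obtain \<pi> \<tau> where u: "uniformized_prime R P \<pi> \<tau>" and pr: "pruefer_like \<pi> (primary_component R M P)"
          by (elim exE conjE)
        interpret module_at_prime R M P \<pi> \<tau> by (intro module_at_prime.intro module_axioms u)
        \<comment> \<open>A map not vanishing on a Pruefer component has an image containing that
          component, which would then be contained in \<open>N\<close>.\<close>
        have FQ: "\<forall>f\<in>F. \<forall>z\<in>T. f z \<in> {\<zero>\<^bsub>M\<^esub>}"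
        proof (intro ballI, rule ccontr)
          fix f z assume f: "f \<in> F" and z: "z \<in> T"
          assume "f z \<notin> {\<zero>\<^bsub>M\<^esub>}"
          then have "T \<subseteq> f ` carrier M" using pruefer_like_endomorphic_image[OF pr FH[OF f] z] by simp
          then show False using PN FN[OF f] by blast
        qed
        show ?thesis
        proof
          fix y assume y: "y \<in> T"
          note yM = T_closed[OF y]
          obtain s t where s: "s \<in> carrier R - P" "t \<in> carrier M" "s \<odot>\<^bsub>M\<^esub> t \<in> {\<zero>\<^bsub>M\<^esub>}" "y \<ominus>\<^bsub>M\<^esub> t \<in> X"
            using key[OF zero_submodule FQ yM] by (elim bexE conjE)
          have sR: "s \<in> carrier R" using s(1) by simp
          have "s \<odot>\<^bsub>M\<^esub> (y \<ominus>\<^bsub>M\<^esub> t) = s \<odot>\<^bsub>M\<^esub> y \<ominus>\<^bsub>M\<^esub> \<zero>\<^bsub>M\<^esub>" using sR yM s(2,3) by (simp add: smult_diff)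
          also have "\<dots> = s \<odot>\<^bsub>M\<^esub> y" using diff_add_cancel[of "s \<odot>\<^bsub>M\<^esub> y" "\<zero>\<^bsub>M\<^esub>"] sR yM by simp
          finally have "s \<odot>\<^bsub>M\<^esub> y \<in> X" using submodule_smult[OF X(1) sR s(4)] by simp
          then show "y \<in> X" by (rule T_mem_if_smult_mem[OF X(1) y s(1)])
        qed
      qed
    qed
    have "torsion_part \<subseteq> X" by (rule torsion_part_subset[OF X(1) TX])
    then have "m \<in> X" if "m \<in> carrier M" for m
      using cE(4)[OF that] LX submodule_add[OF X(1)] by blast
    then show ?thesis using submodule_subset[OF X(1)] by blast
  qed
  show "\<exists>D E. D \<subseteq> submodule_sum R M F (\<lambda>f. f ` carrier M) \<and> complementary R M D E \<and>
      (\<forall>h\<in>mod_hom R M M. h ` D \<subseteq> D) \<and>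
      (\<forall>X. submodule X R M \<and> D \<subseteq> X \<and> submodule_sum R M F (\<lambda>f. f ` carrier M) <+>\<^bsub>M\<^esub> X = carrier M
        \<longrightarrow> X = carrier M)"
    unfolding N_def[symmetric]
    by (rule exI[of _ D], rule exI[of _ E]) (use DN DE inv sup in blast)
qed

end

section \<open>Isomorphism types\<close>

lemma scalar_module_is_module:
  assumes "cring R" "cring S" "\<phi> \<in> ring_hom R S"
  shows "module R (scalar_module \<phi> S)"
proof -
  interpret R: cring R by fact
  interpret S: cring S by fact
  note hom = ring_hom_closed[OF assms(3)] ring_hom_add[OF assms(3)] ring_hom_mult[OF assms(3)]
    ring_hom_one[OF assms(3)]
  have "abelian_group (scalar_module \<phi> S)"
  proof (rule abelian_groupI)
    show "\<exists>y\<in>carrier (scalar_module \<phi> S). y \<oplus>\<^bsub>scalar_module \<phi> S\<^esub> x = \<zero>\<^bsub>scalar_module \<phi> S\<^esub>"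
      if "x \<in> carrier (scalar_module \<phi> S)" for x
      using that S.l_neg[of x] by (intro bexI[of _ "\<ominus>\<^bsub>S\<^esub> x"]) (simp_all add: scalar_module_def)
  qed (simp_all add: scalar_module_def S.a_ac)
  then show ?thesis
    by (intro moduleI assms(1)) (simp_all add: scalar_module_def hom S.l_distr S.r_distr S.m_assoc)
qed

lemma (in cring) regular_module_is_module: "module R (regular_module R)"
  by (rule scalar_module_is_module[OF is_cring is_cring]) (simp add: ring_hom_def)

lemma (in cring) ideal_is_regular_submodule:
  assumes "ideal I R" shows "submodule I R (regular_module R)"
proof -
  interpret I: ideal I R by fact
  interpret reg: module R "regular_module R" by (rule regular_module_is_module)
  show ?thesis
    by (rule reg.submoduleI') (auto simp: scalar_module_def I.Icarr I.I_l_closed)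
qed

lemma (in cring) regular_module_diff:
  assumes "a \<in> carrier R" "b \<in> carrier R"
  shows "a \<ominus>\<^bsub>regular_module R\<^esub> b = a \<ominus> b"
proof -
  interpret reg: module R "regular_module R" by (rule regular_module_is_module)
  have c: "a \<in> carrier (regular_module R)" "b \<in> carrier (regular_module R)"
    using assms by (simp_all add: scalar_module_def)
  have "(a \<ominus> b) \<oplus>\<^bsub>regular_module R\<^esub> b = a"
    using assms by (simp add: scalar_module_def minus_eq a_assoc l_neg)
  then show ?thesis using reg.add_diff_cancel[of "a \<ominus> b" b] assms by (simp add: scalar_module_def)
qed

lemma (in module) submodule_module: "submodule N R M \<Longrightarrow> module R (M\<lparr>carrier := N\<rparr>)"
  using submodule.submodule_is_module module_axioms by blast

section \<open>Recognizing R/I, R and K\<close>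

lemma (in module) mod_isomorphic_cyclic_module_iff:
  assumes N: "submodule N R M" and I: "ideal I R"
  shows "mod_isomorphic R (M\<lparr>carrier := N\<rparr>) (cyclic_module R I) \<longleftrightarrow> cyclic_with_annihilator N I"
proof -
  interpret I: ideal I R by (rule I)
  interpret reg: module R "regular_module R" by (rule R.regular_module_is_module)
  have Is: "submodule I R (regular_module R)" by (rule R.ideal_is_regular_submodule[OF I])
  define Q where "Q = cyclic_module R I"
  define c where "c a = I +>\<^bsub>regular_module R\<^esub> a" for a
  interpret Q: module R Q unfolding Q_def cyclic_module_def by (rule reg.quotient_module_is_module[OF Is])
  interpret MN: module R "M\<lparr>carrier := N\<rparr>" by (rule submodule_module[OF N])
  note NM = submodule_subset[OF N]
  have creg: "carrier (regular_module R) = carrier R" by (simp add: scalar_module_def)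
  have carQ: "carrier Q = c ` carrier R"
    unfolding Q_def cyclic_module_def c_def reg.carrier_quotient_module by (simp add: scalar_module_def)
  have addQ: "c a \<oplus>\<^bsub>Q\<^esub> c b = c (a \<oplus> b)" if "a \<in> carrier R" "b \<in> carrier R" for a b
    unfolding Q_def cyclic_module_def c_def using reg.add_quotient_module[OF Is] that by (simp add: scalar_module_def)
  have smQ: "a \<odot>\<^bsub>Q\<^esub> c b = c (a \<otimes> b)" if "a \<in> carrier R" "b \<in> carrier R" for a b
    unfolding Q_def cyclic_module_def c_def using reg.smult_quotient_module[OF Is] that by (simp add: scalar_module_def)
  have zQ: "\<zero>\<^bsub>Q\<^esub> = I" unfolding Q_def cyclic_module_def by (rule reg.zero_quotient_module)
  have ceq: "c a = c b \<longleftrightarrow> a \<ominus> b \<in> I" if "a \<in> carrier R" "b \<in> carrier R" for a b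
    unfolding c_def using reg.rcoset_eq_iff[OF Is, of a b] that R.regular_module_diff by (simp add: creg)
  have c0: "c a = I \<longleftrightarrow> a \<in> I" if "a \<in> carrier R" for a
    unfolding c_def using reg.rcoset_eq_self_iff[OF Is, of a] that by (simp add: creg)
  show ?thesis
  proof
    assume "mod_isomorphic R (M\<lparr>carrier := N\<rparr>) (cyclic_module R I)"
    then obtain h where h: "h \<in> mod_hom R (M\<lparr>carrier := N\<rparr>) Q" and bij: "bij_betw h N (carrier Q)"
      unfolding mod_isomorphic_def Q_def by auto
    have hsm: "h (a \<odot>\<^bsub>M\<^esub> x) = a \<odot>\<^bsub>Q\<^esub> h x" if "a \<in> carrier R" "x \<in> N" for a x
      using mod_hom_smult[OF h that(1), of x] that(2) by simp
    have h0: "h \<zero>\<^bsub>M\<^esub> = \<zero>\<^bsub>Q\<^esub>" using mod_hom_zero[OF MN.module_axioms Q.module_axioms h] by simp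
    have inj: "x = y" if "x \<in> N" "y \<in> N" "h x = h y" for x y
      using bij that unfolding bij_betw_def by (meson inj_onD)
    have "c \<one> \<in> h ` N" using bij carQ unfolding bij_betw_def by auto
    \<comment> \<open>The generator is the preimage of the class of 1; its annihilator is I because
      the class of a is zero exactly for a in I.\<close>
    then obtain y where y: "y \<in> N" "h y = c \<one>" by auto
    have hy: "h (a \<odot>\<^bsub>M\<^esub> y) = c a" if "a \<in> carrier R" for a
      using hsm[OF that y(1)] y(2) smQ[OF that R.one_closed] that by simp
    have "N = cyclic_submodule y"
    proof
      show "cyclic_submodule y \<subseteq> N" by (rule cyclic_submodule_subset[OF N y(1)])
      show "N \<subseteq> cyclic_submodule y"
      proof
        fix z assume z: "z \<in> N"
        then have "h z \<in> carrier Q" using bij unfolding bij_betw_def by blast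
        then obtain a where a: "a \<in> carrier R" "h z = c a" unfolding carQ by blast
        have "z = a \<odot>\<^bsub>M\<^esub> y" by (rule inj[OF z submodule_smult[OF N a(1) y(1)]]) (simp add: a hy)
        then show "z \<in> cyclic_submodule y" using cyclic_submoduleI[OF a(1)] by simp
      qed
    qed
    moreover have "a \<odot>\<^bsub>M\<^esub> y = \<zero>\<^bsub>M\<^esub> \<longleftrightarrow> a \<in> I" if a: "a \<in> carrier R" for a
    proof -
      have "a \<odot>\<^bsub>M\<^esub> y = \<zero>\<^bsub>M\<^esub> \<longleftrightarrow> h (a \<odot>\<^bsub>M\<^esub> y) = h \<zero>\<^bsub>M\<^esub>"
        using inj[OF submodule_smult[OF N a y(1)] submodule_zero[OF N]] by metis
      then show ?thesis unfolding hy[OF a] h0 zQ c0[OF a] .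
    qed
    ultimately show "cyclic_with_annihilator N I"
      unfolding cyclic_with_annihilator_def by (intro bexI[of _ y] conjI ballI NM[OF y(1)])
  next
    assume "cyclic_with_annihilator N I"
    then obtain y where y: "y \<in> carrier M" "N = cyclic_submodule y"
      and ann: "\<forall>a\<in>carrier R. a \<odot>\<^bsub>M\<^esub> y = \<zero>\<^bsub>M\<^esub> \<longleftrightarrow> a \<in> I"
      unfolding cyclic_with_annihilator_def by (elim bexE conjE)
    have eq: "a \<odot>\<^bsub>M\<^esub> y = b \<odot>\<^bsub>M\<^esub> y \<longleftrightarrow> a \<ominus> b \<in> I" if "a \<in> carrier R" "b \<in> carrier R" for a b
      using ann[rule_format, of "a \<ominus> b"] that y(1)
      by (simp add: smult_diff_left diff_eq_zero_iff)
    have "\<forall>z\<in>N. \<exists>a. a \<in> carrier R \<and> z = a \<odot>\<^bsub>M\<^esub> y" unfolding y(2) cyclic_submodule_def by blast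
    from bchoice[OF this] obtain \<alpha> where \<alpha>: "\<forall>z\<in>N. \<alpha> z \<in> carrier R \<and> z = \<alpha> z \<odot>\<^bsub>M\<^esub> y" by (elim exE)
    then have \<alpha>R: "\<alpha> z \<in> carrier R" and \<alpha>z: "\<alpha> z \<odot>\<^bsub>M\<^esub> y = z" if "z \<in> N" for z using that by auto
    define h where "h z = c (\<alpha> z)" for z
    have hI: "h z = c a" if "a \<in> carrier R" "z \<in> N" "z = a \<odot>\<^bsub>M\<^esub> y" for a z
      unfolding h_def using ceq[OF \<alpha>R[OF that(2)] that(1)] eq[OF \<alpha>R[OF that(2)] that(1)] \<alpha>z[OF that(2)] that(3) by simp
    have "h \<in> mod_hom R (M\<lparr>carrier := N\<rparr>) Q"
    proof (rule mod_homI)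
      show "h x \<in> carrier Q" if "x \<in> carrier (M\<lparr>carrier := N\<rparr>)" for x
        using that \<alpha>R carQ unfolding h_def by simp
      show "h (x \<oplus>\<^bsub>M\<lparr>carrier := N\<rparr>\<^esub> z) = h x \<oplus>\<^bsub>Q\<^esub> h z"
        if "x \<in> carrier (M\<lparr>carrier := N\<rparr>)" "z \<in> carrier (M\<lparr>carrier := N\<rparr>)" for x z
      proof -
        have xz: "x \<in> N" "z \<in> N" using that by auto
        have "x \<oplus>\<^bsub>M\<^esub> z = (\<alpha> x \<oplus> \<alpha> z) \<odot>\<^bsub>M\<^esub> y"
          using \<alpha>R[OF xz(1)] \<alpha>R[OF xz(2)] y(1) by (simp add: smult_l_distr \<alpha>z xz)
        then have "h (x \<oplus>\<^bsub>M\<^esub> z) = c (\<alpha> x \<oplus> \<alpha> z)"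
          using \<alpha>R xz submodule_add[OF N xz] by (intro hI) auto
        then show ?thesis unfolding h_def using addQ \<alpha>R xz by simp
      qed
      show "h (a \<odot>\<^bsub>M\<lparr>carrier := N\<rparr>\<^esub> x) = a \<odot>\<^bsub>Q\<^esub> h x"
        if "a \<in> carrier R" "x \<in> carrier (M\<lparr>carrier := N\<rparr>)" for a x
      proof -
        have x: "x \<in> N" using that by auto
        have "a \<odot>\<^bsub>M\<^esub> x = (a \<otimes> \<alpha> x) \<odot>\<^bsub>M\<^esub> y"
          using \<alpha>R[OF x] y(1) that(1) by (simp add: smult_assoc1 \<alpha>z x)
        then have "h (a \<odot>\<^bsub>M\<^esub> x) = c (a \<otimes> \<alpha> x)"
          using \<alpha>R x that(1) submodule_smult[OF N that(1) x] by (intro hI) auto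
        then show ?thesis unfolding h_def using smQ \<alpha>R x that(1) by simp
      qed
    qed
    moreover have "bij_betw h N (carrier Q)"
      unfolding bij_betw_def
    proof
      show "inj_on h N"
      proof (rule inj_onI)
        fix x z assume xz: "x \<in> N" "z \<in> N" "h x = h z"
        then have "\<alpha> x \<odot>\<^bsub>M\<^esub> y = \<alpha> z \<odot>\<^bsub>M\<^esub> y" unfolding h_def using ceq eq \<alpha>R by simp
        then show "x = z" using \<alpha>z xz by simp
      qed
      show "h ` N = carrier Q"
      proof
        show "h ` N \<subseteq> carrier Q" unfolding carQ h_def using \<alpha>R by blast
        show "carrier Q \<subseteq> h ` N"
        proof
          fix q assume "q \<in> carrier Q"
          then obtain a where a: "a \<in> carrier R" "q = c a" unfolding carQ by blast
          have aN: "a \<odot>\<^bsub>M\<^esub> y \<in> N" unfolding y(2) by (rule cyclic_submoduleI[OF a(1)])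
          have "h (a \<odot>\<^bsub>M\<^esub> y) = c a" by (rule hI[OF a(1) aN refl])
          then show "q \<in> h ` N" using aN a(2) by force
        qed
      qed
    qed
    ultimately show "mod_isomorphic R (M\<lparr>carrier := N\<rparr>) (cyclic_module R I)"
      unfolding mod_isomorphic_def Q_def by auto
  qed
qed

lemma (in module) mod_isomorphic_regular_iff:
  "mod_isomorphic R M (regular_module R) \<longleftrightarrow> (\<exists>e\<in>carrier M. carrier M = cyclic_submodule e \<and>
    (\<forall>a\<in>carrier R. a \<odot>\<^bsub>M\<^esub> e = \<zero>\<^bsub>M\<^esub> \<longrightarrow> a = \<zero>))"
proof
  interpret reg: module R "regular_module R" by (rule R.regular_module_is_module)
  assume "mod_isomorphic R M (regular_module R)"
  then obtain h where h: "h \<in> mod_hom R M (regular_module R)" and bij: "bij_betw h (carrier M) (carrier R)"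
    unfolding mod_isomorphic_def by (auto simp: scalar_module_def)
  have hsm: "h (a \<odot>\<^bsub>M\<^esub> x) = a \<otimes> h x" if "a \<in> carrier R" "x \<in> carrier M" for a x
    using mod_hom_smult[OF h that] by (simp add: scalar_module_def)
  have h0: "h \<zero>\<^bsub>M\<^esub> = \<zero>" using mod_hom_zero[OF module_axioms reg.module_axioms h] by (simp add: scalar_module_def)
  have inj: "x = y" if "x \<in> carrier M" "y \<in> carrier M" "h x = h y" for x y
    using bij that unfolding bij_betw_def by (meson inj_onD)
  have "\<one> \<in> h ` carrier M" using bij unfolding bij_betw_def by simp
  then obtain e where e: "e \<in> carrier M" "h e = \<one>" by auto
  have "z \<in> cyclic_submodule e" if z: "z \<in> carrier M" for z
  proof -
    have hz: "h z \<in> carrier R" using bij z unfolding bij_betw_def by blast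
    have "z = h z \<odot>\<^bsub>M\<^esub> e" by (rule inj[OF z]) (use hz e hsm[OF hz e(1)] in auto)
    then show ?thesis using cyclic_submoduleI[OF hz, of e] by simp
  qed
  then have "carrier M = cyclic_submodule e"
    using submodule_subset[OF submodule_cyclic[OF e(1)]] by blast
  moreover have "a = \<zero>" if "a \<in> carrier R" "a \<odot>\<^bsub>M\<^esub> e = \<zero>\<^bsub>M\<^esub>" for a
    using hsm[OF that(1) e(1)] that h0 e(2) by simp
  ultimately show "\<exists>e\<in>carrier M. carrier M = cyclic_submodule e \<and>
    (\<forall>a\<in>carrier R. a \<odot>\<^bsub>M\<^esub> e = \<zero>\<^bsub>M\<^esub> \<longrightarrow> a = \<zero>)" using e(1) by (intro bexI[of _ e]) auto
next
  assume "\<exists>e\<in>carrier M. carrier M = cyclic_submodule e \<and>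
    (\<forall>a\<in>carrier R. a \<odot>\<^bsub>M\<^esub> e = \<zero>\<^bsub>M\<^esub> \<longrightarrow> a = \<zero>)"
  then obtain e where e: "e \<in> carrier M" "carrier M = cyclic_submodule e"
    and free: "\<forall>a\<in>carrier R. a \<odot>\<^bsub>M\<^esub> e = \<zero>\<^bsub>M\<^esub> \<longrightarrow> a = \<zero>" by (elim bexE conjE)
  have eq: "a = b" if "a \<in> carrier R" "b \<in> carrier R" "a \<odot>\<^bsub>M\<^esub> e = b \<odot>\<^bsub>M\<^esub> e" for a b
  proof -
    have "(a \<ominus> b) \<odot>\<^bsub>M\<^esub> e = \<zero>\<^bsub>M\<^esub>" using that e(1) by (simp add: smult_diff_left diff_eq_zero_iff)
    then have "a \<ominus> b = \<zero>" using free that by simp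
    then show ?thesis using that by simp
  qed
  have "\<forall>z\<in>carrier M. \<exists>a. a \<in> carrier R \<and> z = a \<odot>\<^bsub>M\<^esub> e" using e(2) unfolding cyclic_submodule_def by blast
  from bchoice[OF this] obtain \<alpha> where \<alpha>: "\<forall>z\<in>carrier M. \<alpha> z \<in> carrier R \<and> z = \<alpha> z \<odot>\<^bsub>M\<^esub> e" by (elim exE)
  then have \<alpha>R: "\<alpha> z \<in> carrier R" and \<alpha>z: "\<alpha> z \<odot>\<^bsub>M\<^esub> e = z" if "z \<in> carrier M" for z using that by auto
  have "\<alpha> \<in> mod_hom R M (regular_module R)"
  proof (rule mod_homI)
    show "\<alpha> x \<in> carrier (regular_module R)" if "x \<in> carrier M" for x
      using \<alpha>R[OF that] by (simp add: scalar_module_def)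
    show "\<alpha> (x \<oplus>\<^bsub>M\<^esub> z) = \<alpha> x \<oplus>\<^bsub>regular_module R\<^esub> \<alpha> z" if "x \<in> carrier M" "z \<in> carrier M" for x z
    proof -
      have "\<alpha> (x \<oplus>\<^bsub>M\<^esub> z) = \<alpha> x \<oplus> \<alpha> z"
        by (rule eq) (use that \<alpha>R \<alpha>z e(1) in \<open>simp_all add: smult_l_distr\<close>)
      then show ?thesis by (simp add: scalar_module_def)
    qed
    show "\<alpha> (a \<odot>\<^bsub>M\<^esub> x) = a \<odot>\<^bsub>regular_module R\<^esub> \<alpha> x" if "a \<in> carrier R" "x \<in> carrier M" for a x
    proof -
      have "\<alpha> (a \<odot>\<^bsub>M\<^esub> x) = a \<otimes> \<alpha> x"
        by (rule eq) (use that \<alpha>R \<alpha>z e(1) in \<open>simp_all add: smult_assoc1\<close>)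
      then show ?thesis by (simp add: scalar_module_def)
    qed
  qed
  moreover have "bij_betw \<alpha> (carrier M) (carrier R)"
    unfolding bij_betw_def
  proof
    show "inj_on \<alpha> (carrier M)" by (rule inj_onI) (metis \<alpha>z)
    show "\<alpha> ` carrier M = carrier R"
    proof
      show "\<alpha> ` carrier M \<subseteq> carrier R" using \<alpha>R by blast
      show "carrier R \<subseteq> \<alpha> ` carrier M"
      proof
        fix a assume a: "a \<in> carrier R"
        have aM: "a \<odot>\<^bsub>M\<^esub> e \<in> carrier M" using a e(1) by simp
        have "a = \<alpha> (a \<odot>\<^bsub>M\<^esub> e)" by (rule eq[OF a \<alpha>R[OF aM]]) (simp add: \<alpha>z[OF aM])
        then show "a \<in> \<alpha> ` carrier M" using aM by blast
      qed
    qed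
  qed
  ultimately show "mod_isomorphic R M (regular_module R)"
    unfolding mod_isomorphic_def by (auto simp: scalar_module_def)
qed

text \<open>Fix a non-zero b in L. A relation a x = r b determines the fraction r/a, and x \<mapsto>
  r/a is the isomorphism; divisibility of L makes it onto and torsion-freeness makes it
  injective.\<close>

lemma (in quotient_field) mod_isomorphic_quotient_field_iff:
  assumes M: "module R M" and L: "submodule L R M"
  shows "mod_isomorphic R (M\<lparr>carrier := L\<rparr>) (scalar_module \<iota> K) \<longleftrightarrow> module.rank_one_divisible R M L"
proof -
  interpret M: module R M by (rule M)
  interpret KM: module R "scalar_module \<iota> K"
    by (rule scalar_module_is_module[OF R.is_cring K.is_cring embedding_hom])
  interpret Lmod: module R "M\<lparr>carrier := L\<rparr>" by (rule M.submodule_module[OF L])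
  interpret emb: ring_hom_cring R K \<iota> by (rule embedding_ring_hom_cring)
  note LM = M.submodule_subset[OF L]
  have nz: "\<iota> a \<noteq> \<zero>\<^bsub>K\<^esub>" if "a \<in> carrier R" "a \<noteq> \<zero>" for a using embedding_eq_zero_iff that by simp
  show ?thesis
  proof
    assume "mod_isomorphic R (M\<lparr>carrier := L\<rparr>) (scalar_module \<iota> K)"
    then obtain h where h: "h \<in> mod_hom R (M\<lparr>carrier := L\<rparr>) (scalar_module \<iota> K)"
      and bij: "bij_betw h L (carrier K)"
      unfolding mod_isomorphic_def by (auto simp: scalar_module_def)
    have hsm: "h (a \<odot>\<^bsub>M\<^esub> x) = \<iota> a \<otimes>\<^bsub>K\<^esub> h x" if "a \<in> carrier R" "x \<in> L" for a x
      using mod_hom_smult[OF h that(1), of x] that(2) by (simp add: scalar_module_def)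
    have h0: "h \<zero>\<^bsub>M\<^esub> = \<zero>\<^bsub>K\<^esub>"
      using mod_hom_zero[OF Lmod.module_axioms KM.module_axioms h] by (simp add: scalar_module_def)
    have inj: "x = y" if "x \<in> L" "y \<in> L" "h x = h y" for x y
      using bij that unfolding bij_betw_def by (meson inj_onD)
    have hK: "h x \<in> carrier K" if "x \<in> L" for x using bij that unfolding bij_betw_def by blast
    have surj: "\<exists>x\<in>L. h x = k" if "k \<in> carrier K" for k using bij that unfolding bij_betw_def by force
    have hnz: "h x \<noteq> \<zero>\<^bsub>K\<^esub>" if "x \<in> L" "x \<noteq> \<zero>\<^bsub>M\<^esub>" for x
      using inj[OF that(1) M.submodule_zero[OF L]] h0 that(2) by auto
    show "M.rank_one_divisible L"
      unfolding M.rank_one_divisible_def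
    proof (intro conjI ballI impI)
      show "L \<noteq> {\<zero>\<^bsub>M\<^esub>}"
      proof
        assume "L = {\<zero>\<^bsub>M\<^esub>}"
        then have "\<one>\<^bsub>K\<^esub> = \<zero>\<^bsub>K\<^esub>" using surj[OF K.one_closed] h0 by auto
        then show False using K.one_not_zero by simp
      qed
      show "x = \<zero>\<^bsub>M\<^esub>" if r: "r \<in> carrier R - {\<zero>}" and x: "x \<in> L" "r \<odot>\<^bsub>M\<^esub> x = \<zero>\<^bsub>M\<^esub>" for r x
      proof (rule ccontr)
        assume xnz: "x \<noteq> \<zero>\<^bsub>M\<^esub>"
        have "\<iota> r \<otimes>\<^bsub>K\<^esub> h x = \<zero>\<^bsub>K\<^esub>" using hsm[of r x] r x h0 by simp
        then show False using K.integral[of "\<iota> r" "h x"] nz[of r] hnz[OF x(1) xnz] hK[OF x(1)] r by auto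
      qed
      show "\<exists>y\<in>L. x = r \<odot>\<^bsub>M\<^esub> y" if r: "r \<in> carrier R - {\<zero>}" and x: "x \<in> L" for r x
      proof -
        have u: "\<iota> r \<in> Units K" using nz[of r] r by (simp add: K.field_Units)
        obtain y where y: "y \<in> L" "h y = inv\<^bsub>K\<^esub> (\<iota> r) \<otimes>\<^bsub>K\<^esub> h x" using surj u hK[OF x] by (metis K.Units_inv_closed K.m_closed)
        have "h (r \<odot>\<^bsub>M\<^esub> y) = \<iota> r \<otimes>\<^bsub>K\<^esub> (inv\<^bsub>K\<^esub> (\<iota> r) \<otimes>\<^bsub>K\<^esub> h x)" using hsm[of r y] r y by simp
        also have "\<dots> = (\<iota> r \<otimes>\<^bsub>K\<^esub> inv\<^bsub>K\<^esub> (\<iota> r)) \<otimes>\<^bsub>K\<^esub> h x"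
          using u hK[OF x] r by (intro K.m_assoc[symmetric]) auto
        also have "\<dots> = h x" using u hK[OF x] by simp
        finally have "x = r \<odot>\<^bsub>M\<^esub> y" using inj[OF x M.submodule_smult[OF L _ y(1)], of r] r by simp
        then show ?thesis using y(1) by (rule bexI)
      qed
      show "\<exists>a\<in>carrier R - {\<zero>}. \<exists>r\<in>carrier R. a \<odot>\<^bsub>M\<^esub> x = r \<odot>\<^bsub>M\<^esub> b"
        if x: "x \<in> L" and b: "b \<in> L - {\<zero>\<^bsub>M\<^esub>}" for x b
      proof -
        have u: "h b \<in> Units K" using hnz[of b] hK[of b] b by (simp add: K.field_Units)
        have q: "h x \<otimes>\<^bsub>K\<^esub> inv\<^bsub>K\<^esub> (h b) \<in> carrier K" using u hK[OF x] by simp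
        obtain r a where ra: "r \<in> carrier R" "a \<in> carrier R - {\<zero>}"
          "h x \<otimes>\<^bsub>K\<^esub> inv\<^bsub>K\<^esub> (h b) = \<iota> r \<otimes>\<^bsub>K\<^esub> inv\<^bsub>K\<^esub> (\<iota> a)" using fraction[OF q] by blast
        have ar: "\<iota> a \<otimes>\<^bsub>K\<^esub> (h x \<otimes>\<^bsub>K\<^esub> inv\<^bsub>K\<^esub> (h b)) = \<iota> r"
          using fraction_cross_mult[of r a "h x \<otimes>\<^bsub>K\<^esub> inv\<^bsub>K\<^esub> (h b)"] ra q by simp
        have "\<iota> r \<otimes>\<^bsub>K\<^esub> h b = (\<iota> a \<otimes>\<^bsub>K\<^esub> h x) \<otimes>\<^bsub>K\<^esub> (inv\<^bsub>K\<^esub> (h b) \<otimes>\<^bsub>K\<^esub> h b)"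
          unfolding ar[symmetric] using ra(2) hK[OF x] K.Units_inv_closed[OF u] K.Units_closed[OF u]
          by (simp add: K.m_assoc del: K.Units_l_inv)
        also have "\<dots> = \<iota> a \<otimes>\<^bsub>K\<^esub> h x" using u ra hK[OF x] by simp
        finally have "h (a \<odot>\<^bsub>M\<^esub> x) = h (r \<odot>\<^bsub>M\<^esub> b)" using hsm[of a x] hsm[of r b] ra x b by simp
        then have "a \<odot>\<^bsub>M\<^esub> x = r \<odot>\<^bsub>M\<^esub> b"
          using inj M.submodule_smult[OF L] ra x b by (metis DiffD1)
        then show ?thesis using ra by blast
      qed
    qed
  next
    assume rk: "M.rank_one_divisible L"
    have free: "x = \<zero>\<^bsub>M\<^esub>" if "r \<in> carrier R" "r \<noteq> \<zero>" "x \<in> L" "r \<odot>\<^bsub>M\<^esub> x = \<zero>\<^bsub>M\<^esub>" for r x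
      using rk that unfolding M.rank_one_divisible_def by blast
    have div: "\<exists>y\<in>L. x = r \<odot>\<^bsub>M\<^esub> y" if "r \<in> carrier R" "r \<noteq> \<zero>" "x \<in> L" for r x
      using rk that unfolding M.rank_one_divisible_def by blast
    obtain b where b: "b \<in> L" "b \<noteq> \<zero>\<^bsub>M\<^esub>"
      using rk M.submodule_zero[OF L] unfolding M.rank_one_divisible_def by blast
    note bM = LM[OF b(1)]
    have rank: "\<exists>a r. a \<in> carrier R \<and> a \<noteq> \<zero> \<and> r \<in> carrier R \<and> a \<odot>\<^bsub>M\<^esub> x = r \<odot>\<^bsub>M\<^esub> b" if "x \<in> L" for x
      using rk that b unfolding M.rank_one_divisible_def by blast
    have bfree: "r = s" if "r \<in> carrier R" "s \<in> carrier R" "r \<odot>\<^bsub>M\<^esub> b = s \<odot>\<^bsub>M\<^esub> b" for r s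
    proof (rule ccontr)
      assume "r \<noteq> s"
      then have "r \<ominus> s \<noteq> \<zero>" using that by simp
      moreover have "(r \<ominus> s) \<odot>\<^bsub>M\<^esub> b = \<zero>\<^bsub>M\<^esub>" using that bM by (simp add: M.smult_diff_left M.diff_eq_zero_iff)
      ultimately show False using free[of "r \<ominus> s" b] that b by simp
    qed
    \<comment> \<open>The value k is required to satisfy a k = r for all relations a x = r b at
      once. Independence of the chosen relation is then settled here, and additivity and linearity
      only need some convenient relation.\<close>
    have "\<forall>x\<in>L. \<exists>k. k \<in> carrier K \<and> (\<forall>a\<in>carrier R. \<forall>r\<in>carrier R. a \<noteq> \<zero> \<and> a \<odot>\<^bsub>M\<^esub> x = r \<odot>\<^bsub>M\<^esub> b \<longrightarrow>
        \<iota> a \<otimes>\<^bsub>K\<^esub> k = \<iota> r)"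
    proof
      fix x assume x: "x \<in> L"
      obtain a r where ar: "a \<in> carrier R" "a \<noteq> \<zero>" "r \<in> carrier R" "a \<odot>\<^bsub>M\<^esub> x = r \<odot>\<^bsub>M\<^esub> b"
        using rank[OF x] by (elim exE conjE)
      have u: "\<iota> a \<in> Units K" using nz[OF ar(1,2)] ar(1) by (simp add: K.field_Units)
      define k where "k = \<iota> r \<otimes>\<^bsub>K\<^esub> inv\<^bsub>K\<^esub> (\<iota> a)"
      have k: "k \<in> carrier K" unfolding k_def using u ar(3) by simp
      have ak: "\<iota> a \<otimes>\<^bsub>K\<^esub> k = \<iota> r" using fraction_cross_mult[OF ar(3,1,2) k] k_def by simp
      have "\<iota> a' \<otimes>\<^bsub>K\<^esub> k = \<iota> r'"
        if a': "a' \<in> carrier R" "r' \<in> carrier R" "a' \<odot>\<^bsub>M\<^esub> x = r' \<odot>\<^bsub>M\<^esub> b" for a' r'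
      proof -
        have "(a' \<otimes> r) \<odot>\<^bsub>M\<^esub> b = a' \<odot>\<^bsub>M\<^esub> (a \<odot>\<^bsub>M\<^esub> x)" unfolding ar(4) using a' ar(3) bM by (simp add: M.smult_assoc1)
        also have "\<dots> = a \<odot>\<^bsub>M\<^esub> (r' \<odot>\<^bsub>M\<^esub> b)" unfolding a'(3)[symmetric] using a'(1) ar(1) LM[OF x] by (intro M.smult_swap)
        also have "\<dots> = (a \<otimes> r') \<odot>\<^bsub>M\<^esub> b" using a' ar(1) bM by (simp add: M.smult_assoc1)
        finally have "a' \<otimes> r = a \<otimes> r'" using bfree a' ar(1,3) by simp
        then have "\<iota> a' \<otimes>\<^bsub>K\<^esub> \<iota> r = \<iota> a \<otimes>\<^bsub>K\<^esub> \<iota> r'" using a' ar(1,3) by (metis emb.hom_mult)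
        then have "\<iota> a \<otimes>\<^bsub>K\<^esub> (\<iota> a' \<otimes>\<^bsub>K\<^esub> k) = \<iota> a \<otimes>\<^bsub>K\<^esub> \<iota> r'"
          unfolding ak[symmetric] using a'(1) ar(1) k by (simp add: K.m_lcomm)
        then show ?thesis using K.m_lcancel[OF nz[OF ar(1,2)]] a' ar(1) k by simp
      qed
      then show "\<exists>k. k \<in> carrier K \<and> (\<forall>a\<in>carrier R. \<forall>r\<in>carrier R. a \<noteq> \<zero> \<and> a \<odot>\<^bsub>M\<^esub> x = r \<odot>\<^bsub>M\<^esub> b \<longrightarrow>
        \<iota> a \<otimes>\<^bsub>K\<^esub> k = \<iota> r)" using k by blast
    qed
    from bchoice[OF this] obtain h where h: "\<forall>x\<in>L. h x \<in> carrier K \<and>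
        (\<forall>a\<in>carrier R. \<forall>r\<in>carrier R. a \<noteq> \<zero> \<and> a \<odot>\<^bsub>M\<^esub> x = r \<odot>\<^bsub>M\<^esub> b \<longrightarrow> \<iota> a \<otimes>\<^bsub>K\<^esub> h x = \<iota> r)" by (elim exE)
    have hK: "h x \<in> carrier K" if "x \<in> L" for x using bspec[OF h that] by (rule conjunct1)
    have hI: "\<iota> a \<otimes>\<^bsub>K\<^esub> h x = \<iota> r" if "x \<in> L" "a \<in> carrier R" "a \<noteq> \<zero>" "r \<in> carrier R" "a \<odot>\<^bsub>M\<^esub> x = r \<odot>\<^bsub>M\<^esub> b" for x a r
      using bspec[OF h that(1)] that(2-) by simp
    have canc: "k = k'" if "a \<in> carrier R" "a \<noteq> \<zero>" "k \<in> carrier K" "k' \<in> carrier K" "\<iota> a \<otimes>\<^bsub>K\<^esub> k = \<iota> a \<otimes>\<^bsub>K\<^esub> k'" for a k k'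
      using K.m_lcancel[OF nz[OF that(1,2)]] that by simp
    have hom: "h \<in> mod_hom R (M\<lparr>carrier := L\<rparr>) (scalar_module \<iota> K)"
    proof (rule mod_homI)
      show "h x \<in> carrier (scalar_module \<iota> K)" if "x \<in> carrier (M\<lparr>carrier := L\<rparr>)" for x
        using hK that by (simp add: scalar_module_def)
      show "h (x \<oplus>\<^bsub>M\<lparr>carrier := L\<rparr>\<^esub> y) = h x \<oplus>\<^bsub>scalar_module \<iota> K\<^esub> h y"
        if "x \<in> carrier (M\<lparr>carrier := L\<rparr>)" "y \<in> carrier (M\<lparr>carrier := L\<rparr>)" for x y
      proof -
        have xy: "x \<in> L" "y \<in> L" using that by auto
        note c = LM[OF xy(1)] LM[OF xy(2)] hK[OF xy(1)] hK[OF xy(2)]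
        obtain a r where ar: "a \<in> carrier R" "a \<noteq> \<zero>" "r \<in> carrier R" "a \<odot>\<^bsub>M\<^esub> x = r \<odot>\<^bsub>M\<^esub> b"
          using rank[OF xy(1)] by (elim exE conjE)
        obtain a' r' where ar': "a' \<in> carrier R" "a' \<noteq> \<zero>" "r' \<in> carrier R" "a' \<odot>\<^bsub>M\<^esub> y = r' \<odot>\<^bsub>M\<^esub> b"
          using rank[OF xy(2)] by (elim exE conjE)
        have aa: "a \<otimes> a' \<in> carrier R" "a \<otimes> a' \<noteq> \<zero>" using ar ar' R.integral by auto
        have xyL: "x \<oplus>\<^bsub>M\<^esub> y \<in> L" by (rule M.submodule_add[OF L xy])
        have "(a \<otimes> a') \<odot>\<^bsub>M\<^esub> (x \<oplus>\<^bsub>M\<^esub> y) = a' \<odot>\<^bsub>M\<^esub> (a \<odot>\<^bsub>M\<^esub> x) \<oplus>\<^bsub>M\<^esub> a \<odot>\<^bsub>M\<^esub> (a' \<odot>\<^bsub>M\<^esub> y)"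
          using c ar(1) ar'(1) by (simp add: M.smult_r_distr R.m_comm flip: M.smult_assoc1)
        also have "\<dots> = (a' \<otimes> r \<oplus> a \<otimes> r') \<odot>\<^bsub>M\<^esub> b"
          unfolding ar(4) ar'(4) using ar(1,3) ar'(1,3) bM by (simp add: M.smult_l_distr M.smult_assoc1)
        finally have "(a \<otimes> a') \<odot>\<^bsub>M\<^esub> (x \<oplus>\<^bsub>M\<^esub> y) = (a' \<otimes> r \<oplus> a \<otimes> r') \<odot>\<^bsub>M\<^esub> b" .
        then have "\<iota> (a \<otimes> a') \<otimes>\<^bsub>K\<^esub> h (x \<oplus>\<^bsub>M\<^esub> y) = \<iota> (a' \<otimes> r \<oplus> a \<otimes> r')"
          by (intro hI[OF xyL aa]) (use ar(1,3) ar'(1,3) in auto)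
        also have "\<dots> = \<iota> a' \<otimes>\<^bsub>K\<^esub> (\<iota> a \<otimes>\<^bsub>K\<^esub> h x) \<oplus>\<^bsub>K\<^esub> \<iota> a \<otimes>\<^bsub>K\<^esub> (\<iota> a' \<otimes>\<^bsub>K\<^esub> h y)"
          using hI[OF xy(1) ar] hI[OF xy(2) ar'] ar(1,3) ar'(1,3) by simp
        also have "\<dots> = \<iota> (a \<otimes> a') \<otimes>\<^bsub>K\<^esub> (h x \<oplus>\<^bsub>K\<^esub> h y)"
          using c(3,4) ar(1) ar'(1) by (simp add: K.r_distr K.m_ac)
        finally have "h (x \<oplus>\<^bsub>M\<^esub> y) = h x \<oplus>\<^bsub>K\<^esub> h y" using canc[OF aa hK[OF xyL]] c by simp
        then show ?thesis by (simp add: scalar_module_def)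
      qed
      show "h (s \<odot>\<^bsub>M\<lparr>carrier := L\<rparr>\<^esub> x) = s \<odot>\<^bsub>scalar_module \<iota> K\<^esub> h x"
        if "s \<in> carrier R" "x \<in> carrier (M\<lparr>carrier := L\<rparr>)" for s x
      proof -
        have x: "x \<in> L" and s: "s \<in> carrier R" using that by auto
        obtain a r where ar: "a \<in> carrier R" "a \<noteq> \<zero>" "r \<in> carrier R" "a \<odot>\<^bsub>M\<^esub> x = r \<odot>\<^bsub>M\<^esub> b"
          using rank[OF x] by (elim exE conjE)
        have sx: "s \<odot>\<^bsub>M\<^esub> x \<in> L" by (rule M.submodule_smult[OF L s x])
        have "a \<odot>\<^bsub>M\<^esub> (s \<odot>\<^bsub>M\<^esub> x) = (s \<otimes> r) \<odot>\<^bsub>M\<^esub> b"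
          using M.smult_swap[OF ar(1) s LM[OF x]] ar s bM by (simp add: M.smult_assoc1)
        then have "\<iota> a \<otimes>\<^bsub>K\<^esub> h (s \<odot>\<^bsub>M\<^esub> x) = \<iota> (s \<otimes> r)"
          by (intro hI[OF sx ar(1,2)]) (use s ar(3) in auto)
        also have "\<dots> = \<iota> s \<otimes>\<^bsub>K\<^esub> (\<iota> a \<otimes>\<^bsub>K\<^esub> h x)" using hI[OF x ar] s ar(3) by simp
        also have "\<dots> = \<iota> a \<otimes>\<^bsub>K\<^esub> (\<iota> s \<otimes>\<^bsub>K\<^esub> h x)" using s ar(1) hK[OF x] by (intro K.m_lcomm) auto
        finally have "h (s \<odot>\<^bsub>M\<^esub> x) = \<iota> s \<otimes>\<^bsub>K\<^esub> h x" using canc[OF ar(1,2) hK[OF sx]] s hK[OF x] by simp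
        then show ?thesis by (simp add: scalar_module_def)
      qed
    qed
    have h0: "x = \<zero>\<^bsub>M\<^esub>" if x: "x \<in> L" "h x = \<zero>\<^bsub>K\<^esub>" for x
    proof -
      obtain a r where ar: "a \<in> carrier R" "a \<noteq> \<zero>" "r \<in> carrier R" "a \<odot>\<^bsub>M\<^esub> x = r \<odot>\<^bsub>M\<^esub> b"
        using rank[OF x(1)] by (elim exE conjE)
      have "\<iota> r = \<zero>\<^bsub>K\<^esub>" using hI[OF x(1) ar] x(2) ar(1) by simp
      then have "r = \<zero>" using embedding_eq_zero_iff ar(3) by simp
      then show ?thesis using free[OF ar(1,2) x(1)] ar(4) bM by simp
    qed
    have "bij_betw h L (carrier K)"
      unfolding bij_betw_def
    proof
      show "inj_on h L"
      proof (rule inj_onI)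
        fix x y assume xy: "x \<in> L" "y \<in> L" "h x = h y"
        have "h y \<oplus>\<^bsub>K\<^esub> h (x \<ominus>\<^bsub>M\<^esub> y) = h (y \<oplus>\<^bsub>M\<^esub> (x \<ominus>\<^bsub>M\<^esub> y))"
          using mod_hom_add[OF hom, of y "x \<ominus>\<^bsub>M\<^esub> y"] xy(1,2) M.submodule_diff[OF L] by (simp add: scalar_module_def)
        also have "\<dots> = h y" using LM xy by simp
        finally have "h (x \<ominus>\<^bsub>M\<^esub> y) = \<zero>\<^bsub>K\<^esub>"
          using hK[OF xy(2)] hK[OF M.submodule_diff[OF L xy(1,2)]] by simp
        then have "x \<ominus>\<^bsub>M\<^esub> y = \<zero>\<^bsub>M\<^esub>" by (rule h0[OF M.submodule_diff[OF L xy(1,2)]])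
        then show "x = y" using LM xy by (simp add: M.diff_eq_zero_iff)
      qed
      show "h ` L = carrier K"
      proof
        show "h ` L \<subseteq> carrier K" using hK by blast
        show "carrier K \<subseteq> h ` L"
        proof
          fix k assume k: "k \<in> carrier K"
          obtain p q where pq: "p \<in> carrier R" "q \<in> carrier R - {\<zero>}" "k = \<iota> p \<otimes>\<^bsub>K\<^esub> inv\<^bsub>K\<^esub> (\<iota> q)"
            using fraction[OF k] by blast
          then have q: "q \<in> carrier R" "q \<noteq> \<zero>" by auto
          have "\<iota> q \<otimes>\<^bsub>K\<^esub> k = \<iota> p" using fraction_cross_mult[OF pq(1) q k] pq(3) by simp
          moreover obtain y where y: "y \<in> L" "p \<odot>\<^bsub>M\<^esub> b = q \<odot>\<^bsub>M\<^esub> y"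
            using div[OF q M.submodule_smult[OF L pq(1) b(1)]] by (elim bexE)
          ultimately have "h y = k" using canc[OF q hK[OF y(1)] k] hI[OF y(1) q pq(1)] by simp
          then show "k \<in> h ` L" using y(1) by blast
        qed
      qed
    qed
    then show "mod_isomorphic R (M\<lparr>carrier := L\<rparr>) (scalar_module \<iota> K)"
      unfolding mod_isomorphic_def using hom by (auto simp: scalar_module_def)
  qed
qed

lemma (in module) diff_self [simp]: "x \<in> carrier M \<Longrightarrow> x \<ominus>\<^bsub>M\<^esub> x = \<zero>\<^bsub>M\<^esub>"
  by (simp only: diff_eq_zero_iff)

section \<open>Direct sums and Pruefer modules\<close>

lemma carrier_direct_sum_module: "carrier (direct_sum_module A B) = carrier A \<times> carrier B"
  by (simp add: direct_sum_module_def)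

lemma zero_direct_sum_module: "\<zero>\<^bsub>direct_sum_module A B\<^esub> = (\<zero>\<^bsub>A\<^esub>, \<zero>\<^bsub>B\<^esub>)"
  by (simp add: direct_sum_module_def)

lemma add_direct_sum_module:
  "(x, y) \<oplus>\<^bsub>direct_sum_module A B\<^esub> (x', y') = (x \<oplus>\<^bsub>A\<^esub> x', y \<oplus>\<^bsub>B\<^esub> y')"
  by (simp add: direct_sum_module_def)

lemma smult_direct_sum_module:
  "a \<odot>\<^bsub>direct_sum_module A B\<^esub> (x, y) = (a \<odot>\<^bsub>A\<^esub> x, a \<odot>\<^bsub>B\<^esub> y)"
  by (simp add: direct_sum_module_def)

lemmas direct_sum_module_simps = carrier_direct_sum_module zero_direct_sum_module
  add_direct_sum_module smult_direct_sum_module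

lemma direct_sum_module_is_module:
  assumes "module R A" "module R B"
  shows "module R (direct_sum_module A B)"
proof -
  interpret A: module R A by fact
  interpret B: module R B by fact
  have "abelian_group (direct_sum_module A B)"
  proof (rule abelian_groupI)
    show "\<exists>y\<in>carrier (direct_sum_module A B). y \<oplus>\<^bsub>direct_sum_module A B\<^esub> x = \<zero>\<^bsub>direct_sum_module A B\<^esub>"
      if "x \<in> carrier (direct_sum_module A B)" for x
      using that by (intro bexI[of _ "(\<ominus>\<^bsub>A\<^esub> fst x, \<ominus>\<^bsub>B\<^esub> snd x)"])
        (auto simp: direct_sum_module_simps A.M.l_neg B.M.l_neg)
  qed (auto simp: direct_sum_module_simps A.M.a_ac B.M.a_ac)
  then show ?thesis
    by (intro moduleI A.R.is_cring)
      (auto simp: direct_sum_module_simps A.smult_l_distr A.smult_r_distr A.smult_assoc1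
        B.smult_l_distr B.smult_r_distr B.smult_assoc1)
qed

text \<open>A common complement of the two factors of a direct sum is the graph of an isomorphism.\<close>

lemma mod_isomorphic_if_common_complement:
  assumes A: "module R A" and B: "module R B"
    and XB: "complementary R (direct_sum_module A B) X ({\<zero>\<^bsub>A\<^esub>} \<times> carrier B)"
    and XA: "complementary R (direct_sum_module A B) X (carrier A \<times> {\<zero>\<^bsub>B\<^esub>})"
  shows "mod_isomorphic R A B"
proof -
  interpret A: module R A by fact
  interpret B: module R B by fact
  define S where "S = direct_sum_module A B"
  interpret S: module R S unfolding S_def by (rule direct_sum_module_is_module[OF A B])
  note simps = direct_sum_module_simps[of A B, folded S_def]
  note cB = S.complementaryE[OF XB[folded S_def]] and cA = S.complementaryE[OF XA[folded S_def]]
  have Xc: "a \<in> carrier A" "b \<in> carrier B" if "(a, b) \<in> X" for a b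
    using S.submodule_subset[OF cB(1) that] by (auto simp: simps)
  have diff: "(a \<ominus>\<^bsub>A\<^esub> a', b \<ominus>\<^bsub>B\<^esub> b') \<in> X" if ab: "(a, b) \<in> X" "(a', b') \<in> X" for a b a' b'
  proof -
    have "(a, b) \<oplus>\<^bsub>S\<^esub> (\<ominus>\<^bsub>R\<^esub> \<one>\<^bsub>R\<^esub>) \<odot>\<^bsub>S\<^esub> (a', b') \<in> X"
      by (rule S.submodule_add[OF cB(1) ab(1) S.submodule_smult[OF cB(1) _ ab(2)]]) simp
    then show ?thesis using Xc[OF ab(1)] Xc[OF ab(2)]
      by (simp add: simps A.smult_l_minus B.smult_l_minus a_minus_def)
  qed
  have "\<forall>a\<in>carrier A. \<exists>b. (a, b) \<in> X"
  proof
    fix a assume a: "a \<in> carrier A"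
    then have "(a, \<zero>\<^bsub>B\<^esub>) \<in> carrier S" by (simp add: simps)
    then obtain x y where xy: "x \<in> X" "y \<in> {\<zero>\<^bsub>A\<^esub>} \<times> carrier B" "(a, \<zero>\<^bsub>B\<^esub>) = x \<oplus>\<^bsub>S\<^esub> y"
      using cB(4) by blast
    obtain x1 x2 where x: "x = (x1, x2)" by (cases x)
    have "a = x1" using xy Xc[of x1 x2] by (auto simp: x simps)
    then show "\<exists>b. (a, b) \<in> X" using xy(1) x by blast
  qed
  from bchoice[OF this] obtain h where h: "\<forall>a\<in>carrier A. (a, h a) \<in> X" by (elim exE)
  have hI: "h a = b" if "(a, b) \<in> X" for a b
  proof -
    have ab: "(a, h a) \<in> X" using h Xc(1)[OF that] by blast
    have "(\<zero>\<^bsub>A\<^esub>, h a \<ominus>\<^bsub>B\<^esub> b) \<in> X"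
      using diff[OF ab that] Xc(1)[OF that] by (simp add: A.diff_eq_zero_iff)
    then have "(\<zero>\<^bsub>A\<^esub>, h a \<ominus>\<^bsub>B\<^esub> b) = \<zero>\<^bsub>S\<^esub>"
      using cB(3) Xc[OF ab] Xc[OF that] by simp
    then show ?thesis using Xc[OF ab] Xc[OF that] by (simp add: simps B.diff_eq_zero_iff)
  qed
  have hB: "h a \<in> carrier B" if "a \<in> carrier A" for a using h that Xc(2) by blast
  have "h \<in> mod_hom R A B"
  proof (rule mod_homI)
    show "h a \<in> carrier B" if "a \<in> carrier A" for a by (rule hB[OF that])
    show "h (a \<oplus>\<^bsub>A\<^esub> a') = h a \<oplus>\<^bsub>B\<^esub> h a'" if "a \<in> carrier A" "a' \<in> carrier A" for a a'
    proof (rule hI)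
      have "(a, h a) \<oplus>\<^bsub>S\<^esub> (a', h a') \<in> X" by (rule S.submodule_add[OF cB(1)]) (use h that in auto)
      then show "(a \<oplus>\<^bsub>A\<^esub> a', h a \<oplus>\<^bsub>B\<^esub> h a') \<in> X" by (simp add: simps)
    qed
    show "h (r \<odot>\<^bsub>A\<^esub> a) = r \<odot>\<^bsub>B\<^esub> h a" if "r \<in> carrier R" "a \<in> carrier A" for r a
    proof (rule hI)
      have "r \<odot>\<^bsub>S\<^esub> (a, h a) \<in> X" by (rule S.submodule_smult[OF cB(1) that(1)]) (use h that in auto)
      then show "(r \<odot>\<^bsub>A\<^esub> a, r \<odot>\<^bsub>B\<^esub> h a) \<in> X" by (simp add: simps)
    qed
  qed
  moreover have "bij_betw h (carrier A) (carrier B)"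
    unfolding bij_betw_def
  proof
    show "inj_on h (carrier A)"
    proof (rule inj_onI)
      fix a a' assume aa: "a \<in> carrier A" "a' \<in> carrier A" "h a = h a'"
      have m: "(a, h a) \<in> X" "(a', h a) \<in> X" using h aa by (auto simp: aa(3)[symmetric] dest: bspec)
      have "(a \<ominus>\<^bsub>A\<^esub> a', \<zero>\<^bsub>B\<^esub>) \<in> X"
        using diff[OF m] Xc(2)[OF m(1)] by (simp add: B.diff_eq_zero_iff)
      then have "(a \<ominus>\<^bsub>A\<^esub> a', \<zero>\<^bsub>B\<^esub>) = \<zero>\<^bsub>S\<^esub>" using cA(3) aa(1,2) by simp
      then show "a = a'" using aa(1,2) by (simp add: simps A.diff_eq_zero_iff)
    qed
    show "h ` carrier A = carrier B"
    proof
      show "h ` carrier A \<subseteq> carrier B" using hB by blast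
      show "carrier B \<subseteq> h ` carrier A"
      proof
        fix b assume b: "b \<in> carrier B"
        then have "(\<zero>\<^bsub>A\<^esub>, b) \<in> carrier S" by (simp add: simps)
        then obtain x y where xy: "x \<in> X" "y \<in> carrier A \<times> {\<zero>\<^bsub>B\<^esub>}" "(\<zero>\<^bsub>A\<^esub>, b) = x \<oplus>\<^bsub>S\<^esub> y"
          using cA(4) by blast
        obtain x1 x2 where x: "x = (x1, x2)" by (cases x)
        have "b = x2" using xy Xc[of x1 x2] by (auto simp: x simps)
        then have "h x1 = b" using hI[of x1 x2] xy(1) x by simp
        then show "b \<in> h ` carrier A" using Xc(1)[of x1 x2] xy(1) x by blast
      qed
    qed
  qed
  ultimately show ?thesis unfolding mod_isomorphic_def by blast
qed

lemma mod_isomorphic_direct_sum_iff: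
  assumes M: "module R M" and A: "module R A" and B: "module R B"
  shows "mod_isomorphic R M (direct_sum_module A B) \<longleftrightarrow>
    (\<exists>L N. complementary R M L N \<and> mod_isomorphic R (M\<lparr>carrier := L\<rparr>) A \<and>
      mod_isomorphic R (M\<lparr>carrier := N\<rparr>) B)"
proof -
  interpret M: module R M by fact
  interpret A: module R A by fact
  interpret B: module R B by fact
  define S where "S = direct_sum_module A B"
  interpret S: module R S unfolding S_def by (rule direct_sum_module_is_module[OF A B])
  note simps = direct_sum_module_simps[of A B, folded S_def]
  show ?thesis unfolding S_def[symmetric]
  proof
    assume "mod_isomorphic R M S"
    then obtain h where h: "h \<in> mod_hom R M S" and bij: "bij_betw h (carrier M) (carrier S)"
      unfolding mod_isomorphic_def by blast
    define f where "f x = fst (h x)" for x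
    define g where "g x = snd (h x)" for x
    have fg: "h x = (f x, g x)" for x unfolding f_def g_def by simp
    have f: "f \<in> mod_hom R M A"
    proof (rule mod_homI)
      show "f x \<in> carrier A" if "x \<in> carrier M" for x
        using mod_hom_closed[OF h that] unfolding fg by (simp add: simps)
      show "f (x \<oplus>\<^bsub>M\<^esub> y) = f x \<oplus>\<^bsub>A\<^esub> f y" if "x \<in> carrier M" "y \<in> carrier M" for x y
        using mod_hom_add[OF h that] unfolding fg by (simp add: simps)
      show "f (a \<odot>\<^bsub>M\<^esub> x) = a \<odot>\<^bsub>A\<^esub> f x" if "a \<in> carrier R" "x \<in> carrier M" for a x
        using mod_hom_smult[OF h that] unfolding fg by (simp add: simps)
    qed
    have g: "g \<in> mod_hom R M B"
    proof (rule mod_homI)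
      show "g x \<in> carrier B" if "x \<in> carrier M" for x
        using mod_hom_closed[OF h that] unfolding fg by (simp add: simps)
      show "g (x \<oplus>\<^bsub>M\<^esub> y) = g x \<oplus>\<^bsub>B\<^esub> g y" if "x \<in> carrier M" "y \<in> carrier M" for x y
        using mod_hom_add[OF h that] unfolding fg by (simp add: simps)
      show "g (a \<odot>\<^bsub>M\<^esub> x) = a \<odot>\<^bsub>B\<^esub> g x" if "a \<in> carrier R" "x \<in> carrier M" for a x
        using mod_hom_smult[OF h that] unfolding fg by (simp add: simps)
    qed
    have inj: "x = y" if "x \<in> carrier M" "y \<in> carrier M" "f x = f y" "g x = g y" for x y
      using bij that fg unfolding bij_betw_def by (metis inj_onD)
    have surj: "\<exists>x\<in>carrier M. f x = a \<and> g x = b" if "a \<in> carrier A" "b \<in> carrier B" for a b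
    proof -
      have "(a, b) \<in> h ` carrier M" using bij that unfolding bij_betw_def by (simp add: simps)
      then show ?thesis unfolding fg by auto
    qed
    \<comment> \<open>The preimages of the two factors are the kernels of the opposite
      coordinates.\<close>
    define L where "L = {x \<in> carrier M. g x \<in> {\<zero>\<^bsub>B\<^esub>}}"
    define N where "N = {x \<in> carrier M. f x \<in> {\<zero>\<^bsub>A\<^esub>}}"
    have L: "submodule L R M" unfolding L_def by (rule submodule_vimage[OF M B g B.zero_submodule])
    have N: "submodule N R M" unfolding N_def by (rule submodule_vimage[OF M A f A.zero_submodule])
    have f0: "f \<zero>\<^bsub>M\<^esub> = \<zero>\<^bsub>A\<^esub>" "g \<zero>\<^bsub>M\<^esub> = \<zero>\<^bsub>B\<^esub>" using mod_hom_zero[OF M A f] mod_hom_zero[OF M B g] by auto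
    have "complementary R M L N"
    proof (rule M.complementaryI[OF L N])
      show "x = \<zero>\<^bsub>M\<^esub>" if "x \<in> L" "x \<in> N" for x
        using inj[of x "\<zero>\<^bsub>M\<^esub>"] that f0 unfolding L_def N_def by simp
      show "\<exists>d\<in>L. \<exists>e\<in>N. x = d \<oplus>\<^bsub>M\<^esub> e" if x: "x \<in> carrier M" for x
      proof -
        obtain d where d: "d \<in> carrier M" "f d = f x" "g d = \<zero>\<^bsub>B\<^esub>"
          using surj[OF mod_hom_closed[OF f x] B.M.zero_closed] by blast
        have "f (x \<ominus>\<^bsub>M\<^esub> d) = \<zero>\<^bsub>A\<^esub>"
          using mod_hom_diff[OF M A f x d(1)] mod_hom_closed[OF f x] d(2) by (simp add: A.diff_eq_zero_iff)
        then have "x \<ominus>\<^bsub>M\<^esub> d \<in> N" "d \<in> L" unfolding N_def L_def using x d by auto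
        moreover have "x = d \<oplus>\<^bsub>M\<^esub> (x \<ominus>\<^bsub>M\<^esub> d)" using x d by simp
        ultimately show ?thesis by blast
      qed
    qed
    moreover have "mod_isomorphic R (M\<lparr>carrier := L\<rparr>) A"
      unfolding mod_isomorphic_def
    proof (intro bexI conjI)
      show "f \<in> mod_hom R (M\<lparr>carrier := L\<rparr>) A" using f unfolding mod_hom_def L_def by auto
      show "bij_betw f (carrier (M\<lparr>carrier := L\<rparr>)) (carrier A)"
        unfolding bij_betw_def
      proof
        show "inj_on f (carrier (M\<lparr>carrier := L\<rparr>))"
          by (rule inj_onI) (use inj in \<open>auto simp: L_def\<close>)
        show "f ` carrier (M\<lparr>carrier := L\<rparr>) = carrier A"
          using surj[OF _ B.M.zero_closed] mod_hom_closed[OF f] by (fastforce simp: L_def image_iff)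
      qed
    qed
    moreover have "mod_isomorphic R (M\<lparr>carrier := N\<rparr>) B"
      unfolding mod_isomorphic_def
    proof (intro bexI conjI)
      show "g \<in> mod_hom R (M\<lparr>carrier := N\<rparr>) B" using g unfolding mod_hom_def N_def by auto
      show "bij_betw g (carrier (M\<lparr>carrier := N\<rparr>)) (carrier B)"
        unfolding bij_betw_def
      proof
        show "inj_on g (carrier (M\<lparr>carrier := N\<rparr>))"
          by (rule inj_onI) (use inj in \<open>auto simp: N_def\<close>)
        show "g ` carrier (M\<lparr>carrier := N\<rparr>) = carrier B"
          using surj[OF A.M.zero_closed] mod_hom_closed[OF g] by (fastforce simp: N_def image_iff)
      qed
    qed
    ultimately show "\<exists>L N. complementary R M L N \<and> mod_isomorphic R (M\<lparr>carrier := L\<rparr>) A \<and>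
      mod_isomorphic R (M\<lparr>carrier := N\<rparr>) B" by blast
  next
    assume "\<exists>L N. complementary R M L N \<and> mod_isomorphic R (M\<lparr>carrier := L\<rparr>) A \<and>
      mod_isomorphic R (M\<lparr>carrier := N\<rparr>) B"
    then obtain L N f g where c: "complementary R M L N"
      and f: "f \<in> mod_hom R (M\<lparr>carrier := L\<rparr>) A" "bij_betw f L (carrier A)"
      and g: "g \<in> mod_hom R (M\<lparr>carrier := N\<rparr>) B" "bij_betw g N (carrier B)"
      unfolding mod_isomorphic_def by auto
    note cE = M.complementaryE[OF c]
    obtain p where p: "p \<in> mod_hom R M M" "\<forall>x\<in>L. p x = x" "\<forall>x\<in>N. p x = \<zero>\<^bsub>M\<^esub>"
      "\<forall>x\<in>carrier M. p x \<in> L" "\<forall>x\<in>carrier M. x \<ominus>\<^bsub>M\<^esub> p x \<in> N"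
      by (rule M.complementary_projection[OF c])
    have pL: "p x \<in> L" and pN: "x \<ominus>\<^bsub>M\<^esub> p x \<in> N" and pM: "p x \<in> carrier M" if "x \<in> carrier M" for x
      using p(4,5) that M.submodule_subset[OF cE(1)] by auto
    have fadd: "f (x \<oplus>\<^bsub>M\<^esub> y) = f x \<oplus>\<^bsub>A\<^esub> f y" if "x \<in> L" "y \<in> L" for x y
      using mod_hom_add[OF f(1), of x y] that by simp
    have fsm: "f (a \<odot>\<^bsub>M\<^esub> x) = a \<odot>\<^bsub>A\<^esub> f x" if "a \<in> carrier R" "x \<in> L" for a x
      using mod_hom_smult[OF f(1) that(1), of x] that by simp
    have gadd: "g (x \<oplus>\<^bsub>M\<^esub> y) = g x \<oplus>\<^bsub>B\<^esub> g y" if "x \<in> N" "y \<in> N" for x y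
      using mod_hom_add[OF g(1), of x y] that by simp
    have gsm: "g (a \<odot>\<^bsub>M\<^esub> x) = a \<odot>\<^bsub>B\<^esub> g x" if "a \<in> carrier R" "x \<in> N" for a x
      using mod_hom_smult[OF g(1) that(1), of x] that by simp
    have fc: "f x \<in> carrier A" if "x \<in> L" for x using f(2) that unfolding bij_betw_def by blast
    have gc: "g x \<in> carrier B" if "x \<in> N" for x using g(2) that unfolding bij_betw_def by blast
    define h where "h x = (f (p x), g (x \<ominus>\<^bsub>M\<^esub> p x))" for x
    have "h \<in> mod_hom R M S"
    proof (rule mod_homI)
      show "h x \<in> carrier S" if "x \<in> carrier M" for x
        unfolding h_def using fc[OF pL[OF that]] gc[OF pN[OF that]] by (simp add: simps)
      show "h (x \<oplus>\<^bsub>M\<^esub> y) = h x \<oplus>\<^bsub>S\<^esub> h y" if xy: "x \<in> carrier M" "y \<in> carrier M" for x y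
      proof -
        have "(x \<oplus>\<^bsub>M\<^esub> y) \<ominus>\<^bsub>M\<^esub> p (x \<oplus>\<^bsub>M\<^esub> y) = (x \<ominus>\<^bsub>M\<^esub> p x) \<oplus>\<^bsub>M\<^esub> (y \<ominus>\<^bsub>M\<^esub> p y)"
          unfolding mod_hom_add[OF p(1) xy] using xy pM by (intro M.add_diff_swap)
        then show ?thesis
          unfolding h_def using mod_hom_add[OF p(1) xy] fadd[OF pL[OF xy(1)] pL[OF xy(2)]]
            gadd[OF pN[OF xy(1)] pN[OF xy(2)]] by (simp add: simps)
      qed
      show "h (a \<odot>\<^bsub>M\<^esub> x) = a \<odot>\<^bsub>S\<^esub> h x" if ax: "a \<in> carrier R" "x \<in> carrier M" for a x
      proof -
        have "a \<odot>\<^bsub>M\<^esub> x \<ominus>\<^bsub>M\<^esub> p (a \<odot>\<^bsub>M\<^esub> x) = a \<odot>\<^bsub>M\<^esub> (x \<ominus>\<^bsub>M\<^esub> p x)"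
          unfolding mod_hom_smult[OF p(1) ax] using ax pM by (simp add: M.smult_diff)
        then show ?thesis
          unfolding h_def using mod_hom_smult[OF p(1) ax] fsm[OF ax(1) pL[OF ax(2)]]
            gsm[OF ax(1) pN[OF ax(2)]] by (simp add: simps)
      qed
    qed
    moreover have "bij_betw h (carrier M) (carrier S)"
      unfolding bij_betw_def
    proof
      show "inj_on h (carrier M)"
      proof (rule inj_onI)
        fix x y assume xy: "x \<in> carrier M" "y \<in> carrier M" "h x = h y"
        then have "f (p x) = f (p y)" "g (x \<ominus>\<^bsub>M\<^esub> p x) = g (y \<ominus>\<^bsub>M\<^esub> p y)" unfolding h_def by auto
        then have e: "p x = p y" "x \<ominus>\<^bsub>M\<^esub> p x = y \<ominus>\<^bsub>M\<^esub> p y"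
          using f(2) g(2) pL pN xy(1,2) unfolding bij_betw_def by (meson inj_onD)+
        have "x = (x \<ominus>\<^bsub>M\<^esub> p x) \<oplus>\<^bsub>M\<^esub> p x" using xy(1) pM by simp
        also have "\<dots> = (y \<ominus>\<^bsub>M\<^esub> p y) \<oplus>\<^bsub>M\<^esub> p y" using e by simp
        also have "\<dots> = y" using xy(2) pM by simp
        finally show "x = y" .
      qed
      show "h ` carrier M = carrier S"
      proof
        show "h ` carrier M \<subseteq> carrier S" unfolding h_def using fc pL gc pN by (auto simp: simps)
        show "carrier S \<subseteq> h ` carrier M"
        proof
          fix z assume "z \<in> carrier S"
          then obtain a b where z: "z = (a, b)" "a \<in> carrier A" "b \<in> carrier B" by (auto simp: simps)
          have "a \<in> f ` L" "b \<in> g ` N" using z(2,3) f(2) g(2) unfolding bij_betw_def by auto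
          then obtain l n where ln: "l \<in> L" "n \<in> N" "f l = a" "g n = b" by blast
          have cl: "l \<in> carrier M" "n \<in> carrier M"
            using M.submodule_subset[OF cE(1) ln(1)] M.submodule_subset[OF cE(2) ln(2)] by auto
          have "p (l \<oplus>\<^bsub>M\<^esub> n) = l" using mod_hom_add[OF p(1) cl] p(2,3) ln cl by simp
          then have "h (l \<oplus>\<^bsub>M\<^esub> n) = z" unfolding h_def using ln cl z by simp
          then show "z \<in> h ` carrier M" using cl by blast
        qed
      qed
    qed
    ultimately show "mod_isomorphic R M S" unfolding mod_isomorphic_def by blast
  qed
qed

lemma pruefer_like_restrict_iff:
  assumes M: "module R M" and N: "submodule N R M"
  shows "module.pruefer_like R (M\<lparr>carrier := N\<rparr>) \<pi> N \<longleftrightarrow> module.pruefer_like R M \<pi> N"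
proof -
  interpret M: module R M by fact
  interpret M': module R "M\<lparr>carrier := N\<rparr>" by (rule M.submodule_module[OF N])
  show ?thesis
    unfolding M.pruefer_like_def M'.pruefer_like_def M.cyclic_submodule_def M'.cyclic_submodule_def by simp
qed

lemma pruefer_like_transport:
  assumes A: "module R A" and B: "module R B" and iso: "mod_isomorphic R A B" and \<pi>: "\<pi> \<in> carrier R"
    and pr: "module.pruefer_like R B \<pi> (carrier B)"
  shows "module.pruefer_like R A \<pi> (carrier A)"
proof -
  interpret A: module R A by fact
  interpret B: module R B by fact
  obtain h where h: "h \<in> mod_hom R A B" and bij: "bij_betw h (carrier A) (carrier B)"
    using iso unfolding mod_isomorphic_def by blast
  note hB = mod_hom_closed[OF h] and hsm = mod_hom_smult[OF h] and h0 = mod_hom_zero[OF A B h]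
  have inj: "x = y" if "x \<in> carrier A" "y \<in> carrier A" "h x = h y" for x y
    using bij that unfolding bij_betw_def by (meson inj_onD)
  have surj: "\<exists>x\<in>carrier A. h x = b" if "b \<in> carrier B" for b
  proof -
    have "b \<in> h ` carrier A" using bij that unfolding bij_betw_def by simp
    then show ?thesis by blast
  qed
  have h0': "x = \<zero>\<^bsub>A\<^esub>" if "x \<in> carrier A" "h x = \<zero>\<^bsub>B\<^esub>" for x
    using inj[OF that(1) A.M.zero_closed] that(2) h0 by simp
  show ?thesis
    unfolding A.pruefer_like_def
  proof (intro conjI ballI impI)
    show "carrier A \<noteq> {\<zero>\<^bsub>A\<^esub>}"
    proof
      assume "carrier A = {\<zero>\<^bsub>A\<^esub>}"
      then have "carrier B = {\<zero>\<^bsub>B\<^esub>}" using bij h0 unfolding bij_betw_def by auto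
      then show False using pr unfolding B.pruefer_like_def by blast
    qed
    show "\<exists>y\<in>carrier A. x = \<pi> \<odot>\<^bsub>A\<^esub> y" if x: "x \<in> carrier A" for x
    proof -
      obtain b where b: "b \<in> carrier B" "h x = \<pi> \<odot>\<^bsub>B\<^esub> b"
        using pr hB[OF x] unfolding B.pruefer_like_def by blast
      obtain y where y: "y \<in> carrier A" "h y = b" using surj[OF b(1)] by blast
      have "x = \<pi> \<odot>\<^bsub>A\<^esub> y" by (rule inj[OF x]) (use y \<pi> b(2) hsm[OF \<pi> y(1)] in auto)
      then show ?thesis using y(1) by (rule bexI)
    qed
    show "x' \<in> A.cyclic_submodule x"
      if x: "x \<in> carrier A" and x': "x' \<in> carrier A"
        and s: "\<pi> \<odot>\<^bsub>A\<^esub> x = \<zero>\<^bsub>A\<^esub> \<and> \<pi> \<odot>\<^bsub>A\<^esub> x' = \<zero>\<^bsub>A\<^esub> \<and> x \<noteq> \<zero>\<^bsub>A\<^esub>" for x x'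
    proof -
      have "\<pi> \<odot>\<^bsub>B\<^esub> h x = \<zero>\<^bsub>B\<^esub>" "\<pi> \<odot>\<^bsub>B\<^esub> h x' = \<zero>\<^bsub>B\<^esub>" "h x \<noteq> \<zero>\<^bsub>B\<^esub>"
        using hsm[OF \<pi> x] hsm[OF \<pi> x'] s h0 h0'[OF x] by auto
      then have "h x' \<in> B.cyclic_submodule (h x)"
        using pr hB[OF x] hB[OF x'] unfolding B.pruefer_like_def by metis
      then obtain a where a: "a \<in> carrier R" "h x' = a \<odot>\<^bsub>B\<^esub> h x" by (rule B.cyclic_submoduleE)
      have "x' = a \<odot>\<^bsub>A\<^esub> x" by (rule inj[OF x']) (use x a hsm[OF a(1) x] in auto)
      then show ?thesis using A.cyclic_submoduleI[OF a(1), of x] by simp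
    qed
  qed
qed

text \<open>Instead of extending an isomorphism of socles step by step, a common complement of the
  two factors in the direct sum of A and B is built. Both factors are relatively injective. A
  complement of B containing the pair (u, v) of socle generators also meets A trivially, and
  enlarging it to a complement of A does not change it.\<close>

lemma (in uniformized_prime) pruefer_like_unique:
  assumes mA: "module R A" and mB: "module R B"
    and TA: "carrier A = primary_component R A P" and TB: "carrier B = primary_component R B P"
    and prA: "module.pruefer_like R A \<pi> (carrier A)" and prB: "module.pruefer_like R B \<pi> (carrier B)"
  shows "mod_isomorphic R A B"
proof -
  interpret A: module_at_prime R A P \<pi> \<tau> by (intro module_at_prime.intro mA uniformized_prime_axioms)
  interpret B: module_at_prime R B P \<pi> \<tau> by (intro module_at_prime.intro mB uniformized_prime_axioms)
  define S where "S = direct_sum_module A B"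
  have mS: "module R S" unfolding S_def by (rule direct_sum_module_is_module[OF mA mB])
  interpret S: module_at_prime R S P \<pi> \<tau> by (intro module_at_prime.intro mS uniformized_prime_axioms)
  note simps = direct_sum_module_simps[of A B, folded S_def]
  define A0 where "A0 = carrier A \<times> {\<zero>\<^bsub>B\<^esub>}"
  define B0 where "B0 = {\<zero>\<^bsub>A\<^esub>} \<times> carrier B"
  have A0: "submodule A0 R S" by (rule S.submoduleI') (auto simp: simps A0_def)
  have B0: "submodule B0 R S" by (rule S.submoduleI') (auto simp: simps B0_def)
  have A0T: "A0 \<subseteq> S.T"
  proof
    fix z assume "z \<in> A0"
    then obtain a where a: "a \<in> carrier A" "z = (a, \<zero>\<^bsub>B\<^esub>)" unfolding A0_def by blast
    then obtain n where n: "\<forall>r\<in>ideal_power R P n. r \<odot>\<^bsub>A\<^esub> a = \<zero>\<^bsub>A\<^esub>"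
      using TA unfolding primary_component_def by blast
    have "\<forall>r\<in>ideal_power R P n. r \<odot>\<^bsub>S\<^esub> z = \<zero>\<^bsub>S\<^esub>"
      using n ideal_power_closed a(2) by (simp add: simps)
    then show "z \<in> S.T" unfolding primary_component_def using a by (auto simp: simps)
  qed
  have B0T: "B0 \<subseteq> S.T"
  proof
    fix z assume "z \<in> B0"
    then obtain b where b: "b \<in> carrier B" "z = (\<zero>\<^bsub>A\<^esub>, b)" unfolding B0_def by blast
    then obtain n where n: "\<forall>r\<in>ideal_power R P n. r \<odot>\<^bsub>B\<^esub> b = \<zero>\<^bsub>B\<^esub>"
      using TB unfolding primary_component_def by blast
    have "\<forall>r\<in>ideal_power R P n. r \<odot>\<^bsub>S\<^esub> z = \<zero>\<^bsub>S\<^esub>"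
      using n ideal_power_closed b(2) by (simp add: simps)
    then show "z \<in> S.T" unfolding primary_component_def using b by (auto simp: simps)
  qed
  have divA: "\<exists>y\<in>carrier A. x = \<pi> \<odot>\<^bsub>A\<^esub> y" if "x \<in> carrier A" for x
    using prA that unfolding A.pruefer_like_def by blast
  have divB: "\<exists>y\<in>carrier B. x = \<pi> \<odot>\<^bsub>B\<^esub> y" if "x \<in> carrier B" for x
    using prB that unfolding B.pruefer_like_def by blast
  have injA: "S.relatively_injective A0"
  proof (rule S.primary_divisible_relatively_injective[OF A0 A0T])
    fix z assume "z \<in> A0"
    then obtain a where a: "a \<in> carrier A" "z = (a, \<zero>\<^bsub>B\<^esub>)" unfolding A0_def by blast
    obtain y where y: "y \<in> carrier A" "a = \<pi> \<odot>\<^bsub>A\<^esub> y" using divA[OF a(1)] by (elim bexE)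
    have "z = \<pi> \<odot>\<^bsub>S\<^esub> (y, \<zero>\<^bsub>B\<^esub>)" using a(2) y(2) by (simp add: simps)
    moreover have "(y, \<zero>\<^bsub>B\<^esub>) \<in> A0" using y(1) unfolding A0_def by simp
    ultimately show "\<exists>y\<in>A0. z = \<pi> \<odot>\<^bsub>S\<^esub> y" by (rule bexI)
  qed
  have injB: "S.relatively_injective B0"
  proof (rule S.primary_divisible_relatively_injective[OF B0 B0T])
    fix z assume "z \<in> B0"
    then obtain b where b: "b \<in> carrier B" "z = (\<zero>\<^bsub>A\<^esub>, b)" unfolding B0_def by blast
    obtain y where y: "y \<in> carrier B" "b = \<pi> \<odot>\<^bsub>B\<^esub> y" using divB[OF b(1)] by (elim bexE)
    have "z = \<pi> \<odot>\<^bsub>S\<^esub> (\<zero>\<^bsub>A\<^esub>, y)" using b(2) y(2) by (simp add: simps)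
    moreover have "(\<zero>\<^bsub>A\<^esub>, y) \<in> B0" using y(1) unfolding B0_def by simp
    ultimately show "\<exists>y\<in>B0. z = \<pi> \<odot>\<^bsub>S\<^esub> y" by (rule bexI)
  qed
  obtain u where u: "u \<in> carrier A" "u \<noteq> \<zero>\<^bsub>A\<^esub>" "\<pi> \<odot>\<^bsub>A\<^esub> u = \<zero>\<^bsub>A\<^esub>"
  proof -
    obtain x where x: "x \<in> carrier A" "x \<noteq> \<zero>\<^bsub>A\<^esub>"
      using prA A.M.zero_closed unfolding A.pruefer_like_def by blast
    show ?thesis
      using A.T_nonzero_has_socle[OF A.carrier_is_submodule equalityD1[OF TA] x] that by metis
  qed
  obtain v where v: "v \<in> carrier B" "v \<noteq> \<zero>\<^bsub>B\<^esub>" "\<pi> \<odot>\<^bsub>B\<^esub> v = \<zero>\<^bsub>B\<^esub>"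
  proof -
    obtain x where x: "x \<in> carrier B" "x \<noteq> \<zero>\<^bsub>B\<^esub>"
      using prB B.M.zero_closed unfolding B.pruefer_like_def by blast
    show ?thesis
      using B.T_nonzero_has_socle[OF B.carrier_is_submodule equalityD1[OF TB] x] that by metis
  qed
  have socA: "\<exists>c\<in>carrier R. u = c \<odot>\<^bsub>A\<^esub> a" if a: "a \<in> carrier A" "a \<noteq> \<zero>\<^bsub>A\<^esub>" for a
  proof -
    obtain k :: nat where k: "\<pi> [^] k \<odot>\<^bsub>A\<^esub> a \<in> carrier A" "\<pi> [^] k \<odot>\<^bsub>A\<^esub> a \<noteq> \<zero>\<^bsub>A\<^esub>"
      "\<pi> [^] Suc k \<odot>\<^bsub>A\<^esub> a = \<zero>\<^bsub>A\<^esub>" "\<pi> \<odot>\<^bsub>A\<^esub> (\<pi> [^] k \<odot>\<^bsub>A\<^esub> a) = \<zero>\<^bsub>A\<^esub>"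
      by (rule A.T_nonzero_has_socle[OF A.carrier_is_submodule equalityD1[OF TA] a])
    have "u \<in> A.cyclic_submodule (\<pi> [^] k \<odot>\<^bsub>A\<^esub> a)"
      using prA k(1,2,4) u unfolding A.pruefer_like_def by metis
    then obtain c where c: "c \<in> carrier R" "u = c \<odot>\<^bsub>A\<^esub> (\<pi> [^] k \<odot>\<^bsub>A\<^esub> a)" by (rule A.cyclic_submoduleE)
    then have "u = (c \<otimes> \<pi> [^] k) \<odot>\<^bsub>A\<^esub> a" using a by (simp add: A.smult_assoc1)
    moreover have "c \<otimes> \<pi> [^] k \<in> carrier R" using c(1) by simp
    ultimately show ?thesis by (rule bexI)
  qed
  have socB: "\<exists>c\<in>carrier R. v = c \<odot>\<^bsub>B\<^esub> b" if b: "b \<in> carrier B" "b \<noteq> \<zero>\<^bsub>B\<^esub>" for b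
  proof -
    obtain k :: nat where k: "\<pi> [^] k \<odot>\<^bsub>B\<^esub> b \<in> carrier B" "\<pi> [^] k \<odot>\<^bsub>B\<^esub> b \<noteq> \<zero>\<^bsub>B\<^esub>"
      "\<pi> [^] Suc k \<odot>\<^bsub>B\<^esub> b = \<zero>\<^bsub>B\<^esub>" "\<pi> \<odot>\<^bsub>B\<^esub> (\<pi> [^] k \<odot>\<^bsub>B\<^esub> b) = \<zero>\<^bsub>B\<^esub>"
      by (rule B.T_nonzero_has_socle[OF B.carrier_is_submodule equalityD1[OF TB] b])
    have "v \<in> B.cyclic_submodule (\<pi> [^] k \<odot>\<^bsub>B\<^esub> b)"
      using prB k(1,2,4) v unfolding B.pruefer_like_def by metis
    then obtain c where c: "c \<in> carrier R" "v = c \<odot>\<^bsub>B\<^esub> (\<pi> [^] k \<odot>\<^bsub>B\<^esub> b)" by (rule B.cyclic_submoduleE)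
    then have "v = (c \<otimes> \<pi> [^] k) \<odot>\<^bsub>B\<^esub> b" using b by (simp add: B.smult_assoc1)
    moreover have "c \<otimes> \<pi> [^] k \<in> carrier R" using c(1) by simp
    ultimately show ?thesis by (rule bexI)
  qed
  have uvS: "(u, v) \<in> carrier S" using u v by (simp add: simps)
  have YB: "z = \<zero>\<^bsub>S\<^esub>" if z: "z \<in> S.cyclic_submodule (u, v)" "z \<in> B0" for z
  proof -
    obtain r where r: "r \<in> carrier R" "z = r \<odot>\<^bsub>S\<^esub> (u, v)" using z(1) by (rule S.cyclic_submoduleE)
    have ru: "r \<odot>\<^bsub>A\<^esub> u = \<zero>\<^bsub>A\<^esub>" using z(2) r(2) unfolding B0_def by (simp add: simps)
    have uT: "u \<in> A.T" and vT: "v \<in> B.T" using u v TA TB by auto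
    have "r \<in> P"
    proof (rule ccontr)
      assume "r \<notin> P"
      then have "u = \<zero>\<^bsub>A\<^esub>" using A.T_smult_eq_zero[OF uT, of r] r(1) ru by simp
      then show False using u by simp
    qed
    then have "r \<odot>\<^bsub>B\<^esub> v = \<zero>\<^bsub>B\<^esub>" by (rule B.T_P_smult_eq_zero[OF vT v(3)])
    then show ?thesis using r(2) ru by (simp add: simps)
  qed
  obtain X where X: "S.cyclic_submodule (u, v) \<subseteq> X" "complementary R S X B0"
    by (rule S.relatively_injective_complement[OF injB S.submodule_cyclic[OF uvS] YB])
  note cX = S.complementaryE[OF X(2)]
  have swap: "((u, v) \<ominus>\<^bsub>S\<^esub> (u, \<zero>\<^bsub>B\<^esub>)) = (\<zero>\<^bsub>A\<^esub>, v)" "((u, v) \<ominus>\<^bsub>S\<^esub> (\<zero>\<^bsub>A\<^esub>, v)) = (u, \<zero>\<^bsub>B\<^esub>)"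
    using S.add_diff_cancel_left[of "(u, \<zero>\<^bsub>B\<^esub>)" "(\<zero>\<^bsub>A\<^esub>, v)"] S.add_diff_cancel_left[of "(\<zero>\<^bsub>A\<^esub>, v)" "(u, \<zero>\<^bsub>B\<^esub>)"] u v
    by (simp_all add: simps)
  have uvX: "(u, v) \<in> X" using X(1) S.generator_in_cyclic_submodule[OF uvS] by blast
  \<comment> \<open>Any non-zero element of A has u among its multiples, so (u, 0) would be in X
    and, after subtraction from (u, v), also (0, v), a non-zero element of B.\<close>
  have XA: "z = \<zero>\<^bsub>S\<^esub>" if z: "z \<in> X" "z \<in> A0" for z
  proof (rule ccontr)
    assume nz: "z \<noteq> \<zero>\<^bsub>S\<^esub>"
    obtain a where a: "a \<in> carrier A" "z = (a, \<zero>\<^bsub>B\<^esub>)" using z(2) unfolding A0_def by blast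
    have "a \<noteq> \<zero>\<^bsub>A\<^esub>" using nz a(2) by (auto simp: simps)
    then obtain c where c: "c \<in> carrier R" "u = c \<odot>\<^bsub>A\<^esub> a" using socA[OF a(1)] by blast
    have "c \<odot>\<^bsub>S\<^esub> z \<in> X" by (rule S.submodule_smult[OF cX(1) c(1) z(1)])
    then have "(u, \<zero>\<^bsub>B\<^esub>) \<in> X" using a(2) c by (simp add: simps)
    then have "(\<zero>\<^bsub>A\<^esub>, v) \<in> X" using S.submodule_diff[OF cX(1) uvX] swap(1) by metis
    then have "(\<zero>\<^bsub>A\<^esub>, v) = \<zero>\<^bsub>S\<^esub>" using cX(3) v(1) unfolding B0_def by blast
    then show False using v(2) by (simp add: simps)
  qed
  obtain X' where X': "X \<subseteq> X'" "complementary R S X' A0"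
    by (rule S.relatively_injective_complement[OF injA cX(1) XA])
  note cX' = S.complementaryE[OF X'(2)]
  have XB': "z = \<zero>\<^bsub>S\<^esub>" if z: "z \<in> X'" "z \<in> B0" for z
  proof (rule ccontr)
    assume nz: "z \<noteq> \<zero>\<^bsub>S\<^esub>"
    obtain b where b: "b \<in> carrier B" "z = (\<zero>\<^bsub>A\<^esub>, b)" using z(2) unfolding B0_def by blast
    have "b \<noteq> \<zero>\<^bsub>B\<^esub>" using nz b(2) by (auto simp: simps)
    then obtain c where c: "c \<in> carrier R" "v = c \<odot>\<^bsub>B\<^esub> b" using socB[OF b(1)] by blast
    have "c \<odot>\<^bsub>S\<^esub> z \<in> X'" by (rule S.submodule_smult[OF cX'(1) c(1) z(1)])
    then have "(\<zero>\<^bsub>A\<^esub>, v) \<in> X'" using b(2) c by (simp add: simps)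
    moreover have "(u, v) \<in> X'" using uvX X'(1) by blast
    ultimately have "(u, \<zero>\<^bsub>B\<^esub>) \<in> X'" using S.submodule_diff[OF cX'(1)] swap(2) by metis
    then have "(u, \<zero>\<^bsub>B\<^esub>) = \<zero>\<^bsub>S\<^esub>" using cX'(3) u(1) unfolding A0_def by blast
    then show False using u(2) by (simp add: simps)
  qed
  \<comment> \<open>Since X + B is everything and X \<subseteq> X', the modular law gives X' = X +
    (X' \<inter> B) = X.\<close>
  have "X' \<subseteq> X"
  proof
    fix z assume z: "z \<in> X'"
    have zS: "z \<in> carrier S" using S.submodule_subset[OF cX'(1) z] .
    obtain x b where xb: "x \<in> X" "b \<in> B0" "z = x \<oplus>\<^bsub>S\<^esub> b" using cX(4)[OF zS] by (elim bexE)
    have cl: "x \<in> carrier S" "b \<in> carrier S"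
      using S.submodule_subset[OF cX(1) xb(1)] S.submodule_subset[OF B0 xb(2)] by auto
    have "b \<in> X'" by (rule S.submodule_add_cancel[OF cX'(1), of x]) (use X'(1) xb z cl in auto)
    then have "b = \<zero>\<^bsub>S\<^esub>" using XB' xb(2) by blast
    then show "z \<in> X" using xb cl by simp
  qed
  then have "X' = X" using X'(1) by blast
  then show ?thesis
    using mod_isomorphic_if_common_complement[OF mA mB, of X] X(2) X'(2) unfolding S_def A0_def B0_def by simp
qed

text \<open>If z = \<open>\<pi>\<close> w in M, the power \<open>\<pi>\<close>^(n+1) kills w, so
  \<open>\<tau>\<close>^(n+1) w is in \<open>T\<close>; inverting \<open>\<tau>\<close>^(n+1) on z
  turns this into a division of z inside \<open>T\<close>.\<close>

lemma (in module_at_prime) T_divisible_if_divisible: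
  assumes div: "\<And>z. z \<in> carrier M \<Longrightarrow> \<exists>w\<in>carrier M. z = \<pi> \<odot>\<^bsub>M\<^esub> w" and z: "z \<in> T"
  shows "\<exists>w\<in>T. z = \<pi> \<odot>\<^bsub>M\<^esub> w"
proof -
  obtain n :: nat where n: "\<pi> [^] n \<odot>\<^bsub>M\<^esub> z = \<zero>\<^bsub>M\<^esub>" using T_\<pi>_pow[OF z] .
  obtain w where w: "w \<in> carrier M" "z = \<pi> \<odot>\<^bsub>M\<^esub> w" using div[OF T_closed[OF z]] by (elim bexE)
  have "\<pi> [^] Suc n \<odot>\<^bsub>M\<^esub> w = \<zero>\<^bsub>M\<^esub>" using n w by (simp add: smult_assoc1)
  from \<tau>_pow_in_T[OF w(1) this] have wT: "\<tau> [^] Suc n \<odot>\<^bsub>M\<^esub> w \<in> T" .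
  obtain u where u: "u \<in> carrier R" "u \<odot>\<^bsub>M\<^esub> (\<tau> [^] Suc n \<odot>\<^bsub>M\<^esub> z) = z"
    using T_inverse[OF z \<tau>_pow_notin_P[of "Suc n"]] .
  have "\<pi> \<odot>\<^bsub>M\<^esub> (u \<odot>\<^bsub>M\<^esub> (\<tau> [^] Suc n \<odot>\<^bsub>M\<^esub> w)) = u \<odot>\<^bsub>M\<^esub> (\<tau> [^] Suc n \<odot>\<^bsub>M\<^esub> (\<pi> \<odot>\<^bsub>M\<^esub> w))"
    using smult_swap[of \<pi> u "\<tau> [^] Suc n \<odot>\<^bsub>M\<^esub> w"] smult_swap[of \<pi> "\<tau> [^] Suc n" w] u(1) w(1) by simp
  then have "z = \<pi> \<odot>\<^bsub>M\<^esub> (u \<odot>\<^bsub>M\<^esub> (\<tau> [^] Suc n \<odot>\<^bsub>M\<^esub> w))" using u(2) w(2) by simp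
  then show ?thesis using submodule_smult[OF submodule_T u(1) wT] by (rule bexI)
qed

lemma (in quotient_field) KmodR_facts:
  defines "Q \<equiv> KmodR R K \<iota>"
  defines "q \<equiv> \<lambda>k. \<iota> ` carrier R +>\<^bsub>scalar_module \<iota> K\<^esub> k"
  shows "module R Q"
    and "carrier Q = q ` carrier K"
    and "\<And>a k. a \<in> carrier R \<Longrightarrow> k \<in> carrier K \<Longrightarrow> a \<odot>\<^bsub>Q\<^esub> q k = q (\<iota> a \<otimes>\<^bsub>K\<^esub> k)"
    and "\<And>k. k \<in> carrier K \<Longrightarrow> q k = \<zero>\<^bsub>Q\<^esub> \<longleftrightarrow> k \<in> \<iota> ` carrier R"
proof -
  interpret KM: module R "scalar_module \<iota> K"
    by (rule scalar_module_is_module[OF R.is_cring K.is_cring embedding_hom])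
  interpret reg: module R "regular_module R" by (rule R.regular_module_is_module)
  have "\<iota> \<in> mod_hom R (regular_module R) (scalar_module \<iota> K)"
    by (rule mod_homI) (auto simp: scalar_module_def ring_hom_add[OF embedding_hom] ring_hom_mult[OF embedding_hom])
  from submodule_image[OF reg.module_axioms KM.module_axioms this reg.carrier_is_submodule]
  have D: "submodule (\<iota> ` carrier R) R (scalar_module \<iota> K)" by (simp add: scalar_module_def)
  show "module R Q" unfolding Q_def KmodR_def by (rule KM.quotient_module_is_module[OF D])
  show "carrier Q = q ` carrier K"
    unfolding Q_def KmodR_def q_def KM.carrier_quotient_module by (simp add: scalar_module_def)
  show "a \<odot>\<^bsub>Q\<^esub> q k = q (\<iota> a \<otimes>\<^bsub>K\<^esub> k)" if "a \<in> carrier R" "k \<in> carrier K" for a k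
    unfolding Q_def KmodR_def q_def using KM.smult_quotient_module[OF D that(1), of k] that(2)
    by (simp add: scalar_module_def)
  show "q k = \<zero>\<^bsub>Q\<^esub> \<longleftrightarrow> k \<in> \<iota> ` carrier R" if "k \<in> carrier K" for k
    unfolding Q_def KmodR_def q_def KM.zero_quotient_module
    using KM.rcoset_eq_self_iff[OF D, of k] that by (simp add: scalar_module_def)
qed

text \<open>The socle is generated by the class of \<open>\<tau>\<close>/\<open>\<pi>\<close>. The
  numerator \<open>\<tau>\<close> moves the class of 1/\<open>\<pi>\<close> into the P-primary
  component, and the class is non-zero because \<open>\<tau>\<close> = \<open>\<pi>\<close> r would
  put \<open>\<tau>\<close> into P.\<close>

lemma (in quotient_field) KmodR_pruefer_like:
  assumes u: "uniformized_prime R P \<pi> \<tau>"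
  shows "module.pruefer_like R (KmodR R K \<iota>) \<pi> (primary_component R (KmodR R K \<iota>) P)"
proof -
  define Q where "Q = KmodR R K \<iota>"
  define q where "q k = \<iota> ` carrier R +>\<^bsub>scalar_module \<iota> K\<^esub> k" for k
  note facts = KmodR_facts[folded Q_def q_def]
  interpret Q: module_at_prime R Q P \<pi> \<tau> by (intro module_at_prime.intro facts(1) u)
  interpret emb: ring_hom_cring R K \<iota> by (rule embedding_ring_hom_cring)
  have i\<pi>: "\<iota> \<pi> \<in> Units K" using embedding_eq_zero_iff[of \<pi>] Q.\<pi>_nonzero by (simp add: K.field_Units)
  have canc: "k = k'" if "k \<in> carrier K" "k' \<in> carrier K" "\<iota> \<pi> \<otimes>\<^bsub>K\<^esub> k = \<iota> \<pi> \<otimes>\<^bsub>K\<^esub> k'" for k k'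
    using that i\<pi> by (metis K.Units_l_cancel)
  have divK: "\<exists>k'\<in>carrier K. k = \<iota> \<pi> \<otimes>\<^bsub>K\<^esub> k'" if k: "k \<in> carrier K" for k
  proof
    have c: "inv\<^bsub>K\<^esub> (\<iota> \<pi>) \<in> carrier K" "\<iota> \<pi> \<in> carrier K" using i\<pi> by auto
    show "k = \<iota> \<pi> \<otimes>\<^bsub>K\<^esub> (inv\<^bsub>K\<^esub> (\<iota> \<pi>) \<otimes>\<^bsub>K\<^esub> k)"
      using K.m_assoc[OF c(2,1) k] i\<pi> k by simp
    show "inv\<^bsub>K\<^esub> (\<iota> \<pi>) \<otimes>\<^bsub>K\<^esub> k \<in> carrier K" using c k by simp
  qed
  have div: "\<exists>w\<in>carrier Q. z = \<pi> \<odot>\<^bsub>Q\<^esub> w" if "z \<in> carrier Q" for z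
  proof -
    obtain k where k: "k \<in> carrier K" "z = q k" using \<open>z \<in> carrier Q\<close> unfolding facts(2) by blast
    obtain k' where k': "k' \<in> carrier K" "k = \<iota> \<pi> \<otimes>\<^bsub>K\<^esub> k'" using divK[OF k(1)] by (elim bexE)
    have "z = \<pi> \<odot>\<^bsub>Q\<^esub> q k'" using facts(3)[of \<pi> k'] k k' by simp
    moreover have "q k' \<in> carrier Q" unfolding facts(2) using k'(1) by blast
    ultimately show ?thesis by (rule bexI)
  qed
  obtain k1 where k1: "k1 \<in> carrier K" "\<one>\<^bsub>K\<^esub> = \<iota> \<pi> \<otimes>\<^bsub>K\<^esub> k1" using divK[OF K.one_closed] by (elim bexE)
  define x0 where "x0 = \<tau> \<odot>\<^bsub>Q\<^esub> q k1"
  have qk1: "q k1 \<in> carrier Q" unfolding facts(2) using k1(1) by blast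
  have oneR: "\<one>\<^bsub>K\<^esub> \<in> \<iota> ` carrier R" using emb.hom_one by (metis R.one_closed imageI)
  have "\<pi> \<odot>\<^bsub>Q\<^esub> q k1 = \<zero>\<^bsub>Q\<^esub>" using facts(3)[of \<pi> k1] facts(4)[OF K.one_closed] oneR k1 by simp
  then have "\<pi> [^]\<^bsub>R\<^esub> (1::nat) \<odot>\<^bsub>Q\<^esub> q k1 = \<zero>\<^bsub>Q\<^esub>" by simp
  from Q.\<tau>_pow_in_T[OF qk1 this] have x0T: "x0 \<in> Q.T" unfolding x0_def by simp
  have x0nz: "x0 \<noteq> \<zero>\<^bsub>Q\<^esub>"
  proof
    assume "x0 = \<zero>\<^bsub>Q\<^esub>"
    then have "q (\<iota> \<tau> \<otimes>\<^bsub>K\<^esub> k1) = \<zero>\<^bsub>Q\<^esub>" unfolding x0_def using facts(3)[of \<tau> k1] k1 by simp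
    then have "\<iota> \<tau> \<otimes>\<^bsub>K\<^esub> k1 \<in> \<iota> ` carrier R" using facts(4)[of "\<iota> \<tau> \<otimes>\<^bsub>K\<^esub> k1"] k1 by simp
    then obtain r where r: "r \<in> carrier R" "\<iota> \<tau> \<otimes>\<^bsub>K\<^esub> k1 = \<iota> r" by blast
    have "\<iota> (\<pi> \<otimes> r) = \<iota> \<tau> \<otimes>\<^bsub>K\<^esub> (\<iota> \<pi> \<otimes>\<^bsub>K\<^esub> k1)" using r k1(1) by (simp add: K.m_lcomm flip: r(2))
    also have "\<dots> = \<iota> \<tau>" unfolding k1(2)[symmetric] by simp
    finally have "\<pi> \<otimes> r = \<tau>" using inj_onD[OF embedding_inj, of "\<pi> \<otimes> r" \<tau>] r(1) by simp
    then show False using Q.P.I_r_closed[OF Q.\<pi>_in_P r(1)] Q.\<tau>_notin_P by simp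
  qed
  have soc: "\<exists>a\<in>carrier R. x = a \<odot>\<^bsub>Q\<^esub> x0" if x: "x \<in> Q.T" "\<pi> \<odot>\<^bsub>Q\<^esub> x = \<zero>\<^bsub>Q\<^esub>" for x
  proof -
    have xQ: "x \<in> carrier Q" using Q.T_closed[OF x(1)] .
    obtain k where k: "k \<in> carrier K" "x = q k" using xQ unfolding facts(2) by blast
    have "q (\<iota> \<pi> \<otimes>\<^bsub>K\<^esub> k) = \<zero>\<^bsub>Q\<^esub>" using facts(3)[of \<pi> k] k x(2) by simp
    then have "\<iota> \<pi> \<otimes>\<^bsub>K\<^esub> k \<in> \<iota> ` carrier R" using facts(4)[of "\<iota> \<pi> \<otimes>\<^bsub>K\<^esub> k"] k by simp
    then obtain c where c: "c \<in> carrier R" "\<iota> \<pi> \<otimes>\<^bsub>K\<^esub> k = \<iota> c" by blast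
    have kc: "k = \<iota> c \<otimes>\<^bsub>K\<^esub> k1"
    proof (rule canc)
      have "\<iota> \<pi> \<otimes>\<^bsub>K\<^esub> (\<iota> c \<otimes>\<^bsub>K\<^esub> k1) = \<iota> c \<otimes>\<^bsub>K\<^esub> (\<iota> \<pi> \<otimes>\<^bsub>K\<^esub> k1)" using c(1) k1(1) by (intro K.m_lcomm) auto
      then show "\<iota> \<pi> \<otimes>\<^bsub>K\<^esub> k = \<iota> \<pi> \<otimes>\<^bsub>K\<^esub> (\<iota> c \<otimes>\<^bsub>K\<^esub> k1)" unfolding k1(2)[symmetric] c(2) using c(1) by simp
    qed (use c k k1 in auto)
    then have xc: "x = c \<odot>\<^bsub>Q\<^esub> q k1" using facts(3)[OF c(1) k1(1)] k by simp
    \<comment> \<open>So far x is a multiple of the class of 1/\<open>\<pi>\<close>. Since P kills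
      x, the identity v \<open>\<tau>\<close> + r = 1 rewrites it as a multiple of the class of
      \<open>\<tau>\<close>/\<open>\<pi>\<close>.\<close>
    obtain v r where v: "v \<in> carrier R" "r \<in> P" "v \<otimes> \<tau> \<oplus> r = \<one>" using Q.inverse_mod_P[of \<tau>] Q.\<tau>_notin_P by auto
    have rR: "r \<in> carrier R" using Q.P.Icarr[OF v(2)] .
    have "x = (v \<otimes> \<tau> \<oplus> r) \<odot>\<^bsub>Q\<^esub> x" unfolding v(3) using xQ by simp
    also have "\<dots> = (v \<otimes> \<tau>) \<odot>\<^bsub>Q\<^esub> x \<oplus>\<^bsub>Q\<^esub> r \<odot>\<^bsub>Q\<^esub> x" using v(1) rR xQ by (simp add: Q.smult_l_distr)
    also have "r \<odot>\<^bsub>Q\<^esub> x = \<zero>\<^bsub>Q\<^esub>" by (rule Q.T_P_smult_eq_zero[OF x v(2)])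
    also have "(v \<otimes> \<tau>) \<odot>\<^bsub>Q\<^esub> x = (v \<otimes> c) \<odot>\<^bsub>Q\<^esub> x0"
      unfolding xc x0_def using v(1) c(1) qk1 Q.smult_swap[of \<tau> c "q k1"] by (simp add: Q.smult_assoc1)
    finally have "x = (v \<otimes> c) \<odot>\<^bsub>Q\<^esub> x0" using v(1) c(1) Q.T_closed[OF x0T] by simp
    moreover have "v \<otimes> c \<in> carrier R" using v(1) c(1) by simp
    ultimately show ?thesis by (rule bexI)
  qed
  show ?thesis unfolding Q_def[symmetric] Q.pruefer_like_def
  proof (intro conjI ballI impI)
    show "Q.T \<noteq> {\<zero>\<^bsub>Q\<^esub>}" using x0T x0nz by blast
    show "\<exists>y\<in>Q.T. x = \<pi> \<odot>\<^bsub>Q\<^esub> y" if "x \<in> Q.T" for x by (rule Q.T_divisible_if_divisible[OF div that])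
    show "x' \<in> Q.cyclic_submodule x"
      if x: "x \<in> Q.T" and x': "x' \<in> Q.T"
        and s: "\<pi> \<odot>\<^bsub>Q\<^esub> x = \<zero>\<^bsub>Q\<^esub> \<and> \<pi> \<odot>\<^bsub>Q\<^esub> x' = \<zero>\<^bsub>Q\<^esub> \<and> x \<noteq> \<zero>\<^bsub>Q\<^esub>" for x x'
    proof -
      obtain a where a: "a \<in> carrier R" "x = a \<odot>\<^bsub>Q\<^esub> x0" using soc[OF x] s by blast
      obtain a' where a': "a' \<in> carrier R" "x' = a' \<odot>\<^bsub>Q\<^esub> x0" using soc[OF x'] s by blast
      have px0: "\<pi> \<odot>\<^bsub>Q\<^esub> x0 = \<zero>\<^bsub>Q\<^esub>"
        unfolding x0_def using Q.smult_swap[of \<pi> \<tau> "q k1"] qk1 \<open>\<pi> \<odot>\<^bsub>Q\<^esub> q k1 = \<zero>\<^bsub>Q\<^esub>\<close> by simp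
      have "a \<notin> P" using Q.T_P_smult_eq_zero[OF x0T px0] a(2) s by blast
      then have "x0 \<in> Q.cyclic_submodule x"
        using Q.T_mem_if_smult_mem[OF Q.submodule_cyclic[OF Q.T_closed[OF x]] x0T, of a] a
          Q.generator_in_cyclic_submodule[OF Q.T_closed[OF x]] by simp
      then show ?thesis
        unfolding a'(2) by (rule Q.submodule_smult[OF Q.submodule_cyclic[OF Q.T_closed[OF x]] a'(1)])
    qed
  qed
qed

lemma primary_component_of_primary_module:
  "primary_component R (primary_module R M P) P = primary_component R M P"
  unfolding primary_component_def by auto

text \<open>Uniqueness of primary modules of Pruefer type, applied to M and to the model inside K/R.
  The isomorphism does not refer to \<open>\<pi>\<close>, so the condition is independent of the
  chosen uniformizer.\<close>

lemma (in quotient_field) mod_isomorphic_pruefer_module_iff: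
  assumes u: "uniformized_prime R P \<pi> \<tau>" and M: "module R M"
  shows "mod_isomorphic R (primary_module R M P) (pruefer_module R K \<iota> P) \<longleftrightarrow>
    module.pruefer_like R M \<pi> (primary_component R M P)"
proof -
  interpret M: module_at_prime R M P \<pi> \<tau> by (intro module_at_prime.intro M u)
  have mQ: "module R (KmodR R K \<iota>)" by (rule KmodR_facts(1))
  interpret Q: module_at_prime R "KmodR R K \<iota>" P \<pi> \<tau> by (intro module_at_prime.intro mQ u)
  have prQ: "module.pruefer_like R (pruefer_module R K \<iota> P) \<pi> Q.T"
    unfolding pruefer_module_def pruefer_like_restrict_iff[OF mQ Q.submodule_T] by (rule KmodR_pruefer_like[OF u])
  have mP: "module R (pruefer_module R K \<iota> P)" unfolding pruefer_module_def by (rule Q.submodule_module[OF Q.submodule_T])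
  have mT: "module R (primary_module R M P)" by (rule M.submodule_module[OF M.submodule_T])
  have cP: "carrier (pruefer_module R K \<iota> P) = Q.T" by (simp add: pruefer_module_def)
  show ?thesis
  proof
    assume "mod_isomorphic R (primary_module R M P) (pruefer_module R K \<iota> P)"
    then have "module.pruefer_like R (primary_module R M P) \<pi> (carrier (primary_module R M P))"
      using pruefer_like_transport[OF mT mP] prQ cP M.\<pi>_closed by simp
    then show "M.pruefer_like \<pi> M.T" using pruefer_like_restrict_iff[OF M M.submodule_T] by simp
  next
    assume pr: "M.pruefer_like \<pi> M.T"
    show "mod_isomorphic R (primary_module R M P) (pruefer_module R K \<iota> P)"
    proof (rule uniformized_prime.pruefer_like_unique[OF u mT mP])
      show "carrier (primary_module R M P) = primary_component R (primary_module R M P) P"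
        unfolding primary_component_of_primary_module by simp
      show "carrier (pruefer_module R K \<iota> P) = primary_component R (pruefer_module R K \<iota> P) P"
        unfolding cP unfolding pruefer_module_def primary_component_of_primary_module by (rule refl)
      show "module.pruefer_like R (primary_module R M P) \<pi> (carrier (primary_module R M P))"
        using pr pruefer_like_restrict_iff[OF M M.submodule_T] by simp
      show "module.pruefer_like R (pruefer_module R K \<iota> P) \<pi> (carrier (pruefer_module R K \<iota> P))"
        unfolding cP by (rule prQ)
    qed
  qed
qed

section \<open>Assembling the classification\<close>

context dedekind_module
begin

text \<open>The family is always independent, since the components at P and at the other primes have
  disjoint supports, and its sum is the torsion part. Statements about this direct sum thus become
  statements about \<open>torsion_part\<close>.\<close>

lemma internal_direct_sum_primary_components_iff:
  "internal_direct_sum R M (nonzero_primes R) (primary_component R M) S \<longleftrightarrow> S = torsion_part"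
proof -
  have sub: "primary_component R M P \<subseteq> carrier M" if "P \<in> nonzero_primes R" for P
    using submodule_subset[OF submodule_primary_component[OF that]] by blast
  have Ssub: "submodule (submodule_sum R M I (primary_component R M)) R M" if "I \<subseteq> nonzero_primes R" for I
    using that sub by (intro submodule_submodule_sum) blast
  have sum: "submodule_sum R M (nonzero_primes R) (primary_component R M) = torsion_part"
  proof
    show "submodule_sum R M (nonzero_primes R) (primary_component R M) \<subseteq> torsion_part"
      by (rule submodule_sum_least[OF submodule_torsion_part primary_component_subset_torsion_part])
    show "torsion_part \<subseteq> submodule_sum R M (nonzero_primes R) (primary_component R M)"
      by (rule torsion_part_subset[OF Ssub[OF order_refl] submodule_sum_upper])
  qed
  have "independent_submodules R M (nonzero_primes R) (primary_component R M)"
    unfolding independent_submodules_def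
  proof (intro ballI conjI submodule_primary_component)
    fix P assume P: "P \<in> nonzero_primes R"
    define Z where "Z = submodule_sum R M (nonzero_primes R - {P}) (primary_component R M)"
    have Z: "submodule Z R M" unfolding Z_def by (rule Ssub) blast
    have ZC: "Z \<subseteq> torsion_supported (- {P})" unfolding Z_def
      by (rule submodule_sum_least[OF torsion_supported_submodule])
        (rule primary_component_subset_torsion_supported, auto)
    have PC: "primary_component R M P \<subseteq> torsion_supported {P}"
      by (rule primary_component_subset_torsion_supported[OF P]) simp
    have "x = \<zero>\<^bsub>M\<^esub>" if "x \<in> primary_component R M P" "x \<in> Z" for x
      using torsion_supported_disjoint[of x "{P}"] that PC ZC by blast
    moreover have "\<zero>\<^bsub>M\<^esub> \<in> primary_component R M P" "\<zero>\<^bsub>M\<^esub> \<in> Z"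
      using submodule_zero[OF submodule_primary_component[OF P]] submodule_zero[OF Z] by auto
    ultimately show "primary_component R M P \<inter> Z = {\<zero>\<^bsub>M\<^esub>}" by blast
  qed
  then show ?thesis unfolding internal_direct_sum_def sum by blast
qed

text \<open>A common non-zero annihilator makes N torsion, and a torsion element has no component in
  the torsion-free L.\<close>

lemma torsion_part_eq_complement:
  assumes c: "complementary R M L N" and L: "rank_one_divisible L"
    and r: "r \<in> carrier R" "r \<noteq> \<zero>" "\<And>x. x \<in> N \<Longrightarrow> r \<odot>\<^bsub>M\<^esub> x = \<zero>\<^bsub>M\<^esub>"
  shows "torsion_part = N"
proof
  note cE = complementaryE[OF c]
  show "N \<subseteq> torsion_part"
    unfolding torsion_part_def using r submodule_subset[OF cE(2)] by blast
  show "torsion_part \<subseteq> N"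
  proof
    fix x assume x: "x \<in> torsion_part"
    then obtain s where s: "s \<in> carrier R" "s \<noteq> \<zero>" "s \<odot>\<^bsub>M\<^esub> x = \<zero>\<^bsub>M\<^esub>" and xM: "x \<in> carrier M"
      unfolding torsion_part_def by blast
    obtain l n where ln: "l \<in> L" "n \<in> N" "x = l \<oplus>\<^bsub>M\<^esub> n" using cE(4)[OF xM] by (elim bexE)
    have cl: "l \<in> carrier M" "n \<in> carrier M"
      using submodule_subset[OF cE(1) ln(1)] submodule_subset[OF cE(2) ln(2)] by auto
    have "s \<odot>\<^bsub>M\<^esub> l \<oplus>\<^bsub>M\<^esub> s \<odot>\<^bsub>M\<^esub> n = \<zero>\<^bsub>M\<^esub> \<oplus>\<^bsub>M\<^esub> \<zero>\<^bsub>M\<^esub>"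
      using s(1,3) cl unfolding ln(3) by (simp add: smult_r_distr)
    then have "s \<odot>\<^bsub>M\<^esub> l = \<zero>\<^bsub>M\<^esub>"
      using complementary_decomp_unique[OF c submodule_smult[OF cE(1) s(1) ln(1)] submodule_zero[OF cE(1)]
          submodule_smult[OF cE(2) s(1) ln(2)] submodule_zero[OF cE(2)]] by simp
    then have "l = \<zero>\<^bsub>M\<^esub>" using L s(1,2) ln(1) unfolding rank_one_divisible_def by blast
    then show "x \<in> N" using ln cl by simp
  qed
qed

lemma complementary_carrier_zero: "complementary R M (carrier M) {\<zero>\<^bsub>M\<^esub>}"
  by (rule complementary_sym, rule complementaryI[OF zero_submodule carrier_is_submodule]) auto

lemma zero_cyclic_submodule: "{\<zero>\<^bsub>M\<^esub>} = cyclic_submodule \<zero>\<^bsub>M\<^esub>"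
  using cyclic_submodule_subset[OF zero_submodule, of "\<zero>\<^bsub>M\<^esub>"] generator_in_cyclic_submodule[of "\<zero>\<^bsub>M\<^esub>"] by auto

lemma cyclic_with_annihilatorD:
  "cyclic_with_annihilator N I \<Longrightarrow> \<exists>y\<in>carrier M. N = cyclic_submodule y"
  unfolding cyclic_with_annihilator_def by blast

lemma ideal_power_of_nonzero_prime:
  assumes "P \<in> nonzero_primes R"
  shows "ideal (ideal_power R P n) R" "\<exists>r\<in>ideal_power R P n. r \<noteq> \<zero>"
proof -
  obtain \<pi> \<tau> where "module_at_prime R M P \<pi> \<tau>" using exists_module_at_prime[OF assms] .
  then interpret module_at_prime R M P \<pi> \<tau> .
  show "ideal (ideal_power R P n) R" by (rule ideal_ideal_power)
  show "\<exists>r\<in>ideal_power R P n. r \<noteq> \<zero>"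
    using pow_in_ideal_power[OF \<pi>_in_P, of n] pow_\<pi>_nonzero[of n] by blast
qed

end

section \<open>The two cases of the classification\<close>

lemma (in quotient_field) local_classification:
  assumes M: "dedekind_module R M" and loc: "local_ring R" and \<mm>: "maximalideal \<mm> R"
  shows "dual_strongly_self_CS_Baer R M \<longleftrightarrow>
    mod_isomorphic R M (regular_module R) \<or>
    mod_isomorphic R M (scalar_module \<iota> K) \<or>
    mod_isomorphic R M (KmodR R K \<iota>) \<or>
    (\<exists>n::nat. mod_isomorphic R M (cyclic_module R (ideal_power R \<mm> n))) \<or>
    (\<exists>n::nat. mod_isomorphic R M
      (direct_sum_module (scalar_module \<iota> K) (cyclic_module R (ideal_power R \<mm> n))))"
    (is "_ \<longleftrightarrow> ?reg \<or> ?K \<or> ?KR \<or> ?cyc \<or> ?sum")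
proof -
  interpret M: dedekind_module R M by (rule M)
  have mM: "module R M" by (rule M.module_axioms)
  have mK: "module R (scalar_module \<iota> K)"
    by (rule scalar_module_is_module[OF R.is_cring K.is_cring embedding_hom])
  have mKR: "module R (KmodR R K \<iota>)" by (rule KmodR_facts(1))
  interpret KR: dedekind_module R "KmodR R K \<iota>"
    by (intro dedekind_module.intro dedekind_module_axioms.intro mKR M.dedekind_ring_axioms M.not_field)
  have \<mm>np: "\<mm> \<in> nonzero_primes R"
    using R.maximalideal_prime[OF \<mm>] M.not_field R.zeromaximalideal_eq_field \<mm>
    unfolding nonzero_primes_def by auto
  have np: "P = \<mm>" if "P \<in> nonzero_primes R" for P
    using M.nonzero_prime_maximal[OF that] \<mm> local_ring.unique_maximalideal[OF loc] by blast
  have Mid: "M\<lparr>carrier := carrier M\<rparr> = M" by simp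
  define T where "T = primary_component R M \<mm>"
  have Ts: "submodule T R M" unfolding T_def by (rule M.submodule_primary_component[OF \<mm>np])
  have tT: "M.torsion_part = T"
  proof
    show "M.torsion_part \<subseteq> T" by (rule M.torsion_part_subset[OF Ts]) (use np T_def in blast)
    show "T \<subseteq> M.torsion_part" unfolding T_def by (rule M.primary_component_subset_torsion_part[OF \<mm>np])
  qed
  obtain \<pi> \<tau> where u: "uniformized_prime R \<mm> \<pi> \<tau>" using M.exists_uniformizer[OF \<mm>np] by blast
  have \<pi>R: "\<pi> \<in> carrier R" by (rule uniformized_prime.\<pi>_closed[OF u])
  have idp: "ideal (ideal_power R \<mm> n) R" for n by (rule M.ideal_power_of_nonzero_prime(1)[OF \<mm>np])
  have cycR: "mod_isomorphic R M (cyclic_module R (ideal_power R \<mm> n)) \<longleftrightarrow>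
      M.cyclic_with_annihilator (carrier M) (ideal_power R \<mm> n)" for n
    using M.mod_isomorphic_cyclic_module_iff[OF M.carrier_is_submodule idp] unfolding Mid .
  \<comment> \<open>With a single non-zero prime, K/R is its own primary component, because every
    fraction is killed modulo R by its denominator.\<close>
  have KRT: "carrier (KmodR R K \<iota>) = primary_component R (KmodR R K \<iota>) \<mm>"
  proof
    show "primary_component R (KmodR R K \<iota>) \<mm> \<subseteq> carrier (KmodR R K \<iota>)"
      using KR.submodule_subset[OF KR.submodule_primary_component[OF \<mm>np]] by blast
    have "KR.torsion_part \<subseteq> primary_component R (KmodR R K \<iota>) \<mm>"
      by (rule KR.torsion_part_subset[OF KR.submodule_primary_component[OF \<mm>np]]) (use np in blast)
    moreover have "carrier (KmodR R K \<iota>) \<subseteq> KR.torsion_part"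
    proof
      fix z assume z: "z \<in> carrier (KmodR R K \<iota>)"
      then obtain k where k: "k \<in> carrier K" "z = \<iota> ` carrier R +>\<^bsub>scalar_module \<iota> K\<^esub> k"
        unfolding KmodR_facts(2) by blast
      obtain a b where ab: "a \<in> carrier R" "b \<in> carrier R - {\<zero>}" "k = \<iota> a \<otimes>\<^bsub>K\<^esub> inv\<^bsub>K\<^esub> (\<iota> b)"
        using fraction[OF k(1)] by blast
      then have b: "b \<in> carrier R" "b \<noteq> \<zero>" by auto
      have "\<iota> b \<otimes>\<^bsub>K\<^esub> k = \<iota> a" using fraction_cross_mult[OF ab(1) b k(1)] ab(3) by simp
      then have "b \<odot>\<^bsub>KmodR R K \<iota>\<^esub> z = \<zero>\<^bsub>KmodR R K \<iota>\<^esub>"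
        unfolding k(2) KmodR_facts(3)[OF b(1) k(1)] using KmodR_facts(4)[of "\<iota> a"] ab(1) by simp
      then show "z \<in> KR.torsion_part" unfolding KR.torsion_part_def using z b by blast
    qed
    ultimately show "carrier (KmodR R K \<iota>) \<subseteq> primary_component R (KmodR R K \<iota>) \<mm>" by blast
  qed
  have KRpr: "pruefer_module R K \<iota> \<mm> = KmodR R K \<iota>"
    unfolding pruefer_module_def KRT[symmetric] by simp
  show ?thesis
  proof
    assume "dual_strongly_self_CS_Baer R M"
    then interpret M: dedekind_baer_module R M
      by (intro dedekind_baer_module.intro dedekind_baer_module_axioms.intro M)
    show "?reg \<or> ?K \<or> ?KR \<or> ?cyc \<or> ?sum"
    proof (rule M.baer_module_cases)
      fix e assume "e \<in> carrier M" "carrier M = M.cyclic_submodule e"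
        "\<forall>a\<in>carrier R. a \<odot>\<^bsub>M\<^esub> e = \<zero>\<^bsub>M\<^esub> \<longrightarrow> a = \<zero>"
      then have ?reg unfolding M.mod_isomorphic_regular_iff by (intro bexI[of _ e] conjI)
      then show ?thesis by blast
    next
      fix L assume c: "complementary R M M.torsion_part L" and rk: "M.rank_one_divisible L"
        and cyc: "\<forall>P\<in>nonzero_primes R. \<exists>n. M.cyclic_with_annihilator (primary_component R M P) (ideal_power R P n)"
      obtain n where n: "M.cyclic_with_annihilator T (ideal_power R \<mm> n)"
        using bspec[OF cyc \<mm>np] unfolding T_def by (elim exE)
      note cE = M.complementaryE[OF c]
      have "mod_isomorphic R (M\<lparr>carrier := L\<rparr>) (scalar_module \<iota> K)"
        using mod_isomorphic_quotient_field_iff[OF mM cE(2)] rk by simp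
      moreover have "mod_isomorphic R (M\<lparr>carrier := T\<rparr>) (cyclic_module R (ideal_power R \<mm> n))"
        using M.mod_isomorphic_cyclic_module_iff[OF Ts idp] n by simp
      moreover have "complementary R M L T" using M.complementary_sym[OF c] unfolding tT .
      moreover have "module R (cyclic_module R (ideal_power R \<mm> n))"
        unfolding cyclic_module_def
        by (rule module.quotient_module_is_module[OF R.regular_module_is_module R.ideal_is_regular_submodule[OF idp]])
      ultimately have ?sum using mod_isomorphic_direct_sum_iff[OF mM mK] by blast
      then show ?thesis by blast
    next
      assume all: "M.torsion_part = carrier M"
        and prim: "\<forall>P\<in>nonzero_primes R.
          (\<exists>\<pi> \<tau>. uniformized_prime R P \<pi> \<tau> \<and> M.pruefer_like \<pi> (primary_component R M P)) \<or>
          (\<exists>n. M.cyclic_with_annihilator (primary_component R M P) (ideal_power R P n))"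
      have TM: "T = carrier M" using all tT by simp
      from bspec[OF prim \<mm>np] show ?thesis
      proof
        assume "\<exists>\<pi> \<tau>. uniformized_prime R \<mm> \<pi> \<tau> \<and> M.pruefer_like \<pi> (primary_component R M \<mm>)"
        then obtain \<pi> \<tau> where "uniformized_prime R \<mm> \<pi> \<tau>" "M.pruefer_like \<pi> (primary_component R M \<mm>)"
          by (elim exE conjE)
        then have "mod_isomorphic R (primary_module R M \<mm>) (pruefer_module R K \<iota> \<mm>)"
          using mod_isomorphic_pruefer_module_iff[OF _ mM] by blast
        then have ?KR unfolding KRpr using TM unfolding T_def by simp
        then show ?thesis by blast
      next
        assume "\<exists>n. M.cyclic_with_annihilator (primary_component R M \<mm>) (ideal_power R \<mm> n)"
        then have ?cyc using cycR TM unfolding T_def by simp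
        then show ?thesis by blast
      qed
    qed
  next
    assume "?reg \<or> ?K \<or> ?KR \<or> ?cyc \<or> ?sum"
    then show "dual_strongly_self_CS_Baer R M"
    proof (elim disjE)
      assume ?reg
      then show ?thesis
        unfolding M.mod_isomorphic_regular_iff using M.local_cyclic_baer loc by blast
    next
      assume ?K
      then have rk: "M.rank_one_divisible (carrier M)"
        using mod_isomorphic_quotient_field_iff[OF mM M.carrier_is_submodule] unfolding Mid by simp
      \<comment> \<open>With zero complement the annihilator can be taken to be 1; the primary
        component is then zero, which counts as cyclic.\<close>
      have t0: "M.torsion_part = {\<zero>\<^bsub>M\<^esub>}"
        by (rule M.torsion_part_eq_complement[OF M.complementary_carrier_zero rk R.one_closed]) auto
      have cy: "\<exists>y\<in>carrier M. primary_component R M P = M.cyclic_submodule y" if "P \<in> nonzero_primes R" for P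
        using np[OF that] tT t0 M.zero_cyclic_submodule unfolding T_def by auto
      show ?thesis
        by (rule M.structured_module_baer[of "carrier M"])
          (use rk cy M.complementary_sym[OF M.complementary_carrier_zero] t0 in auto)
    next
      assume KR: ?KR
      have prK: "KR.pruefer_like \<pi> (carrier (KmodR R K \<iota>))"
        using KmodR_pruefer_like[OF u] unfolding KRT[symmetric] .
      have pr: "M.pruefer_like \<pi> (carrier M)" by (rule pruefer_like_transport[OF mM mKR KR \<pi>R prK])
      obtain h where h: "h \<in> mod_hom R M (KmodR R K \<iota>)" and bij: "bij_betw h (carrier M) (carrier (KmodR R K \<iota>))"
        using KR unfolding mod_isomorphic_def by blast
      have TM: "T = carrier M"
      proof
        show "T \<subseteq> carrier M" using M.submodule_subset[OF Ts] by blast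
        show "carrier M \<subseteq> T"
        proof
          fix x assume x: "x \<in> carrier M"
          have "h x \<in> primary_component R (KmodR R K \<iota>) \<mm>" using mod_hom_closed[OF h x] KRT by simp
          then obtain n where n: "\<forall>a\<in>ideal_power R \<mm> n. a \<odot>\<^bsub>KmodR R K \<iota>\<^esub> h x = \<zero>\<^bsub>KmodR R K \<iota>\<^esub>"
            unfolding primary_component_def by blast
          have "a \<odot>\<^bsub>M\<^esub> x = \<zero>\<^bsub>M\<^esub>" if a: "a \<in> ideal_power R \<mm> n" for a
          proof -
            have aR: "a \<in> carrier R" using ideal.Icarr[OF idp a] .
            have "h (a \<odot>\<^bsub>M\<^esub> x) = h \<zero>\<^bsub>M\<^esub>"
              using mod_hom_smult[OF h aR x] n a mod_hom_zero[OF mM mKR h] by simp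
            then show ?thesis
              using inj_onD[OF bij_betw_imp_inj_on[OF bij]] aR x by simp
          qed
          then show "x \<in> T" unfolding T_def primary_component_def using x by blast
        qed
      qed
      have "\<exists>\<pi> \<tau>. uniformized_prime R P \<pi> \<tau> \<and> M.pruefer_like \<pi> (primary_component R M P)"
        if "P \<in> nonzero_primes R" for P
        using np[OF that] u pr TM unfolding T_def by auto
      \<comment> \<open>This is the torsion situation of the converse, with complement L =
        0.\<close>
      then show ?thesis
        using M.structured_module_baer[of "{\<zero>\<^bsub>M\<^esub>}"] M.complementary_carrier_zero tT TM by simp
    next
      assume ?cyc
      then obtain n where "M.cyclic_with_annihilator (carrier M) (ideal_power R \<mm> n)" using cycR by blast
      then show ?thesis using M.cyclic_with_annihilatorD M.local_cyclic_baer loc by blast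
    next
      assume ?sum
      then obtain n where n: "mod_isomorphic R M
        (direct_sum_module (scalar_module \<iota> K) (cyclic_module R (ideal_power R \<mm> n)))" by (elim exE)
      have "module R (cyclic_module R (ideal_power R \<mm> n))"
        unfolding cyclic_module_def
        by (rule module.quotient_module_is_module[OF R.regular_module_is_module R.ideal_is_regular_submodule[OF idp]])
      then obtain L N where c: "complementary R M L N"
        and L: "mod_isomorphic R (M\<lparr>carrier := L\<rparr>) (scalar_module \<iota> K)"
        and N: "mod_isomorphic R (M\<lparr>carrier := N\<rparr>) (cyclic_module R (ideal_power R \<mm> n))"
        using n mod_isomorphic_direct_sum_iff[OF mM mK] by blast
      note cE = M.complementaryE[OF c]
      have rk: "M.rank_one_divisible L" using mod_isomorphic_quotient_field_iff[OF mM cE(1)] L by simp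
      have cy: "M.cyclic_with_annihilator N (ideal_power R \<mm> n)"
        using M.mod_isomorphic_cyclic_module_iff[OF cE(2) idp] N by simp
      then obtain y where y: "y \<in> carrier M" "N = M.cyclic_submodule y"
        and ann: "\<forall>a\<in>carrier R. a \<odot>\<^bsub>M\<^esub> y = \<zero>\<^bsub>M\<^esub> \<longleftrightarrow> a \<in> ideal_power R \<mm> n"
        unfolding M.cyclic_with_annihilator_def by (elim bexE conjE)
      obtain r where r: "r \<in> ideal_power R \<mm> n" "r \<noteq> \<zero>" using M.ideal_power_of_nonzero_prime(2)[OF \<mm>np] by blast
      have rR: "r \<in> carrier R" using ideal.Icarr[OF idp r(1)] .
      have "r \<odot>\<^bsub>M\<^esub> x = \<zero>\<^bsub>M\<^esub>" if x: "x \<in> N" for x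
      proof -
        obtain a where a: "a \<in> carrier R" "x = a \<odot>\<^bsub>M\<^esub> y" using x unfolding y(2) by (rule M.cyclic_submoduleE)
        show ?thesis using M.smult_swap[OF rR a(1) y(1)] bspec[OF ann rR] r(1) a by simp
      qed
      then have tN: "M.torsion_part = N" by (rule M.torsion_part_eq_complement[OF c rk rR r(2)])
      have cy: "\<exists>y\<in>carrier M. primary_component R M P = M.cyclic_submodule y" if "P \<in> nonzero_primes R" for P
        using np[OF that] tT tN y unfolding T_def by auto
      show ?thesis
      proof (rule M.structured_module_baer)
        show "complementary R M M.torsion_part L" unfolding tN by (rule M.complementary_sym[OF c])
      qed (use rk cy in auto)
    qed
  qed
qed

text \<open>The free cyclic case would make R local, so only the case with a divisible complement
  and the torsion case remain; they are conditions (a) and (b).\<close>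

lemma (in quotient_field) nonlocal_classification:
  assumes M: "dedekind_module R M" and nloc: "\<not> local_ring R"
  shows "dual_strongly_self_CS_Baer R M \<longleftrightarrow>
    (\<exists>S L. internal_direct_sum R M (nonzero_primes R) (primary_component R M) S \<and>
      complementary R M S L \<and>
      mod_isomorphic R (M\<lparr>carrier := L\<rparr>) (scalar_module \<iota> K) \<and>
      (\<forall>\<pp> \<in> nonzero_primes R. \<exists>n::nat.
        mod_isomorphic R (primary_module R M \<pp>) (cyclic_module R (ideal_power R \<pp> n)))) \<or>
    (internal_direct_sum R M (nonzero_primes R) (primary_component R M) (carrier M) \<and>
      (\<forall>\<pp> \<in> nonzero_primes R.
        mod_isomorphic R (primary_module R M \<pp>) (pruefer_module R K \<iota> \<pp>) \<or>
        (\<exists>n::nat. mod_isomorphic R (primary_module R M \<pp>) (cyclic_module R (ideal_power R \<pp> n)))))"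
    (is "_ \<longleftrightarrow> ?a \<or> ?b")
proof -
  interpret M: dedekind_module R M by (rule M)
  have mM: "module R M" by (rule M.module_axioms)
  have cyc_iff: "mod_isomorphic R (primary_module R M P) (cyclic_module R (ideal_power R P n)) \<longleftrightarrow>
      M.cyclic_with_annihilator (primary_component R M P) (ideal_power R P n)" if "P \<in> nonzero_primes R" for P n
    by (rule M.mod_isomorphic_cyclic_module_iff[OF M.submodule_primary_component[OF that]
        M.ideal_power_of_nonzero_prime(1)[OF that]])
  note pr_iff = mod_isomorphic_pruefer_module_iff[OF _ mM]
  show ?thesis
  proof
    assume "dual_strongly_self_CS_Baer R M"
    then interpret M: dedekind_baer_module R M
      by (intro dedekind_baer_module.intro dedekind_baer_module_axioms.intro M)
    show "?a \<or> ?b"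
    proof (rule M.baer_module_cases)
      assume "local_ring R"
      then show ?thesis using nloc by blast
    next
      fix L assume c: "complementary R M M.torsion_part L" and rk: "M.rank_one_divisible L"
        and cyc: "\<forall>P\<in>nonzero_primes R. \<exists>n. M.cyclic_with_annihilator (primary_component R M P) (ideal_power R P n)"
      note cE = M.complementaryE[OF c]
      have "mod_isomorphic R (M\<lparr>carrier := L\<rparr>) (scalar_module \<iota> K)"
        using mod_isomorphic_quotient_field_iff[OF mM cE(2)] rk by simp
      moreover have "\<forall>P\<in>nonzero_primes R. \<exists>n::nat.
          mod_isomorphic R (primary_module R M P) (cyclic_module R (ideal_power R P n))"
        using cyc cyc_iff by simp
      ultimately have ?a
        using c M.internal_direct_sum_primary_components_iff[of M.torsion_part]
        by (intro exI[of _ M.torsion_part] exI[of _ L] conjI) simp_all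
      then show ?thesis by blast
    next
      assume all: "M.torsion_part = carrier M"
        and prim: "\<forall>P\<in>nonzero_primes R.
          (\<exists>\<pi> \<tau>. uniformized_prime R P \<pi> \<tau> \<and> M.pruefer_like \<pi> (primary_component R M P)) \<or>
          (\<exists>n. M.cyclic_with_annihilator (primary_component R M P) (ideal_power R P n))"
      have "mod_isomorphic R (primary_module R M P) (pruefer_module R K \<iota> P) \<or>
          (\<exists>n::nat. mod_isomorphic R (primary_module R M P) (cyclic_module R (ideal_power R P n)))"
        if P: "P \<in> nonzero_primes R" for P
        using bspec[OF prim P] pr_iff[of P] cyc_iff[OF P] by blast
      then have ?b using M.internal_direct_sum_primary_components_iff[of "carrier M"] all by simp
      then show ?thesis by blast
    qed
  next
    have cyc: "\<exists>y\<in>carrier M. primary_component R M P = M.cyclic_submodule y"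
      if "P \<in> nonzero_primes R" "mod_isomorphic R (primary_module R M P) (cyclic_module R (ideal_power R P n))" for P n
      using M.cyclic_with_annihilatorD cyc_iff that by blast
    assume "?a \<or> ?b"
    then show "dual_strongly_self_CS_Baer R M"
    proof (elim disjE)
      assume ?a
      then obtain S L where S: "internal_direct_sum R M (nonzero_primes R) (primary_component R M) S"
        and c: "complementary R M S L" and L: "mod_isomorphic R (M\<lparr>carrier := L\<rparr>) (scalar_module \<iota> K)"
        and prim: "\<forall>P\<in>nonzero_primes R. \<exists>n::nat.
          mod_isomorphic R (primary_module R M P) (cyclic_module R (ideal_power R P n))" by (elim exE conjE)
      have ST: "S = M.torsion_part" using S M.internal_direct_sum_primary_components_iff by blast
      have rk: "M.rank_one_divisible L"
        using mod_isomorphic_quotient_field_iff[OF mM M.complementaryE(2)[OF c]] L by simp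
      have cy: "\<exists>y\<in>carrier M. primary_component R M P = M.cyclic_submodule y" if P: "P \<in> nonzero_primes R" for P
      proof -
        obtain n :: nat where "mod_isomorphic R (primary_module R M P) (cyclic_module R (ideal_power R P n))"
          using bspec[OF prim P] by (elim exE)
        then show ?thesis by (rule cyc[OF P])
      qed
      show ?thesis by (rule M.structured_module_baer[OF c[unfolded ST]]) (use rk cy in auto)
    next
      assume b: ?b
      have tM: "M.torsion_part = carrier M"
        using conjunct1[OF b] M.internal_direct_sum_primary_components_iff[of "carrier M"] by simp
      show ?thesis
      proof (rule M.structured_module_baer)
        show "complementary R M M.torsion_part {\<zero>\<^bsub>M\<^esub>}" unfolding tM by (rule M.complementary_carrier_zero)
        fix P assume P: "P \<in> nonzero_primes R"
        obtain \<pi> \<tau> where u: "uniformized_prime R P \<pi> \<tau>" using M.exists_uniformizer[OF P] by blast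
        from bspec[OF conjunct2[OF b] P]
        show "(\<exists>y\<in>carrier M. primary_component R M P = M.cyclic_submodule y) \<or>
          (\<exists>\<pi> \<tau>. uniformized_prime R P \<pi> \<tau> \<and> M.pruefer_like \<pi> (primary_component R M P))"
        proof
          assume "mod_isomorphic R (primary_module R M P) (pruefer_module R K \<iota> P)"
          then have "M.pruefer_like \<pi> (primary_component R M P)" using pr_iff[OF u] by simp
          then show ?thesis using u by blast
        next
          assume "\<exists>n::nat. mod_isomorphic R (primary_module R M P) (cyclic_module R (ideal_power R P n))"
          then show ?thesis using cyc[OF P] by blast
        qed
      qed simp
    qed
  qed
qed

text \<open>The only proper ideal of a field is zero. So the assumption that R is not local also
  rules out fields, which \<open>dedekind_domain\<close> admits.\<close>

lemma (in field) local_ring: "local_ring R"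
proof -
  have "\<mm> = {\<zero>}" if "maximalideal \<mm> R" for \<mm>
  proof -
    interpret m: maximalideal \<mm> R by (rule that)
    show ?thesis using all_ideals m.is_ideal m.I_notcarr by blast
  qed
  then have "\<exists>!\<mm>. maximalideal \<mm> R" using zeromaximalideal by (intro ex1I[of _ "{\<zero>}"])
  then show ?thesis by (intro local_ring.intro local_ring_axioms.intro is_cring)
qed

theorem corollary9p11:
  fixes R :: "('a, 'c) ring_scheme"
    and K :: "('k, 'd) ring_scheme"
    and \<iota> :: "'a \<Rightarrow> 'k"
    and M :: "('a, 'b, 'e) module_scheme"
  assumes "dedekind_domain R K \<iota>"
    and "module R M"
  shows
    "(\<forall>\<mm>. discrete_valuation_ring R \<and> maximalideal \<mm> R \<longrightarrow>
        (dual_strongly_self_CS_Baer R M \<longleftrightarrow>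
          mod_isomorphic R M (regular_module R) \<or>
          mod_isomorphic R M (scalar_module \<iota> K) \<or>
          mod_isomorphic R M (KmodR R K \<iota>) \<or>
          (\<exists>n::nat. mod_isomorphic R M (cyclic_module R (ideal_power R \<mm> n))) \<or>
          (\<exists>n::nat. mod_isomorphic R M
            (direct_sum_module (scalar_module \<iota> K) (cyclic_module R (ideal_power R \<mm> n))))))
     \<and>
     (\<not> local_ring R \<longrightarrow>
        (dual_strongly_self_CS_Baer R M \<longleftrightarrow>
          (\<exists>S L. internal_direct_sum R M (nonzero_primes R) (primary_component R M) S \<and>
            complementary R M S L \<and>
            mod_isomorphic R (M\<lparr>carrier := L\<rparr>) (scalar_module \<iota> K) \<and>
            (\<forall>\<pp> \<in> nonzero_primes R. \<exists>n::nat.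
              mod_isomorphic R (primary_module R M \<pp>) (cyclic_module R (ideal_power R \<pp> n)))) \<or>
          (internal_direct_sum R M (nonzero_primes R) (primary_component R M) (carrier M) \<and>
            (\<forall>\<pp> \<in> nonzero_primes R.
              mod_isomorphic R (primary_module R M \<pp>) (pruefer_module R K \<iota> \<pp>) \<or>
              (\<exists>n::nat.
                mod_isomorphic R (primary_module R M \<pp>) (cyclic_module R (ideal_power R \<pp> n)))))))"
proof -
  have dr: "dedekind_ring R" by (rule dedekind_domain.dedekind_ring[OF assms(1)])
  have qf: "quotient_field R K \<iota>" by (rule dedekind_domain.axioms(2)[OF assms(1)])
  have dm: "dedekind_module R M" if "\<not> field R"
    using that by (intro dedekind_module.intro dedekind_module_axioms.intro dr assms(2))
  show ?thesis
  proof (rule conjI; intro allI impI)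
    fix \<mm> assume d: "discrete_valuation_ring R \<and> maximalideal \<mm> R"
    then have d1: "discrete_valuation_ring R" and d2: "maximalideal \<mm> R" by auto
    show "dual_strongly_self_CS_Baer R M \<longleftrightarrow>
          mod_isomorphic R M (regular_module R) \<or>
          mod_isomorphic R M (scalar_module \<iota> K) \<or>
          mod_isomorphic R M (KmodR R K \<iota>) \<or>
          (\<exists>n::nat. mod_isomorphic R M (cyclic_module R (ideal_power R \<mm> n))) \<or>
          (\<exists>n::nat. mod_isomorphic R M
            (direct_sum_module (scalar_module \<iota> K) (cyclic_module R (ideal_power R \<mm> n))))"
      by (rule quotient_field.local_classification[OF qf dm[OF discrete_valuation_ring.not_field[OF d1]]
          discrete_valuation_ring.axioms(2)[OF d1] d2])
  next
    assume nl: "\<not> local_ring R"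
    then have "\<not> field R" using field.local_ring by blast
    from quotient_field.nonlocal_classification[OF qf dm[OF this] nl]
    show "dual_strongly_self_CS_Baer R M \<longleftrightarrow>
          (\<exists>S L. internal_direct_sum R M (nonzero_primes R) (primary_component R M) S \<and>
            complementary R M S L \<and>
            mod_isomorphic R (M\<lparr>carrier := L\<rparr>) (scalar_module \<iota> K) \<and>
            (\<forall>\<pp> \<in> nonzero_primes R. \<exists>n::nat.
              mod_isomorphic R (primary_module R M \<pp>) (cyclic_module R (ideal_power R \<pp> n)))) \<or>
          (internal_direct_sum R M (nonzero_primes R) (primary_component R M) (carrier M) \<and>
            (\<forall>\<pp> \<in> nonzero_primes R.
              mod_isomorphic R (primary_module R M \<pp>) (pruefer_module R K \<iota> \<pp>) \<or>
              (\<exists>n::nat.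
                mod_isomorphic R (primary_module R M \<pp>) (cyclic_module R (ideal_power R \<pp> n)))))" .
  qed
qed

end
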